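(* Let $R$ be a real closed field. Let $f\in R[v,w]$ be a polynomial of even degree $d\geq 2$ such that the closure of $\{f=0\}$ in $\mathbb{P}^2_R$ is a nodal rational curve with normalization $\Delta$, and such that either (a) $\Delta(R)\neq\varnothing$ (so $\Delta\simeq\mathbb{P}^1_R$); or (b) $\Delta(R)=\varnothing$ (so $\Delta$ is an anisotropic conic) and $f$ is nonnegative. If $d\leq 4$, then the algebraic variety over $R$ defined by the equation $$x^2+y^2=f(v,w)$$ is $R$-rational.
   Context: A variety $X$ of dimension $n$ over a field $k$ is $k$-rational if it is birational over $k$ to $\mathbb{A}^n_k$. The closure of $\{f=0\}$ in $\mathbb{P}^2_R$ is the plane curve of degree $d$ (taken with its scheme structure) defined by the homogenization of $f$. A nodal rational curve is here a geometrically integral curve whose only singularities over an algebraic closure are ordinary double points, and whose normalization is (a smooth projective geometrically connected curve) of genus $0$. The polynomial $f$ is nonnegative if $f(r,s)\geq 0$ for all $r,s\in R$, with respect to the unique ordering of $R$. *)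

theory Defs
  imports "HOL-Algebra.Algebraic_Closure_Type" "HOL-Algebra.Embedded_Algebras"
    "HOL-Algebra.QuotRing" "HOL-Library.FuncSet"
begin

section \<open>Real closed fields\<close>

text \<open>The order of a real closed field is unique (its nonnegative elements are the squares),
  so including it in the class adds no data.\<close>

class real_closed_field = linordered_field +
  assumes nonneg_imp_square: "0 \<le> a \<Longrightarrow> \<exists>b. a = b * b"
    and odd_degree_imp_root: "odd n \<Longrightarrow> c n \<noteq> 0 \<Longrightarrow> \<exists>x. (\<Sum>k\<le>n. c k * x ^ k) = 0"


section \<open>Localizations\<close>

text \<open>For \<open>S\<close> a multiplicative subset of the commutative ring \<open>R\<close>, fractions are classes of pairs
  (numerator, denominator).\<close>

definition localization_rel ::
    "('r, 'm) ring_scheme \<Rightarrow> 'r set \<Rightarrow> (('r \<times> 'r) \<times> ('r \<times> 'r)) set" where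
  "localization_rel R S =
     {((a, s), (b, t)). a \<in> carrier R \<and> s \<in> S \<and> b \<in> carrier R \<and> t \<in> S \<and>
        (\<exists>u\<in>S. u \<otimes>\<^bsub>R\<^esub> (a \<otimes>\<^bsub>R\<^esub> t \<ominus>\<^bsub>R\<^esub> b \<otimes>\<^bsub>R\<^esub> s) = \<zero>\<^bsub>R\<^esub>)}"

definition fraction ::
    "('r, 'm) ring_scheme \<Rightarrow> 'r set \<Rightarrow> 'r \<Rightarrow> 'r \<Rightarrow> ('r \<times> 'r) set" where
  "fraction R S a s = localization_rel R S `` {(a, s)}"

definition localization ::
    "('r, 'm) ring_scheme \<Rightarrow> 'r set \<Rightarrow> ('r \<times> 'r) set ring" where
  "localization R S =
     \<lparr> carrier = (carrier R \<times> S) // localization_rel R S,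
       monoid.mult = (\<lambda>p q. \<Union>(a, s)\<in>p. \<Union>(b, t)\<in>q. fraction R S (a \<otimes>\<^bsub>R\<^esub> b) (s \<otimes>\<^bsub>R\<^esub> t)),
       one = fraction R S \<one>\<^bsub>R\<^esub> \<one>\<^bsub>R\<^esub>,
       ring.zero = fraction R S \<zero>\<^bsub>R\<^esub> \<one>\<^bsub>R\<^esub>,
       add = (\<lambda>p q. \<Union>(a, s)\<in>p. \<Union>(b, t)\<in>q.
                fraction R S (a \<otimes>\<^bsub>R\<^esub> t \<oplus>\<^bsub>R\<^esub> b \<otimes>\<^bsub>R\<^esub> s) (s \<otimes>\<^bsub>R\<^esub> t)) \<rparr>"

definition powers_of :: "('r, 'm) ring_scheme \<Rightarrow> 'r \<Rightarrow> 'r set" where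
  "powers_of R a = range (\<lambda>n::nat. a [^]\<^bsub>R\<^esub> n)"


section \<open>Affine hypersurfaces, birationality and rationality\<close>

text \<open>Polynomial rings in several variables are iterated univariate polynomial rings.
  Algebras over a field \<open>'k\<close> are given by a ring \<open>A\<close> together with its structure map
  \<open>\<iota> :: 'k \<Rightarrow> _\<close>. For the hypersurface with equation \<open>F\<close>, \<open>const\<close> below is the inclusion of
  the constants into the polynomial ring.\<close>

definition hypersurface_ring :: "'p::comm_ring_1 \<Rightarrow> 'p set ring" where
  "hypersurface_ring F = ring_of_type_algebra Quot (PIdl\<^bsub>ring_of_type_algebra\<^esub> F)"

definition hypersurface_const :: "'p::comm_ring_1 \<Rightarrow> ('k \<Rightarrow> 'p) \<Rightarrow> 'k \<Rightarrow> 'p set" where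
  "hypersurface_const F const c =
     (PIdl\<^bsub>ring_of_type_algebra\<^esub> F) +>\<^bsub>ring_of_type_algebra\<^esub> const c"

text \<open>Two integral affine varieties \<open>Spec A\<close> and \<open>Spec B\<close> over \<open>'k\<close> are birational if they have
  isomorphic nonempty (hence dense) open subschemes. Shrinking, these can be taken to be principal
  opens \<open>D(a)\<close> and \<open>D(b)\<close>, whose coordinate rings are \<open>A[1/a]\<close> and \<open>B[1/b]\<close>.\<close>

definition birational ::
    "'r ring \<Rightarrow> ('k \<Rightarrow> 'r) \<Rightarrow> 's ring \<Rightarrow> ('k \<Rightarrow> 's) \<Rightarrow> bool" where
  "birational A \<iota> B \<kappa> \<longleftrightarrow>
     domain A \<and> domain B \<and>
     (\<exists>a\<in>carrier A - {\<zero>\<^bsub>A\<^esub>}. \<exists>b\<in>carrier B - {\<zero>\<^bsub>B\<^esub>}.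
        let S = powers_of A a; T = powers_of B b in
        \<exists>\<phi>\<in>ring_iso (localization A S) (localization B T).
          \<forall>c. \<phi> (fraction A S (\<iota> c) \<one>\<^bsub>A\<^esub>) = fraction B T (\<kappa> c) \<one>\<^bsub>B\<^esub>)"

definition rational_threefold :: "'r ring \<Rightarrow> ('k::field \<Rightarrow> 'r) \<Rightarrow> bool" where
  "rational_threefold A \<iota> \<longleftrightarrow>
     birational A \<iota> (ring_of_type_algebra :: 'k poly poly poly ring) (\<lambda>c. [:[:[:c:]:]:])"

text \<open>A polynomial in \<open>R[v,w]\<close> is an element of \<open>'a poly poly\<close>, with \<open>v\<close> the inner and \<open>w\<close> the
  outer variable; \<open>R[v,w,x,y]\<close> is \<open>'a poly poly poly poly\<close>, with \<open>y\<close> outermost.\<close>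

definition sum_two_squares_eqn :: "'a::comm_ring_1 poly poly \<Rightarrow> 'a poly poly poly poly" where
  "sum_two_squares_eqn f = (let x = [:[:0, 1:]:]; y = [:0, 1:] in x ^ 2 + y ^ 2 - [:[:f:]:])"

definition rational_sum_two_squares :: "'a::field poly poly \<Rightarrow> bool" where
  "rational_sum_two_squares f \<longleftrightarrow>
     (let F = sum_two_squares_eqn f in
      rational_threefold (hypersurface_ring F) (hypersurface_const F (\<lambda>c. [:[:[:[:c:]:]:]:])))"


section \<open>Function fields of one variable\<close>

text \<open>\<open>K\<close> is a field and \<open>k\<close> the subfield of constants. The closed points of the smooth projective
  model of \<open>K\<close> over \<open>k\<close> are the normalized discrete valuations of \<open>K\<close> trivial on \<open>k\<close>. Since
  \<open>v(0) = \<infinity>\<close>, valuations are functions on the nonzero elements only (and \<open>undefined\<close> elsewhere,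
  so that each place is represented by exactly one function).\<close>

definition places :: "'r ring \<Rightarrow> 'r set \<Rightarrow> ('r \<Rightarrow> int) set" where
  "places K k =
     {v \<in> extensional (carrier K - {\<zero>\<^bsub>K\<^esub>}).
        (\<forall>x\<in>carrier K - {\<zero>\<^bsub>K\<^esub>}. \<forall>y\<in>carrier K - {\<zero>\<^bsub>K\<^esub>}.
           v (x \<otimes>\<^bsub>K\<^esub> y) = v x + v y \<and>
           (x \<oplus>\<^bsub>K\<^esub> y \<noteq> \<zero>\<^bsub>K\<^esub> \<longrightarrow> v (x \<oplus>\<^bsub>K\<^esub> y) \<ge> min (v x) (v y))) \<and>
        v ` (carrier K - {\<zero>\<^bsub>K\<^esub>}) = UNIV \<and>
        (\<forall>c\<in>k - {\<zero>\<^bsub>K\<^esub>}. v c = 0)}"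

definition place_ring :: "'r ring \<Rightarrow> ('r \<Rightarrow> int) \<Rightarrow> 'r ring" where
  "place_ring K v = K \<lparr>carrier := {x \<in> carrier K. x = \<zero>\<^bsub>K\<^esub> \<or> v x \<ge> 0}\<rparr>"

definition place_ideal :: "'r ring \<Rightarrow> ('r \<Rightarrow> int) \<Rightarrow> 'r set" where
  "place_ideal K v = {x \<in> carrier K. x = \<zero>\<^bsub>K\<^esub> \<or> v x > 0}"

definition residue_field :: "'r ring \<Rightarrow> ('r \<Rightarrow> int) \<Rightarrow> 'r set ring" where
  "residue_field K v = place_ring K v Quot place_ideal K v"

definition residue_consts :: "'r ring \<Rightarrow> 'r set \<Rightarrow> ('r \<Rightarrow> int) \<Rightarrow> 'r set set" where
  "residue_consts K k v = (\<lambda>c. place_ideal K v +>\<^bsub>place_ring K v\<^esub> c) ` k"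

definition place_degree :: "'r ring \<Rightarrow> 'r set \<Rightarrow> ('r \<Rightarrow> int) \<Rightarrow> nat" where
  "place_degree K k v =
     ring.dim (residue_field K v) (residue_consts K k v) (carrier (residue_field K v))"

text \<open>The \<open>k\<close>-points of the smooth projective model are the places with residue field \<open>k\<close>.\<close>

definition rational_places :: "'r ring \<Rightarrow> 'r set \<Rightarrow> ('r \<Rightarrow> int) set" where
  "rational_places K k =
     {v \<in> places K k. carrier (residue_field K v) = residue_consts K k v}"

definition divisors :: "'r ring \<Rightarrow> 'r set \<Rightarrow> (('r \<Rightarrow> int) \<Rightarrow> int) set" where
  "divisors K k = {D. finite {v. D v \<noteq> 0} \<and> {v. D v \<noteq> 0} \<subseteq> places K k}"

definition divisor_degree :: "'r ring \<Rightarrow> 'r set \<Rightarrow> (('r \<Rightarrow> int) \<Rightarrow> int) \<Rightarrow> int" where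
  "divisor_degree K k D = (\<Sum>v | D v \<noteq> 0. D v * int (place_degree K k v))"

definition riemann_roch_space :: "'r ring \<Rightarrow> 'r set \<Rightarrow> (('r \<Rightarrow> int) \<Rightarrow> int) \<Rightarrow> 'r set" where
  "riemann_roch_space K k D =
     {x \<in> carrier K. x = \<zero>\<^bsub>K\<^esub> \<or> (\<forall>v\<in>places K k. v x \<ge> - D v)}"

text \<open>The genus is the maximum of \<open>deg D - l(D) + 1\<close> over all divisors \<open>D\<close>. This is the
  usual definition when \<open>k\<close> is algebraically closed in \<open>K\<close>, which holds below since the
  curve is geometrically integral.\<close>

definition has_genus :: "'r ring \<Rightarrow> 'r set \<Rightarrow> int \<Rightarrow> bool" where
  "has_genus K k g \<longleftrightarrow>
     (let \<delta> = (\<lambda>D. divisor_degree K k D - int (ring.dim K k (riemann_roch_space K k D)) + 1) in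
      (\<exists>D\<in>divisors K k. \<delta> D = g) \<and> (\<forall>D\<in>divisors K k. \<delta> D \<le> g))"


section \<open>Plane curves\<close>

definition total_degree :: "'a::zero poly poly \<Rightarrow> nat" where
  "total_degree f = Max (insert 0 {i + j | i j. poly.coeff (poly.coeff f j) i \<noteq> 0})"

text \<open>The homogenization of \<open>f(v,w)\<close> with respect to a third variable \<open>u\<close>, the outermost one;
  it is the equation of the closure of \<open>{f = 0}\<close> in the projective plane.\<close>

definition homogenization :: "'a::comm_ring_1 poly poly \<Rightarrow> 'a poly poly poly" where
  "homogenization f =
     (let d = total_degree f in
      \<Sum>(i, j) | i + j \<le> d.
        Polynomial.monom (Polynomial.monom (Polynomial.monom (poly.coeff (poly.coeff f j) i) i) j)
          (d - i - j))"

text \<open>Evaluation of \<open>G(v,w,u)\<close> in an algebra with structure map \<open>\<iota>\<close>.\<close>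

definition eval3 ::
    "('a::comm_ring_1 \<Rightarrow> 'b::comm_ring_1) \<Rightarrow> 'a poly poly poly \<Rightarrow> 'b \<Rightarrow> 'b \<Rightarrow> 'b \<Rightarrow> 'b" where
  "eval3 \<iota> G v w u =
     poly (map_poly (\<lambda>g. poly (map_poly (\<lambda>h. poly (map_poly \<iota> h) v) g) w) G) u"

text \<open>Local equations of the projective plane curve \<open>G = 0\<close> at its points and at the other points of
  the plane, in the three standard affine charts: in each chart, the point \<open>(a,b)\<close> is translated
  to the origin. The local coordinates are \<open>s\<close> (inner variable) and \<open>t\<close> (outer variable).\<close>

definition local_equations :: "'a::comm_ring_1 poly poly poly \<Rightarrow> 'a poly poly set" where
  "local_equations G =
     (\<Union>a b. let as = [:[:a, 1:]:]; bt = [:[:b:], 1:]; E = eval3 (\<lambda>c. [:[:c:]:]) G in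
        {E as bt 1, E as 1 bt, E 1 as bt})"

definition singular_at_origin :: "'a::idom poly poly \<Rightarrow> bool" where
  "singular_at_origin g \<longleftrightarrow>
     poly (poly g 0) 0 = 0 \<and> poly (poly (map_poly pderiv g) 0) 0 = 0 \<and>
     poly (poly (pderiv g) 0) 0 = 0"

text \<open>Ordinary double point: multiplicity two with distinct tangent lines, that is, the degree two
  part of \<open>g\<close> is the product of two non-proportional linear forms \<open>\<alpha> s + \<beta> t\<close> and
  \<open>\<gamma> s + \<delta> t\<close>. To be used over algebraically closed fields.\<close>

definition ordinary_double_point_at_origin :: "'a::idom poly poly \<Rightarrow> bool" where
  "ordinary_double_point_at_origin g \<longleftrightarrow>
     singular_at_origin g \<and>
     (\<exists>\<alpha> \<beta> \<gamma> \<delta>. \<alpha> * \<delta> - \<beta> * \<gamma> \<noteq> 0 \<and>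
        poly.coeff (poly.coeff g 0) 2 = \<alpha> * \<gamma> \<and>
        poly.coeff (poly.coeff g 1) 1 = \<alpha> * \<delta> + \<beta> * \<gamma> \<and>
        poly.coeff (poly.coeff g 2) 0 = \<beta> * \<delta>)"

definition nodal_plane_curve :: "'a::idom poly poly poly \<Rightarrow> bool" where
  "nodal_plane_curve G \<longleftrightarrow>
     (\<forall>g\<in>local_equations G. singular_at_origin g \<longrightarrow> ordinary_double_point_at_origin g)"

text \<open>The normalization \<open>\<Delta>\<close> of the closure of \<open>{f = 0}\<close> is the smooth projective curve whose
  function field is that of the affine curve \<open>f = 0\<close>.\<close>

definition curve_function_field ::
    "'a::field poly poly \<Rightarrow> ('a poly poly set \<times> 'a poly poly set) set ring" where
  "curve_function_field f =
     (let A = hypersurface_ring f in localization A (carrier A - {\<zero>\<^bsub>A\<^esub>}))"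

definition curve_constants ::
    "'a::field poly poly \<Rightarrow> ('a poly poly set \<times> 'a poly poly set) set set" where
  "curve_constants f =
     (let A = hypersurface_ring f in
      range (\<lambda>c. fraction A (carrier A - {\<zero>\<^bsub>A\<^esub>})
                   (hypersurface_const f (\<lambda>c. [:[:c:]:]) c) \<one>\<^bsub>A\<^esub>))"

definition normalization_points ::
    "'a::field poly poly \<Rightarrow> (('a poly poly set \<times> 'a poly poly set) set \<Rightarrow> int) set" where
  "normalization_points f = rational_places (curve_function_field f) (curve_constants f)"

text \<open>Geometric integrality is primality of the equation over the algebraic closure.\<close>

definition nodal_rational_closure :: "'a::field poly poly \<Rightarrow> bool" where
  "nodal_rational_closure f \<longleftrightarrow>
     (let G = homogenization (map_poly (map_poly to_ac) f) in
      prime_elem G \<and> nodal_plane_curve G) \<and>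
     has_genus (curve_function_field f) (curve_constants f) 0"

definition nonnegative_poly :: "'a::linordered_field poly poly \<Rightarrow> bool" where
  "nonnegative_poly f \<longleftrightarrow> (\<forall>r s. poly (poly f [:s:]) r \<ge> 0)"

end

theory Submission
 imports Defs
begin

text \<open>
 Let \<open>K\<close> be the function field of the curve \<open>f = 0\<close> over the real closed field \<open>R\<close>. The idea is to
 find coordinates \<open>v', w'\<close> of the plane in which \<open>f\<close> has degree at most two in \<open>w'\<close>, so that
 \<open>x\<^sup>2 + y\<^sup>2 = f\<close> becomes a conic bundle \<open>x\<^sup>2 + y\<^sup>2 = a w'\<^sup>2 + b w' + c\<close> over the \<open>v'\<close>-line. Classically
 one projects a quartic from a double point; here the pencil of lines is found on the normalization.

 Since the genus is zero, \<open>dim L(D) \<ge> deg D + 1\<close> for divisors \<open>D\<close> of degree \<open>\<ge> 0\<close>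
 (\<open>genus_0_sections\<close>). Choose a place \<open>P\<close> of degree \<open>\<delta> = 1\<close> or, if there is none, with residue field
 \<open>R(\<surd>-1)\<close> and \<open>\<delta> = 2\<close>. Such places exist because quartics factor over \<open>R\<close>. The curve is then a line or a
 circle (\<open>model_rational_place\<close>, \<open>model_complex_place\<close>). Take \<open>n\<close> minimal with \<open>h\<langle>1, v, w\<rangle> \<subseteq> L(nP)\<close> for
 some \<open>h \<noteq> 0\<close>. By minimality \<open>h, hv, hw\<close> have no common zero, so a suitable quotient \<open>u\<close> of two linear
 forms has a coprime numerator and denominator, and elements of \<open>L((n - 1)P)\<close> that are independent over \<open>R\<close>
 stay independent over \<open>R(u)\<close>. As \<open>[K : R(u)] \<le> 4\<close>, it follows that \<open>(n - 1)\<delta> < 4\<close>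
 (\<open>level_bound\<close>). So \<open>\<Lambda> = h\<langle>1, v, w\<rangle>\<close> has codimension at most two in a space of dimension five that contains
 the products of elements of a three-dimensional space \<open>V\<close>. The two linear forms cutting out \<open>\<Lambda>\<close> define a
 pencil of symmetric bilinear forms on \<open>V\<close>, which has a singular member because a real cubic has a root. Its
 radical gives \<open>m p\<^sub>1, m p\<^sub>2 \<in> \<Lambda>\<close> with \<open>p\<^sub>1, p\<^sub>2 \<in> V\<close> independent (\<open>ex_quadratic_pencil\<close>). Thus
 \<open>v' = p\<^sub>1/p\<^sub>2\<close> is a quotient of linear forms in \<open>1, v, w\<close>, and \<open>K = R(v')(\<omega>)\<close> with \<open>\<omega>\<^sup>2 = e(v')\<close>,
 \<open>deg e \<le> 2\<close>, since lines meet a conic in two points.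

 In these coordinates \<open>b\<^sup>2 - 4ac\<close> is \<open>e\<close> times a square, so completing the square turns the threefold into
 \<open>x\<^sup>2 + y\<^sup>2 = a (w\<^sup>2 - e)\<close> (up to squares). At a simple real zero of \<open>a\<close>, and at infinity, \<open>e\<close> is nonnegative,
 because otherwise the curve would contain a line (\<open>rational_if_quadratic\<close>). This makes \<open>a\<close> a constant times a
 sum of two squares or a norm from \<open>R(v)(\<surd>e)\<close>, and such a factor can be absorbed into \<open>x + iy\<close> or
 \<open>w + \<surd>e\<close>. What remains is a split quadric or a quadric with a rational point, and these are rational
 (\<open>rational_sum_two_squares_conic_bundle\<close>). The only bad case, \<open>a\<close> and \<open>e\<close> both nonpositive, is excluded by
 a real point of the normalization or by \<open>f \<ge> 0\<close>.

 All fields are subfields \<open>fieldgen k S\<close> of a large algebraically closed field.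
 Birationality is reduced to an equality of such fields (\<open>rational_if_purely_transcendental\<close>), and the places
 and Riemann-Roch spaces of the abstract function field are carried over to \<open>K\<close>.
\<close>

hide_const (open) UnivPoly.monom UnivPoly.coeff Polynomials.degree

section \<open>Evaluation of iterated polynomials\<close>

locale comm_hom =
 fixes k :: "'a::comm_ring_1 => 'b::comm_ring_1"
 assumes hom_0 [simp]: "k 0 = 0"
  and hom_1 [simp]: "k 1 = 1"
  and hom_add [simp]: "k (x + y) = k x + k y"
  and hom_mult [simp]: "k (x * y) = k x * k y"
begin

lemma hom_minus [simp]: "k (- x) = - k x"
 using hom_add[of x "- x"] by (simp add: eq_neg_iff_add_eq_0 add.commute)

lemma hom_diff [simp]: "k (x - y) = k x - k y"
 using hom_add[of x "- y"] by simp

lemma hom_power [simp]: "k (x ^ n) = k x ^ n"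
 by (induction n) auto

lemma hom_sum: "k (sum g A) = (\<Sum>i\<in>A. k (g i))"
 by (induction A rule: infinite_finite_induct) auto

lemma hom_prod: "k (prod g A) = (\<Prod>i\<in>A. k (g i))"
 by (induction A rule: infinite_finite_induct) auto

lemma hom_of_nat [simp]: "k (of_nat n) = of_nat n"
 by (induction n) auto

lemma hom_numeral [simp]: "k (numeral n) = numeral n"
 using hom_of_nat[of "numeral n"] by (simp del: hom_of_nat)

end

definition peval :: "('a::comm_ring_1 => 'b::comm_ring_1) => 'a poly => 'b => 'b" where
 "peval k p x = poly (map_poly k p) x"

definition ev2 :: "('a::comm_ring_1 => 'b::comm_ring_1) => 'a poly poly => 'b => 'b => 'b" where
 "ev2 k p v w = peval (\<lambda>g. peval k g v) p w"

context comm_hom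
begin

lemma peval_pCons [simp]: "peval k (pCons a p) x = k a + x * peval k p x"
 by (cases "a = 0 \<and> p = 0") (auto simp: peval_def map_poly_pCons)

lemma peval_0 [simp]: "peval k 0 x = 0"
 by (simp add: peval_def)

lemma peval_add [simp]: "peval k (p + q) x = peval k p x + peval k q x"
proof (induction p arbitrary: q)
 case (pCons a p)
 show ?case
 proof (cases q)
  case (pCons b q')
  then show ?thesis using pCons.IH[of q'] by (simp add: algebra_simps)
 qed
qed simp

lemma peval_smult [simp]: "peval k (smult c p) x = k c * peval k p x"
 by (induction p) (auto simp: algebra_simps)

lemma peval_mult [simp]: "peval k (p * q) x = peval k p x * peval k q x"
 by (induction p) (auto simp: algebra_simps)

lemma peval_1 [simp]: "peval k 1 x = 1"
 by (simp add: one_pCons)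

lemma comm_hom_peval: "comm_hom (\<lambda>p. peval k p x)"
 by unfold_locales auto

lemma comm_hom_ev2: "comm_hom (\<lambda>p. ev2 k p v w)"
 unfolding ev2_def using comm_hom.comm_hom_peval[OF comm_hom_peval] .

lemma peval_monom [simp]: "peval k (Polynomial.monom c n) x = k c * x ^ n"
 by (induction n) (auto simp: monom_0 monom_Suc algebra_simps)

lemma peval_sum_le:
 assumes "degree p \<le> n"
 shows "peval k p x = (\<Sum>i\<le>n. k (coeff p i) * x ^ i)"
proof -
 interpret E: comm_hom "\<lambda>p. peval k p x" by (rule comm_hom_peval)
 have "p = (\<Sum>i\<le>n. Polynomial.monom (coeff p i) i)"
  using poly_as_sum_of_monoms'[OF assms] by simp
 then have "peval k p x = (\<Sum>i\<le>n. peval k (Polynomial.monom (coeff p i) i) x)"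
  by (metis E.hom_sum)
 then show ?thesis by simp
qed

lemma ev2_simps [simp]:
 "ev2 k 0 v w = 0" "ev2 k 1 v w = 1" "ev2 k (p + q) v w = ev2 k p v w + ev2 k q v w"
 "ev2 k (p * q) v w = ev2 k p v w * ev2 k q v w" "ev2 k (- p) v w = - ev2 k p v w"
 "ev2 k (p - q) v w = ev2 k p v w - ev2 k q v w" "ev2 k (p ^ n) v w = ev2 k p v w ^ n"
 using comm_hom.hom_0[OF comm_hom_ev2] comm_hom.hom_1[OF comm_hom_ev2]
  comm_hom.hom_add[OF comm_hom_ev2] comm_hom.hom_mult[OF comm_hom_ev2]
  comm_hom.hom_minus[OF comm_hom_ev2] comm_hom.hom_diff[OF comm_hom_ev2]
  comm_hom.hom_power[OF comm_hom_ev2]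
 by metis+

lemma ev2_pCons [simp]: "ev2 k (pCons a p) v w = peval k a v + w * ev2 k p v w"
 unfolding ev2_def by (rule comm_hom.peval_pCons[OF comm_hom_peval])

lemma ev2_sum: "ev2 k (sum g A) v w = (\<Sum>i\<in>A. ev2 k (g i) v w)"
 using comm_hom.hom_sum[OF comm_hom_ev2] .

lemma peval_minus [simp]: "peval k (- p) x = - peval k p x"
 using comm_hom.hom_minus[OF comm_hom_peval] .

lemma peval_diff [simp]: "peval k (p - q) x = peval k p x - peval k q x"
 using comm_hom.hom_diff[OF comm_hom_peval] .

lemma peval_power [simp]: "peval k (p ^ n) x = peval k p x ^ n"
 using comm_hom.hom_power[OF comm_hom_peval] .

lemma peval_sum: "peval k (sum g A) x = (\<Sum>i\<in>A. peval k (g i) x)"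
 using comm_hom.hom_sum[OF comm_hom_peval] .

lemma peval_poly: "peval k p (k x) = k (poly p x)"
 by (induction p) auto

end

lemma comm_hom_comp: "comm_hom h ==> comm_hom k ==> comm_hom (\<lambda>x. h (k x))"
 unfolding comm_hom_def by simp

lemma hom_peval:
 assumes "comm_hom h" "comm_hom k"
 shows "h (peval k p x) = peval (\<lambda>c. h (k c)) p (h x)"
proof -
 interpret h: comm_hom h by fact
 interpret k: comm_hom k by fact
 interpret hk: comm_hom "\<lambda>c. h (k c)" by (rule comm_hom_comp) fact+
 show ?thesis by (induction p) auto
qed

lemma hom_ev2:
 assumes "comm_hom h" "comm_hom k"
 shows "h (ev2 k p v w) = ev2 (\<lambda>c. h (k c)) p (h v) (h w)"
 unfolding ev2_def
 by (subst hom_peval[OF assms(1) comm_hom.comm_hom_peval[OF assms(2)]])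
  (simp add: hom_peval[OF assms])

section \<open>Total degree and homogeneous evaluation\<close>

definition tdeg_le :: "'a::zero poly poly => nat => bool" where
 "tdeg_le p n \<longleftrightarrow> (\<forall>i j. coeff (coeff p j) i ~= 0 \<longrightarrow> i + j \<le> n)"

lemma finite_poly_support: "finite {(i, j). coeff (coeff p j) i ~= 0}"
proof (rule finite_subset)
 show "{(i, j). coeff (coeff p j) i ~= 0}
   \<subseteq> (\<Union>j\<in>{..degree p}. (\<lambda>i. (i, j)) ` {..degree (coeff p j)})"
  by (auto simp: image_iff intro!: le_degree)
qed simp

lemma total_degree_le_iff: "total_degree p \<le> n \<longleftrightarrow> tdeg_le p n"
proof -
 have eq: "{i + j | i j. coeff (coeff p j) i ~= 0}
   = (\<lambda>(i, j). i + j) ` {(i, j). coeff (coeff p j) i ~= 0}"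
  unfolding image_def by fastforce
 have fin: "finite (insert 0 {i + j | i j. coeff (coeff p j) i ~= 0})"
  unfolding eq using finite_poly_support[of p] by simp
 show ?thesis unfolding total_degree_def tdeg_le_def Max_le_iff[OF fin insert_not_empty]
  by blast
qed

lemma tdeg_le_mono: "tdeg_le p m ==> m \<le> n ==> tdeg_le p n"
 unfolding tdeg_le_def by (meson order_trans)

lemma ex_tdeg_le: "\<exists>n. tdeg_le p n"
 using total_degree_le_iff by blast

lemma tdeg_le_0 [simp]: "tdeg_le 0 n"
 by (simp add: tdeg_le_def)

lemma tdeg_le_add:
 fixes p q :: "'a::comm_ring_1 poly poly"
 shows "tdeg_le p n ==> tdeg_le q n ==> tdeg_le (p + q) n"
 unfolding tdeg_le_def by (metis add_0 coeff_add)

lemma tdeg_le_sum: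
 fixes g :: "'c => 'a::comm_ring_1 poly poly"
 shows "(\<And>i. i \<in> A ==> tdeg_le (g i) n) ==> tdeg_le (sum g A) n"
 by (induction A rule: infinite_finite_induct) (auto intro: tdeg_le_add)

lemma tdeg_le_mult:
 fixes p q :: "'a::comm_ring_1 poly poly"
 assumes "tdeg_le p m" "tdeg_le q n"
 shows "tdeg_le (p * q) (m + n)"
 unfolding tdeg_le_def
proof (intro allI impI)
 fix i j assume ne: "coeff (coeff (p * q) j) i ~= 0"
 have "coeff (coeff (p * q) j) i = (\<Sum>b\<le>j. \<Sum>a\<le>i.
   coeff (coeff p b) a * coeff (coeff q (j - b)) (i - a))"
  by (simp add: coeff_mult coeff_sum)
 then obtain b where b: "b \<le> j" "(\<Sum>a\<le>i.
   coeff (coeff p b) a * coeff (coeff q (j - b)) (i - a)) ~= 0"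
  using ne by (metis (no_types, lifting) atMost_iff sum.neutral)
 then obtain a where a: "a \<le> i" "coeff (coeff p b) a * coeff (coeff q (j - b)) (i - a) ~= 0"
  by (metis (no_types, lifting) atMost_iff sum.neutral)
 then have "a + b \<le> m" "i - a + (j - b) \<le> n"
  using assms unfolding tdeg_le_def by (metis mult_zero_left mult_zero_right)+
 then show "i + j \<le> m + n" using a b by linarith
qed

lemma tdeg_le_const [simp]: "tdeg_le [:[:c:]:] n"
 by (auto simp: tdeg_le_def coeff_pCons split: nat.splits)

lemma tdeg_le_power:
 fixes p :: "'a::comm_ring_1 poly poly"
 assumes "tdeg_le p m"
 shows "tdeg_le (p ^ n) (n * m)"
proof (induction n)
 case 0
 show ?case using tdeg_le_const[of 1 0] by (simp add: one_pCons)
next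
 case (Suc n)
 then show ?case using tdeg_le_mult[OF assms Suc] by simp
qed

lemma tdeg_le_linear: "tdeg_le [:[:a, b:], [:c:]:] 1"
 by (auto simp: tdeg_le_def coeff_pCons split: nat.splits)

lemma tdeg_le_degree:
 assumes "tdeg_le p n" shows "degree p \<le> n" "degree (coeff p j) \<le> n - j"
proof -
 show "degree p \<le> n"
 proof (rule degree_le, intro allI impI)
  fix j assume "n < j"
  then have "coeff (coeff p j) i = 0" for i
   using assms unfolding tdeg_le_def by (metis add_leD2 leD)
  then show "coeff p j = 0" by (simp add: poly_eq_iff)
 qed
 show "degree (coeff p j) \<le> n - j"
 proof (rule degree_le, intro allI impI)
  fix i assume "n - j < i"
  then show "coeff (coeff p j) i = 0"
   using assms unfolding tdeg_le_def by (metis less_diff_conv2 le_cases not_le add_leD2 less_diff_conv)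
 qed
qed

definition heval ::
  "('a::comm_ring_1 => 'b::comm_ring_1) => nat => 'a poly poly => (nat => 'b) => 'b" where
 "heval k n p Z = (\<Sum>j\<le>n. \<Sum>i\<le>n - j.
   k (coeff (coeff p j) i) * (Z 1 ^ i * Z 2 ^ j * Z 0 ^ (n - j - i)))"

lemma (in comm_hom) ev2_sum_le:
 assumes "tdeg_le p n"
 shows "ev2 k p v w = (\<Sum>j\<le>n. \<Sum>i\<le>n - j. k (coeff (coeff p j) i) * (v ^ i * w ^ j))"
proof -
 have "ev2 k p v w = (\<Sum>j\<le>n. peval k (coeff p j) v * w ^ j)"
  unfolding ev2_def
  by (rule comm_hom.peval_sum_le[OF comm_hom_peval tdeg_le_degree(1)[OF assms]])
 also have "\<dots> = (\<Sum>j\<le>n. (\<Sum>i\<le>n - j. k (coeff (coeff p j) i) * v ^ i) * w ^ j)"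
  by (intro sum.cong refl) (simp add: peval_sum_le[OF tdeg_le_degree(2)[OF assms]])
 finally show ?thesis by (simp add: sum_distrib_right mult.assoc)
qed

lemma heval_homogeneous: "heval k n p (\<lambda>i. c * Z i) = c ^ n * heval k n p Z"
proof -
 have "k (coeff (coeff p j) i) * ((c * Z 1) ^ i * (c * Z 2) ^ j * (c * Z 0) ^ (n - j - i))
   = c ^ n * (k (coeff (coeff p j) i) * (Z 1 ^ i * Z 2 ^ j * Z 0 ^ (n - j - i)))"
  if "j \<le> n" "i \<le> n - j" for i j
 proof -
  have "c ^ (i + j + (n - j - i)) = c ^ i * c ^ j * c ^ (n - j - i)" by (simp only: power_add)
  moreover have "i + j + (n - j - i) = n" using that by simp
  ultimately have "c ^ n = c ^ i * c ^ j * c ^ (n - j - i)" by simp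
  then show ?thesis by (simp add: power_mult_distrib ac_simps)
 qed
 then show ?thesis unfolding heval_def sum_distrib_left by (intro sum.cong refl) auto
qed

lemma (in comm_hom) heval_affine:
 assumes "tdeg_le p n" "Z 0 = 1"
 shows "heval k n p Z = ev2 k p (Z 1) (Z 2)"
 using assms by (simp add: heval_def ev2_sum_le)

lemma heval_field:
 fixes k :: "'a::comm_ring_1 => 'b::field"
 assumes "comm_hom k" "tdeg_le p n" "Z 0 ~= 0"
 shows "heval k n p Z = Z 0 ^ n * ev2 k p (Z 1 / Z 0) (Z 2 / Z 0)"
 using heval_homogeneous[of k n p "Z 0" "\<lambda>i. Z i / Z 0"]
  comm_hom.heval_affine[OF assms(1,2), of "\<lambda>i. Z i / Z 0"] assms(3)
 by simp

lemma hom_heval: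
 assumes "comm_hom h" "comm_hom k"
 shows "h (heval k n p Z) = heval (\<lambda>c. h (k c)) n p (\<lambda>i. h (Z i))"
proof -
 interpret comm_hom h by fact
 show ?thesis unfolding heval_def by (simp add: hom_sum)
qed

lemma heval_cong: "Z 0 = Y 0 ==> Z 1 = Y 1 ==> Z 2 = Y 2 ==> heval k n p Z = heval k n p Y"
 by (simp add: heval_def)

text \<open>The monomial substitution \<open>(v, w) \<mapsto> (uv, uw)\<close> turns the total degree into the degree in the
 single variable \<open>u\<close>; reversing coefficients then gives the homogenization.\<close>

definition grade :: "'a::comm_ring_1 poly poly => 'a poly poly poly" where
 "grade p = ev2 (\<lambda>c. [:[:[:c:]:]:]) p [:0, [:[:0, 1:]:]:] [:0, [:0, 1:]:]"

lemma comm_hom_const3: "comm_hom (\<lambda>c::'a::comm_ring_1. [:[:[:c:]:]:])"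
 by unfold_locales (auto simp: one_pCons)

lemma comm_hom_const2: "comm_hom (\<lambda>c::'a::comm_ring_1. [:[:c:]:])"
 by unfold_locales (auto simp: one_pCons)

lemma comm_hom_const4: "comm_hom (\<lambda>c::'a::comm_ring_1. [:[:[:[:c:]:]:]:])"
 by unfold_locales (auto simp: one_pCons)

lemma comm_hom_grade: "comm_hom (grade :: 'a::comm_ring_1 poly poly => _)"
 unfolding grade_def[abs_def] by (rule comm_hom.comm_hom_ev2[OF comm_hom_const3])

lemma grade_monom:
 "[:[:[:c:]:]:] * ([:0, [:[:0, 1:]:]:] ^ i * [:0, [:0, 1:]:] ^ j)
  = Polynomial.monom (Polynomial.monom (Polynomial.monom (c::'a::comm_ring_1) i) j) (i + j)"
proof -
 have A: "[:0, q:] ^ i = Polynomial.monom (q ^ i) i" for q :: "'a poly poly" and i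
  by (induction i) (auto simp: monom_0 monom_Suc one_pCons smult_monom)
 have B: "[:[:0, 1:]:] ^ i = [:Polynomial.monom (1::'a) i:]" for i
  by (induction i) (auto simp: monom_0 monom_Suc one_pCons)
 have C: "[:0, 1:] ^ j = Polynomial.monom (1::'a poly) j" for j
  by (simp add: monom_altdef)
 show ?thesis
  unfolding A B C by (simp add: mult_monom smult_monom)
qed

lemma coeff_grade:
 "coeff (coeff (coeff (grade p) n) j) i
  = (if i + j = n then coeff (coeff p j) i else 0)"
proof -
 obtain m where m: "tdeg_le p m" using ex_tdeg_le by blast
 let ?g = "\<lambda>j i. Polynomial.monom (Polynomial.monom (Polynomial.monom (coeff (coeff p j) i) i) j) (i + j)"
 have "grade p = (\<Sum>j'\<le>m. \<Sum>i'\<le>m - j'. ?g j' i')"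
  unfolding grade_def comm_hom.ev2_sum_le[OF comm_hom_const3 m]
  by (simp only: grade_monom)
 then have "coeff (coeff (coeff (grade p) n) j) i
   = (\<Sum>j'\<le>m. \<Sum>i'\<le>m - j'. coeff (coeff (coeff (?g j' i') n) j) i)"
  by (simp add: coeff_sum)
 also have "\<dots> = (\<Sum>j'\<le>m. \<Sum>i'\<le>m - j'. if j' = j then (if i' = i then (if i + j = n then coeff (coeff p j) i else 0) else 0) else 0)"
  by (intro sum.cong refl) (auto simp: coeff_monom)
 also have "\<dots> = (\<Sum>j'\<le>m. if j' = j then (if i \<le> m - j then (if i + j = n then coeff (coeff p j) i else 0) else 0) else 0)"
  by (intro sum.cong refl) (auto simp: sum.delta)
 also have "\<dots> = (if i + j = n then coeff (coeff p j) i else 0)"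
  using m unfolding tdeg_le_def by (auto simp: sum.delta) (metis add_le_imp_le_diff add_leD2)+
 finally show ?thesis .
qed

lemma grade_degree_le_iff: "degree (grade p) \<le> n \<longleftrightarrow> tdeg_le p n"
proof
 assume "degree (grade p) \<le> n"
 then have "coeff (grade p) l = 0" if "l > n" for l
  using that by (simp add: coeff_eq_0)
 then have "coeff (coeff p j) i = 0" if "i + j > n" for i j
  using that coeff_grade[of p "i + j" j i] by simp
 then show "tdeg_le p n" unfolding tdeg_le_def by (meson not_le)
next
 assume t: "tdeg_le p n"
 show "degree (grade p) \<le> n"
 proof (rule degree_le, intro allI impI)
  fix l assume "n < l"
  then have "coeff (coeff (coeff (grade p) l) j) i = 0" for i j
   using t unfolding coeff_grade tdeg_le_def by (auto simp flip: not_le)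
  then show "coeff (grade p) l = 0" by (simp add: poly_eq_iff)
 qed
qed

lemma degree_grade: "degree (grade p) = total_degree p"
 using grade_degree_le_iff[of p] total_degree_le_iff[of p]
 by (metis le_antisym le_refl)

text \<open>Setting the grading variable to \<open>1\<close> recovers the polynomial, so grading loses no information.\<close>

lemma poly_grade_1: "poly (grade p) 1 = p"
proof -
 have h: "comm_hom (\<lambda>q::'a::comm_ring_1 poly poly poly. poly q 1)" by unfold_locales auto
 show ?thesis
 proof -
  have "poly (grade p) 1 = ev2 (\<lambda>c. [:[:c:]:]) p [:[:0, 1:]:] [:0, 1:]"
   unfolding grade_def by (subst hom_ev2[OF h comm_hom_const3]) simp
  also have "\<dots> = p"
  proof -
   have A: "peval (\<lambda>c. [:[:c:]:]) g [:[:0, 1:]:] = [:g:]" for g :: "'a poly"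
    by (induction g) (auto simp: comm_hom.peval_pCons[OF comm_hom_const2] comm_hom.peval_0[OF comm_hom_const2])
   show ?thesis
    by (induction p) (auto simp: comm_hom.ev2_pCons[OF comm_hom_const2] comm_hom.ev2_simps[OF comm_hom_const2] A)
  qed
  finally show ?thesis .
 qed
qed

lemma grade_eq_0_iff [simp]: "grade p = 0 \<longleftrightarrow> p = 0"
 using poly_grade_1[of p] comm_hom.hom_0[OF comm_hom_grade] by auto

lemma total_degree_mult:
 fixes p q :: "'a::idom poly poly"
 assumes "p ~= 0" "q ~= 0"
 shows "total_degree (p * q) = total_degree p + total_degree q"
 unfolding degree_grade[symmetric] comm_hom.hom_mult[OF comm_hom_grade]
 using assms by (simp add: degree_mult_eq)

text \<open>The power of \<open>u\<close> in the homogenization is the complement of the total degree.\<close>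

lemma homogenization_eq_reflect: "homogenization p = reflect_poly (grade p)"
proof -
 let ?d = "total_degree p"
 have fin: "finite {(i, j). i + j \<le> ?d}"
  by (rule finite_subset[of _ "{..?d} \<times> {..?d}"]) auto
 have "coeff (coeff (coeff (homogenization p) n) j) i
  = coeff (coeff (coeff (reflect_poly (grade p)) n) j) i" for n j i
 proof -
  have "coeff (coeff (coeff (homogenization p) n) j) i
    = (\<Sum>x\<in>{(i, j). i + j \<le> ?d}. if x = (i, j) then
      (if ?d - i - j = n then coeff (coeff p j) i else 0) else 0)"
   unfolding homogenization_def Let_def coeff_sum
   by (rule sum.cong) (auto simp: coeff_monom split: if_splits)
  also have "\<dots> = (if i + j \<le> ?d then (if ?d - i - j = n then coeff (coeff p j) i else 0) else 0)"
   unfolding sum.delta[OF fin] by simp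
  also have "\<dots> = coeff (coeff (coeff (reflect_poly (grade p)) n) j) i"
   by (auto simp: coeff_reflect_poly degree_grade coeff_grade)
  finally show ?thesis .
 qed
 then show ?thesis by (simp add: poly_eq_iff)
qed

text \<open>A divisor of a product \<open>AB\<close> in the affine plane becomes, after homogenization, a divisor of the
 product of the homogenizations; setting \<open>u = 1\<close> goes back.\<close>

lemma prime_elem_dehomogenize:
 fixes f :: "'a::field poly poly"
 assumes pr: "prime_elem (homogenization f)" and deg: "total_degree f > 0"
 shows "prime_elem f"
proof (rule prime_elemI)
 have one: "poly (reflect_poly q) 1 = poly q 1" for q :: "'a poly poly poly"
 proof -
  have sl: "poly (Poly xs) 1 = sum_list xs" for xs :: "'a poly poly list"
   by (induction xs) auto
  show "poly (reflect_poly q) 1 = poly q 1" using sl[of "rev (coeffs q)"] sl[of "coeffs q"]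
   by (simp add: reflect_poly_def sum_list_rev)
 qed
 have dehom: "poly (homogenization q) 1 = q" for q :: "'a poly poly"
  unfolding homogenization_eq_reflect one by (rule poly_grade_1)
 have mult: "homogenization (p * q) = homogenization p * homogenization q" for p q :: "'a poly poly"
  unfolding homogenization_eq_reflect comm_hom.hom_mult[OF comm_hom_grade]
  by (rule reflect_poly_mult)
 show "f ~= 0" using deg by (auto simp: total_degree_def)
 show "\<not> f dvd 1"
 proof
  assume "f dvd 1"
  then obtain g where g: "1 = f * g" ..
  then have "f ~= 0" "g ~= 0" by auto
  then have "total_degree (f * g) \<ge> total_degree f" by (simp add: total_degree_mult)
  moreover have "total_degree (1 :: 'a poly poly) \<le> 0"
   unfolding total_degree_le_iff using tdeg_le_const[of "1::'a" 0] by (simp add: one_pCons)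
  ultimately show False using deg g by simp
 qed
 fix a b assume "f dvd a * b"
 then have "homogenization f dvd homogenization a * homogenization b"
  by (metis mult dvd_def)
 then have "homogenization f dvd homogenization a \<or> homogenization f dvd homogenization b"
  using pr prime_elem_dvd_multD by blast
 then show "f dvd a \<or> f dvd b"
  using dehom by (metis dvd_def poly_mult)
qed

section \<open>Generated subfields and growth\<close>

inductive_set fieldgen :: "('a => 'b::field) => 'b set => 'b set" for k S where
 const: "k c \<in> fieldgen k S"
| gen: "x \<in> S ==> x \<in> fieldgen k S"
| add: "x \<in> fieldgen k S ==> y \<in> fieldgen k S ==> x + y \<in> fieldgen k S"
| mult: "x \<in> fieldgen k S ==> y \<in> fieldgen k S ==> x * y \<in> fieldgen k S"
| uminus: "x \<in> fieldgen k S ==> - x \<in> fieldgen k S"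
| inverse: "x \<in> fieldgen k S ==> inverse x \<in> fieldgen k S"

locale field_hom = comm_hom k for k :: "'a::field => 'b::field"
begin

lemma hom_eq_0_iff [simp]: "k x = 0 \<longleftrightarrow> x = 0"
proof
 assume *: "k x = 0"
 show "x = 0"
 proof (rule ccontr)
  assume "x ~= 0"
  then have "k x * k (inverse x) = 1" using hom_mult[of x "inverse x"] by simp
  then show False using * by simp
 qed
qed simp

lemma hom_eq_iff [simp]: "k x = k y \<longleftrightarrow> x = y"
 using hom_eq_0_iff[of "x - y"] by simp

lemma hom_inverse [simp]: "k (inverse x) = inverse (k x)"
proof (cases "x = 0")
 case False
 then have "k x * k (inverse x) = 1" using hom_mult[of x "inverse x"] by simp
 then show ?thesis by (simp add: inverse_unique)
qed simp

lemma hom_divide [simp]: "k (x / y) = k x / k y"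
 by (simp add: field_class.field_divide_inverse)

sublocale vs: vector_space "\<lambda>c x. k c * x"
 by unfold_locales (auto simp: algebra_simps)

lemmas fg = fieldgen.intros

lemma fg_0 [simp]: "0 \<in> fieldgen k S" using fg(1)[of k 0 S] by simp
lemma fg_1 [simp]: "1 \<in> fieldgen k S" using fg(1)[of k 1 S] by simp
lemma fg_diff: "x \<in> fieldgen k S ==> y \<in> fieldgen k S ==> x - y \<in> fieldgen k S"
 using fg(3)[OF _ fg(5)] by fastforce
lemma fg_divide: "x \<in> fieldgen k S ==> y \<in> fieldgen k S ==> x / y \<in> fieldgen k S"
 unfolding field_class.field_divide_inverse by (simp add: fg)
lemma fg_power: "x \<in> fieldgen k S ==> x ^ n \<in> fieldgen k S"
 by (induction n) (auto intro: fg)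
lemma fg_sum: "(\<And>i. i \<in> A ==> g i \<in> fieldgen k S) ==> sum g A \<in> fieldgen k S"
 by (induction A rule: infinite_finite_induct) (auto intro: fg)
lemma fg_prod: "(\<And>i. i \<in> A ==> g i \<in> fieldgen k S) ==> prod g A \<in> fieldgen k S"
 by (induction A rule: infinite_finite_induct) (auto intro: fg)
lemma fg_peval: "x \<in> fieldgen k S ==> peval k p x \<in> fieldgen k S"
 by (induction p) (auto intro: fg)
lemma fg_ev2: "v \<in> fieldgen k S ==> w \<in> fieldgen k S ==> ev2 k p v w \<in> fieldgen k S"
 by (induction p) (auto intro: fg fg_peval)

lemmas fgI = fg fg_diff fg_divide fg_power fg_sum fg_prod fg_peval fg_ev2

lemma fieldgen_least:
 assumes "S \<subseteq> fieldgen k T" "x \<in> fieldgen k S"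
 shows "x \<in> fieldgen k T"
 using assms(2) by (induction x rule: fieldgen.induct) (use assms(1) in \<open>auto intro: fg\<close>)

lemma fieldgen_eqI: "S \<subseteq> fieldgen k T ==> T \<subseteq> fieldgen k S ==> fieldgen k S = fieldgen k T"
 using fieldgen_least by blast

definition indep_fam :: "'i set => ('i => 'b) => bool" where
 "indep_fam I z \<longleftrightarrow> (\<forall>c. (\<Sum>i\<in>I. k (c i) * z i) = 0 \<longrightarrow> (\<forall>i\<in>I. c i = 0))"

text \<open>Steinitz exchange for families, where repetitions count as dependence.\<close>

lemma indep_fam_card_le:
 assumes "finite I" "indep_fam I z" "\<And>i. i \<in> I ==> z i \<in> vs.span B" "finite B"
 shows "card I \<le> card B"
proof -
 have inj: "inj_on z I"
 proof (rule inj_onI, rule ccontr)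
  fix i j assume ij: "i \<in> I" "j \<in> I" "z i = z j" "i ~= j"
  define c where "c = (\<lambda>l. if l = i then 1 else if l = j then - 1 else (0::'a))"
  have "(\<Sum>l\<in>I. k (c l) * z l) = (\<Sum>l\<in>{i, j}. k (c l) * z l)"
   using assms(1) ij by (intro sum.mono_neutral_right) (auto simp: c_def)
  also have "\<dots> = 0" using ij by (simp add: c_def)
  finally have "c i = 0" using assms(2) ij(1) unfolding indep_fam_def by blast
  then show False by (simp add: c_def)
 qed
 have "vs.independent (z ` I)"
 proof (rule vs.independent_if_scalars_zero)
  show "finite (z ` I)" using assms(1) by simp
  fix g x assume s: "(\<Sum>x\<in>z ` I. k (g x) * x) = 0" and x: "x \<in> z ` I"
  have "(\<Sum>i\<in>I. k (g (z i)) * z i) = 0"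
   using s by (simp add: sum.reindex[OF inj])
  then have "\<forall>i\<in>I. g (z i) = 0"
   using assms(2) unfolding indep_fam_def by (elim allE[of _ "\<lambda>i. g (z i)"]) blast
  then show "g x = 0" using x by blast
 qed
 then have "card (z ` I) \<le> card B"
  using vs.independent_span_bound[OF assms(4)] assms(3) by blast
 then show ?thesis by (simp add: card_image[OF inj])
qed

lemma indep_fam_scale: "b ~= 0 ==> indep_fam I z ==> indep_fam I (\<lambda>i. b * z i)"
 unfolding indep_fam_def
proof (intro allI impI)
 fix c assume b: "b ~= 0" "\<forall>c. (\<Sum>i\<in>I. k (c i) * z i) = 0 \<longrightarrow> (\<forall>i\<in>I. c i = 0)"
  and s: "(\<Sum>i\<in>I. k (c i) * (b * z i)) = 0"
 have "b * (\<Sum>i\<in>I. k (c i) * z i) = 0" using s by (simp add: sum_distrib_left ac_simps)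
 then show "\<forall>i\<in>I. c i = 0" using b by simp
qed

lemma span_mult_closed:
 assumes "\<And>x. x \<in> A ==> y * x \<in> vs.span B" "z \<in> vs.span A"
 shows "y * z \<in> vs.span B"
 using assms(2)
proof (induction rule: vs.span_induct_alt)
 case base
 show ?case by (simp add: vs.span_zero)
next
 case (step c x z)
 have "y * (k c * x + z) = k c * (y * x) + y * z" by (simp add: algebra_simps)
 then show ?case using step assms(1) by (metis vs.span_add vs.span_scale)
qed

text \<open>Multiplication by a \<open>controlled\<close> element raises the level of the filtration \<open>Z\<close> by a bounded
 amount, up to a common denominator \<open>b\<close>. The point of the definition is that it is stable under
 all field operations: for inverses, numerator and denominator are exchanged.\<close>

definition controlled :: "(nat => 'b set) => 'b => 'b => nat => bool" where
 "controlled Z b y r \<longleftrightarrow> b ~= 0 \<and> (\<forall>M. \<forall>z\<in>Z M. b * z \<in> Z (M + r) \<and> b * y * z \<in> Z (M + r))"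

lemma controlled_fieldgen:
 assumes Z: "\<And>M. vs.subspace (Z M)"
  and gens: "\<And>x. x \<in> S ==> \<exists>b r. controlled Z b x r"
  and y: "y \<in> fieldgen k S"
 shows "\<exists>b r. controlled Z b y r"
 using y
proof (induction rule: fieldgen.induct)
 case (const c)
 have "controlled Z 1 (k c) 0"
  using vs.subspace_scale[OF Z] by (simp add: controlled_def)
 then show ?case by blast
next
 case (gen x)
 then show ?case using gens by blast
next
 case (add x y)
 then obtain b r b' r' where c: "controlled Z b x r" "controlled Z b' y r'" by blast
 have "controlled Z (b * b') (x + y) (r + r')"
  unfolding controlled_def
 proof (intro conjI allI ballI)
  fix M z assume z: "z \<in> Z M"
  have 1: "b * z \<in> Z (M + r)" "b * x * z \<in> Z (M + r)" "b' * y * z \<in> Z (M + r')" "b' * z \<in> Z (M + r')"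
   using c z unfolding controlled_def by auto
  have 2: "b' * (b * z) \<in> Z (M + r + r')" "b' * (b * x * z) \<in> Z (M + r + r')"
    "b * (b' * y * z) \<in> Z (M + r' + r)"
   using c 1 unfolding controlled_def by auto
  have "b * b' * (x + y) * z = b' * (b * x * z) + b * (b' * y * z)" by (simp add: algebra_simps)
  moreover have "M + r' + r = M + r + r'" by simp
  ultimately show "b * b' * (x + y) * z \<in> Z (M + (r + r'))"
   using vs.subspace_add[OF Z 2(2)] 2(3) by (metis add.assoc)
  show "b * b' * z \<in> Z (M + (r + r'))" using 2(1) by (simp add: ac_simps)
 qed (use c in \<open>auto simp: controlled_def\<close>)
 then show ?case by blast
next
 case (mult x y)
 then obtain b r b' r' where c: "controlled Z b x r" "controlled Z b' y r'" by blast
 have "controlled Z (b * b') (x * y) (r + r')"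
  unfolding controlled_def
 proof (intro conjI allI ballI)
  fix M z assume z: "z \<in> Z M"
  have 1: "b * z \<in> Z (M + r)" "b * x * z \<in> Z (M + r)" using c z unfolding controlled_def by auto
  have 2: "b' * (b * z) \<in> Z (M + r + r')" "b' * y * (b * x * z) \<in> Z (M + r + r')"
   using c 1 unfolding controlled_def by auto
  show "b * b' * (x * y) * z \<in> Z (M + (r + r'))" "b * b' * z \<in> Z (M + (r + r'))"
   using 2 by (simp_all add: ac_simps)
 qed (use c in \<open>auto simp: controlled_def\<close>)
 then show ?case by blast
next
 case (uminus x)
 then obtain b r where c: "controlled Z b x r" by blast
 have "controlled Z b (- x) r"
  using c vs.subspace_neg[OF Z] unfolding controlled_def by simp
 then show ?case by blast
next
 case (inverse x)
 then obtain b r where c: "controlled Z b x r" by blast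
 show ?case
 proof (cases "x = 0")
  case True
  then show ?thesis using c by auto
 next
  case False
  have "controlled Z (b * x) (inverse x) r"
   using c False unfolding controlled_def by (simp add: mult.assoc)
  then show ?thesis by blast
 qed
qed

lemma controlled_family:
 assumes "finite I" "\<And>M. vs.subspace (Z M)" "\<And>i. i \<in> I ==> \<exists>b r. controlled Z b (y i) r"
 shows "\<exists>b r. \<forall>i\<in>I. b ~= 0 \<and> controlled Z b (y i) r"
 using assms(1,3)
proof (induction I)
 case empty
 then show ?case by auto
next
 case (insert j I)
 then obtain b r b' r' where c: "\<And>i. i \<in> I ==> controlled Z b (y i) r" "controlled Z b' (y j) r'"
  by (meson insertCI)
 show ?case
 proof (cases "I = {}")
  case True
  then show ?thesis using c(2) by (auto simp: controlled_def)
 next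
  case False
  then have b0: "b ~= 0" "b' ~= 0" using c by (auto simp: controlled_def)
  have A: "controlled Z (b * b') (y i) (r + r')" if i: "i \<in> I" for i
   unfolding controlled_def
  proof (intro conjI allI ballI)
   fix M z assume z: "z \<in> Z M"
   have 1: "b * z \<in> Z (M + r)" "b * y i * z \<in> Z (M + r)"
    using c(1)[OF i] z unfolding controlled_def by auto
   have 2: "b' * (b * z) \<in> Z (M + r + r')" "b' * (b * y i * z) \<in> Z (M + r + r')"
    using c(2) 1 unfolding controlled_def by auto
   show "b * b' * y i * z \<in> Z (M + (r + r'))" "b * b' * z \<in> Z (M + (r + r'))"
    using 2 by (simp_all add: ac_simps)
  qed (use b0 in auto)
  have "controlled Z (b * b') (y j) (r + r')"
   unfolding controlled_def
  proof (intro conjI allI ballI)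
   fix M z assume z: "z \<in> Z M"
   obtain i where i: "i \<in> I" using False by blast
   have 1: "b' * z \<in> Z (M + r')" "b' * y j * z \<in> Z (M + r')"
    using c(2) z unfolding controlled_def by auto
   have 2: "b * (b' * z) \<in> Z (M + r' + r)" "b * (b' * y j * z) \<in> Z (M + r' + r)"
    using c(1)[OF i] 1 unfolding controlled_def by auto
   show "b * b' * y j * z \<in> Z (M + (r + r'))" "b * b' * z \<in> Z (M + (r + r'))"
    using 2 by (simp_all add: ac_simps)
  qed (use b0 in auto)
  then show ?thesis using A b0 by (intro exI[of _ "b * b'"] exI[of _ "r + r'"]) auto
 qed
qed

lemma controlled_power:
 fixes y :: 'b
 assumes "\<And>M z. z \<in> Z M ==> y * z \<in> Z (M + r)" "z \<in> Z M"
 shows "y ^ n * z \<in> Z (M + n * r)"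
proof (induction n)
 case 0
 show ?case using assms(2) by simp
next
 case (Suc n)
 from assms(1)[OF this] show ?case by (simp add: ac_simps)
qed

lemma controlled_monomial:
 assumes c: "controlled Z b y r" and z: "z \<in> Z M" and i: "i \<le> m"
 shows "b ^ m * y ^ i * z \<in> Z (M + m * r)"
proof -
 have 1: "b ^ (m - i) * z \<in> Z (M + (m - i) * r)"
  by (rule controlled_power[where Z = Z and r = r]) (use c z in \<open>auto simp: controlled_def\<close>)
 have "(b * y) ^ i * (b ^ (m - i) * z) \<in> Z (M + (m - i) * r + i * r)"
  by (rule controlled_power[where Z = Z and r = r, OF _ 1]) (use c in \<open>auto simp: controlled_def\<close>)
 moreover have "M + (m - i) * r + i * r = M + m * r"
  using i by (metis add.assoc add_mult_distrib le_add_diff_inverse2)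
 moreover have "(b * y) ^ i * (b ^ (m - i) * z) = b ^ m * y ^ i * z"
  using i by (simp add: power_mult_distrib ac_simps flip: power_add)
 ultimately show ?thesis by simp
qed

end

section \<open>Transcendence degree three\<close>

definition (in field_hom) alg_indep3 :: "'b => 'b => 'b => bool" where
 "alg_indep3 p q r \<longleftrightarrow> (\<forall>T. finite T \<longrightarrow> indep_fam T (\<lambda>(i, j, l). p ^ i * q ^ j * r ^ l))"

text \<open>If \<open>p\<close>, \<open>q\<close>, \<open>r\<close> satisfied a relation, then modulo its leading monomial the polynomials of
 degree at most \<open>M\<close> in them would only span a space of dimension \<open>O(M\<^sup>2)\<close>, too small to contain
 the \<open>(m + 1)\<^sup>3\<close> independent monomials in \<open>v\<close>, \<open>w\<close>, \<open>x\<close> (over a common denominator).\<close>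

lemma (in field_hom) alg_indep3_generators:
 assumes E: "{v, w, x} \<subseteq> fieldgen k {p, q, r}" and indep: "alg_indep3 v w x"
 shows "alg_indep3 p q r"
proof (rule ccontr)
 assume "\<not> alg_indep3 p q r"
 define mon where "mon = (\<lambda>(i, j, l). p ^ i * q ^ j * r ^ l)"
 obtain T c t0 where T: "finite T" "(\<Sum>t\<in>T. k (c t) * mon t) = 0" "t0 \<in> T" "c t0 ~= 0"
  using \<open>\<not> alg_indep3 p q r\<close> unfolding alg_indep3_def indep_fam_def mon_def by blast
 define T' where "T' = {t \<in> T. c t ~= 0}"
 have T': "finite T'" "T' ~= {}" "\<And>t. t \<in> T' ==> c t ~= 0"
  using T unfolding T'_def by (simp, blast, blast)
 have sum': "(\<Sum>t\<in>T'. k (c t) * mon t) = 0"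
  using T(2) unfolding T'_def by (subst sum.mono_neutral_left[of T]) (auto simp: T(1))
 obtain N where N: "\<And>i j l. (i, j, l) \<in> T' ==> i < N \<and> j < N \<and> l < N"
 proof -
  define N where "N = Suc (Max ((\<lambda>(i, j, l). i + j + l) ` T'))"
  have "i + j + l < N" if "(i, j, l) \<in> T'" for i j l
  proof -
   have "i + j + l \<in> (\<lambda>(i, j, l). i + j + l) ` T'" using that by force
   then show ?thesis unfolding N_def using T'(1) by (simp add: less_Suc_eq_le)
  qed
  then show ?thesis by (intro that[of N]) fastforce
 qed
 then have N0: "N > 0" using T'(2) by fastforce
 define wt where "wt = (\<lambda>(i, j, l). i * (N * N) + j * N + l)"
 have wt_inj: "t = t'" if "t \<in> T'" "t' \<in> T'" "wt t = wt t'" for t t'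
 proof -
  obtain i j l i' j' l' where t: "t = (i, j, l)" "t' = (i', j', l')" by (metis prod_cases3)
  have b: "i < N" "j < N" "l < N" "i' < N" "j' < N" "l' < N" using N that t by auto
  have e: "(i * N + j) * N + l = (i' * N + j') * N + l'"
   using that(3) t by (simp add: wt_def algebra_simps)
  have "((i * N + j) * N + l) mod N = l" "((i' * N + j') * N + l') mod N = l'"
   using b by (simp_all add: mod_mult_self3)
  then have l: "l = l'" using e by metis
  then have e2: "i * N + j = i' * N + j'" using e N0 by simp
  have "(i * N + j) mod N = j" "(i' * N + j') mod N = j'"
   using b by (simp_all add: mod_mult_self3)
  then have "j = j'" using e2 by metis
  then show ?thesis using e2 N0 t l by simp
 qed
 obtain top where top: "top \<in> T'" "\<And>t. t \<in> T' ==> wt t \<le> wt top"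
 proof -
  have "Max (wt ` T') \<in> wt ` T'" using T' by (intro Max_in) auto
  then obtain t where t: "t \<in> T'" "wt t = Max (wt ` T')" by force
  show ?thesis by (rule that[OF t(1)]) (use T'(1) t(2) in simp)
 qed
 have top_less: "wt t < wt top" if "t \<in> T' - {top}" for t
  using that top wt_inj by (metis Diff_iff insertCI le_neq_implies_less)
 obtain \<alpha> \<beta> \<gamma> where abc: "top = (\<alpha>, \<beta>, \<gamma>)" by (metis prod_cases3)
 have top_eq: "mon top = (\<Sum>t\<in>T' - {top}. k (- c t / c top) * mon t)"
 proof -
  have "k (c top) * mon top + (\<Sum>t\<in>T' - {top}. k (c t) * mon t) = 0"
   using sum' by (simp add: sum.remove[OF T'(1) top(1)])
  then have "k (c top) * mon top = - (\<Sum>t\<in>T' - {top}. k (c t) * mon t)"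
   by (simp add: eq_neg_iff_add_eq_0)
  moreover have "k (c top) ~= 0" using T'(3)[OF top(1)] by simp
  ultimately have "mon top = - (\<Sum>t\<in>T' - {top}. k (c t) * mon t) / k (c top)"
   by (metis nonzero_mult_div_cancel_left)
  then show ?thesis
   by (simp add: sum_divide_distrib sum_negf)
 qed
 define G where "G = (\<lambda>M. mon ` {(i, j, l). wt (i, j, l) \<le> M \<and> \<not> (\<alpha> \<le> i \<and> \<beta> \<le> j \<and> \<gamma> \<le> l)})"
 define Z where "Z = (\<lambda>M. vs.span (mon ` {t. wt t \<le> M}))"
 have wt_add: "wt (i + i', j + j', l + l') = wt (i, j, l) + wt (i', j', l')" for i j l i' j' l'
  by (simp add: wt_def algebra_simps)
 have mon_add: "mon (i + i', j + j', l + l') = mon (i, j, l) * mon (i', j', l')" for i j l i' j' l'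
  by (simp add: mon_def power_add ac_simps)
 have red: "mon t \<in> vs.span (G (wt t + e))" for t e
 proof (induction "wt t" arbitrary: t e rule: less_induct)
  case less
  obtain i j l where t: "t = (i, j, l)" by (metis prod_cases3)
  show ?case
  proof (cases "\<alpha> \<le> i \<and> \<beta> \<le> j \<and> \<gamma> \<le> l")
   case False
   then show ?thesis unfolding t by (intro vs.span_base) (auto simp: G_def)
  next
   case True
   define s where "s = (i - \<alpha>, j - \<beta>, l - \<gamma>)"
   have ms: "mon t = mon s * mon top"
    unfolding t s_def abc using mon_add[of "i - \<alpha>" \<alpha> "j - \<beta>" \<beta> "l - \<gamma>" \<gamma>] True by simp
   have ws: "wt t = wt s + wt top"
    unfolding t s_def abc using wt_add[of "i - \<alpha>" \<alpha> "j - \<beta>" \<beta> "l - \<gamma>" \<gamma>] True by simp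
   have "mon s * mon u \<in> vs.span (G (wt t + e))" if u: "u \<in> T' - {top}" for u
   proof -
    obtain i' j' l' where u': "u = (i', j', l')" by (metis prod_cases3)
    define y where "y = (i - \<alpha> + i', j - \<beta> + j', l - \<gamma> + l')"
    have "mon y = mon s * mon u" "wt y = wt s + wt u"
     unfolding y_def s_def u' using mon_add wt_add by simp_all
    moreover have "wt y < wt t" using top_less[OF u] ws calculation by simp
    moreover have "wt y + (wt t + e - wt y) = wt t + e" using \<open>wt y < wt t\<close> by simp
    ultimately show ?thesis using less[of y "wt t + e - wt y"] by simp
   qed
   then have "(\<Sum>u\<in>T' - {top}. k (- c u / c top) * (mon s * mon u)) \<in> vs.span (G (wt t + e))"
    by (intro vs.span_sum vs.span_scale)
   moreover have "mon t = (\<Sum>u\<in>T' - {top}. k (- c u / c top) * (mon s * mon u))"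
    unfolding ms top_eq by (simp add: sum_distrib_left ac_simps)
   ultimately show ?thesis by simp
  qed
 qed
 have ZG: "z \<in> vs.span (G M)" if "z \<in> Z M" for z M
 proof -
  have "mon t \<in> vs.span (G M)" if "wt t \<le> M" for t
   using red[of t "M - wt t"] that by simp
  then have "vs.span (mon ` {t. wt t \<le> M}) \<subseteq> vs.span (G M)"
   by (intro vs.span_minimal) (auto simp: vs.subspace_span)
  then show ?thesis using that by (auto simp: Z_def)
 qed
 define C where "C = \<alpha> + \<beta> + \<gamma>"
 have card_G: "finite (G M) \<and> card (G M) \<le> C * (M + 1) ^ 2" for M
 proof -
  let ?A = "{..<\<alpha>} \<times> {..M} \<times> {..M}" and ?B = "{..M} \<times> {..<\<beta>} \<times> {..M}"
   and ?C = "{..M} \<times> {..M} \<times> {..<\<gamma>}"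
  have le: "i \<le> M \<and> j \<le> M \<and> l \<le> M" if "wt (i, j, l) \<le> M" for i j l
  proof -
   have "i \<le> i * (N * N)" "j \<le> j * N" using N0 by simp_all
   moreover have "i * (N * N) + j * N + l \<le> M" using that by (simp add: wt_def)
   ultimately show ?thesis by linarith
  qed
  have sub: "{(i, j, l). wt (i, j, l) \<le> M \<and> \<not> (\<alpha> \<le> i \<and> \<beta> \<le> j \<and> \<gamma> \<le> l)} \<subseteq> ?A \<union> ?B \<union> ?C"
  proof
   fix t assume t: "t \<in> {(i, j, l). wt (i, j, l) \<le> M \<and> \<not> (\<alpha> \<le> i \<and> \<beta> \<le> j \<and> \<gamma> \<le> l)}"
   obtain i j l where ijl: "t = (i, j, l)" by (metis prod_cases3)
   then have "wt (i, j, l) \<le> M" "i < \<alpha> \<or> j < \<beta> \<or> l < \<gamma>" using t by (simp_all add: not_le)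
   then show "t \<in> ?A \<union> ?B \<union> ?C" using le[of i j l] ijl by simp
  qed
  have "card (?A \<union> ?B \<union> ?C) \<le> card (?A \<union> ?B) + card ?C" "card (?A \<union> ?B) \<le> card ?A + card ?B"
   by (rule card_Un_le)+
  then have "card (?A \<union> ?B \<union> ?C) \<le> card ?A + card ?B + card ?C" by linarith
  also have "\<dots> = C * (M + 1) ^ 2"
   by (simp add: C_def power2_eq_square algebra_simps)
  finally have c: "card (?A \<union> ?B \<union> ?C) \<le> C * (M + 1) ^ 2" .
  have f: "finite (?A \<union> ?B \<union> ?C)" by simp
  have "card (G M) \<le> card {(i, j, l). wt (i, j, l) \<le> M \<and> \<not> (\<alpha> \<le> i \<and> \<beta> \<le> j \<and> \<gamma> \<le> l)}"
   unfolding G_def by (rule card_image_le) (rule finite_subset[OF sub f])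
  also have "\<dots> \<le> card (?A \<union> ?B \<union> ?C)" by (rule card_mono[OF f sub])
  finally show ?thesis using c finite_subset[OF sub f] by (simp add: G_def)
 qed
 have Zsub: "vs.subspace (Z M)" for M by (simp add: Z_def vs.subspace_span)
 have Zmult: "mon s * z \<in> Z (M + wt s)" if "z \<in> Z M" for s z M
  unfolding Z_def
 proof (rule span_mult_closed)
  show "z \<in> vs.span (mon ` {t. wt t \<le> M})" using that by (simp add: Z_def)
  fix y assume "y \<in> mon ` {t. wt t \<le> M}"
  then obtain t where t: "y = mon t" "wt t \<le> M" by blast
  obtain i j l i' j' l' where e: "t = (i, j, l)" "s = (i', j', l')" by (metis prod_cases3)
  have "mon s * mon t = mon (i' + i, j' + j, l' + l)" "wt (i' + i, j' + j, l' + l) \<le> M + wt s"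
   using t(2) unfolding e mon_add wt_add by simp_all
  then show "mon s * y \<in> vs.span (mon ` {t. wt t \<le> M + wt s})"
   unfolding t(1) by (auto intro!: vs.span_base)
 qed
 have Zmono: "Z M \<subseteq> Z (M + e)" for M e
  unfolding Z_def by (intro vs.span_mono image_mono) auto
 have gens: "\<exists>b s. controlled Z b y s" if y: "y \<in> {p, q, r}" for y
 proof -
  have "\<exists>t. y = mon t" using y
  proof (elim insertE)
   show "\<exists>t. y = mon t" if "y = p" using that by (intro exI[of _ "(1, 0, 0)"]) (simp add: mon_def)
   show "\<exists>t. y = mon t" if "y = q" using that by (intro exI[of _ "(0, 1, 0)"]) (simp add: mon_def)
   show "\<exists>t. y = mon t" if "y = r" using that by (intro exI[of _ "(0, 0, 1)"]) (simp add: mon_def)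
  qed simp
  then obtain t where "y = mon t" ..
  then have "controlled Z 1 y (wt t)"
   unfolding controlled_def using Zmult[of _ _ t] Zmono[of _ "wt t"] by (metis mult_1 subsetD zero_neq_one)
  then show ?thesis by blast
 qed
 have "\<exists>b s. controlled Z b y s" if "y \<in> {v, w, x}" for y
  by (rule controlled_fieldgen[where S = "{p, q, r}", OF Zsub gens]) (use that E in auto)
 then have "\<exists>b s. \<forall>y\<in>{v, w, x}. b ~= 0 \<and> controlled Z b y s"
  by (intro controlled_family) (use Zsub in auto)
 then obtain b s where "\<forall>y\<in>{v, w, x}. b ~= 0 \<and> controlled Z b y s" by blast
 then have bs: "\<And>y. y \<in> {v, w, x} ==> controlled Z b y s" and b0: "b ~= 0"
  by auto
 have one: "1 \<in> Z 0"
 proof -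
  have "1 = mon (0, 0, 0)" "wt (0, 0, 0) \<le> 0" by (simp_all add: mon_def wt_def)
  then show ?thesis unfolding Z_def by (metis (mono_tags, lifting) image_eqI mem_Collect_eq vs.span_base)
 qed
 define m where "m = C * (3 * s + 1) ^ 2"
 let ?I = "{..m} \<times> {..m} \<times> {..m}"
 have inZ: "b ^ (3 * m) * (v ^ i * w ^ j * x ^ l) \<in> Z (3 * m * s)" if "i \<le> m" "j \<le> m" "l \<le> m" for i j l
 proof -
  have 1: "b ^ m * v ^ i * 1 \<in> Z (0 + m * s)"
   by (rule controlled_monomial) (use bs one that in auto)
  have 2: "b ^ m * w ^ j * (b ^ m * v ^ i * 1) \<in> Z (0 + m * s + m * s)"
   by (rule controlled_monomial) (use bs 1 that in auto)
  have 3: "b ^ m * x ^ l * (b ^ m * w ^ j * (b ^ m * v ^ i * 1)) \<in> Z (0 + m * s + m * s + m * s)"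
   by (rule controlled_monomial) (use bs 2 that in auto)
  have "b ^ (3 * m) = b ^ m * b ^ m * b ^ m" by (simp add: numeral_3_eq_3 power_add)
  moreover have "3 * m * s = 0 + m * s + m * s + m * s" by simp
  ultimately show ?thesis using 3 by (simp only: ac_simps mult_1_right mult_1_left)
 qed
 have "card ?I \<le> card (G (3 * m * s))"
 proof (rule indep_fam_card_le)
  show "indep_fam ?I (\<lambda>t. b ^ (3 * m) * (case t of (i, j, l) => v ^ i * w ^ j * x ^ l))"
   using indep b0 unfolding alg_indep3_def by (intro indep_fam_scale) auto
  show "b ^ (3 * m) * (case t of (i, j, l) => v ^ i * w ^ j * x ^ l) \<in> vs.span (G (3 * m * s))"
   if "t \<in> ?I" for t using that inZ ZG by auto
 qed (use card_G in auto)
 then have "(m + 1) * (m + 1) ^ 2 \<le> C * (3 * m * s + 1) ^ 2"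
  using card_G[of "3 * m * s"] by (simp add: power2_eq_square)
 also have "\<dots> \<le> C * ((3 * s + 1) * (m + 1)) ^ 2"
  by (intro mult_left_mono power_mono) (auto simp: algebra_simps)
 also have "\<dots> = (C * (3 * s + 1) ^ 2) * (m + 1) ^ 2" by (simp only: power_mult_distrib mult.assoc)
 also have "\<dots> = m * (m + 1) ^ 2" by (simp only: m_def)
 finally show False by simp
qed

section \<open>Finiteness over a one-variable subfield\<close>

text \<open>The equation reduces powers of \<open>\<zeta>\<close> at the cost of a power of the leading coefficient, so all of
 \<open>k(u, \<zeta>)\<close> is controlled. If \<open>x\<close> raises the level by \<open>s\<close>, the products \<open>x\<^sup>i y\<^sub>j\<close> with \<open>i \<le> m\<close>, \<open>j \<le> d s\<close>
 have level about \<open>m s\<close>, up to a common denominator. Level \<open>m s\<close> has dimension about \<open>d s m\<close>, but there are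
 \<open>(m + 1)(d s + 1)\<close> products.\<close>

lemma (in field_hom) relation_over_controlled:
 fixes \<zeta> :: 'b
 assumes G: "ev2 k G u \<zeta> = 0" "peval k (lead_coeff G) u ~= 0"
 defines "d \<equiv> degree G"
 defines "Z \<equiv> (\<lambda>M. vs.span ((\<lambda>(a, b). u ^ a * \<zeta> ^ b) ` ({..M} \<times> {..<d})))"
 shows "\<And>x. x \<in> fieldgen k {u, \<zeta>} ==> \<exists>b r. controlled Z b x r"
  and "controlled Z 1 u 1"
  and "controlled Z b x s ==> (\<And>j. j \<le> d * s ==> y j \<in> fieldgen k {u, \<zeta>}) ==>
   \<exists>\<phi>. (\<exists>j\<le>d * s. \<phi> j ~= 0) \<and> (\<Sum>j\<le>d * s. peval k (\<phi> j) x * y j) = 0"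
proof -
 have d0: "d > 0"
 proof (rule ccontr)
  assume "\<not> d > 0"
  then obtain g where "G = [:g:]" unfolding d_def using degree_eq_zeroE by blast
  then show False using G by simp
 qed
 have Zsub: "vs.subspace (Z M)" for M by (simp add: Z_def vs.subspace_span)
 have Zmono: "Z M \<subseteq> Z (M + e)" for M e
  unfolding Z_def by (intro vs.span_mono image_mono) auto
 have Zbase: "u ^ a * \<zeta> ^ b \<in> Z M" if "a \<le> M" "b < d" for a b M
  unfolding Z_def using that by (auto intro!: vs.span_base)
 have Zpoly: "peval k g u * \<zeta> ^ b * u ^ a \<in> Z (a + e)"
  if "degree g \<le> e" "b < d" for g b a e
 proof -
  have "peval k g u * \<zeta> ^ b * u ^ a = (\<Sum>i\<le>e. k (coeff g i) * (u ^ (i + a) * \<zeta> ^ b))"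
   by (simp add: peval_sum_le[OF that(1)] sum_distrib_right sum_distrib_left power_add ac_simps)
  also have "\<dots> \<in> Z (a + e)"
   by (intro vs.subspace_sum[OF Zsub] vs.subspace_scale[OF Zsub] Zbase) (use that in auto)
  finally show ?thesis .
 qed
 have cu: "controlled Z 1 u 1"
  unfolding controlled_def
 proof (intro conjI allI ballI)
  fix M z assume z: "z \<in> Z M"
  show "1 * z \<in> Z (M + 1)" using z Zmono[of M 1] by auto
  have "u * z \<in> Z (M + 1)" unfolding Z_def
  proof (rule span_mult_closed)
   show "z \<in> vs.span ((\<lambda>(a, b). u ^ a * \<zeta> ^ b) ` ({..M} \<times> {..<d}))" using z by (simp add: Z_def)
   fix y assume "y \<in> (\<lambda>(a, b). u ^ a * \<zeta> ^ b) ` ({..M} \<times> {..<d})"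
   then obtain a b where ab: "a \<le> M" "b < d" "y = u ^ a * \<zeta> ^ b" by auto
   have uy: "u * y = u ^ (Suc a) * \<zeta> ^ b" unfolding ab by (simp add: ac_simps)
   show "u * y \<in> vs.span ((\<lambda>(a, b). u ^ a * \<zeta> ^ b) ` ({..M + 1} \<times> {..<d}))"
    unfolding uy using Zbase[of "Suc a" "M + 1" b] ab unfolding Z_def by simp
  qed
  then show "1 * u * z \<in> Z (M + 1)" by simp
 qed simp
 obtain e where e: "\<And>b. degree (coeff G b) \<le> e"
 proof -
  define e where "e = (\<Sum>b\<le>d. degree (coeff G b))"
  have "degree (coeff G b) \<le> e" for b
  proof (cases "b \<le> d")
   case True
   then show ?thesis unfolding e_def by (intro member_le_sum) auto
  next
   case False
   then show ?thesis by (simp add: d_def coeff_eq_0)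
  qed
  then show ?thesis by (rule that)
 qed
 let ?l = "peval k (lead_coeff G) u"
 have top: "?l * \<zeta> ^ d = - (\<Sum>b<d. peval k (coeff G b) u * \<zeta> ^ b)"
 proof -
  have "ev2 k G u \<zeta> = (\<Sum>b\<le>d. peval k (coeff G b) u * \<zeta> ^ b)"
   unfolding ev2_def d_def by (rule comm_hom.peval_sum_le[OF comm_hom_peval]) simp
  then show ?thesis using G(1)
   by (simp add: lessThan_Suc_atMost[symmetric] d_def eq_neg_iff_add_eq_0 add.commute)
 qed
 have cz: "controlled Z ?l \<zeta> e"
  unfolding controlled_def
 proof (intro conjI allI ballI)
  fix M z assume z: "z \<in> Z M"
  have A: "?l * (u ^ a * \<zeta> ^ b) \<in> Z (M + e)" if "a \<le> M" "b < d" for a b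
   using Zpoly[of "lead_coeff G" e b a] that e Zmono[of "a + e" "M - a"] by (auto simp: ac_simps)
  show "?l * z \<in> Z (M + e)" unfolding Z_def
   by (rule span_mult_closed[where A = "(\<lambda>(a, b). u ^ a * \<zeta> ^ b) ` ({..M} \<times> {..<d})"])
    (use z A in \<open>auto simp: Z_def\<close>)
  have B: "?l * \<zeta> * (u ^ a * \<zeta> ^ b) \<in> Z (M + e)" if ab: "a \<le> M" "b < d" for a b
  proof (cases "Suc b < d")
   case True
   then show ?thesis using A[of a "Suc b"] ab by (simp add: ac_simps)
  next
   case False
   then have bd: "Suc b = d" using ab by simp
   have "?l * \<zeta> * (u ^ a * \<zeta> ^ b) = ?l * \<zeta> ^ d * u ^ a"
    using bd by (auto simp: ac_simps)
   also have "\<dots> = - (\<Sum>b<d. peval k (coeff G b) u * \<zeta> ^ b * u ^ a)"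
    unfolding top by (simp add: sum_distrib_right)
   also have "\<dots> \<in> Z (a + e)"
    by (intro vs.subspace_neg[OF Zsub] vs.subspace_sum[OF Zsub] Zpoly) (use e in auto)
   also have "Z (a + e) \<subseteq> Z (M + e)"
    using Zmono[of "a + e" "M - a"] ab by (simp add: add.commute)
   finally show ?thesis .
  qed
  show "?l * \<zeta> * z \<in> Z (M + e)" unfolding Z_def
   by (rule span_mult_closed[where A = "(\<lambda>(a, b). u ^ a * \<zeta> ^ b) ` ({..M} \<times> {..<d})"])
    (use z B in \<open>auto simp: Z_def\<close>)
 qed (use G in auto)
 show all: "\<exists>b r. controlled Z b x r" if "x \<in> fieldgen k {u, \<zeta>}" for x
  by (rule controlled_fieldgen[OF Zsub _ that]) (use cu cz in blast)
 show "controlled Z 1 u 1" by fact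
 assume cx: "controlled Z b x s" and y: "\<And>j. j \<le> d * s ==> y j \<in> fieldgen k {u, \<zeta>}"
 have b0: "b ~= 0" using cx by (simp add: controlled_def)
 have "\<exists>b r. \<forall>i\<in>{..d * s}. b ~= 0 \<and> controlled Z b (y i) r"
  by (rule controlled_family) (use Zsub all y in auto)
 then obtain b' r where "\<forall>i\<in>{..d * s}. b' ~= 0 \<and> controlled Z b' (y i) r" by blast
 then have b': "b' ~= 0 \<and> controlled Z b' (y j) r" if "j \<le> d * s" for j using that by simp
 have one: "1 \<in> Z 0" using Zbase[of 0 0 0] d0 by simp
 define m where "m = d * r + d"
 let ?I = "{..m} \<times> {..d * s}"
 let ?g = "\<lambda>(i, j). b ^ m * b' * (x ^ i * y j)"
 let ?B = "(\<lambda>(a, b). u ^ a * \<zeta> ^ b) ` ({..r + m * s} \<times> {..<d})"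
 have "\<not> indep_fam ?I ?g"
 proof
  assume i: "indep_fam ?I ?g"
  have "card ?I \<le> card ?B"
  proof (rule indep_fam_card_le[OF _ i])
   show "?g t \<in> vs.span ?B" if "t \<in> ?I" for t
   proof -
    obtain i j where ij: "t = (i, j)" by (metis surj_pair)
    then have t: "t = (i, j)" "i \<le> m" "j \<le> d * s" using that by auto
    have "b' * y j * 1 \<in> Z (0 + r)" using b'[OF t(3)] one unfolding controlled_def by blast
    then have "b ^ m * x ^ i * (b' * y j * 1) \<in> Z (0 + r + m * s)"
     by (rule controlled_monomial[OF cx _ t(2)])
    then show ?thesis unfolding t(1) by (simp add: Z_def ac_simps)
   qed
  qed auto
  also have "card ?B \<le> card ({..r + m * s} \<times> {..<d})" by (rule card_image_le) simp
  finally have "(m + 1) * (d * s + 1) \<le> (r + m * s + 1) * d" by simp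
  then show False by (simp add: m_def algebra_simps)
 qed
 then obtain c where c: "(\<Sum>t\<in>?I. k (c t) * ?g t) = 0" "\<exists>t\<in>?I. c t ~= 0"
  unfolding indep_fam_def by blast
 define \<phi> where "\<phi> = (\<lambda>j. \<Sum>i\<le>m. Polynomial.monom (c (i, j)) i)"
 have coeff_\<phi>: "coeff (\<phi> j) i = c (i, j)" if "i \<le> m" for i j
  using that by (simp add: \<phi>_def coeff_sum coeff_monom)
 obtain i0 j0 where ij: "i0 \<le> m" "j0 \<le> d * s" "c (i0, j0) ~= 0" using c(2) by auto
 then have "\<phi> j0 ~= 0" using coeff_\<phi>[of i0 j0] by (metis coeff_0)
 moreover have "(\<Sum>j\<le>d * s. peval k (\<phi> j) x * y j) = 0"
 proof -
  have "0 = (\<Sum>i\<le>m. \<Sum>j\<le>d * s. k (c (i, j)) * (b ^ m * b' * (x ^ i * y j)))"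
   using c(1) by (simp add: sum.cartesian_product case_prod_unfold)
  also have "\<dots> = (\<Sum>j\<le>d * s. \<Sum>i\<le>m. k (c (i, j)) * (b ^ m * b' * (x ^ i * y j)))"
   by (rule sum.swap)
  also have "\<dots> = b ^ m * b' * (\<Sum>j\<le>d * s. peval k (\<phi> j) x * y j)"
   by (simp add: \<phi>_def peval_sum sum_distrib_left sum_distrib_right ac_simps)
  finally show ?thesis using b0 b'[OF ij(2)] by auto
 qed
 ultimately show "\<exists>\<phi>. (\<exists>j\<le>d * s. \<phi> j ~= 0) \<and> (\<Sum>j\<le>d * s. peval k (\<phi> j) x * y j) = 0"
  using ij(2) by blast
qed

section \<open>Localizations inside a field\<close>

text \<open>A ring that is identified with a subring of a field by an injective homomorphism.\<close>

locale embedded_ring = cring A for A :: "'r ring" (structure) +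
 fixes e :: "'r => 'b::field"
 assumes e_add [simp]: "a \<in> carrier A ==> b \<in> carrier A ==> e (a \<oplus> b) = e a + e b"
  and e_mult [simp]: "a \<in> carrier A ==> b \<in> carrier A ==> e (a \<otimes> b) = e a * e b"
  and e_one [simp]: "e \<one> = 1"
  and e_inj: "inj_on e (carrier A)"
begin

lemma e_zero [simp]: "e \<zero> = 0"
 using e_add[of \<zero> \<zero>] by (metis add_cancel_right_right l_zero zero_closed)

lemma e_minus [simp]: "a \<in> carrier A ==> e (\<ominus> a) = - e a"
 using e_add[of a "\<ominus> a"] by (simp add: r_neg eq_neg_iff_add_eq_0 add.commute)

lemma e_diff [simp]: "a \<in> carrier A ==> b \<in> carrier A ==> e (a \<ominus> b) = e a - e b"
 by (simp add: a_minus_def)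

lemma e_pow [simp]: "a \<in> carrier A ==> e (a [^] (n::nat)) = e a ^ n"
 by (induction n) simp_all

lemma e_eq_iff: "a \<in> carrier A ==> b \<in> carrier A ==> e a = e b \<longleftrightarrow> a = b"
 using e_inj by (auto dest: inj_onD)

lemma e_eq_0_iff [simp]: "a \<in> carrier A ==> e a = 0 \<longleftrightarrow> a = \<zero>"
 using e_eq_iff[of a \<zero>] by simp

lemma is_domain: "domain A"
proof (rule domain.intro[OF is_cring domain_axioms.intro])
 show "\<one> ~= \<zero>" using e_one e_zero by force
 fix a b assume ab: "a \<otimes> b = \<zero>" "a \<in> carrier A" "b \<in> carrier A"
 then have "e a * e b = 0" using e_mult e_zero by metis
 then show "a = \<zero> \<or> b = \<zero>" using ab by auto
qed

definition fractions :: "'r set => 'b set" where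
 "fractions S = {e a / e s | a s. a \<in> carrier A \<and> s \<in> S}"

definition fraction_class :: "'r set => 'b => ('r \<times> 'r) set" where
 "fraction_class S y = {(b, t). b \<in> carrier A \<and> t \<in> S \<and> e b / e t = y}"

end

locale embedded_localization = embedded_ring +
 fixes S :: "'a set"
 assumes S_sub: "S \<subseteq> carrier A - {\<zero>}" and S_one: "\<one> \<in> S"
  and S_mult: "s \<in> S ==> t \<in> S ==> s \<otimes> t \<in> S"
begin

lemma S_carrier: "s \<in> S ==> s \<in> carrier A" and S_nonzero: "s \<in> S ==> e s ~= 0"
 using S_sub by auto

lemma rel_iff: "((a, s), (b, t)) \<in> localization_rel A S \<longleftrightarrow>
  a \<in> carrier A \<and> s \<in> S \<and> b \<in> carrier A \<and> t \<in> S \<and> e a / e s = e b / e t"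
proof -
 have "(\<exists>u\<in>S. u \<otimes> (a \<otimes> t \<ominus> b \<otimes> s) = \<zero>) \<longleftrightarrow> e a / e s = e b / e t"
  if as: "a \<in> carrier A" "s \<in> S" "b \<in> carrier A" "t \<in> S"
 proof -
  have c: "a \<otimes> t \<ominus> b \<otimes> s \<in> carrier A" using as S_carrier by simp
  have eq: "e (a \<otimes> t \<ominus> b \<otimes> s) = e a * e t - e b * e s" using as S_carrier by simp
  have "(\<exists>u\<in>S. u \<otimes> (a \<otimes> t \<ominus> b \<otimes> s) = \<zero>) \<longleftrightarrow> a \<otimes> t \<ominus> b \<otimes> s = \<zero>"
  proof
   assume "\<exists>u\<in>S. u \<otimes> (a \<otimes> t \<ominus> b \<otimes> s) = \<zero>"
   then obtain u where u: "u \<in> S" "u \<otimes> (a \<otimes> t \<ominus> b \<otimes> s) = \<zero>" by blast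
   then show "a \<otimes> t \<ominus> b \<otimes> s = \<zero>"
    using domain.integral[OF is_domain u(2) S_carrier[OF u(1)] c] S_sub by auto
  next
   assume "a \<otimes> t \<ominus> b \<otimes> s = \<zero>"
   then show "\<exists>u\<in>S. u \<otimes> (a \<otimes> t \<ominus> b \<otimes> s) = \<zero>" using S_one by (intro bexI[of _ \<one>]) auto
  qed
  also have "\<dots> \<longleftrightarrow> e a * e t = e b * e s" using e_eq_0_iff[OF c] eq by simp
  also have "\<dots> \<longleftrightarrow> e a / e s = e b / e t" using S_nonzero as by (simp add: frac_eq_eq)
  finally show ?thesis .
 qed
 then show ?thesis unfolding localization_rel_def by auto
qed

lemma fraction_eq:
 assumes "a \<in> carrier A" "s \<in> S"
 shows "fraction A S a s = fraction_class S (e a / e s)"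
 unfolding fraction_def fraction_class_def Image_singleton using assms by (auto simp: rel_iff)

lemma fraction_class_inj: "inj_on (fraction_class S) (fractions S)"
proof (rule inj_onI)
 fix y z assume yz: "y \<in> fractions S" "z \<in> fractions S" "fraction_class S y = fraction_class S z"
 then obtain a s where "a \<in> carrier A" "s \<in> S" "y = e a / e s" unfolding fractions_def by blast
 then have "(a, s) \<in> fraction_class S y" by (simp add: fraction_class_def)
 then have "(a, s) \<in> fraction_class S z" using yz(3) by simp
 then show "y = z" using \<open>y = e a / e s\<close> by (simp add: fraction_class_def)
qed

lemma carrier_localization: "carrier (localization A S) = fraction_class S ` fractions S"
proof -
 have "carrier (localization A S) = (\<lambda>x. localization_rel A S `` {x}) ` (carrier A \<times> S)"
  by (auto simp: localization_def quotient_def)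
 also have "\<dots> = {fraction_class S (e a / e s) | a s. a \<in> carrier A \<and> s \<in> S}"
  using fraction_eq unfolding fraction_def by (force simp: image_iff)
 also have "\<dots> = fraction_class S ` fractions S"
  by (auto simp: fractions_def)
 finally show ?thesis .
qed

lemma fractions_closed:
 assumes "y \<in> fractions S" "z \<in> fractions S"
 shows "y * z \<in> fractions S" "y + z \<in> fractions S"
proof -
 obtain a s b t where as: "a \<in> carrier A" "s \<in> S" "y = e a / e s" "b \<in> carrier A" "t \<in> S" "z = e b / e t"
  using assms unfolding fractions_def by auto
 have 1: "y * z = e (a \<otimes> b) / e (s \<otimes> t)" using as S_carrier by simp
 have 2: "y + z = e (a \<otimes> t \<oplus> b \<otimes> s) / e (s \<otimes> t)"
  using as S_carrier S_nonzero by (simp add: add_frac_eq)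
 show "y * z \<in> fractions S" unfolding fractions_def 1 using as S_carrier S_mult by blast
 show "y + z \<in> fractions S" unfolding fractions_def 2 using as S_carrier S_mult by blast
qed

lemma localization_ops:
 assumes "y \<in> fractions S" "z \<in> fractions S"
 shows "fraction_class S y \<otimes>\<^bsub>localization A S\<^esub> fraction_class S z = fraction_class S (y * z)"
  and "fraction_class S y \<oplus>\<^bsub>localization A S\<^esub> fraction_class S z = fraction_class S (y + z)"
proof -
 have ne: "fraction_class S y ~= {}" "fraction_class S z ~= {}"
  using assms unfolding fractions_def fraction_class_def by auto
 have m: "fraction A S (a \<otimes> b) (s \<otimes> t) = fraction_class S (y * z)"
  and p: "fraction A S (a \<otimes> t \<oplus> b \<otimes> s) (s \<otimes> t) = fraction_class S (y + z)"
  if "(a, s) \<in> fraction_class S y" "(b, t) \<in> fraction_class S z" for a s b t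
 proof -
  have as: "a \<in> carrier A" "s \<in> S" "e a / e s = y" "b \<in> carrier A" "t \<in> S" "e b / e t = z"
   using that by (auto simp: fraction_class_def)
  have 1: "y * z = e (a \<otimes> b) / e (s \<otimes> t)" using as S_carrier by auto
  have 2: "y + z = e (a \<otimes> t \<oplus> b \<otimes> s) / e (s \<otimes> t)"
   using as S_carrier S_nonzero by (auto simp: add_frac_eq)
  show "fraction A S (a \<otimes> b) (s \<otimes> t) = fraction_class S (y * z)"
   unfolding 1 by (rule fraction_eq) (use as S_carrier S_mult in auto)
  show "fraction A S (a \<otimes> t \<oplus> b \<otimes> s) (s \<otimes> t) = fraction_class S (y + z)"
   unfolding 2 by (rule fraction_eq) (use as S_carrier S_mult in auto)
 qed
 have const: "(\<Union>(a, s)\<in>P. \<Union>(b, t)\<in>Q. h a s b t) = H"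
  if "P ~= {}" "Q ~= {}" "\<And>a s b t. (a, s) \<in> P ==> (b, t) \<in> Q ==> h a s b t = H"
  for P Q and h :: "'a => 'a => 'a => 'a => ('a \<times> 'a) set" and H
 proof -
  have "(\<Union>(a, s)\<in>P. \<Union>(b, t)\<in>Q. h a s b t) = (\<Union>x\<in>P. \<Union>y\<in>Q. H)"
   by (intro SUP_cong refl) (auto simp: that(3) split: prod.splits)
  then show ?thesis using that(1,2) by simp
 qed
 show "fraction_class S y \<otimes>\<^bsub>localization A S\<^esub> fraction_class S z = fraction_class S (y * z)"
  unfolding localization_def monoid.simps by (rule const[OF ne m])
 show "fraction_class S y \<oplus>\<^bsub>localization A S\<^esub> fraction_class S z = fraction_class S (y + z)"
  unfolding localization_def ring.simps by (rule const[OF ne p])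
qed

lemma localization_one_zero:
 "\<one>\<^bsub>localization A S\<^esub> = fraction_class S 1" "\<zero>\<^bsub>localization A S\<^esub> = fraction_class S 0"
 unfolding localization_def using fraction_eq[OF one_closed S_one] fraction_eq[OF zero_closed S_one]
 by simp_all

lemma fractions_one_zero: "1 \<in> fractions S" "0 \<in> fractions S"
proof -
 have "1 = e \<one> / e \<one>" "0 = e \<zero> / e \<one>" by simp_all
 then show "1 \<in> fractions S" "0 \<in> fractions S"
  using S_one unfolding fractions_def by blast+
qed

end

text \<open>Both localizations are identified with the same subset of the field.\<close>

lemma localizations_isomorphic:
 assumes "embedded_localization A e S" "embedded_localization B e' T"
  and eq: "embedded_ring.fractions A e S = embedded_ring.fractions B e' T"
 shows "\<exists>\<phi>\<in>ring_iso (localization A S) (localization B T).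
  \<forall>a\<in>carrier A. \<forall>b\<in>carrier B. e a = e' b \<longrightarrow>
   \<phi> (fraction A S a \<one>\<^bsub>A\<^esub>) = fraction B T b \<one>\<^bsub>B\<^esub>"
proof -
 interpret A: embedded_localization A e S by fact
 interpret B: embedded_localization B e' T by fact
 define \<phi> where "\<phi> = B.fraction_class T \<circ> inv_into (A.fractions S) (A.fraction_class S)"
 have \<phi>: "\<phi> (A.fraction_class S y) = B.fraction_class T y" if "y \<in> A.fractions S" for y
  unfolding \<phi>_def using that by (simp add: inv_into_f_f[OF A.fraction_class_inj])
 have bij: "bij_betw \<phi> (carrier (localization A S)) (carrier (localization B T))"
  unfolding \<phi>_def A.carrier_localization B.carrier_localization
 proof (rule bij_betw_trans)
  show "bij_betw (inv_into (A.fractions S) (A.fraction_class S)) (A.fraction_class S ` A.fractions S) (A.fractions S)"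
   by (rule bij_betw_inv_into) (simp add: bij_betw_def A.fraction_class_inj)
  show "bij_betw (B.fraction_class T) (A.fractions S) (B.fraction_class T ` B.fractions T)"
   unfolding eq by (simp add: bij_betw_def B.fraction_class_inj)
 qed
 have "\<phi> \<in> ring_hom (localization A S) (localization B T)"
 proof (rule ring_hom_memI)
  fix x assume "x \<in> carrier (localization A S)"
  then show "\<phi> x \<in> carrier (localization B T)" using bij by (auto simp: bij_betw_def)
  fix y assume "y \<in> carrier (localization A S)"
  then obtain a b where ab: "a \<in> A.fractions S" "x = A.fraction_class S a" "b \<in> A.fractions S" "y = A.fraction_class S b"
   using \<open>x \<in> _\<close> unfolding A.carrier_localization by blast
  show "\<phi> (x \<otimes>\<^bsub>localization A S\<^esub> y) = \<phi> x \<otimes>\<^bsub>localization B T\<^esub> \<phi> y"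
   "\<phi> (x \<oplus>\<^bsub>localization A S\<^esub> y) = \<phi> x \<oplus>\<^bsub>localization B T\<^esub> \<phi> y"
   unfolding ab(2,4) using ab A.fractions_closed
   by (simp_all add: A.localization_ops B.localization_ops \<phi> eq[symmetric])
 next
  show "\<phi> \<one>\<^bsub>localization A S\<^esub> = \<one>\<^bsub>localization B T\<^esub>"
   unfolding A.localization_one_zero B.localization_one_zero by (rule \<phi>) (rule A.fractions_one_zero)
 qed
 then have iso: "\<phi> \<in> ring_iso (localization A S) (localization B T)"
  using bij by (simp add: ring_iso_def)
 have "\<phi> (fraction A S a \<one>\<^bsub>A\<^esub>) = fraction B T b \<one>\<^bsub>B\<^esub>"
  if "a \<in> carrier A" "b \<in> carrier B" "e a = e' b" for a b
 proof -
  have "e a / e \<one>\<^bsub>A\<^esub> \<in> A.fractions S" unfolding A.fractions_def using that A.S_one by blast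
  then show ?thesis
   using that by (simp add: A.fraction_eq[OF _ A.S_one] B.fraction_eq[OF _ B.S_one] \<phi>)
 qed
 then show ?thesis using iso by blast
qed

lemma type_algebra_simps [simp]:
 "carrier (ring_of_type_algebra :: 'r::comm_ring_1 ring) = UNIV"
 "x \<otimes>\<^bsub>ring_of_type_algebra :: 'r::comm_ring_1 ring\<^esub> y = x * y"
 "x \<oplus>\<^bsub>ring_of_type_algebra :: 'r::comm_ring_1 ring\<^esub> y = x + y"
 "\<one>\<^bsub>ring_of_type_algebra :: 'r::comm_ring_1 ring\<^esub> = 1"
 "\<zero>\<^bsub>ring_of_type_algebra :: 'r::comm_ring_1 ring\<^esub> = 0"
 by (simp_all add: ring_of_type_algebra_def)

lemma embedded_type_algebra:
 assumes "comm_hom h" "\<And>p. h p = (0::'b::field) ==> p = 0"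
 shows "embedded_ring (ring_of_type_algebra :: 'r::comm_ring_1 ring) h"
proof -
 interpret comm_hom h by fact
 interpret cring "ring_of_type_algebra :: 'r ring" by (rule cring_from_type_algebra)
 show ?thesis
 proof
  show "inj_on h (carrier ring_of_type_algebra)"
   using assms(2)[of "x - y" for x y] by (auto intro!: inj_onI)
 qed auto
qed

lemma embedded_hypersurface:
 fixes F :: "'r::comm_ring_1" and h :: "'r => 'b::field"
 assumes h: "comm_hom h" and ker: "\<And>p. h p = 0 \<longleftrightarrow> F dvd p"
 defines "e \<equiv> \<lambda>c. the_elem (h ` c)"
 shows "embedded_ring (hypersurface_ring F) e"
  and "e ` carrier (hypersurface_ring F) = range h"
  and "\<And>\<iota> c. hypersurface_const F \<iota> c \<in> carrier (hypersurface_ring F)"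
  and "\<And>\<iota> c. e (hypersurface_const F \<iota> c) = h (\<iota> c)"
proof -
 let ?P = "ring_of_type_algebra :: 'r ring" and ?B = "ring_of_type_algebra :: 'b ring"
 interpret h: comm_hom h by fact
 interpret P: cring ?P by (rule cring_from_type_algebra)
 interpret B: cring ?B by (rule cring_from_type_algebra)
 interpret H: ring_hom_ring ?P ?B h
  by unfold_locales (auto simp: ring_hom_def)
 have k: "PIdl\<^bsub>?P\<^esub> F = a_kernel ?P ?B h"
  unfolding cgenideal_def a_kernel_def' using ker by (auto simp: dvd_def mult.commute)
 have A: "hypersurface_ring F = ?P Quot a_kernel ?P ?B h"
  by (simp add: hypersurface_ring_def k)
 have cr: "cring (hypersurface_ring F)"
  unfolding A by (rule ideal.quotient_is_cring[OF H.kernel_is_ideal P.is_cring])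
 have hom: "e \<in> ring_hom (hypersurface_ring F) ?B"
  unfolding A e_def by (rule H.the_elem_hom)
 show "embedded_ring (hypersurface_ring F) e"
 proof (intro embedded_ring.intro cr embedded_ring_axioms.intro)
  show "inj_on e (carrier (hypersurface_ring F))"
   unfolding A e_def using H.the_elem_inj by (blast intro: inj_onI)
 qed (use hom in \<open>auto simp: ring_hom_def\<close>)
 show "e ` carrier (hypersurface_ring F) = range h"
  unfolding A e_def using H.the_elem_surj by simp
 fix \<iota> :: "'k => 'r" and c
 show "hypersurface_const F \<iota> c \<in> carrier (hypersurface_ring F)"
  unfolding A hypersurface_const_def k by (auto simp: FactRing_def A_RCOSETS_def')
 show "e (hypersurface_const F \<iota> c) = h (\<iota> c)"
  unfolding hypersurface_const_def k e_def by simp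
qed

section \<open>Birationality from equality of generated fields\<close>

locale subring_of = field_hom k for k :: "'a::field => 'b::field" +
 fixes D :: "'b set"
 assumes D_const: "k c \<in> D" and D_add: "x \<in> D ==> y \<in> D ==> x + y \<in> D"
  and D_mult: "x \<in> D ==> y \<in> D ==> x * y \<in> D" and D_uminus: "x \<in> D ==> - x \<in> D"
begin

lemma D_0: "0 \<in> D" and D_1: "1 \<in> D"
 using D_const[of 0] D_const[of 1] by simp_all

lemma D_power: "x \<in> D ==> x ^ n \<in> D"
 by (induction n) (auto intro: D_1 D_mult)

lemma D_peval_gen:
 assumes "\<And>c. h c \<in> D" "x \<in> D" "comm_hom h"
 shows "peval h p x \<in> D"
proof -
 interpret h: comm_hom h by fact
 show ?thesis by (induction p) (auto intro: D_add D_mult D_0 assms)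
qed

definition loc :: "'b => 'b set" where
 "loc b = {x / b ^ n | x n. x \<in> D}"

lemma D_loc: "x \<in> D ==> x \<in> loc b"
proof -
 assume "x \<in> D"
 moreover have "x = x / b ^ 0" by simp
 ultimately show ?thesis unfolding loc_def by blast
qed

lemma loc_subring:
 assumes "b \<in> D" "b ~= 0"
 shows "subring_of k (loc b)"
proof
 show "k c \<in> loc b" for c using D_loc[OF D_const] .
 fix x assume "x \<in> loc b"
 then obtain x' n where x: "x' \<in> D" "x = x' / b ^ n" by (auto simp: loc_def)
 show "- x \<in> loc b" unfolding loc_def x(2) minus_divide_left using D_uminus[OF x(1)] by blast
 fix y assume "y \<in> loc b"
 then obtain y' m where y: "y' \<in> D" "y = y' / b ^ m" by (auto simp: loc_def)
 have "x + y = (x' * b ^ m + y' * b ^ n) / b ^ (n + m)" "x * y = (x' * y') / b ^ (n + m)"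
  unfolding x y using assms(2) by (simp_all add: power_add field_simps)
 moreover have "x' * b ^ m + y' * b ^ n \<in> D" "x' * y' \<in> D"
  using x(1) y(1) assms(1) by (auto intro!: D_add D_mult D_power)
 ultimately show "x + y \<in> loc b" "x * y \<in> loc b" unfolding loc_def by blast+
qed

lemma inverse_loc: "1 / b \<in> loc b"
proof -
 have "1 / b = 1 / b ^ 1" by simp
 then show ?thesis unfolding loc_def using D_1 by blast
qed

text \<open>Fractions of elements of \<open>D\<close> are closed under the field operations.\<close>

lemma fieldgen_quotient:
 assumes "S \<subseteq> D" "x \<in> fieldgen k S"
 shows "\<exists>a\<in>D. \<exists>b\<in>D. b ~= 0 \<and> x = a / b"
 using assms(2)
proof (induction rule: fieldgen.induct)
 case (const c)
 show ?case using D_const[of c] D_1 by (intro bexI[of _ "k c"] bexI[of _ 1]) auto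
next
 case (gen x)
 then show ?case using assms(1) D_1 by (intro bexI[of _ x] bexI[of _ 1]) auto
next
 case (add x y)
 then obtain a b c d where *: "a \<in> D" "b \<in> D" "b ~= 0" "x = a / b" "c \<in> D" "d \<in> D" "d ~= 0" "y = c / d" by blast
 then show ?case by (intro bexI[of _ "a * d + c * b"] bexI[of _ "b * d"]) (auto intro: D_add D_mult simp: add_frac_eq)
next
 case (mult x y)
 then obtain a b c d where *: "a \<in> D" "b \<in> D" "b ~= 0" "x = a / b" "c \<in> D" "d \<in> D" "d ~= 0" "y = c / d" by blast
 then show ?case by (intro bexI[of _ "a * c"] bexI[of _ "b * d"]) (auto intro: D_mult)
next
 case (uminus x)
 then obtain a b where *: "a \<in> D" "b \<in> D" "b ~= 0" "x = a / b" by blast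
 then show ?case by (intro bexI[of _ "- a"] bexI[of _ b]) (auto intro: D_uminus)
next
 case (inverse x)
 then obtain a b where *: "a \<in> D" "b \<in> D" "b ~= 0" "x = a / b" by blast
 show ?case
 proof (cases "a = 0")
  case True
  then show ?thesis using * D_0 D_1 by (intro bexI[of _ 0] bexI[of _ 1]) auto
 next
  case False
  then show ?thesis using * by (intro bexI[of _ b] bexI[of _ a]) auto
 qed
qed

lemma common_denominator:
 assumes "finite I" "S \<subseteq> D" "I \<subseteq> fieldgen k S"
 shows "\<exists>b\<in>D. b ~= 0 \<and> (\<forall>x\<in>I. x \<in> loc b)"
 using assms(1,3)
proof (induction I)
 case empty
 show ?case using D_1 by (intro bexI[of _ 1]) auto
next
 case (insert x I)
 then obtain b where b: "b \<in> D" "b ~= 0" "\<And>y. y \<in> I ==> y \<in> loc b" by blast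
 obtain a c where ac: "a \<in> D" "c \<in> D" "c ~= 0" "x = a / c"
  using fieldgen_quotient[OF assms(2), of x] insert.prems by blast
 have bc: "b * c \<in> D" "b * c ~= 0" using b ac D_mult by auto
 have "y \<in> loc (b * c)" if y: "y \<in> I" for y
 proof -
  obtain y' n where y': "y' \<in> D" "y = y' / b ^ n" using b(3)[OF y] unfolding loc_def by blast
  have "y = y' * c ^ n / (b * c) ^ n" using ac(3) b(2) by (simp add: y' power_mult_distrib)
  then show ?thesis unfolding loc_def using D_mult[OF y'(1) D_power[OF ac(2), of n]] by blast
 qed
 moreover have "x \<in> loc (b * c)"
 proof -
  have "x = a * b / (b * c) ^ 1" using ac b by simp
  then show ?thesis unfolding loc_def using D_mult[OF ac(1) b(1)] by blast
 qed
 ultimately show ?case using bc by (intro bexI[of _ "b * c"]) auto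
qed

end

text \<open>Two finitely generated domains with the same fraction field become equal after inverting
 one element in each: invert denominators for the generators of either ring over the other.\<close>

lemma equal_localizations:
 assumes "subring_of k D" "subring_of k D'" "finite S" "finite S'" "S \<subseteq> D" "S' \<subseteq> D'"
  and minD: "\<And>R. subring_of k R ==> S \<subseteq> R ==> D \<subseteq> R"
  and minD': "\<And>R. subring_of k R ==> S' \<subseteq> R ==> D' \<subseteq> R"
  and gen: "fieldgen k S = fieldgen k S'"
 shows "\<exists>a\<in>D - {0}. \<exists>b\<in>D' - {0}. subring_of.loc D a = subring_of.loc D' b"
proof -
 interpret D: subring_of k D by fact
 interpret D': subring_of k D' by fact
 have "S' \<subseteq> fieldgen k S" "S \<subseteq> fieldgen k S'"
  using fieldgen.gen[of _ S' k] fieldgen.gen[of _ S k] gen by (auto simp: subset_iff)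
 then obtain q b0 where q: "q \<in> D" "q ~= 0" "S' \<subseteq> D.loc q" and b0: "b0 \<in> D'" "b0 ~= 0" "S \<subseteq> D'.loc b0"
  using D.common_denominator[of S' S] D'.common_denominator[of S S'] assms(3-6) unfolding subset_iff by blast
 have D'q: "D' \<subseteq> D.loc q" by (rule minD'[OF D.loc_subring[OF q(1,2)] q(3)])
 have Db: "D \<subseteq> D'.loc b0" by (rule minD[OF D'.loc_subring[OF b0(1,2)] b0(3)])
 obtain m l where m: "m \<in> D" "b0 = m / q ^ l" using D'q b0(1) unfolding D.loc_def by blast
 obtain n j where n: "n \<in> D'" "q = n / b0 ^ j" using Db q(1) unfolding D'.loc_def by blast
 have nz: "m ~= 0" "n ~= 0" using m n b0(2) q(2) by auto
 define a where "a = q * m"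
 define b where "b = b0 * n"
 have a: "a \<in> D" "a ~= 0" and b: "b \<in> D'" "b ~= 0"
  using q(2) b0(2) nz D.D_mult[OF q(1) m(1)] D'.D_mult[OF b0(1) n(1)] by (simp_all add: a_def b_def)
 interpret La: subring_of k "D.loc a" by (rule D.loc_subring[OF a])
 interpret Lb: subring_of k "D'.loc b" by (rule D'.loc_subring[OF b])
 have inva: "1 / q \<in> D.loc a" "1 / m \<in> D.loc a"
 proof -
  have e: "1 / q = m * (1 / a)" "1 / m = q * (1 / a)" using nz q by (simp_all add: a_def)
  show "1 / q \<in> D.loc a" unfolding e by (intro La.D_mult D.D_loc m D.inverse_loc)
  show "1 / m \<in> D.loc a" unfolding e by (intro La.D_mult D.D_loc q D.inverse_loc)
 qed
 have invb: "1 / b0 \<in> D'.loc b" "1 / n \<in> D'.loc b"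
 proof -
  have e: "1 / b0 = n * (1 / b)" "1 / n = b0 * (1 / b)" using nz b0 by (simp_all add: b_def)
  show "1 / b0 \<in> D'.loc b" unfolding e by (intro Lb.D_mult D'.D_loc n D'.inverse_loc)
  show "1 / n \<in> D'.loc b" unfolding e by (intro Lb.D_mult D'.D_loc b0 D'.inverse_loc)
 qed
 have "D' \<subseteq> D.loc a"
 proof
  fix x assume "x \<in> D'"
  then obtain y i where y: "y \<in> D" "x = y / q ^ i" using D'q unfolding D.loc_def by blast
  then have "x = y * (1 / q) ^ i" by (simp add: power_one_over divide_simps)
  then show "x \<in> D.loc a" using La.D_mult[OF D.D_loc[OF y(1)] La.D_power[OF inva(1)]] by simp
 qed
 moreover have "D \<subseteq> D'.loc b"
 proof
  fix x assume "x \<in> D"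
  then obtain y i where y: "y \<in> D'" "x = y / b0 ^ i" using Db unfolding D'.loc_def by blast
  then have "x = y * (1 / b0) ^ i" by (simp add: power_one_over divide_simps)
  then show "x \<in> D'.loc b" using Lb.D_mult[OF D'.D_loc[OF y(1)] Lb.D_power[OF invb(1)]] by simp
 qed
 moreover have "1 / b \<in> D.loc a"
 proof -
  have 1: "q ^ l * (1 / m) = 1 / b0" using m(2) by simp
  have 2: "n = q * b0 ^ j" using n(2) b0(2) by simp
  have e: "1 / b = q ^ l * (1 / m) * ((q ^ l * (1 / m)) ^ j * (1 / q))"
   unfolding 1 b_def 2 by (simp add: power_one_over)
  show ?thesis unfolding e by (intro La.D_mult La.D_power inva D.D_loc q(1))
 qed
 moreover have "1 / a \<in> D'.loc b"
 proof -
  have 1: "b0 ^ j * (1 / n) = 1 / q" using n(2) by simp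
  have 2: "m = b0 * q ^ l" using m(2) q(2) by simp
  have e: "1 / a = b0 ^ j * (1 / n) * ((b0 ^ j * (1 / n)) ^ l * (1 / b0))"
   unfolding 1 a_def 2 by (simp add: power_one_over)
  show ?thesis unfolding e by (intro Lb.D_mult Lb.D_power invb D'.D_loc b0(1))
 qed
 ultimately have sub: "D' \<subseteq> D.loc a" "D \<subseteq> D'.loc b" "1 / b \<in> D.loc a" "1 / a \<in> D'.loc b"
  by blast+
 have "D'.loc b \<subseteq> D.loc a"
 proof
  fix x assume "x \<in> D'.loc b"
  then obtain y i where y: "y \<in> D'" "x = y / b ^ i" unfolding D'.loc_def by blast
  then have "x = y * (1 / b) ^ i" by (simp add: power_one_over divide_simps)
  then show "x \<in> D.loc a" using La.D_mult[OF subsetD[OF sub(1) y(1)] La.D_power[OF sub(3)]] by simp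
 qed
 moreover have "D.loc a \<subseteq> D'.loc b"
 proof
  fix x assume "x \<in> D.loc a"
  then obtain y i where y: "y \<in> D" "x = y / a ^ i" unfolding D.loc_def by blast
  then have "x = y * (1 / a) ^ i" by (simp add: power_one_over divide_simps)
  then show "x \<in> D'.loc b" using Lb.D_mult[OF subsetD[OF sub(2) y(1)] Lb.D_power[OF sub(4)]] by simp
 qed
 ultimately have "D.loc a = D'.loc b" by blast
 then show ?thesis using a b by blast
qed

section \<open>Three and four variables\<close>

definition ev3 :: "('a::comm_ring_1 => 'b::comm_ring_1) => 'a poly poly poly => 'b => 'b => 'b => 'b" where
 "ev3 k p v w x = peval (\<lambda>g. ev2 k g v w) p x"

definition ev4 ::
  "('a::comm_ring_1 => 'b::comm_ring_1) => 'a poly poly poly poly => 'b => 'b => 'b => 'b => 'b" where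
 "ev4 k p v w x y = peval (\<lambda>g. ev3 k g v w x) p y"

context comm_hom
begin

lemma comm_hom_ev3: "comm_hom (\<lambda>p. ev3 k p v w x)"
 unfolding ev3_def by (rule comm_hom.comm_hom_peval[OF comm_hom_ev2])

lemma comm_hom_ev4: "comm_hom (\<lambda>p. ev4 k p v w x y)"
 unfolding ev4_def by (rule comm_hom.comm_hom_peval[OF comm_hom_ev3])

lemma ev3_pCons [simp]: "ev3 k (pCons a p) v w x = ev2 k a v w + x * ev3 k p v w x"
 unfolding ev3_def by (rule comm_hom.peval_pCons[OF comm_hom_ev2])

lemma ev4_pCons [simp]: "ev4 k (pCons a p) v w x y = ev3 k a v w x + y * ev4 k p v w x y"
 unfolding ev4_def by (rule comm_hom.peval_pCons[OF comm_hom_ev3])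

lemma ev34_0 [simp]: "ev3 k 0 v w x = 0" "ev4 k 0 v w x y = 0"
 using comm_hom.hom_0[OF comm_hom_ev3] comm_hom.hom_0[OF comm_hom_ev4] by auto

lemma ev34_1 [simp]: "ev3 k 1 v w x = 1" "ev4 k 1 v w x y = 1"
 using comm_hom.hom_1[OF comm_hom_ev3] comm_hom.hom_1[OF comm_hom_ev4] by auto

lemma ev2_monom: "ev2 k (Polynomial.monom a j) v w = peval k a v * w ^ j"
 unfolding ev2_def by (rule comm_hom.peval_monom[OF comm_hom_peval])

lemma ev3_monom: "ev3 k (Polynomial.monom a l) v w x = ev2 k a v w * x ^ l"
 unfolding ev3_def by (rule comm_hom.peval_monom[OF comm_hom_ev2])

lemma ev3_sum_box:
 assumes "\<And>i j l. coeff (coeff (coeff p l) j) i ~= 0 ==> i \<le> n \<and> j \<le> n \<and> l \<le> n"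
 shows "ev3 k p v w x = (\<Sum>(i, j, l)\<in>{..n} \<times> {..n} \<times> {..n}.
  k (coeff (coeff (coeff p l) j) i) * (v ^ i * w ^ j * x ^ l))"
proof -
 have 0: "coeff (coeff (coeff p l) j) i = 0" if "n < i \<or> n < j \<or> n < l" for i j l
  using assms[of l j i] that by linarith
 have dp: "degree p \<le> n" "degree (coeff p l) \<le> n"
  "degree (coeff (coeff p l) j) \<le> n" for l j
  by (rule degree_le; simp add: poly_eq_iff 0)+
 have "ev3 k p v w x = (\<Sum>l\<le>n. (\<Sum>j\<le>n. (\<Sum>i\<le>n. k (coeff (coeff (coeff p l) j) i) * v ^ i) * w ^ j) * x ^ l)"
  unfolding ev3_def comm_hom.peval_sum_le[OF comm_hom_ev2 dp(1)]
  unfolding ev2_def comm_hom.peval_sum_le[OF comm_hom_peval dp(2)]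
  unfolding peval_sum_le[OF dp(3)] ..
 also have "\<dots> = (\<Sum>l\<le>n. \<Sum>j\<le>n. \<Sum>i\<le>n. k (coeff (coeff (coeff p l) j) i) * (v ^ i * w ^ j * x ^ l))"
  by (simp add: sum_distrib_right mult.assoc)
 also have "\<dots> = (\<Sum>i\<le>n. \<Sum>j\<le>n. \<Sum>l\<le>n. k (coeff (coeff (coeff p l) j) i) * (v ^ i * w ^ j * x ^ l))"
  by (subst sum.swap, subst (2) sum.swap, subst sum.swap) simp
 finally show ?thesis by (simp add: sum.cartesian_product case_prod_unfold)
qed

end

lemma ex_coeff_bound3:
 "\<exists>n. \<forall>i j l. coeff (coeff (coeff p l) j) i ~= 0 \<longrightarrow> i \<le> n \<and> j \<le> n \<and> l \<le> n"
proof -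
 let ?d = "degree p"
 let ?e = "\<lambda>l. degree (coeff p l)"
 let ?g = "\<lambda>l j. degree (coeff (coeff p l) j)"
 define n where "n = ?d + (\<Sum>l\<le>?d. ?e l) + (\<Sum>l\<le>?d. \<Sum>j\<le>?e l. ?g l j)"
 have "i \<le> n \<and> j \<le> n \<and> l \<le> n" if ne: "coeff (coeff (coeff p l) j) i ~= 0" for i j l
 proof -
  have l: "l \<le> ?d" using ne by (metis coeff_0 le_degree)
  have j: "j \<le> ?e l" using ne by (metis coeff_0 le_degree)
  have i: "i \<le> ?g l j" using ne by (metis le_degree)
  have "?e l \<le> (\<Sum>l\<le>?d. ?e l)" using l by (intro member_le_sum) auto
  moreover have "?g l j \<le> (\<Sum>j\<le>?e l. ?g l j)" using j by (intro member_le_sum) auto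
  moreover have "(\<Sum>j\<le>?e l. ?g l j) \<le> (\<Sum>l\<le>?d. \<Sum>j\<le>?e l. ?g l j)"
   using l by (intro member_le_sum[where f = "\<lambda>l. \<Sum>j\<le>?e l. ?g l j"]) auto
  ultimately show ?thesis using i j l unfolding n_def by linarith
 qed
 then show ?thesis by blast
qed

context field_hom
begin

text \<open>The counting in boxes of exponents is equivalent to the absence of polynomial relations.\<close>

lemma alg_indep3_iff: "alg_indep3 v w x \<longleftrightarrow> (\<forall>p. ev3 k p v w x = 0 \<longrightarrow> p = 0)"
proof
 assume ind: "alg_indep3 v w x"
 show "\<forall>p. ev3 k p v w x = 0 \<longrightarrow> p = 0"
 proof (intro allI impI)
  fix p assume p: "ev3 k p v w x = 0"
  obtain n where n: "\<And>i j l. coeff (coeff (coeff p l) j) i ~= 0 ==> i \<le> n \<and> j \<le> n \<and> l \<le> n"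
   using ex_coeff_bound3[of p] by blast
  have "indep_fam ({..n} \<times> {..n} \<times> {..n}) (\<lambda>(i, j, l). v ^ i * w ^ j * x ^ l)"
   using ind unfolding alg_indep3_def by simp
  moreover have "(\<Sum>t\<in>{..n} \<times> {..n} \<times> {..n}. k (case t of (i, j, l) => coeff (coeff (coeff p l) j) i)
    * (case t of (i, j, l) => v ^ i * w ^ j * x ^ l)) = 0"
   using p ev3_sum_box[where p = p and n = n and v = v and w = w and x = x] n by (simp add: case_prod_unfold)
  ultimately have "\<forall>t\<in>{..n} \<times> {..n} \<times> {..n}. (case t of (i, j, l) => coeff (coeff (coeff p l) j) i) = 0"
   unfolding indep_fam_def
   by (elim allE[of _ "\<lambda>t. case t of (i, j, l) => coeff (coeff (coeff p l) j) i"]) blast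
  then have "coeff (coeff (coeff p l) j) i = 0" for i j l
   using n[of l j i] by fastforce
  then show "p = 0" by (simp add: poly_eq_iff)
 qed
next
 assume inj: "\<forall>p. ev3 k p v w x = 0 \<longrightarrow> p = 0"
 show "alg_indep3 v w x"
  unfolding alg_indep3_def indep_fam_def
 proof (intro allI impI)
  fix T :: "(nat \<times> nat \<times> nat) set" and c
  assume T: "finite T" and s: "(\<Sum>i\<in>T. k (c i) * (case i of (i, j, l) => v ^ i * w ^ j * x ^ l)) = 0"
  define m where "m = (\<lambda>(i, j, l). Polynomial.monom (Polynomial.monom (Polynomial.monom (c (i, j, l)) i) j) l)"
  define p where "p = sum m T"
  have "ev3 k (m t) v w x = k (c t) * (case t of (i, j, l) => v ^ i * w ^ j * x ^ l)" for t
   by (cases t) (simp add: m_def ev3_monom ev2_monom ac_simps)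
  then have "ev3 k p v w x = 0"
   using s by (simp add: p_def comm_hom.hom_sum[OF comm_hom_ev3])
  then have p0: "p = 0" using inj by blast
  show "\<forall>t\<in>T. c t = 0"
  proof
   fix t assume t: "t \<in> T"
   obtain i j l where e: "t = (i, j, l)" by (metis prod_cases3)
   have "coeff (coeff (coeff p l) j) i
    = (\<Sum>t'\<in>T. coeff (coeff (coeff (m t') l) j) i)"
    by (simp add: p_def coeff_sum)
   also have "\<dots> = (\<Sum>t'\<in>T. if t' = t then c t else 0)"
    by (rule sum.cong) (auto simp: m_def e coeff_monom split: prod.splits)
   also have "\<dots> = c t" using T t by simp
   finally show "c t = 0" using p0 by simp
  qed
 qed
qed

end

lemma embedded_localization_powers:
 assumes "embedded_ring A e" "a \<in> carrier A" "a ~= \<zero>\<^bsub>A\<^esub>"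
 shows "embedded_localization A e (powers_of A a)"
  and "embedded_ring.fractions A e (powers_of A a) = {e x / e a ^ n | x n. x \<in> carrier A}"
proof -
 interpret embedded_ring A e by fact
 interpret domain A by (rule is_domain)
 have nz: "a [^]\<^bsub>A\<^esub> n ~= \<zero>\<^bsub>A\<^esub>" for n :: nat
 proof -
  have "e (a [^]\<^bsub>A\<^esub> n) ~= 0" using assms by simp
  then show ?thesis by auto
 qed
 show "embedded_localization A e (powers_of A a)"
 proof
  show "powers_of A a \<subseteq> carrier A - {\<zero>\<^bsub>A\<^esub>}" using assms nz by (auto simp: powers_of_def)
  show "\<one>\<^bsub>A\<^esub> \<in> powers_of A a" unfolding powers_of_def by (metis nat_pow_0 rangeI)
  fix s t assume "s \<in> powers_of A a" "t \<in> powers_of A a"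
  then obtain m n :: nat where "s = a [^]\<^bsub>A\<^esub> m" "t = a [^]\<^bsub>A\<^esub> n" by (auto simp: powers_of_def)
  then have "s \<otimes>\<^bsub>A\<^esub> t = a [^]\<^bsub>A\<^esub> (m + n)" using assms by (simp add: nat_pow_mult)
  then show "s \<otimes>\<^bsub>A\<^esub> t \<in> powers_of A a" by (simp add: powers_of_def)
 qed
 show "fractions (powers_of A a) = {e x / e a ^ n | x n. x \<in> carrier A}"
 proof -
  have "fractions (powers_of A a) = {e x / e (a [^]\<^bsub>A\<^esub> n) | x (n::nat). x \<in> carrier A}"
   unfolding fractions_def powers_of_def by blast
  then show ?thesis using assms(2) by simp
 qed
qed

text \<open>Since \<open>-1\<close> is not a square in \<open>R(v,w)\<close>, neither is \<open>f - x\<^sup>2\<close> in \<open>R(v,w,x)\<close>.\<close>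

lemma kernel_sum_two_squares:
 fixes k :: "'a::linordered_field => 'b::field"
 assumes "field_hom k" and ind: "field_hom.alg_indep3 k v w x" and y: "y ^ 2 = ev2 k f v w - x ^ 2"
 shows "ev4 k p v w x y = 0 \<longleftrightarrow> sum_two_squares_eqn f dvd p"
proof -
 interpret field_hom k by fact
 interpret E: comm_hom "\<lambda>p. ev4 k p v w x y" by (rule comm_hom_ev4)
 interpret E3: comm_hom "\<lambda>p. ev3 k p v w x" by (rule comm_hom_ev3)
 define F0 :: "'a poly poly poly" where "F0 = [:- f, 0, 1:]"
 have F: "sum_two_squares_eqn f = [:F0, 0, 1:]"
  by (simp add: sum_two_squares_eqn_def F0_def power2_eq_square)
 have EF: "ev4 k (sum_two_squares_eqn f) v w x y = 0"
 proof -
  have "y * y = ev2 k f v w - x * x" using y by (simp add: power2_eq_square)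
  then show ?thesis unfolding F F0_def by simp
 qed
 have div: "\<exists>q p0 p1. p = [:F0, 0, 1:] * q + [:p0, p1:]" for p
 proof (induction p)
  case 0
  show ?case by (intro exI[of _ 0]) simp
 next
  case (pCons a p)
  then obtain q p0 p1 where p: "p = [:F0, 0, 1:] * q + [:p0, p1:]" by blast
  have "pCons a p = [:F0, 0, 1:] * (pCons 0 q + [:p1:]) + [:a - p1 * F0, p0:]"
   unfolding p by (simp add: algebra_simps)
  then show ?case by blast
 qed
 show ?thesis
 proof
  assume "sum_two_squares_eqn f dvd p"
  then show "ev4 k p v w x y = 0" using EF by (auto simp: dvd_def)
 next
  assume p0: "ev4 k p v w x y = 0"
  obtain q a b where p: "p = [:F0, 0, 1:] * q + [:a, b:]" using div by blast
  have "ev4 k p v w x y = ev4 k (sum_two_squares_eqn f) v w x y * ev4 k q v w x y + ev4 k [:a, b:] v w x y"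
   unfolding p F by (simp only: E.hom_add E.hom_mult)
  then have ab: "ev3 k a v w x + y * ev3 k b v w x = 0"
   using p0 EF by simp
  have "ev3 k a v w x ^ 2 = y ^ 2 * ev3 k b v w x ^ 2"
   using ab by (metis eq_neg_iff_add_eq_0 power2_minus power_mult_distrib)
  also have "y ^ 2 = ev3 k (- F0) v w x"
   unfolding y F0_def by (simp add: power2_eq_square)
  finally have "ev3 k (a ^ 2 - (- F0) * b ^ 2) v w x = 0" by simp
  then have eq: "a ^ 2 = (- F0) * b ^ 2"
   using ind unfolding alg_indep3_iff by (metis eq_iff_diff_eq_0)
  define s where "s = (\<lambda>p :: 'a poly poly poly. lead_coeff (lead_coeff (lead_coeff p)))"
  have s_mult: "s (p * q) = s p * s q" for p q by (simp add: s_def lead_coeff_mult)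
  have s_0: "s p = 0 \<longleftrightarrow> p = 0" for p by (simp add: s_def)
  have "s F0 = 1" by (simp add: s_def F0_def)
  moreover have "s (- F0) = - s F0" by (simp add: s_def)
  moreover have "s (a * a) = s ((- F0) * (b * b))"
   using eq by (simp only: power2_eq_square)
  ultimately have "s a ^ 2 = - (s b ^ 2)"
   unfolding s_mult by (simp add: power2_eq_square)
  then have "s a ^ 2 + s b ^ 2 = 0" by simp
  then have "s a = 0" "s b = 0" by (simp_all add: sum_power2_eq_zero_iff)
  then have "p = sum_two_squares_eqn f * q" unfolding p F by (simp add: s_0)
  then show "sum_two_squares_eqn f dvd p" by simp
 qed
qed

text \<open>The generators \<open>p, q, r\<close> are algebraically independent, so polynomials in them form a polynomial ring. It
 has the same fraction field as the coordinate ring, and both become equal after inverting one element in each.\<close>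

lemma rational_if_purely_transcendental:
 fixes k :: "'a::linordered_field => 'b::field"
 assumes hom: "field_hom k" and ind: "field_hom.alg_indep3 k v w x"
  and y: "y ^ 2 = ev2 k f v w - x ^ 2"
  and gen: "fieldgen k {v, w, x, y} = fieldgen k {p, q, r}"
 shows "rational_sum_two_squares f"
proof -
 interpret field_hom k by fact
 let ?F = "sum_two_squares_eqn f"
 let ?A = "hypersurface_ring ?F" and ?B = "ring_of_type_algebra :: 'a poly poly poly ring"
 let ?e' = "\<lambda>s. ev3 k s p q r"
 obtain e where emb: "embedded_ring ?A e" "e ` carrier ?A = range (\<lambda>p. ev4 k p v w x y)"
  and emb_const: "\<And>(\<iota> :: 'a => _) c. hypersurface_const ?F \<iota> c \<in> carrier ?A"
   "\<And>(\<iota> :: 'a => _) c. e (hypersurface_const ?F \<iota> c) = ev4 k (\<iota> c) v w x y"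
  using embedded_hypersurface[OF comm_hom_ev4 kernel_sum_two_squares[OF hom ind y]] by blast
 have ind': "alg_indep3 p q r"
  by (rule alg_indep3_generators[OF _ ind]) (use gen fieldgen.gen[of _ "{v, w, x, y}" k] in auto)
 have embB: "embedded_ring ?B ?e'"
  by (rule embedded_type_algebra[OF comm_hom_ev3]) (use ind' in \<open>simp add: alg_indep3_iff\<close>)
 interpret A: embedded_ring ?A e by (rule emb(1))
 interpret B: embedded_ring ?B ?e' by (rule embB)
 define D where "D = range (\<lambda>p. ev4 k p v w x y)"
 define D' where "D' = range ?e'"
 have range_subring: "subring_of k (range h)" if h: "comm_hom h" "\<And>c. k c = h (i c)"
  for h :: "'z::comm_ring_1 => 'b" and i
 proof -
  interpret h: comm_hom h by fact
  show ?thesis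
  proof
   show "k c \<in> range h" for c using h(2) by simp
  qed (auto simp flip: h.hom_add h.hom_mult h.hom_minus)
 qed
 have c4: "k c = ev4 k [:[:[:[:c:]:]:]:] v w x y" and c3: "k c = ?e' [:[:[:c:]:]:]" for c
  by simp_all
 have D: "subring_of k D"
  unfolding D_def by (rule range_subring[OF comm_hom_ev4 c4])
 have D': "subring_of k D'"
  unfolding D'_def by (rule range_subring[OF comm_hom_ev3 c3])
 have ev3_in: "ev3 k s v w x \<in> R" if R: "subring_of k R" "v \<in> R" "w \<in> R" "x \<in> R" for R s v w x
 proof -
  interpret R: subring_of k R by fact
  show ?thesis unfolding ev3_def ev2_def
   by (intro R.D_peval_gen comm_hom_peval comm_hom.comm_hom_peval[OF comm_hom_peval] R.D_const R comm_hom_axioms)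
 qed
 have ev4_in: "ev4 k s v w x y \<in> R" if R: "subring_of k R" "v \<in> R" "w \<in> R" "x \<in> R" "y \<in> R" for R s
 proof -
  interpret R: subring_of k R by fact
  show ?thesis unfolding ev4_def by (intro R.D_peval_gen ev3_in R comm_hom_ev3)
 qed
 have in_D: "{v, w, x, y} \<subseteq> D"
 proof -
  have "v = ev4 k [:[:[:[:0, 1:]:]:]:] v w x y" "w = ev4 k [:[:[:0, 1:]:]:] v w x y"
   "x = ev4 k [:[:0, 1:]:] v w x y" "y = ev4 k [:0, 1:] v w x y"
   by simp_all
  then show ?thesis unfolding D_def by blast
 qed
 have in_D': "{p, q, r} \<subseteq> D'"
 proof -
  have "p = ?e' [:[:[:0, 1:]:]:]" "q = ?e' [:[:0, 1:]:]" "r = ?e' [:0, 1:]"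
   by simp_all
  then show ?thesis unfolding D'_def by blast
 qed
 have "\<exists>a\<in>D - {0}. \<exists>b\<in>D' - {0}. subring_of.loc D a = subring_of.loc D' b"
 proof (rule equal_localizations[OF D D' _ _ in_D in_D' _ _ gen])
  show "D \<subseteq> R" if "subring_of k R" "{v, w, x, y} \<subseteq> R" for R
   unfolding D_def using ev4_in[OF that(1)] that(2) by auto
  show "D' \<subseteq> R" if "subring_of k R" "{p, q, r} \<subseteq> R" for R
   unfolding D'_def using ev3_in[OF that(1)] that(2) by auto
 qed auto
 then obtain a b where ab: "a \<in> D" "a ~= 0" "b \<in> D'" "b ~= 0" "subring_of.loc D a = subring_of.loc D' b"
  by blast
 obtain \<alpha> where \<alpha>: "\<alpha> \<in> carrier ?A" "e \<alpha> = a" 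
 proof -
  have "a \<in> e ` carrier ?A" using ab(1) emb(2) unfolding D_def by simp
  then show ?thesis using that by blast
 qed
 obtain \<beta> where \<beta>: "?e' \<beta> = b" using ab(3) unfolding D'_def by auto
 have nz: "\<alpha> ~= \<zero>\<^bsub>?A\<^esub>" "\<beta> ~= 0" using \<alpha> \<beta> ab A.e_zero B.e_zero by auto
 note LA = embedded_localization_powers[OF emb(1) \<alpha>(1) nz(1)]
 note LB = embedded_localization_powers[OF embB, of \<beta>, simplified, OF nz(2)]
 have fA: "A.fractions (powers_of ?A \<alpha>) = subring_of.loc D a"
  unfolding LA(2) subring_of.loc_def[OF D] \<alpha>(2)
  unfolding D_def emb(2)[symmetric] by blast
 have fB: "B.fractions (powers_of ?B \<beta>) = subring_of.loc D' b"
 proof -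
  have "subring_of.loc D' b = {x / b ^ n | x n. x \<in> D'}" by (rule subring_of.loc_def[OF D'])
  then show ?thesis unfolding LB(2) \<beta> by (auto simp: D'_def)
 qed
 obtain \<phi> where \<phi>: "\<phi> \<in> ring_iso (localization ?A (powers_of ?A \<alpha>)) (localization ?B (powers_of ?B \<beta>))"
  "\<And>s t. s \<in> carrier ?A ==> t \<in> carrier ?B ==> e s = ?e' t ==>
   \<phi> (fraction ?A (powers_of ?A \<alpha>) s \<one>\<^bsub>?A\<^esub>) = fraction ?B (powers_of ?B \<beta>) t \<one>\<^bsub>?B\<^esub>"
  using localizations_isomorphic[OF LA(1) LB(1)] fA fB ab(5) by auto
 have "\<phi> (fraction ?A (powers_of ?A \<alpha>) (hypersurface_const ?F (\<lambda>c. [:[:[:[:c:]:]:]:]) c) \<one>\<^bsub>?A\<^esub>)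
   = fraction ?B (powers_of ?B \<beta>) [:[:[:c:]:]:] \<one>\<^bsub>?B\<^esub>" for c
  by (rule \<phi>(2)) (use emb_const in auto)
 then show ?thesis
  unfolding rational_sum_two_squares_def rational_threefold_def birational_def Let_def
  using A.is_domain B.is_domain \<alpha>(1) nz
  by (intro conjI bexI[of _ \<alpha>] bexI[of _ \<beta>] bexI[OF _ \<phi>(1)] allI) auto
qed

section \<open>Rationality of conic bundles\<close>

lemma hom_ev3:
 assumes "comm_hom h" "comm_hom k"
 shows "h (ev3 k p v w x) = ev3 (\<lambda>c. h (k c)) p (h v) (h w) (h x)"
 unfolding ev3_def
 by (subst hom_peval[OF assms(1) comm_hom.comm_hom_ev2[OF assms(2)]]) (simp add: hom_ev2[OF assms])

lemma ex_generic_point: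
 "\<exists>(k :: 'a::field => 'a poly poly poly fract alg_closure) v w x.
   field_hom k \<and> field_hom.alg_indep3 k v w x"
proof -
 interpret c3: comm_hom "\<lambda>c::'a. [:[:[:c:]:]:]" by (rule comm_hom_const3)
 define h :: "'a poly poly poly => 'a poly poly poly fract alg_closure" where "h = (\<lambda>p. to_ac (to_fract p))"
 have h: "comm_hom h" by unfold_locales (auto simp: h_def)
 have h0: "h p = 0 \<longleftrightarrow> p = 0" for p by (simp add: h_def)
 define k where "k = (\<lambda>c. h [:[:[:c:]:]:])"
 have "comm_hom k" unfolding k_def by (rule comm_hom_comp[OF h comm_hom_const3])
 then have k: "field_hom k" by (rule field_hom.intro)
 have A: "peval (\<lambda>c. [:[:[:c:]:]:]) g [:[:[:0, 1:]:]:] = [:[:g:]:]" for g :: "'a poly"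
  by (induction g) simp_all
 have B: "ev2 (\<lambda>c. [:[:[:c:]:]:]) g [:[:[:0, 1:]:]:] [:[:0, 1:]:] = [:g:]" for g :: "'a poly poly"
  by (induction g) (simp_all add: A)
 have C: "ev3 (\<lambda>c. [:[:[:c:]:]:]) g [:[:[:0, 1:]:]:] [:[:0, 1:]:] [:0, 1:] = g" for g :: "'a poly poly poly"
  by (induction g) (simp_all add: B)
 have "ev3 k p (h [:[:[:0, 1:]:]:]) (h [:[:0, 1:]:]) (h [:0, 1:]) = h p" for p
  unfolding k_def hom_ev3[OF h comm_hom_const3, symmetric] C ..
 then have "field_hom.alg_indep3 k (h [:[:[:0, 1:]:]:]) (h [:[:0, 1:]:]) (h [:0, 1:])"
  unfolding field_hom.alg_indep3_iff[OF k] by (simp add: h0)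
 then show ?thesis using k by blast
qed

lemma degree_le_2E:
 assumes "degree p \<le> 2"
 obtains c0 c1 c2 where "p = [:c0, c1, c2:]"
proof
 show "p = [:coeff p 0, coeff p 1, coeff p 2:]"
 proof (rule poly_eqI)
  fix n :: nat
  consider "n = 0" | "n = 1" | "n = 2" | "n > 2" by linarith
  then show "coeff p n = coeff [:coeff p 0, coeff p 1, coeff p 2:] n"
  proof cases
   case 4
   then show ?thesis using assms by (simp add: coeff_eq_0 degree_pCons_eq_if)
  qed (auto simp: numeral_2_eq_2)
 qed
qed

lemma nonneg_sqrt: "0 \<le> (c::'a::real_closed_field) ==> \<exists>s\<ge>0. s ^ 2 = c"
proof -
 assume "0 \<le> c"
 then obtain b where b: "c = b * b" using nonneg_imp_square by blast
 then show ?thesis by (intro exI[of _ "\<bar>b\<bar>"]) (simp add: power2_eq_square)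
qed

lemma pos_sqrt: "0 < (c::'a::real_closed_field) ==> \<exists>s>0. s ^ 2 = c"
proof -
 assume c: "0 < c"
 then obtain s where s: "s \<ge> 0" "s ^ 2 = c" using nonneg_sqrt[of c] by auto
 then have "s ~= 0" using c by auto
 then show ?thesis using s by (intro exI[of _ s]) simp
qed

locale rcf_hom = field_hom k for k :: "'a::real_closed_field => 'b::field"
begin

lemma two_nonzero [simp]: "(2::'b) ~= 0"
 using hom_eq_0_iff[of 2] hom_numeral[of "num.Bit0 num.One"] by simp

lemma four_nonzero [simp]: "(4::'b) ~= 0"
 using hom_eq_0_iff[of 4] hom_numeral[of "num.Bit0 (num.Bit0 num.One)"] by simp

definition rational3 :: "'b set => bool" where
 "rational3 E \<longleftrightarrow> (\<exists>p q r. E = fieldgen k {p, q, r})"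

text \<open>An isotropic quadric is rational: here \<open>w\<^sup>2 - y\<^sup>2\<close> splits.\<close>

lemma rational3_split:
 assumes E: "E = fieldgen k {v, w, x, y}" and ind: "alg_indep3 v0 w0 x0" "{v0, w0, x0} \<subseteq> E"
  and eq: "x ^ 2 + y ^ 2 = w ^ 2 - peval k e v"
 shows "rational3 E"
proof (cases "w + y = 0")
 case True
 then have y: "y = - w" by (simp add: eq_neg_iff_add_eq_0 add.commute)
 have "- w \<in> fieldgen k {v, w, x}" by (intro fg(5)) (auto intro: fg)
 then have "E = fieldgen k {v, w, x}"
  unfolding E y by (intro fieldgen_eqI) (auto intro: fg)
 then have "alg_indep3 v w x" using alg_indep3_generators[of v0 w0 x0 v w x] ind by simp
 moreover have "ev3 k [:[:e:], 0, 1:] v w x = 0"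
  using eq y by (simp add: power2_eq_square)
 ultimately have "[:[:e:], 0, 1:] = 0" unfolding alg_indep3_iff by blast
 then show ?thesis by simp
next
 case False
 have "(w - y) * (w + y) = x ^ 2 + peval k e v"
  using eq by (simp add: algebra_simps power2_eq_square)
 then have wy: "w - y = (x ^ 2 + peval k e v) / (w + y)"
  using False by (simp add: nonzero_eq_divide_eq)
 have "w * 2 = (w + y) + (w - y)" "y * 2 = (w + y) - (w - y)" by simp_all
 then have w: "w = ((w + y) + (x ^ 2 + peval k e v) / (w + y)) / k 2"
  and y: "y = ((w + y) - (x ^ 2 + peval k e v) / (w + y)) / k 2"
  unfolding wy by (simp_all add: nonzero_eq_divide_eq)
 let ?T = "{v, x, w + y}"
 have T: "v \<in> fieldgen k ?T" "x \<in> fieldgen k ?T" "w + y \<in> fieldgen k ?T" by (auto intro: fg)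
 have "w \<in> fieldgen k ?T" by (subst w) (intro fgI T)
 moreover have "y \<in> fieldgen k ?T" by (subst y) (intro fgI T)
 moreover have "w + y \<in> fieldgen k {v, w, x, y}" by (intro fg(3)) (auto intro: fg)
 ultimately have "E = fieldgen k ?T" unfolding E using T by (intro fieldgen_eqI) (auto intro: fg)
 then show ?thesis unfolding rational3_def by blast
qed

text \<open>Projection of the quadric \<open>x\<^sup>2 + y\<^sup>2 + w\<^sup>2 = e(v)\<close> from a rational point on it.\<close>

lemma rational3_sphere:
 assumes E: "E = fieldgen k {v, w, x, y}" and ind: "alg_indep3 v0 w0 x0" "{v0, w0, x0} \<subseteq> E"
  and eq: "x ^ 2 + y ^ 2 = - (w ^ 2 - peval k e v)" and deg: "degree e \<le> 2"
  and pos: "poly e h > 0"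
 shows "rational3 E"
proof -
 obtain e0 e1 e2 where e: "e = [:e0, e1, e2:]" using degree_le_2E[OF deg] .
 obtain s where s: "s > 0" "s ^ 2 = poly e h" using pos_sqrt[OF pos] by blast
 define t where "t = v - k h"
 have t0: "t ~= 0"
 proof
  assume "t = 0"
  then have v: "v = k h" by (simp add: t_def)
  have "E = fieldgen k {w, x, y}"
   unfolding E v by (rule fieldgen_eqI) (auto intro: fg)
  then have "alg_indep3 w x y" using alg_indep3_generators[of v0 w0 x0 w x y] ind by simp
  moreover have "ev3 k [:[:[:- poly e h, 0, 1:], 0, 1:], 0, 1:] w x y = 0"
  proof -
   have "x * x + y * y = - (w * w - k (poly e h))" using eq by (simp add: v peval_poly power2_eq_square)
   then show ?thesis by (simp add: algebra_simps)
  qed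
  ultimately have "[:[:[:- poly e h, 0, 1:], 0, 1:], 0, 1:] = 0" unfolding alg_indep3_iff by blast
  then show False by simp
 qed
 define e' where "e' = e1 + 2 * e2 * h"
 have ev: "peval k e v = k (s ^ 2) + k e' * t + k e2 * t ^ 2"
 proof -
  have 1: "poly e h = e0 + e1 * h + e2 * h * h" by (simp add: e ring_distribs mult.commute)
  have 2: "peval k e v = k e0 + k e1 * v + k e2 * (v * v)" by (simp add: e ring_distribs mult.left_commute mult.commute)
  show ?thesis unfolding s(2) 1 2 e'_def t_def unfolding power2_eq_square by (simp add: ring_distribs)
 qed
 define x' y' w' where "x' = x / t" and "y' = y / t" and "w' = (w - k s) / t"
 have xyw: "x = x' * t" "y = y' * t" "w = w' * t + k s"
  using t0 by (simp_all add: x'_def y'_def w'_def)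
 define D where "D = x' ^ 2 + y' ^ 2 + w' ^ 2 - k e2"
 have "(x' * t) ^ 2 + (y' * t) ^ 2 = - ((w' * t + k s) ^ 2 - (k (s ^ 2) + k e' * t + k e2 * t ^ 2))"
  using eq unfolding ev xyw[symmetric] .
 then have "t * (t * D) = t * (k e' - 2 * k s * w')"
  unfolding D_def by (simp add: algebra_simps power2_eq_square)
 then have rel: "t * D = k e' - 2 * k s * w'" using t0 by simp
 let ?T = "{x', y', w'}"
 have T: "x' \<in> fieldgen k ?T" "y' \<in> fieldgen k ?T" "w' \<in> fieldgen k ?T" by (auto intro: fg)
 have G: "v \<in> E" "w \<in> E" "x \<in> E" "y \<in> E" unfolding E by (auto intro: fg)
 have tE: "t \<in> E" unfolding t_def E by (intro fgI G[unfolded E])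
 have inE: "x' \<in> E" "y' \<in> E" "w' \<in> E"
  unfolding x'_def y'_def w'_def E by (intro fgI G[unfolded E] tE[unfolded E])+
 have D0: "D ~= 0"
 proof
  assume D: "D = 0"
  then have "2 * k s * w' = k e'" using rel by simp
  then have w': "w' = k (e' / (2 * s))" using s(1) by (simp add: nonzero_eq_divide_eq ac_simps)
  let ?U = "{x', y', v}"
  have U: "x' \<in> fieldgen k ?U" "y' \<in> fieldgen k ?U" "v \<in> fieldgen k ?U" by (auto intro: fg)
  have tU: "t \<in> fieldgen k ?U" unfolding t_def by (intro fgI U)
  have wU: "w' \<in> fieldgen k ?U" unfolding w' by (rule fg)
  have "x' * t \<in> fieldgen k ?U" "y' * t \<in> fieldgen k ?U" "w' * t + k s \<in> fieldgen k ?U"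
   by (intro fgI U tU wU)+
  then have "E = fieldgen k ?U"
   using U inE G unfolding xyw[symmetric] E by (intro fieldgen_eqI) auto
  then have "alg_indep3 x' y' v" using alg_indep3_generators[of v0 w0 x0 x' y' v] ind by simp
  moreover have "ev3 k [:[:[:(e' / (2 * s)) ^ 2 - e2, 0, 1:], 0, 1:]:] x' y' v = 0"
  proof -
   have "x' * x' + y' * y' + w' * w' - k e2 = 0" using D unfolding D_def by (simp add: power2_eq_square)
   moreover have "k ((e' / (2 * s)) ^ 2 - e2) = w' * w' - k e2" unfolding w' by (simp add: power2_eq_square)
   ultimately show ?thesis by (simp add: algebra_simps)
  qed
  ultimately have "[:[:[:(e' / (2 * s)) ^ 2 - e2, 0, 1:], 0, 1:]:] = 0" unfolding alg_indep3_iff by blast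
  then show False by simp
 qed
 then have t: "t = (k e' - k 2 * k s * w') / D" using rel by (simp add: nonzero_eq_divide_eq)
 have DT: "D \<in> fieldgen k ?T" unfolding D_def by (intro fgI T)
 have tT: "t \<in> fieldgen k ?T" unfolding t by (intro fgI T DT)
 have v: "v = t + k h" by (simp add: t_def)
 have vT: "v \<in> fieldgen k ?T" unfolding v by (intro fgI tT)
 have "x' * t \<in> fieldgen k ?T" "y' * t \<in> fieldgen k ?T" "w' * t + k s \<in> fieldgen k ?T"
  by (intro fgI T tT)+
 then have "E = fieldgen k ?T" using inE vT unfolding xyw[symmetric] E by (intro fieldgen_eqI) auto
 then show ?thesis unfolding rational3_def by blast
qed

lemma rational3_sign:
 assumes E: "E = fieldgen k {v, w, x, y}" and ind: "alg_indep3 v0 w0 x0" "{v0, w0, x0} \<subseteq> E"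
  and c: "c ~= 0" and eq: "x ^ 2 + y ^ 2 = k c * (w ^ 2 - peval k e v)"
  and deg: "degree e \<le> 2" and pos: "c < 0 ==> \<exists>h. poly e h > 0"
 shows "rational3 E"
proof -
 have "\<bar>c\<bar> > 0" using c by simp
 then obtain s where s: "s > 0" "s ^ 2 = \<bar>c\<bar>" using pos_sqrt by blast
 define x' y' where "x' = x / k s" and "y' = y / k s"
 have ks: "k s ~= 0" using s by simp
 have xy: "x = x' * k s" "y = y' * k s" using ks by (simp_all add: x'_def y'_def)
 have E': "E = fieldgen k {v, w, x', y'}"
  unfolding E
 proof (rule fieldgen_eqI)
  let ?S = "{v, w, x', y'}" and ?T = "{v, w, x, y}"
  have S: "v \<in> fieldgen k ?S" "w \<in> fieldgen k ?S" "x' \<in> fieldgen k ?S" "y' \<in> fieldgen k ?S" by (auto intro: fg)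
  have "x' * k s \<in> fieldgen k ?S" "y' * k s \<in> fieldgen k ?S" by (intro fgI S)+
  then show "?T \<subseteq> fieldgen k ?S" using S unfolding xy[symmetric] by auto
  have T: "v \<in> fieldgen k ?T" "w \<in> fieldgen k ?T" "x \<in> fieldgen k ?T" "y \<in> fieldgen k ?T" by (auto intro: fg)
  have "x' \<in> fieldgen k ?T" "y' \<in> fieldgen k ?T" unfolding x'_def y'_def by (intro fgI T)+
  then show "?S \<subseteq> fieldgen k ?T" using T by auto
 qed
 have "(x' * k s) ^ 2 + (y' * k s) ^ 2 = k c * (w ^ 2 - peval k e v)"
  using eq unfolding xy[symmetric] .
 then have "(x' ^ 2 + y' ^ 2) * k (s ^ 2) = k c * (w ^ 2 - peval k e v)"
  by (simp add: algebra_simps power2_eq_square)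
 then have q: "(x' ^ 2 + y' ^ 2) * k \<bar>c\<bar> = k c * (w ^ 2 - peval k e v)" unfolding s(2) .
 show ?thesis
 proof (cases "c > 0")
  case True
  then have "k c * (x' ^ 2 + y' ^ 2) = k c * (w ^ 2 - peval k e v)" using q by (simp add: mult.commute)
  then have "x' ^ 2 + y' ^ 2 = w ^ 2 - peval k e v" using c by simp
  then show ?thesis by (rule rational3_split[OF E' ind])
 next
  case False
  then have cn: "c < 0" using c by simp
  then have "(x' ^ 2 + y' ^ 2) * (- k c) = k c * (w ^ 2 - peval k e v)" using q by simp
  then have "- (k c * (x' ^ 2 + y' ^ 2)) = k c * (w ^ 2 - peval k e v)" by (simp add: mult.commute)
  then have "k c * (x' ^ 2 + y' ^ 2) = k c * (- (w ^ 2 - peval k e v))"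
   unfolding mult_minus_right by (simp only: minus_equation_iff[of "k c * (x' ^ 2 + y' ^ 2)"])
  then have "x' ^ 2 + y' ^ 2 = - (w ^ 2 - peval k e v)"
   using c by (simp only: mult_cancel_left hom_eq_0_iff simp_thms)
  then show ?thesis using pos[OF cn] rational3_sphere[OF E' ind _ deg] by blast
 qed
qed

text \<open>Multiplying \<open>x + iy\<close> by \<open>(p + iq)\<inverse>\<close> removes a sum of two squares from the coefficient.\<close>

lemma rational3_two_squares:
 assumes E: "E = fieldgen k {v, w, x, y}" and ind: "alg_indep3 v0 w0 x0" "{v0, w0, x0} \<subseteq> E"
  and c: "c ~= 0" and N: "peval k (p ^ 2 + q ^ 2) v ~= 0"
  and eq: "x ^ 2 + y ^ 2 = k c * peval k (p ^ 2 + q ^ 2) v * (w ^ 2 - peval k e v)"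
  and deg: "degree e \<le> 2" and pos: "c < 0 ==> \<exists>h. poly e h > 0"
 shows "rational3 E"
proof -
 define P Q where "P = peval k p v" and "Q = peval k q v"
 define n where "n = P ^ 2 + Q ^ 2"
 have nN: "peval k (p ^ 2 + q ^ 2) v = n" by (simp add: n_def P_def Q_def)
 then have n0: "n ~= 0" using N by simp
 define x' y' where "x' = (P * x + Q * y) / n" and "y' = (P * y - Q * x) / n"
 have nxy: "n * x' = P * x + Q * y" "n * y' = P * y - Q * x" using n0 by (simp_all add: x'_def y'_def)
 have "n * (P * x' - Q * y') = P * (n * x') - Q * (n * y')" "n * (Q * x' + P * y') = Q * (n * x') + P * (n * y')"
  by (simp_all add: algebra_simps)
 then have "n * (P * x' - Q * y') = P * (P * x + Q * y) - Q * (P * y - Q * x)"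
  "n * (Q * x' + P * y') = Q * (P * x + Q * y) + P * (P * y - Q * x)"
  unfolding nxy by blast+
 moreover have "P * (P * x + Q * y) - Q * (P * y - Q * x) = n * x" "Q * (P * x + Q * y) + P * (P * y - Q * x) = n * y"
  by (simp_all add: n_def algebra_simps power2_eq_square)
 ultimately have "n * (P * x' - Q * y') = n * x" "n * (Q * x' + P * y') = n * y" by (simp_all only:)
 then have xy: "x = P * x' - Q * y'" "y = Q * x' + P * y'"
  unfolding mult_left_cancel[OF n0] by simp_all
 have PQ: "P \<in> fieldgen k S" "Q \<in> fieldgen k S" if "v \<in> fieldgen k S" for S
  unfolding P_def Q_def by (rule fg_peval[OF that])+
 have E': "E = fieldgen k {v, w, x', y'}"
  unfolding E
 proof (rule fieldgen_eqI)
  let ?S = "{v, w, x', y'}" and ?T = "{v, w, x, y}"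
  have S: "v \<in> fieldgen k ?S" "w \<in> fieldgen k ?S" "x' \<in> fieldgen k ?S" "y' \<in> fieldgen k ?S" by (auto intro: fg)
  have "P * x' - Q * y' \<in> fieldgen k ?S" "Q * x' + P * y' \<in> fieldgen k ?S"
   by (intro fgI PQ S)+
  then show "?T \<subseteq> fieldgen k ?S" using S unfolding xy[symmetric] by auto
  have T: "v \<in> fieldgen k ?T" "w \<in> fieldgen k ?T" "x \<in> fieldgen k ?T" "y \<in> fieldgen k ?T" by (auto intro: fg)
  have "x' \<in> fieldgen k ?T" "y' \<in> fieldgen k ?T"
   unfolding x'_def y'_def n_def by (intro fgI PQ T)+
  then show "?S \<subseteq> fieldgen k ?T" using T by auto
 qed
 have "n * (x' ^ 2 + y' ^ 2) = (P * x' - Q * y') ^ 2 + (Q * x' + P * y') ^ 2"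
  unfolding n_def by (simp add: algebra_simps power2_eq_square)
 then have "n * (x' ^ 2 + y' ^ 2) = n * (k c * (w ^ 2 - peval k e v))"
  unfolding xy[symmetric] eq nN by (simp add: ac_simps)
 then have "x' ^ 2 + y' ^ 2 = k c * (w ^ 2 - peval k e v)" using n0 by simp
 then show ?thesis by (rule rational3_sign[OF E' ind c _ deg pos])
qed

text \<open>Similarly a norm \<open>h\<^sup>2 - e\<close> from \<open>R(v)(\<surd>e)\<close> is removed by multiplying \<open>w + \<surd>e\<close> by \<open>h + \<surd>e\<close>.\<close>

lemma rational3_norm:
 assumes E: "E = fieldgen k {v, w, x, y}" and ind: "alg_indep3 v0 w0 x0" "{v0, w0, x0} \<subseteq> E"
  and c: "c ~= 0" and N: "peval k (h ^ 2 - e) v ~= 0" and hw: "peval k h v + w ~= 0"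
  and eq: "x ^ 2 + y ^ 2 = k c * peval k (h ^ 2 - e) v * (w ^ 2 - peval k e v)"
  and deg: "degree e \<le> 2" and pos: "c < 0 ==> \<exists>h. poly e h > 0"
 shows "rational3 E"
proof -
 define H e' where "H = peval k h v" and "e' = peval k e v"
 have N': "peval k (h ^ 2 - e) v = H ^ 2 - e'" by (simp add: H_def e'_def)
 then have N0: "H ^ 2 - e' ~= 0" using N by simp
 define z where "z = H + w"
 have z0: "z ~= 0" using hw by (simp add: z_def H_def)
 define w' x' y' where "w' = (H * w + e') / z" and "x' = x / z" and "y' = y / z"
 have xy: "x = x' * z" "y = y' * z" using z0 by (simp_all add: x'_def y'_def)
 have wz: "w' * z = H * w + e'" using z0 by (simp add: w'_def)
 have wHz: "z * (w' - H) = e' - H ^ 2"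
  using wz by (simp add: z_def algebra_simps power2_eq_square)
 then have "w' - H ~= 0" using N0 by auto
 then have wH: "z = (e' - H ^ 2) / (w' - H)"
  using wHz by (simp only: nonzero_eq_divide_eq not_False_eq_True)
 have w: "w = z - H" by (simp add: z_def)
 have He: "H \<in> fieldgen k S" "e' \<in> fieldgen k S" if "v \<in> fieldgen k S" for S
  unfolding H_def e'_def by (rule fg_peval[OF that])+
 have E': "E = fieldgen k {v, w', x', y'}"
  unfolding E
 proof (rule fieldgen_eqI)
  let ?S = "{v, w', x', y'}" and ?T = "{v, w, x, y}"
  have S: "v \<in> fieldgen k ?S" "w' \<in> fieldgen k ?S" "x' \<in> fieldgen k ?S" "y' \<in> fieldgen k ?S" by (auto intro: fg)
  have zS: "z \<in> fieldgen k ?S" by (subst wH) (intro fgI He S)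
  have "x' * z \<in> fieldgen k ?S" "y' * z \<in> fieldgen k ?S" "z - H \<in> fieldgen k ?S"
   by (intro fgI He S zS)+
  then show "?T \<subseteq> fieldgen k ?S" using S unfolding xy[symmetric] w[symmetric] by auto
  have T: "v \<in> fieldgen k ?T" "w \<in> fieldgen k ?T" "x \<in> fieldgen k ?T" "y \<in> fieldgen k ?T" by (auto intro: fg)
  have "w' \<in> fieldgen k ?T" "x' \<in> fieldgen k ?T" "y' \<in> fieldgen k ?T"
   unfolding w'_def x'_def y'_def z_def by (intro fgI He T)+
  then show "?S \<subseteq> fieldgen k ?T" using T by auto
 qed
 have "(w' ^ 2 - e') * z ^ 2 = (w' * z) ^ 2 - e' * z ^ 2" by (simp add: algebra_simps power2_eq_square)
 also have "\<dots> = (H ^ 2 - e') * (w ^ 2 - e')"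
  unfolding wz unfolding z_def by (simp add: algebra_simps power2_eq_square)
 finally have n: "(H ^ 2 - e') * (w ^ 2 - e') = (w' ^ 2 - e') * z ^ 2" ..
 have "z ^ 2 * (x' ^ 2 + y' ^ 2) = (x' * z) ^ 2 + (y' * z) ^ 2"
  by (simp add: algebra_simps power2_eq_square)
 also have "\<dots> = k c * ((H ^ 2 - e') * (w ^ 2 - e'))"
  unfolding xy[symmetric] eq N' by (simp add: e'_def ac_simps)
 also have "\<dots> = z ^ 2 * (k c * (w' ^ 2 - e'))" unfolding n by (simp add: ac_simps)
 finally have "x' ^ 2 + y' ^ 2 = k c * (w' ^ 2 - peval k e v)" using z0 by (simp add: e'_def)
 then show ?thesis by (rule rational3_sign[OF E' ind c _ deg pos])
qed

end

text \<open>A coefficient \<open>a\<close> of degree at most two is, up to a constant, a sum of two squares or a norm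
 from \<open>R(v)(\<surd>e)\<close>, provided that \<open>e\<close> is nonnegative at the simple real zeros of \<open>a\<close>, the point at
 infinity included.\<close>

lemma quadratic_two_squares_or_norm:
 fixes a e :: "'a::real_closed_field poly"
 assumes dega: "degree a \<le> 2" and a_nz: "a ~= 0" and dege: "degree e \<le> 2"
  and nsq: "\<And>h. e ~= h ^ 2"
  and root: "\<And>\<rho>. poly a \<rho> = 0 ==> poly (pderiv a) \<rho> ~= 0 ==> poly e \<rho> \<ge> 0"
  and infty: "degree a = 1 ==> coeff e 2 \<ge> 0"
  and pos: "(\<exists>t. poly a t > 0) \<or> (\<exists>t. poly e t > 0)"
 shows "\<exists>c. c ~= 0 \<and> (c < 0 \<longrightarrow> (\<exists>t. poly e t > 0)) \<and>
  ((\<exists>p q. a = Polynomial.smult c (p ^ 2 + q ^ 2)) \<or> (\<exists>h. a = Polynomial.smult c (h ^ 2 - e)))"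
proof -
 obtain a0 a1 a2 where a: "a = [:a0, a1, a2:]" using degree_le_2E[OF dega] .
 obtain e0 e1 e2 where e: "e = [:e0, e1, e2:]" using degree_le_2E[OF dege] .
 have ev: "poly e t = e0 + e1 * t + e2 * t ^ 2" for t by (simp add: e algebra_simps power2_eq_square)
 have av: "poly a t = a0 + a1 * t + a2 * t ^ 2" for t by (simp add: a algebra_simps power2_eq_square)
 have sq: "\<exists>c. c ~= 0 \<and> (c < 0 \<longrightarrow> (\<exists>t. poly e t > 0)) \<and>
   ((\<exists>p q. a = Polynomial.smult c (p ^ 2 + q ^ 2)) \<or> (\<exists>h. a = Polynomial.smult c (h ^ 2 - e)))"
  if a': "a = Polynomial.smult c (p ^ 2 + q ^ 2)" "c ~= 0" for c p q
 proof -
  have "poly a t \<le> 0" if "c < 0" for t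
   unfolding a' using that by (simp add: mult_nonpos_nonneg)
  then have "c < 0 \<longrightarrow> (\<exists>t. poly e t > 0)" using pos by (meson not_le)
  then show ?thesis using a' by blast
 qed
 consider (const) "a2 = 0 \<and> a1 = 0" | (lin) "a2 = 0 \<and> a1 ~= 0" | (def) "a2 ~= 0 \<and> a1 ^ 2 - 4 * a0 * a2 \<le> 0"
  | (indef) "a2 ~= 0 \<and> a1 ^ 2 - 4 * a0 * a2 > 0" by linarith
 then show ?thesis
 proof cases
  case const
  then have "a = Polynomial.smult a0 (1 ^ 2 + 0 ^ 2)" "a0 ~= 0" using a a_nz by auto
  then show ?thesis by (rule sq)
 next
  case lin
  define \<rho> where "\<rho> = - a0 / a1"
  have ar: "a0 = - a1 * \<rho>" using lin by (simp add: \<rho>_def)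
  have e\<rho>: "poly e \<rho> \<ge> 0"
   by (rule root) (use lin ar in \<open>simp_all add: a pderiv_pCons\<close>)
  have e2: "e2 \<ge> 0" using infty lin by (simp add: a e numeral_2_eq_2)
  obtain s where s: "s ^ 2 = poly e \<rho>" using nonneg_sqrt[OF e\<rho>] by blast
  obtain u where u: "u ^ 2 = e2" using nonneg_sqrt[OF e2] by blast
  define \<kappa> where "\<kappa> = 2 * s * u - 2 * \<rho> * e2 - e1"
  have he: "[:s - u * \<rho>, u:] ^ 2 - e = Polynomial.smult \<kappa> [:- \<rho>, 1:]"
  proof -
   have "(s - u * \<rho>) ^ 2 - e0 = s ^ 2 - 2 * s * u * \<rho> + u ^ 2 * \<rho> ^ 2 - e0"
    by (simp add: algebra_simps power2_eq_square)
   also have "\<dots> = - \<kappa> * \<rho>"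
    unfolding s u ev \<kappa>_def by (simp add: ring_distribs power2_eq_square)
   finally have c0: "(s - u * \<rho>) * (s - u * \<rho>) - e0 = - \<kappa> * \<rho>" by (simp only: power2_eq_square)
   have "(s - u * \<rho>) * u + (s - u * \<rho>) * u - e1 = 2 * s * u - 2 * \<rho> * u ^ 2 - e1"
    by (simp add: algebra_simps power2_eq_square)
   then have c1: "(s - u * \<rho>) * u + (s - u * \<rho>) * u - e1 = \<kappa>" unfolding u \<kappa>_def .
   have c2: "u * u - e2 = 0" using u by (simp add: power2_eq_square)
   have "[:s - u * \<rho>, u:] ^ 2 - e = [:(s - u * \<rho>) * (s - u * \<rho>) - e0,
     (s - u * \<rho>) * u + (s - u * \<rho>) * u - e1, u * u - e2:]"
    by (simp add: e power2_eq_square mult.commute)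
   then show ?thesis unfolding c0 c1 c2 by simp
  qed
  have \<kappa>0: "\<kappa> ~= 0" using he nsq[of "[:s - u * \<rho>, u:]"] by auto
  have "a = Polynomial.smult (a1 / \<kappa>) ([:s - u * \<rho>, u:] ^ 2 - e)"
   unfolding he using \<kappa>0 lin ar by (simp add: a)
  moreover have "a1 / \<kappa> ~= 0" using lin \<kappa>0 by simp
  moreover have "\<exists>t. poly e t > 0"
  proof (cases "poly e \<rho> > 0")
   case False
   then have z: "poly e \<rho> = 0" using e\<rho> by simp
   define b where "b = e1 + 2 * e2 * \<rho>"
   have sh: "poly e (\<rho> + t) = b * t + e2 * t ^ 2" for t
   proof -
    have "poly e (\<rho> + t) = poly e \<rho> + b * t + e2 * t ^ 2"
     unfolding ev b_def by (simp add: algebra_simps power2_eq_square)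
    then show ?thesis using z by simp
   qed
   show ?thesis
   proof (cases "b = 0")
    case True
    have "e2 ~= 0"
    proof
     assume "e2 = 0"
     then have "e = 0 ^ 2" using True z unfolding b_def ev by (simp add: e)
     then show False using nsq by blast
    qed
    then have "poly e (\<rho> + 1) > 0" using e2 sh[of 1] True by simp
    then show ?thesis by blast
   next
    case False
    then have "b * b > 0" by (simp add: zero_less_mult_iff linorder_neq_iff) linarith
    moreover have "e2 * b ^ 2 \<ge> 0" using e2 by simp
    ultimately have "poly e (\<rho> + b) > 0" using sh[of b] by linarith
    then show ?thesis by blast
   qed
  qed blast
  ultimately show ?thesis by blast
 next
  case def
  define D where "D = (4 * a0 * a2 - a1 ^ 2) / (4 * a2 ^ 2)"
  have "D \<ge> 0" unfolding D_def using def by simp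
  then obtain s where s: "s ^ 2 = D" using nonneg_sqrt by blast
  have "a = Polynomial.smult a2 ([:a1 / (2 * a2), 1:] ^ 2 + [:s:] ^ 2)"
  proof -
   have "a2 * (a1 / (2 * a2) * (a1 / (2 * a2)) + D) = a0"
    using def unfolding D_def by (simp add: field_simps power2_eq_square)
   then have "a2 * (a1 / (2 * a2) * (a1 / (2 * a2)) + s * s) = a0" using s by (simp add: power2_eq_square)
   moreover have "a2 * (a1 / (2 * a2) + a1 / (2 * a2)) = a1" using def by (simp add: field_simps)
   ultimately show ?thesis by (simp add: a power2_eq_square)
  qed
  then show ?thesis using sq[of a2] def by blast
 next
  case indef
  then obtain s where s: "s > 0" "s ^ 2 = a1 ^ 2 - 4 * a0 * a2" using pos_sqrt[of "a1 ^ 2 - 4 * a0 * a2"] by blast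
  define \<rho>1 \<rho>2 where "\<rho>1 = (- a1 + s) / (2 * a2)" and "\<rho>2 = (- a1 - s) / (2 * a2)"
  have ne: "\<rho>1 ~= \<rho>2" using s(1) indef by (simp add: \<rho>1_def \<rho>2_def field_simps)
  have sum: "a1 = - a2 * (\<rho>1 + \<rho>2)" using indef by (simp add: \<rho>1_def \<rho>2_def field_simps)
  have "\<rho>1 * \<rho>2 = (a1 ^ 2 - s ^ 2) / (4 * a2 ^ 2)"
   by (simp add: \<rho>1_def \<rho>2_def algebra_simps power2_eq_square diff_divide_distrib add_divide_distrib)
  also have "\<dots> = a0 / a2" unfolding s(2) using indef by (simp add: field_simps power2_eq_square)
  finally have prod: "a0 = a2 * (\<rho>1 * \<rho>2)" using indef by simp
  have r1: "poly a \<rho>1 = 0" "poly a \<rho>2 = 0" unfolding av sum prod by (simp_all add: algebra_simps power2_eq_square)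
  have d: "poly (pderiv a) \<rho>1 ~= 0" "poly (pderiv a) \<rho>2 ~= 0"
  proof -
   have "poly (pderiv a) \<rho>1 = a2 * (\<rho>1 - \<rho>2)" "poly (pderiv a) \<rho>2 = a2 * (\<rho>2 - \<rho>1)"
    unfolding a sum by (simp_all add: pderiv_pCons algebra_simps)
   then show "poly (pderiv a) \<rho>1 ~= 0" "poly (pderiv a) \<rho>2 ~= 0" using ne indef by simp_all
  qed
  have e\<rho>: "poly e \<rho>1 \<ge> 0" "poly e \<rho>2 \<ge> 0" using root r1 d by blast+
  obtain s1 s2 where s12: "s1 ^ 2 = poly e \<rho>1" "s2 ^ 2 = poly e \<rho>2" using nonneg_sqrt[OF e\<rho>(1)] nonneg_sqrt[OF e\<rho>(2)] by blast
  define u where "u = (s1 - s2) / (\<rho>1 - \<rho>2)"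
  define h where "h = [:s1 - u * \<rho>1, u:]"
  have h1: "poly h \<rho>1 = s1" by (simp add: h_def)
  have h2: "poly h \<rho>2 = s2"
  proof -
   have "u * (\<rho>1 - \<rho>2) = s1 - s2" using ne by (simp add: u_def)
   then show ?thesis by (simp add: h_def algebra_simps)
  qed
  define \<kappa> where "\<kappa> = u ^ 2 - e2"
  have quad: "p = Polynomial.smult p2 [:\<rho>1 * \<rho>2, - (\<rho>1 + \<rho>2), 1:]"
   if p: "p = [:p0, p1, p2:]" "poly p \<rho>1 = 0" "poly p \<rho>2 = 0" for p p0 p1 p2
  proof -
   have q: "p0 + p1 * \<rho>1 + p2 * \<rho>1 ^ 2 = 0" "p0 + p1 * \<rho>2 + p2 * \<rho>2 ^ 2 = 0"
    using p by (simp_all add: algebra_simps power2_eq_square)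
   have "(\<rho>1 - \<rho>2) * (p1 + p2 * (\<rho>1 + \<rho>2)) = (p0 + p1 * \<rho>1 + p2 * \<rho>1 ^ 2) - (p0 + p1 * \<rho>2 + p2 * \<rho>2 ^ 2)"
    by (simp add: algebra_simps power2_eq_square)
   then have "p1 + p2 * (\<rho>1 + \<rho>2) = 0" using ne q by simp
   then have p1: "p1 = - p2 * (\<rho>1 + \<rho>2)" by (simp add: eq_neg_iff_add_eq_0)
   have "p0 + - p2 * (\<rho>1 + \<rho>2) * \<rho>1 + p2 * \<rho>1 ^ 2 = 0" using q(1) unfolding p1 .
   then have "p0 = p2 * (\<rho>1 * \<rho>2)" by (simp add: algebra_simps power2_eq_square)
   then show ?thesis using p(1) p1 by (simp add: algebra_simps)
  qed
  have he: "h ^ 2 - e = Polynomial.smult \<kappa> [:\<rho>1 * \<rho>2, - (\<rho>1 + \<rho>2), 1:]"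
  proof (rule quad)
   show "h ^ 2 - e = [:(s1 - u * \<rho>1) ^ 2 - e0, 2 * ((s1 - u * \<rho>1) * u) - e1, \<kappa>:]"
    by (simp add: h_def e \<kappa>_def power2_eq_square mult.commute)
   show "poly (h ^ 2 - e) \<rho>1 = 0" "poly (h ^ 2 - e) \<rho>2 = 0" using h1 h2 s12 by simp_all
  qed
  have \<kappa>0: "\<kappa> ~= 0" using he nsq[of h] by auto
  have "a = Polynomial.smult (a2 / \<kappa>) (h ^ 2 - e)"
   unfolding he using \<kappa>0 quad[OF a r1] by simp
  moreover have "a2 / \<kappa> ~= 0" using indef \<kappa>0 by simp
  moreover have "\<exists>t. poly e t > 0"
  proof (cases "poly e \<rho>1 > 0 \<or> poly e \<rho>2 > 0")
   case False
   then have z: "poly e \<rho>1 = 0" "poly e \<rho>2 = 0" using e\<rho> by auto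
   have e': "e = Polynomial.smult e2 [:\<rho>1 * \<rho>2, - (\<rho>1 + \<rho>2), 1:]" by (rule quad[OF e z])
   have pe: "poly e t = e2 * ((t - \<rho>1) * (t - \<rho>2))" for t
    by (subst e') (simp add: algebra_simps)
   have "e2 ~= 0" using e' nsq[of 0] by auto
   show ?thesis
   proof (cases "e2 > 0")
    case True
    define t where "t = max \<rho>1 \<rho>2 + 1"
    have "t - \<rho>1 > 0" "t - \<rho>2 > 0" unfolding t_def by linarith+
    then have "poly e t > 0" unfolding pe using True by simp
    then show ?thesis by blast
   next
    case False
    then have "e2 < 0" using \<open>e2 ~= 0\<close> by simp
    moreover have "((\<rho>1 + \<rho>2) / 2 - \<rho>1) * ((\<rho>1 + \<rho>2) / 2 - \<rho>2) = - (((\<rho>1 - \<rho>2) / 2) ^ 2)"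
     by (simp add: field_simps power2_eq_square)
    moreover have "((\<rho>1 - \<rho>2) / 2) ^ 2 > 0" using ne by simp
    ultimately have "poly e ((\<rho>1 + \<rho>2) / 2) > 0" unfolding pe by (metis mult_neg_neg neg_less_0_iff_less)
    then show ?thesis by blast
   qed
  qed blast
  ultimately show ?thesis by blast
 qed
qed

section \<open>Linear changes of projective coordinates\<close>

definition mat_vec :: "('a => 'b::comm_ring_1) => (nat => nat => 'a) => (nat => 'b) => nat => 'b" where
 "mat_vec k M z i = k (M i 0) * z 0 + k (M i 1) * z 1 + k (M i 2) * z 2"

definition inverse3 :: "(nat => nat => 'a::comm_ring_1) => (nat => nat => 'a) => bool" where
 "inverse3 M N \<longleftrightarrow>
  (\<forall>i<3. \<forall>j<3. M i 0 * N 0 j + M i 1 * N 1 j + M i 2 * N 2 j = (if i = j then 1 else 0))"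

definition affine_point :: "'b::comm_ring_1 => 'b => nat => 'b" where
 "affine_point v w i = (if i = 0 then 1 else if i = 1 then v else w)"

definition linear_poly :: "(nat => nat => 'a::comm_ring_1) => nat => 'a poly poly" where
 "linear_poly M i = [:[:M i 0, M i 1:], [:M i 2:]:]"

text \<open>The polynomial \<open>f\<close>, homogenized in degree \<open>d\<close>, in the coordinates given by \<open>M\<close>.\<close>

definition change_coords :: "nat => (nat => nat => 'a::comm_ring_1) => 'a poly poly => 'a poly poly" where
 "change_coords d M f = heval (\<lambda>c. [:[:c:]:]) d f (linear_poly M)"

lemma (in comm_hom) mat_vec_inverse:
 assumes "inverse3 M N" "i < 3"
 shows "mat_vec k M (mat_vec k N z) i = z i"
proof -
 have "mat_vec k M (mat_vec k N z) i = k (M i 0 * N 0 0 + M i 1 * N 1 0 + M i 2 * N 2 0) * z 0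
   + k (M i 0 * N 0 1 + M i 1 * N 1 1 + M i 2 * N 2 1) * z 1
   + k (M i 0 * N 0 2 + M i 1 * N 1 2 + M i 2 * N 2 2) * z 2"
  by (simp add: mat_vec_def algebra_simps)
 also have "\<dots> = k (if i = 0 then 1 else 0) * z 0 + k (if i = 1 then 1 else 0) * z 1 + k (if i = 2 then 1 else 0) * z 2"
 proof -
  have "M i 0 * N 0 j + M i 1 * N 1 j + M i 2 * N 2 j = (if i = j then 1 else 0)" if "j < 3" for j
   using assms that unfolding inverse3_def by blast
  from this[of 0] this[of 1] this[of 2] show ?thesis by simp
 qed
 also have "\<dots> = z i"
 proof -
  have "i = 0 \<or> i = 1 \<or> i = 2" using assms(2) by linarith
  then show ?thesis by auto
 qed
 finally show ?thesis .
qed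

lemma (in comm_hom) ev2_linear_poly: "ev2 k (linear_poly M i) v w = mat_vec k M (affine_point v w) i"
 by (simp add: linear_poly_def mat_vec_def affine_point_def algebra_simps)

lemma (in comm_hom) ev2_change_coords:
 "ev2 k (change_coords d M f) v w = heval k d f (mat_vec k M (affine_point v w))"
 unfolding change_coords_def
 by (subst hom_heval[OF comm_hom_ev2 comm_hom_const2]) (simp add: ev2_linear_poly)

lemma (in comm_hom) heval_affine_point:
 "tdeg_le p n ==> heval k n p (affine_point v w) = ev2 k p v w"
 by (subst heval_affine) (simp_all add: affine_point_def)

lemma tdeg_le_change_coords: "tdeg_le (change_coords d M f) d"
 unfolding change_coords_def heval_def
proof (intro tdeg_le_sum)
 fix j i assume "j \<in> {..d}" "i \<in> {..d - j}"
 then have e: "d = 0 + (i * 1 + j * 1 + (d - j - i) * 1)" by simp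
 have l: "tdeg_le (linear_poly M n) 1" for n unfolding linear_poly_def by (rule tdeg_le_linear)
 show "tdeg_le ([:[:coeff (coeff f j) i:]:] *
   (linear_poly M 1 ^ i * linear_poly M 2 ^ j * linear_poly M 0 ^ (d - j - i))) d"
  by (subst e) (intro tdeg_le_mult tdeg_le_power l tdeg_le_const)
qed

text \<open>Homogeneous coordinates \<open>l\<close> of the same point in the new system are divided by \<open>l 0\<close>.\<close>

lemma (in field_hom) change_coords_relation:
 assumes f: "tdeg_le f d" and inv: "inverse3 N M"
  and l0: "mat_vec k M (affine_point v w) 0 ~= 0"
 defines "l \<equiv> mat_vec k M (affine_point v w)"
 shows "ev2 k f v w = l 0 ^ d * ev2 k (change_coords d N f) (l 1 / l 0) (l 2 / l 0)"
  and "l 0 * mat_vec k N (affine_point (l 1 / l 0) (l 2 / l 0)) i = mat_vec k N l i"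
  and "i < 3 ==> mat_vec k N l i = affine_point v w i"
proof -
 let ?p = "affine_point (l 1 / l 0) (l 2 / l 0)"
 have l0': "l 0 ~= 0" using l0 by (simp add: l_def)
 show A: "l 0 * mat_vec k N ?p i = mat_vec k N l i" for i
  using l0' by (simp add: mat_vec_def affine_point_def algebra_simps)
 show B: "mat_vec k N l i = affine_point v w i" if "i < 3" for i
  unfolding l_def by (rule mat_vec_inverse[OF inv that])
 have "ev2 k f v w = heval k d f (affine_point v w)" by (simp add: heval_affine_point[OF f])
 also have "\<dots> = heval k d f (\<lambda>i. l 0 * mat_vec k N ?p i)"
 proof (rule heval_cong)
  have AB: "affine_point v w i = l 0 * mat_vec k N ?p i" if "i < 3" for i unfolding A by (rule B[OF that, symmetric])
  show "affine_point v w 0 = l 0 * mat_vec k N ?p 0" "affine_point v w 1 = l 0 * mat_vec k N ?p 1"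
   "affine_point v w 2 = l 0 * mat_vec k N ?p 2" by (rule AB, simp)+
 qed
 also have "\<dots> = l 0 ^ d * ev2 k (change_coords d N f) (l 1 / l 0) (l 2 / l 0)"
  unfolding heval_homogeneous ev2_change_coords ..
 finally show "ev2 k f v w = l 0 ^ d * ev2 k (change_coords d N f) (l 1 / l 0) (l 2 / l 0)" .
qed

text \<open>After a change of coordinates making \<open>f\<close> quadratic in \<open>w\<close>, the threefold is a conic bundle
 \<open>x\<^sup>2 + y\<^sup>2 = a w\<^sup>2 + b w + c\<close> over the \<open>v\<close>-line, which is put into one of the above forms by
 completing the square.\<close>

lemma rational_sum_two_squares_conic_bundle:
 fixes f :: "'a::real_closed_field poly poly"
 assumes f: "tdeg_le f (2 * m)" and MN: "inverse3 M N" "inverse3 N M"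
  and f': "change_coords (2 * m) N f = [:c, b, a:]"
  and ab: "a = 0 ==> b ~= 0"
  and dega: "degree a \<le> 2"
  and disc: "a ~= 0 ==> r1 ~= 0 \<and> r2 ~= 0 \<and> r2 ^ 2 * (b ^ 2 - Polynomial.smult 4 (a * c)) = r1 ^ 2 * e"
  and dege: "degree e \<le> 2"
  and nsq: "\<And>h. a ~= 0 ==> e ~= h ^ 2"
  and root: "\<And>\<rho>. a ~= 0 ==> poly a \<rho> = 0 ==> poly (pderiv a) \<rho> ~= 0 ==> poly e \<rho> \<ge> 0"
  and infty: "degree a = 1 ==> coeff e 2 \<ge> 0"
  and pos: "a ~= 0 ==> (\<exists>t. poly a t > 0) \<or> (\<exists>t. poly e t > 0)"
 shows "rational_sum_two_squares f"
proof -
 obtain k :: "'a => 'a poly poly poly fract alg_closure" and v w x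
  where k: "field_hom k" and ind: "field_hom.alg_indep3 k v w x"
  using ex_generic_point by blast
 interpret rcf_hom k by (rule rcf_hom.intro[OF k])
 obtain y where y: "y ^ 2 = ev2 k f v w - x ^ 2"
  using nth_root_exists[of 2 "ev2 k f v w - x ^ 2"] by auto
 let ?E = "fieldgen k {v, w, x, y}"
 define l where "l = mat_vec k M (affine_point v w)"
 have l0: "l 0 ~= 0"
 proof
  assume "l 0 = 0"
  then have "ev3 k [:linear_poly M 0:] v w x = 0" by (simp add: ev2_linear_poly l_def)
  then have "linear_poly M 0 = 0" using ind unfolding alg_indep3_iff by (metis pCons_eq_0_iff)
  then have "M 0 0 = 0" "M 0 1 = 0" "M 0 2 = 0" by (auto simp: linear_poly_def)
  moreover have "M 0 0 * N 0 0 + M 0 1 * N 1 0 + M 0 2 * N 2 0 = 1"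
   using MN(1) unfolding inverse3_def by (metis zero_less_numeral)
  ultimately show False by simp
 qed
 define v' w' x' y' where "v' = l 1 / l 0" and "w' = l 2 / l 0" and "x' = x / l 0 ^ m" and "y' = y / l 0 ^ m"
 define n where "n = mat_vec k N (affine_point v' w')"
 have rel: "ev2 k f v w = l 0 ^ (2 * m) * (peval k c v' + w' * (peval k b v' + w' * peval k a v'))"
  using change_coords_relation(1)[OF f MN(2), of v w] l0 unfolding l_def[symmetric] v'_def[symmetric] w'_def[symmetric] f'
  by simp
 have n: "l 0 * n i = affine_point v w i" if "i < 3" for i
  using change_coords_relation(2,3)[OF f MN(2), of v w i] l0 that
  unfolding l_def[symmetric] v'_def[symmetric] w'_def[symmetric] n_def by simp
 have n0: "l 0 = 1 / n 0"
 proof -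
  have "l 0 * n 0 = 1" using n[of 0] by (simp add: affine_point_def)
  then show ?thesis by (metis mult.commute mult_zero_left nonzero_eq_divide_eq zero_neq_one mult_zero_right)
 qed
 have vw: "v = l 0 * n 1" "w = l 0 * n 2" using n[of 1] n[of 2] by (simp_all add: affine_point_def)
 have n_in: "n i \<in> fieldgen k S" if "v' \<in> fieldgen k S" "w' \<in> fieldgen k S" for S i
  unfolding n_def mat_vec_def affine_point_def using that
  by (simp; intro fg(1,3,4,5,6); simp add: that fg)
 have l_in: "l i \<in> fieldgen k S" if "v \<in> fieldgen k S" "w \<in> fieldgen k S" for S i
  unfolding l_def mat_vec_def affine_point_def using that
  by (simp; intro fg(1,3,4,5,6); simp add: that fg)
 have E': "?E = fieldgen k {v', w', x', y'}"
 proof (rule fieldgen_eqI)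
  let ?S = "{v', w', x', y'}" and ?T = "{v, w, x, y}"
  have S: "v' \<in> fieldgen k ?S" "w' \<in> fieldgen k ?S" "x' \<in> fieldgen k ?S" "y' \<in> fieldgen k ?S" by (auto intro: fg)
  have l0S: "l 0 \<in> fieldgen k ?S" unfolding n0 by (intro fg_divide fg_1 n_in S)
  have xy: "x = x' * l 0 ^ m" "y = y' * l 0 ^ m" using l0 by (simp_all add: x'_def y'_def)
  have "l 0 * n 1 \<in> fieldgen k ?S" "l 0 * n 2 \<in> fieldgen k ?S" "x' * l 0 ^ m \<in> fieldgen k ?S" "y' * l 0 ^ m \<in> fieldgen k ?S"
   by (intro fg_power fg(4) l0S S n_in)+
  then show "?T \<subseteq> fieldgen k ?S" unfolding vw[symmetric] xy[symmetric] by auto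
  have T: "v \<in> fieldgen k ?T" "w \<in> fieldgen k ?T" "x \<in> fieldgen k ?T" "y \<in> fieldgen k ?T" by (auto intro: fg)
  have "v' \<in> fieldgen k ?T" "w' \<in> fieldgen k ?T" "x' \<in> fieldgen k ?T" "y' \<in> fieldgen k ?T"
   unfolding v'_def w'_def x'_def y'_def by (intro fg_divide fg_power l_in T)+
  then show "?S \<subseteq> fieldgen k ?T" by auto
 qed
 have indE: "{v, w, x} \<subseteq> ?E" by (auto intro: fg)
 have ind': "alg_indep3 v' w' x"
 proof (rule alg_indep3_generators[OF _ ind])
  let ?U = "{v', w', x}"
  have U: "v' \<in> fieldgen k ?U" "w' \<in> fieldgen k ?U" "x \<in> fieldgen k ?U" by (auto intro: fg)
  have l0U: "l 0 \<in> fieldgen k ?U" unfolding n0 by (intro fg_divide fg_1 n_in U)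
  have "l 0 * n 1 \<in> fieldgen k ?U" "l 0 * n 2 \<in> fieldgen k ?U" by (intro fg(4) l0U n_in U)+
  then show "{v, w, x} \<subseteq> fieldgen k ?U" unfolding vw[symmetric] using U by auto
 qed
 have ind2: "p = 0" if "ev2 k p v' w' = 0" for p
 proof -
  have "ev3 k [:p:] v' w' x = 0" using that by simp
  then show ?thesis using ind' unfolding alg_indep3_iff by (metis pCons_eq_0_iff)
 qed
 have ind1: "p = 0" if "peval k p v' = 0" for p
  using ind2[of "[:p:]"] that by simp
 define A B C where "A = peval k a v'" and "B = peval k b v'" and "C = peval k c v'"
 have eq: "x' ^ 2 + y' ^ 2 = A * w' ^ 2 + B * w' + C"
 proof -
  have "x' ^ 2 + y' ^ 2 = (x ^ 2 + y ^ 2) / l 0 ^ (2 * m)"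
   by (simp add: x'_def y'_def power_divide add_divide_distrib power_mult[symmetric] mult.commute)
  also have "x ^ 2 + y ^ 2 = l 0 ^ (2 * m) * (C + w' * (B + w' * A))"
   using y rel by (simp add: A_def B_def C_def)
  finally show ?thesis using l0 by (simp add: algebra_simps power2_eq_square)
 qed
 have "rational3 ?E"
 proof (cases "a = 0")
  case True
  have B0: "B ~= 0" using ind1[of b] ab[OF True] by (auto simp: B_def)
  have "A = 0" using True by (simp add: A_def)
  then have w: "w' = (x' ^ 2 + y' ^ 2 - C) / B" using eq B0 by (simp add: nonzero_eq_divide_eq mult.commute)
  let ?S = "{v', x', y'}"
  have S: "v' \<in> fieldgen k ?S" "x' \<in> fieldgen k ?S" "y' \<in> fieldgen k ?S" by (auto intro: fg)
  have "(x' ^ 2 + y' ^ 2 - C) / B \<in> fieldgen k ?S"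
   unfolding B_def C_def by (intro fg_divide fg_diff fg(3) fg_power fg_peval S)
  then have "fieldgen k {v', w', x', y'} = fieldgen k ?S"
   unfolding w[symmetric] using S by (intro fieldgen_eqI) (auto intro: fg)
  then show ?thesis unfolding E' rational3_def by blast
 next
  case False
  note disc = disc[OF False] and nsq = nsq[OF False] and root = root[OF False] and pos = pos[OF False]
  define R1 R2 e' where "R1 = peval k r1 v'" and "R2 = peval k r2 v'" and "e' = peval k e v'"
  have nz: "A ~= 0" "R1 ~= 0" "R2 ~= 0"
   using ind1[of a] ind1[of r1] ind1[of r2] disc False by (auto simp: A_def R1_def R2_def)
  have "peval k (r2 ^ 2 * (b ^ 2 - Polynomial.smult 4 (a * c))) v' = peval k (r1 ^ 2 * e) v'" using disc by simp
  then have D: "R2 ^ 2 * (B ^ 2 - 4 * (A * C)) = R1 ^ 2 * e'"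
   by (simp add: R1_def R2_def A_def B_def C_def e'_def)
  define s where "s = 2 * A * R2 / R1"
  have s0: "s ~= 0" using nz by (simp add: s_def)
  define W x'' y'' where "W = (2 * A * w' + B) * R2 / R1" and "x'' = x' * s" and "y'' = y' * s"
  have wW: "w' = (W * R1 / R2 - B) / (k 2 * A)" using nz by (simp add: W_def nonzero_eq_divide_eq mult.commute)
  have xy: "x' = x'' / s" "y' = y'' / s" using s0 by (simp_all add: x''_def y''_def)
  have P: "A \<in> fieldgen k S" "B \<in> fieldgen k S" "R1 \<in> fieldgen k S" "R2 \<in> fieldgen k S" "s \<in> fieldgen k S"
   if "v' \<in> fieldgen k S" for S
  proof -
   show *: "A \<in> fieldgen k S" "B \<in> fieldgen k S" "R1 \<in> fieldgen k S" "R2 \<in> fieldgen k S"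
    unfolding A_def B_def R1_def R2_def by (rule fg_peval[OF that])+
   have "s = k 2 * A * R2 / R1" by (simp add: s_def)
   also have "\<dots> \<in> fieldgen k S" by (intro fg_divide fg(4) * fg(1))
   finally show "s \<in> fieldgen k S" .
  qed
  have E'': "?E = fieldgen k {v', W, x'', y''}"
   unfolding E'
  proof (rule fieldgen_eqI)
   let ?S = "{v', W, x'', y''}" and ?T = "{v', w', x', y'}"
   have S: "v' \<in> fieldgen k ?S" "W \<in> fieldgen k ?S" "x'' \<in> fieldgen k ?S" "y'' \<in> fieldgen k ?S" by (auto intro: fg)
   have "(W * R1 / R2 - B) / (k 2 * A) \<in> fieldgen k ?S" "x'' / s \<in> fieldgen k ?S" "y'' / s \<in> fieldgen k ?S"
    by (intro fg_divide fg_diff fg(4) fg(1) P S)+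
   then show "?T \<subseteq> fieldgen k ?S" unfolding wW[symmetric] xy[symmetric] using S by auto
   have T: "v' \<in> fieldgen k ?T" "w' \<in> fieldgen k ?T" "x' \<in> fieldgen k ?T" "y' \<in> fieldgen k ?T" by (auto intro: fg)
   have "W = (k 2 * A * w' + B) * R2 / R1" by (simp add: W_def)
   also have "\<dots> \<in> fieldgen k ?T" by (intro fg_divide fg(3) fg(4) fg(1) P T)
   finally have "W \<in> fieldgen k ?T" .
   moreover have "x'' \<in> fieldgen k ?T" "y'' \<in> fieldgen k ?T" unfolding x''_def y''_def by (intro fg(4) P T)+
   ultimately show "?S \<subseteq> fieldgen k ?T" using T by auto
  qed
  have eq2: "x'' ^ 2 + y'' ^ 2 = A * (W ^ 2 - e')"
  proof -
   have Rs: "R1 * W = R2 * (2 * A * w' + B)" "R1 * s = 2 * A * R2" using nz by (simp_all add: W_def s_def)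
   have "R1 ^ 2 * (x'' ^ 2 + y'' ^ 2) = (R1 * s) ^ 2 * (x' ^ 2 + y' ^ 2)"
    by (simp add: x''_def y''_def algebra_simps power2_eq_square)
   also have "\<dots> = A * ((R2 * (2 * A * w' + B)) ^ 2 - R2 ^ 2 * (B ^ 2 - 4 * (A * C)))"
    unfolding Rs(2) eq by (simp add: algebra_simps power2_eq_square)
   also have "\<dots> = R1 ^ 2 * (A * (W ^ 2 - e'))"
    unfolding D Rs(1)[symmetric] by (simp add: algebra_simps power2_eq_square)
   finally show ?thesis using nz by simp
  qed
  obtain c0 where c0: "c0 ~= 0" "c0 < 0 ==> \<exists>t. poly e t > 0"
   and alt: "(\<exists>p q. a = Polynomial.smult c0 (p ^ 2 + q ^ 2)) \<or> (\<exists>h. a = Polynomial.smult c0 (h ^ 2 - e))"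
   using quadratic_two_squares_or_norm[OF dega False dege nsq root infty pos] by blast
  from alt show ?thesis
  proof (elim disjE exE)
   fix p q assume pq: "a = Polynomial.smult c0 (p ^ 2 + q ^ 2)"
   have Apq: "A = k c0 * peval k (p ^ 2 + q ^ 2) v'" unfolding A_def pq by (rule peval_smult)
   then have "peval k (p ^ 2 + q ^ 2) v' ~= 0" using nz(1) by auto
   then show ?thesis
    using rational3_two_squares[OF E'' ind indE c0(1) _ _ dege c0(2)] eq2 unfolding Apq e'_def by blast
  next
   fix h assume h: "a = Polynomial.smult c0 (h ^ 2 - e)"
   have Ah: "A = k c0 * peval k (h ^ 2 - e) v'" unfolding A_def h by (rule peval_smult)
   then have N0: "peval k (h ^ 2 - e) v' ~= 0" using nz(1) by auto
   have hW: "peval k h v' + W ~= 0"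
   proof
    assume "peval k h v' + W = 0"
    then have "R1 * peval k h v' + R1 * W = 0" by (metis distrib_left mult_zero_right)
    then have "ev2 k [:r1 * h + r2 * b, Polynomial.smult 2 (a * r2):] v' w' = 0"
     using nz by (simp add: W_def R1_def[symmetric] R2_def[symmetric] A_def[symmetric] B_def[symmetric] algebra_simps)
    then have "[:r1 * h + r2 * b, Polynomial.smult 2 (a * r2):] = 0" by (rule ind2)
    then show False using False disc by simp
   qed
   show ?thesis
    using rational3_norm[OF E'' ind indE c0(1) N0 hW _ dege c0(2)] eq2 unfolding Ah e'_def by blast
  qed
 qed
 then obtain p q r where "?E = fieldgen k {p, q, r}" unfolding rational3_def by blast
 then show ?thesis by (rule rational_if_purely_transcendental[OF k ind y])
qed

section \<open>Existence of places\<close>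

lemma (in subring_of) D_sum: "(\<And>i. i \<in> I ==> g i \<in> D) ==> sum g I \<in> D"
 by (induction I rule: infinite_finite_induct) (auto intro: D_add D_0)

locale subfield_over = field_hom k for k :: "'a::field => 'b::field" +
 fixes K :: "'b set"
 assumes K_const: "k c \<in> K" and K_add: "x \<in> K ==> y \<in> K ==> x + y \<in> K"
  and K_mult: "x \<in> K ==> y \<in> K ==> x * y \<in> K" and K_uminus: "x \<in> K ==> - x \<in> K"
  and K_inverse: "x \<in> K ==> inverse x \<in> K"
begin

sublocale K: subring_of k K
 by unfold_locales (rule K_const K_add K_mult K_uminus; assumption?)+

lemma K_divide: "x \<in> K ==> y \<in> K ==> x / y \<in> K"
 unfolding field_class.field_divide_inverse by (intro K_mult K_inverse)

lemma K_diff: "x \<in> K ==> y \<in> K ==> x - y \<in> K"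
 using K_add[OF _ K_uminus, of x y] by simp

lemma K_sum: "(\<And>i. i \<in> I ==> g i \<in> K) ==> sum g I \<in> K"
 by (induction I rule: infinite_finite_induct) (auto intro: K_add K.D_0)

lemma K_peval: "x \<in> K ==> peval k p x \<in> K"
 by (rule K.D_peval_gen[OF K_const _ comm_hom_axioms])

definition is_place :: "('b => int) => bool" where
 "is_place u \<longleftrightarrow> (\<forall>x\<in>K - {0}. \<forall>y\<in>K - {0}.
   u (x * y) = u x + u y \<and> (x + y ~= 0 \<longrightarrow> u (x + y) \<ge> min (u x) (u y))) \<and>
   u ` (K - {0}) = UNIV \<and> (\<forall>c. c ~= 0 \<longrightarrow> u (k c) = 0)"

text \<open>This says that \<open>K\<close> has degree at most \<open>N\<close> over \<open>k(y)\<close>.\<close>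

definition finite_over :: "'b => nat => bool" where
 "finite_over y N \<longleftrightarrow> (\<forall>g. (\<forall>j\<le>N. g j \<in> K) \<longrightarrow>
   (\<exists>\<phi>. (\<exists>j\<le>N. \<phi> j ~= 0) \<and> (\<Sum>j\<le>N. peval k (\<phi> j) y * g j) = 0))"

end

text \<open>Dividing by the largest power of \<open>y\<close> that divides all its coefficients makes a relation
 nontrivial modulo \<open>y\<close>.\<close>

lemma (in subfield_over) primitive_relation:
 fixes N :: nat
 assumes y_nz: "y ~= 0" and fin: "finite_over y N" and g: "\<And>j. j \<le> N ==> g j \<in> K"
 shows "\<exists>\<phi>. (\<exists>j\<le>N. coeff (\<phi> j) 0 ~= 0) \<and> (\<Sum>j\<le>N. peval k (\<phi> j) y * g j) = 0"
proof -
 define R where "R = (\<lambda>m \<phi>. (\<exists>j\<le>N. coeff (\<phi> j) m ~= 0) \<and> (\<Sum>j\<le>N. peval k (\<phi> j) y * g j) = 0)"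
 obtain \<phi> where \<phi>: "\<exists>j\<le>N. \<phi> j ~= 0" "(\<Sum>j\<le>N. peval k (\<phi> j) y * g j) = 0"
  using fin g unfolding finite_over_def by blast
 then obtain j where j: "j \<le> N" "\<phi> j ~= 0" by blast
 then obtain m where "coeff (\<phi> j) m ~= 0" by (auto simp: poly_eq_iff)
 then have "\<exists>\<phi>. R m \<phi>" unfolding R_def using \<phi>(2) j(1) by blast
 then have "\<exists>\<phi>. R 0 \<phi>"
 proof (induction m)
  case (Suc m)
  then obtain \<phi> where \<phi>: "R (Suc m) \<phi>" by blast
  show ?case
  proof (cases "\<exists>j\<le>N. coeff (\<phi> j) 0 ~= 0")
   case True
   then show ?thesis using \<phi> unfolding R_def by blast
  next
   case False
   define \<psi> where "\<psi> = (\<lambda>j. poly_shift 1 (\<phi> j))"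
   have e: "\<phi> j = pCons 0 (\<psi> j)" if "j \<le> N" for j
    using False that unfolding \<psi>_def
    by (intro poly_eqI) (auto simp: coeff_pCons coeff_poly_shift split: nat.splits)
   have "y * (\<Sum>j\<le>N. peval k (\<psi> j) y * g j) = (\<Sum>j\<le>N. peval k (\<phi> j) y * g j)"
    unfolding sum_distrib_left by (rule sum.cong) (simp_all add: e mult.assoc)
   also have "\<dots> = 0" using \<phi> unfolding R_def by blast
   finally have "(\<Sum>j\<le>N. peval k (\<psi> j) y * g j) = 0" using y_nz by simp
   moreover have "\<exists>j\<le>N. coeff (\<psi> j) m ~= 0"
    using \<phi> unfolding R_def \<psi>_def by (auto simp: coeff_poly_shift)
   ultimately have "\<exists>\<phi>. R m \<phi>" unfolding R_def by blast
   then show ?thesis by (rule Suc.IH)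
  qed
 qed
 then show ?thesis unfolding R_def .
qed

text \<open>Chevalley's argument: a subring of \<open>K\<close> that is maximal among those not containing \<open>z\<close>, but
 containing \<open>y = 1/z\<close>, is a valuation ring.\<close>

locale maximal_subring = subfield_over k K for k :: "'a::field => 'b::field" and K +
 fixes y :: 'b and V :: "'b set"
 assumes y_K: "y \<in> K" and y_nz: "y ~= 0" and V_ring: "subring_of k V" and V_K: "V \<subseteq> K"
  and y_V: "y \<in> V" and inv_y: "inverse y \<notin> V"
  and V_max: "\<And>S. subring_of k S ==> V \<subseteq> S ==> S \<subseteq> K ==> inverse y \<notin> S ==> S = V"
begin

sublocale V: subring_of k V by (rule V_ring)

definition span_pow :: "'b => nat => 'b set" where
 "span_pow x n = {\<Sum>i\<le>n. a i * x ^ i | a. \<forall>i. a i \<in> V}"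

lemma span_powI: "a \<in> V ==> i \<le> n ==> a * x ^ i \<in> span_pow x n"
proof -
 assume a: "a \<in> V" "i \<le> n"
 have "a * x ^ i = (\<Sum>j\<le>n. (if j = i then a else 0) * x ^ j)"
  using a(2) by (simp add: if_distrib[of "\<lambda>c. c * _"] cong: if_cong)
 then show ?thesis unfolding span_pow_def using a(1) V.D_0 by (intro CollectI exI[of _ "\<lambda>j. if j = i then a else 0"]) auto
qed

lemma span_pow_add: "s \<in> span_pow x n ==> t \<in> span_pow x n ==> s + t \<in> span_pow x n"
proof -
 assume "s \<in> span_pow x n" "t \<in> span_pow x n"
 then obtain a b where ab: "\<forall>i. a i \<in> V" "s = (\<Sum>i\<le>n. a i * x ^ i)" "\<forall>i. b i \<in> V" "t = (\<Sum>i\<le>n. b i * x ^ i)"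
  unfolding span_pow_def by blast
 have "s + t = (\<Sum>i\<le>n. (a i + b i) * x ^ i)" unfolding ab by (simp add: sum.distrib ring_distribs)
 then show ?thesis unfolding span_pow_def using ab V.D_add by (intro CollectI exI[of _ "\<lambda>i. a i + b i"]) auto
qed

lemma span_pow_smult: "c \<in> V ==> s \<in> span_pow x n ==> c * s \<in> span_pow x n"
proof -
 assume c: "c \<in> V" "s \<in> span_pow x n"
 then obtain a where a: "\<forall>i. a i \<in> V" "s = (\<Sum>i\<le>n. a i * x ^ i)" unfolding span_pow_def by blast
 have "c * s = (\<Sum>i\<le>n. (c * a i) * x ^ i)" unfolding a by (simp add: sum_distrib_left mult.assoc)
 then show ?thesis unfolding span_pow_def using a c V.D_mult by (intro CollectI exI[of _ "\<lambda>i. c * a i"]) auto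
qed

lemma span_pow_sum: "finite I ==> (\<And>i. i \<in> I ==> g i \<in> span_pow x n) ==> sum g I \<in> span_pow x n"
proof (induction I rule: finite_induct)
 case empty
 show ?case using span_powI[OF V.D_0, of 0 n x] by simp
next
 case (insert i I)
 then show ?case by (simp add: span_pow_add)
qed

lemma span_pow_mono: "n \<le> m ==> span_pow x n \<subseteq> span_pow x m"
 unfolding span_pow_def[of x n] by (auto intro!: span_pow_sum span_powI)

text \<open>By maximality \<open>V[x]\<close> contains \<open>1/y\<close>.\<close>

lemma adjoin:
 assumes "x \<in> K" "x \<notin> V"
 shows "\<exists>n. \<exists>s\<in>span_pow x n. 1 = y * s"
proof -
 let ?S = "\<Union>n. span_pow x n"
 have VS: "V \<subseteq> ?S" using span_powI[of _ 0 0 x] by fastforce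
 have mult: "s * t \<in> ?S" if st: "s \<in> span_pow x n" "t \<in> span_pow x m" for s t n m
 proof -
  obtain a where a: "\<forall>i. a i \<in> V" "s = (\<Sum>i\<le>n. a i * x ^ i)"
   using st(1) unfolding span_pow_def by blast
  obtain b where b: "\<forall>i. b i \<in> V" "t = (\<Sum>i\<le>m. b i * x ^ i)"
   using st(2) unfolding span_pow_def by blast
  have "s * t = (\<Sum>i\<le>n. \<Sum>j\<le>m. (a i * b j) * x ^ (i + j))"
   unfolding a b by (simp add: sum_product power_add ac_simps)
  also have "\<dots> \<in> span_pow x (n + m)"
   by (intro span_pow_sum span_powI V.D_mult) (use a b in auto)
  finally show ?thesis by blast
 qed
 have S: "subring_of k ?S"
 proof
  show "k c \<in> ?S" for c using VS V.D_const by blast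
  fix s t assume "s \<in> ?S" "t \<in> ?S"
  then obtain n m where nm: "s \<in> span_pow x n" "t \<in> span_pow x m" by blast
  then have "s \<in> span_pow x (max n m)" "t \<in> span_pow x (max n m)"
   using span_pow_mono[of n "max n m" x] span_pow_mono[of m "max n m" x] by auto
  then show "s + t \<in> ?S" using span_pow_add by blast
  show "s * t \<in> ?S" using mult nm by blast
 next
  fix s assume "s \<in> ?S"
  then obtain n where "s \<in> span_pow x n" by blast
  then have "- 1 * s \<in> span_pow x n" by (intro span_pow_smult V.D_uminus V.D_1)
  then show "- s \<in> ?S" by auto
 qed
 have xS: "x \<in> ?S" using span_powI[OF V.D_1, of 1 1 x] by auto
 have SK: "?S \<subseteq> K"
  unfolding span_pow_def using V_K assms(1) by (auto intro!: K_sum K_mult K.D_power)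
 have "inverse y \<in> ?S"
  using V_max[OF S VS SK] xS assms(2) by blast
 then obtain n where "inverse y \<in> span_pow x n" by blast
 then show ?thesis using y_nz by (intro exI[of _ n] bexI[of _ "inverse y"]) auto
qed

text \<open>With \<open>b 0\<close> the constant coefficient of \<open>t\<close>, the second relation expresses \<open>(1 - y b 0) x\<^sup>n\<^sup>+\<^sup>1\<close> by
 lower powers. So multiplying the first one by \<open>1 - y b 0\<close> removes its top power.\<close>

lemma reduce_relation:
 assumes x0: "x ~= 0" and s: "s \<in> span_pow x (Suc n)" "1 = y * s"
  and t: "t \<in> span_pow (inverse x) m" "1 = y * t" and mn: "m \<le> Suc n"
 shows "\<exists>s\<in>span_pow x n. 1 = y * s"
proof -
 obtain a where a: "\<forall>i. a i \<in> V" "s = (\<Sum>i\<le>Suc n. a i * x ^ i)" using s unfolding span_pow_def by blast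
 obtain b where b: "\<forall>i. b i \<in> V" "t = (\<Sum>i\<le>m. b i * inverse x ^ i)" using t unfolding span_pow_def by blast
 define r where "r = (\<Sum>i\<le>n. a i * x ^ i)"
 have r: "r \<in> span_pow x n" unfolding r_def span_pow_def using a by blast
 have s': "s = r + a (Suc n) * x ^ Suc n" unfolding a r_def by simp
 define q where "q = (\<Sum>i\<in>{1..m}. b i * x ^ (Suc n - i))"
 have q: "q \<in> span_pow x n" unfolding q_def by (rule span_pow_sum) (use b in \<open>auto intro!: span_powI\<close>)
 have "t = b 0 + (\<Sum>i\<in>{1..m}. b i * inverse x ^ i)"
 proof -
  have "{..m} = insert 0 {1..m}" by auto
  then show ?thesis unfolding b by simp
 qed
 moreover have "x ^ Suc n * (\<Sum>i\<in>{1..m}. b i * inverse x ^ i) = q"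
  unfolding q_def sum_distrib_left
 proof (rule sum.cong)
  fix i assume "i \<in> {1..m}"
  then have "Suc n = (Suc n - i) + i" using mn by auto
  then have "x ^ Suc n = x ^ (Suc n - i) * x ^ i" by (metis power_add)
  then show "x ^ Suc n * (b i * inverse x ^ i) = b i * x ^ (Suc n - i)"
   using x0 by (simp add: power_inverse)
 qed simp
 ultimately have xt: "x ^ Suc n * t = x ^ Suc n * b 0 + q" by (simp only: distrib_left)
 have top: "x ^ Suc n * (1 - y * b 0) = y * q"
 proof -
  have "x ^ Suc n = y * (x ^ Suc n * t)" using t(2) by (metis mult.left_commute mult.right_neutral)
  then have "x ^ Suc n = y * (x ^ Suc n * b 0) + y * q" unfolding xt by (simp only: distrib_left)
  then show ?thesis by (simp only: right_diff_distrib mult_1_right mult.left_commute[of y] diff_eq_eq add.commute)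
 qed
 have "1 - y * b 0 = y * s * (1 - y * b 0)" using s(2) by simp
 also have "\<dots> = y * (r * (1 - y * b 0)) + y * a (Suc n) * (x ^ Suc n * (1 - y * b 0))"
  unfolding s' by (simp only: distrib_left distrib_right mult.assoc)
 also have "\<dots> = y * ((1 - y * b 0) * r + a (Suc n) * y * q)"
  unfolding top by (simp only: distrib_left ac_simps)
 finally have "1 - y * b 0 = y * ((1 - y * b 0) * r + a (Suc n) * y * q)" .
 then have "1 = y * (((1 - y * b 0) * r + a (Suc n) * y * q) + b 0)"
  unfolding distrib_left[of y _ "b 0"] by (simp add: eq_diff_eq[symmetric])
 moreover have "((1 - y * b 0) * r + a (Suc n) * y * q) + b 0 \<in> span_pow x n"
 proof -
  have "1 - y * b 0 = 1 + - (y * b 0)" by simp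
  also have "\<dots> \<in> V" using y_V b by (intro V.D_add V.D_1 V.D_uminus V.D_mult) auto
  finally have "(1 - y * b 0) * r \<in> span_pow x n" by (rule span_pow_smult[OF _ r])
  moreover have "a (Suc n) * y * q \<in> span_pow x n" using a y_V by (intro span_pow_smult q V.D_mult) auto
  moreover have "b 0 \<in> span_pow x n" using span_powI[of "b 0" 0 n x] b by simp
  ultimately show ?thesis by (intro span_pow_add)
 qed
 ultimately show ?thesis by blast
qed

text \<open>Otherwise there are relations for \<open>x\<close> and for \<open>1/x\<close>, and the longer of the two can always be shortened.\<close>

lemma valuation_ring:
 assumes x: "x \<in> K" "x ~= 0"
 shows "x \<in> V \<or> inverse x \<in> V"
proof (rule ccontr)
 assume neg: "\<not> (x \<in> V \<or> inverse x \<in> V)"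
 define P where "P = (\<lambda>z n. \<exists>s\<in>span_pow z n. 1 = y * s)"
 have P0: "\<not> P z 0" for z
 proof
  assume "P z 0"
  then obtain a where "a \<in> V" "1 = y * a" unfolding P_def span_pow_def by auto
  then have "inverse y = a" using inverse_unique[of y a] by simp
  then show False using inv_y \<open>a \<in> V\<close> by simp
 qed
 have step: "\<exists>n' m'. P x n' \<and> P (inverse x) m' \<and> n' + m' < n + m" if nm: "P x n" "P (inverse x) m" for n m
 proof (cases "m \<le> n")
  case True
  obtain n' where n': "n = Suc n'" using nm(1) P0 by (cases n) auto
  have "P x n'" using reduce_relation[OF x(2), of _ n' _ m] nm True unfolding n' P_def by blast
  then show ?thesis using nm(2) n' by (intro exI[of _ n'] exI[of _ m]) auto
 next
  case False
  obtain m' where m': "m = Suc m'" using nm(2) P0 by (cases m) auto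
  have "P (inverse x) m'"
   using reduce_relation[of "inverse x" _ m' _ n] nm False x(2) unfolding m' P_def inverse_inverse_eq by auto
  then show ?thesis using nm(1) m' by (intro exI[of _ n] exI[of _ m']) auto
 qed
 have "\<not> (P x n \<and> P (inverse x) m)" for n m
 proof (induction "n + m" arbitrary: n m rule: less_induct)
  case less
  then show ?case using step by blast
 qed
 moreover have "\<exists>n. P x n" "\<exists>m. P (inverse x) m"
  using adjoin[of x] adjoin[of "inverse x"] neg x K_inverse unfolding P_def by auto
 ultimately show False by blast
qed

definition maxid :: "'b set" where
 "maxid = {x \<in> V. x = 0 \<or> inverse x \<notin> V}"

lemma maxid_mult: "a \<in> V ==> x \<in> maxid ==> a * x \<in> maxid"
proof -
 assume a: "a \<in> V" "x \<in> maxid"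
 have "inverse (a * x) \<notin> V" if ne: "a * x ~= 0"
 proof
  assume "inverse (a * x) \<in> V"
  then have "a * inverse (a * x) \<in> V" using a by (intro V.D_mult)
  moreover have "a * inverse (a * x) = inverse x" using ne by (simp add: field_simps)
  ultimately have "inverse x \<in> V" by (simp only:)
  moreover have "x ~= 0" using ne by auto
  ultimately show False using a(2) unfolding maxid_def by blast
 qed
 then show ?thesis using a V.D_mult unfolding maxid_def by blast
qed

lemma maxid_add: "a \<in> maxid ==> b \<in> maxid ==> a + b \<in> maxid"
proof (cases "a = 0 \<or> b = 0")
 case False
 assume ab: "a \<in> maxid" "b \<in> maxid"
 have nz: "a ~= 0" "b ~= 0" using False by auto
 have abK: "a \<in> K" "b \<in> K" using ab V_K unfolding maxid_def by auto
 have "a / b \<in> V \<or> inverse (a / b) \<in> V" using valuation_ring[of "a / b"] abK nz K_divide by simp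
 then show ?thesis
 proof
  assume "a / b \<in> V"
  then have "(a / b + 1) * b \<in> maxid" by (intro maxid_mult ab V.D_add V.D_1)
  then show ?thesis using nz by (simp add: distrib_right)
 next
  assume "inverse (a / b) \<in> V"
  then have "(b / a + 1) * a \<in> maxid" by (intro maxid_mult ab V.D_add V.D_1) simp
  then show ?thesis using nz by (simp add: distrib_right add.commute)
 qed
qed auto

lemma maxid_sum: "finite I ==> (\<And>i. i \<in> I ==> g i \<in> maxid) ==> sum g I \<in> maxid"
proof (induction I rule: finite_induct)
 case empty
 show ?case unfolding maxid_def by (simp add: V.D_0)
qed (auto intro: maxid_add)

lemma maxid_uminus: "a \<in> maxid ==> - a \<in> maxid"
 using maxid_mult[OF V.D_uminus[OF V.D_1]] by simp

lemma y_maxid: "y \<in> maxid" using y_V inv_y unfolding maxid_def by simp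

lemma maxid_V: "a \<in> maxid ==> a \<in> V" unfolding maxid_def by simp

lemma one_notin_maxid: "1 \<notin> maxid" unfolding maxid_def using V.D_1 by simp

lemma const_maxid: "k c \<in> maxid ==> c = 0"
 using maxid_mult[OF V.D_const[of "inverse c"], of "k c"] one_notin_maxid
 by (cases "c = 0") (auto simp flip: hom_mult hom_inverse)

lemma quotient_maxid: "a \<in> K ==> b \<in> K ==> a ~= 0 ==> b ~= 0 ==> a / b \<notin> V ==> b / a \<in> maxid"
 using valuation_ring[of "a / b"] K_divide unfolding maxid_def by simp

lemma peval_y_V: "peval k p y \<in> V"
 by (rule V.D_peval_gen[OF V.D_const y_V comm_hom_axioms])

lemma peval_y_const: "peval k p y - k (coeff p 0) \<in> maxid"
proof (cases p)
 case (pCons a q)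
 then show ?thesis using maxid_mult[OF peval_y_V y_maxid, of q] by (simp add: mult.commute)
qed

end

locale discrete_maximal_subring = maximal_subring k K y V
 for k :: "'a::field => 'b::field" and K y V +
 fixes N :: nat
 assumes y_finite: "finite_over y N"
  and y_transcendental: "\<And>p. peval k p y = 0 ==> p = 0"
begin

text \<open>A strictly increasing chain of principal ideals starting at \<open>y V\<close> has length at most \<open>N\<close>,
 because its generators are independent over \<open>k(y)\<close>.\<close>

lemma chain_bound:
 assumes g: "\<And>j. j \<le> N ==> g j \<in> maxid" "\<And>j. j \<le> N ==> g j ~= 0" "g 0 = y"
  and chain: "\<And>i j. i < j ==> j \<le> N ==> g i / g j \<in> maxid"
 shows False
proof -
 have gK: "g j \<in> K" if "j \<le> N" for j using g(1)[OF that] maxid_V V_K by blast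
 obtain \<phi> where \<phi>: "\<exists>j\<le>N. coeff (\<phi> j) 0 ~= 0" "(\<Sum>j\<le>N. peval k (\<phi> j) y * g j) = 0"
  using primitive_relation[OF y_nz y_finite, of g] gK by blast
 define J where "J = {j. j \<le> N \<and> coeff (\<phi> j) 0 ~= 0}"
 have J: "finite J" "J ~= {}" using \<phi>(1) unfolding J_def by auto
 define j where "j = Max J"
 have jJ: "j \<in> J" unfolding j_def using J by (rule Max_in)
 then have j: "j \<le> N" "coeff (\<phi> j) 0 ~= 0" unfolding J_def by auto
 have above: "coeff (\<phi> i) 0 = 0" if "i \<le> N" "i > j" for i
  using Max_ge[OF J(1), of i] that unfolding j_def J_def by fastforce
 have other: "peval k (\<phi> i) y * (g i / g j) \<in> maxid" if i: "i \<in> {..N} - {j}" for i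
 proof (cases "i < j")
  case True
  then show ?thesis using chain[of i j] j i by (intro maxid_mult peval_y_V) auto
 next
  case False
  then have ij: "i > j" "i \<le> N" using i by auto
  obtain \<psi> where \<psi>: "\<phi> i = pCons 0 \<psi>" using above[OF ij(2,1)] by (metis pCons_cases coeff_pCons_0)
  have "y / g j \<in> V"
  proof (cases "j = 0")
   case True
   then show ?thesis using g(3) y_nz V.D_1 by simp
  next
   case False
   then show ?thesis using chain[of 0 j] j g(3) maxid_V by simp
  qed
  then have "(peval k \<psi> y * (y / g j)) * g i \<in> maxid"
   by (intro maxid_mult V.D_mult peval_y_V g ij)
  then show ?thesis by (simp add: \<psi> ac_simps)
 qed
 have "(\<Sum>i\<le>N. peval k (\<phi> i) y * g i) / g j = (\<Sum>i\<le>N. peval k (\<phi> i) y * (g i / g j))"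
  by (simp add: sum_divide_distrib)
 also have "\<dots> = peval k (\<phi> j) y + (\<Sum>i\<in>{..N} - {j}. peval k (\<phi> i) y * (g i / g j))"
  using j g(2)[OF j(1)] by (subst sum.remove[of "{..N}" j]) auto
 finally have "peval k (\<phi> j) y = - (\<Sum>i\<in>{..N} - {j}. peval k (\<phi> i) y * (g i / g j))"
  using \<phi>(2) by (simp add: eq_neg_iff_add_eq_0)
 also have "\<dots> \<in> maxid" by (intro maxid_uminus maxid_sum other) simp
 finally have "peval k (\<phi> j) y + - (peval k (\<phi> j) y - k (coeff (\<phi> j) 0)) \<in> maxid"
  by (intro maxid_add maxid_uminus peval_y_const)
 then show False using const_maxid j(2) by simp
qed

text \<open>By the bound on chains, some element of the maximal ideal divides all others.\<close>

lemma uniformizer: "\<exists>t. t \<in> maxid \<and> t ~= 0 \<and> (\<forall>x\<in>maxid. x / t \<in> V)"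
proof (rule ccontr)
 assume neg: "\<not> ?thesis"
 define C where "C = (\<lambda>(n::nat) g. g 0 = y \<and> (\<forall>j\<le>n. g j \<in> maxid \<and> g j ~= 0) \<and> (\<forall>i j. i < j \<and> j \<le> n \<longrightarrow> g i / g j \<in> maxid))"
 have "\<exists>g. C n g" for n
 proof (induction n)
  case 0
  show ?case by (intro exI[of _ "\<lambda>_. y"]) (simp add: C_def y_maxid y_nz)
 next
  case (Suc n)
  then obtain g where g: "C n g" by blast
  have gn: "g n \<in> maxid" "g n ~= 0" using g unfolding C_def by auto
  obtain x where x: "x \<in> maxid" "x / g n \<notin> V" using neg gn by blast
  have x0: "x ~= 0" using x(2) V.D_0 by auto
  have gx: "g n / x \<in> maxid"
   using quotient_maxid[of x "g n"] x x0 gn maxid_V V_K by blast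
  define h where "h = g(Suc n := x)"
  have "h i / h j \<in> maxid" if "i < j" "j \<le> Suc n" for i j
  proof (cases "j = Suc n")
   case True
   have "g i / x \<in> maxid"
   proof (cases "i = n")
    case False
    then have "i < n" using that True by simp
    then have "g i / g n \<in> maxid" using g unfolding C_def by blast
    then have "(g i / g n) * (g n / x) \<in> maxid" by (intro maxid_mult gx maxid_V)
    then show ?thesis using gn by simp
   qed (use gx in simp)
   then show ?thesis using True that by (simp add: h_def)
  next
   case False
   then show ?thesis using that g unfolding C_def h_def by simp
  qed
  then have "C (Suc n) h"
   using g x x0 unfolding C_def h_def by (auto simp: le_Suc_eq)
  then show ?case by blast
 qed
 then obtain g where "C N g" by blast
 then show False using chain_bound[of g] unfolding C_def by blast
qed

text \<open>Every element is a power of the uniformizer times a unit, because powers of the uniformizer eventually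
 lose divisibility into a given element. The exponent is the valuation.\<close>

lemma ex_place: "\<exists>u. is_place u \<and> u y > 0"
proof -
 obtain t where t: "t \<in> maxid" "t ~= 0" "\<And>x. x \<in> maxid ==> x / t \<in> V" using uniformizer by blast
 have tK: "t \<in> K" and tV: "t \<in> V" using t(1) maxid_V V_K by auto
 define U where "U = {x \<in> V. x ~= 0 \<and> inverse x \<in> V}"
 have U_mult: "a * b \<in> U" if "a \<in> U" "b \<in> U" for a b
  using that V.D_mult unfolding U_def by (auto simp: mult.commute)
 have U_inv: "inverse a \<in> U" if "a \<in> U" for a using that unfolding U_def by auto
 have U_1: "1 \<in> U" unfolding U_def using V.D_1 by simp
 have VU: "x \<in> U \<or> x \<in> maxid" if "x \<in> V" for x using that unfolding U_def maxid_def by auto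
 have U_not: "x \<notin> maxid" if "x \<in> U" for x using that unfolding U_def maxid_def by auto
 have tpow: "t ^ Suc n \<in> maxid" for n using maxid_mult[OF V.D_power[OF tV] t(1), of n] by (simp add: mult.commute)
 have tpowU: "t powi n \<notin> U" if n0: "n ~= 0" for n
 proof
  assume U: "t powi n \<in> U"
  have "\<exists>m. t ^ Suc m \<in> U"
  proof (cases "n > 0")
   case True
   then obtain m where "n = int (Suc m)" by (metis gr0_implies_Suc zero_less_imp_eq_int)
   then show ?thesis using U by (metis power_int_of_nat)
  next
   case False
   then obtain m where m: "- n = int (Suc m)" using n0 by (metis gr0_implies_Suc neg_0_less_iff_less linorder_neqE_linordered_idom zero_less_imp_eq_int)
   have "t powi (- n) \<in> U" using U_inv[OF U] by (simp add: power_int_minus)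
   then show ?thesis unfolding m by (metis power_int_of_nat)
  qed
  then show False using tpow U_not by blast
 qed
 have bound_y: "\<exists>l. y / t ^ l \<in> U"
 proof (rule ccontr)
  assume neg: "\<not> (\<exists>l. y / t ^ l \<in> U)"
  have inm: "y / t ^ l \<in> maxid" for l
  proof (induction l)
   case (Suc l)
   have "y / t ^ l / t \<in> V" by (rule t(3)[OF Suc])
   then have "y / t ^ Suc l \<in> V" by (simp add: mult.commute)
   then show ?case using VU neg by blast
  qed (simp add: y_maxid)
  define g where "g = (\<lambda>j. if j = 0 then y else t ^ (Suc N - j))"
  show False
  proof (rule chain_bound[of g])
   fix j assume j: "j \<le> N"
   have "Suc N - j = Suc (N - j)" using j by simp
   then show "g j \<in> maxid" using tpow[of "N - j"] y_maxid by (simp add: g_def)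
   show "g j ~= 0" using t(2) y_nz by (simp add: g_def)
  next
   show "g 0 = y" by (simp add: g_def)
   fix i j assume ij: "i < j" "j \<le> N"
   show "g i / g j \<in> maxid"
   proof (cases "i = 0")
    case True
    then show ?thesis using inm ij by (simp add: g_def)
   next
    case False
    have "Suc N - i = Suc (j - i - 1) + (Suc N - j)" using ij by simp
    then have "t ^ (Suc N - i) = t ^ Suc (j - i - 1) * t ^ (Suc N - j)" by (metis power_add)
    then show ?thesis using tpow[of "j - i - 1"] False ij t(2) by (simp add: g_def)
   qed
  qed
 qed
 then obtain l where l: "y / t ^ l \<in> U" by blast
 have yjl: "y ^ j / t ^ (l * j) \<in> U" for j
 proof (induction j)
  case (Suc j)
  have eq: "y ^ Suc j / t ^ (l * Suc j) = (y / t ^ l) * (y ^ j / t ^ (l * j))"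
   by (simp add: power_add)
  show ?case unfolding eq by (rule U_mult[OF l Suc])
 qed (simp add: U_1)
 have divides: "\<exists>j. y ^ j / x \<in> V" if x: "x \<in> V" "x ~= 0" for x
 proof -
  have xK: "x ^ j \<in> K" for j using x V_K by (intro K.D_power) auto
  obtain \<phi> where \<phi>: "\<exists>j\<le>N. \<phi> j ~= 0" "(\<Sum>j\<le>N. peval k (\<phi> j) y * x ^ j) = 0"
   using y_finite xK unfolding finite_over_def by blast
  define i where "i = (LEAST j. j \<le> N \<and> \<phi> j ~= 0)"
  have i: "i \<le> N" "\<phi> i ~= 0" using LeastI_ex[OF \<phi>(1)] unfolding i_def by auto
  have below: "\<phi> j = 0" if "j < i" for j using not_less_Least[of j "\<lambda>j. j \<le> N \<and> \<phi> j ~= 0"] that i unfolding i_def by auto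
  define r where "r = (\<Sum>j\<in>{Suc i..N}. peval k (\<phi> j) y * x ^ (j - Suc i))"
  have rV: "r \<in> V"
   unfolding r_def by (intro V.D_sum V.D_mult peval_y_V V.D_power x)
  have "0 = (\<Sum>j\<in>{i..N}. peval k (\<phi> j) y * x ^ j)"
   unfolding \<phi>(2)[symmetric] by (rule sum.mono_neutral_right) (auto simp: below)
  also have "\<dots> = peval k (\<phi> i) y * x ^ i + (\<Sum>j\<in>{Suc i..N}. peval k (\<phi> j) y * x ^ j)"
   using i(1) by (simp add: sum.atLeast_Suc_atMost)
  also have "(\<Sum>j\<in>{Suc i..N}. peval k (\<phi> j) y * x ^ j) = x ^ i * (x * r)"
   unfolding r_def sum_distrib_left
  proof (rule sum.cong)
   fix j assume "j \<in> {Suc i..N}"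
   then have "j = i + 1 + (j - Suc i)" by simp
   then have "x ^ j = x ^ i * x * x ^ (j - Suc i)" by (metis power_add power_one_right)
   then show "peval k (\<phi> j) y * x ^ j = x ^ i * (x * (peval k (\<phi> j) y * x ^ (j - Suc i)))" by (simp add: ac_simps)
  qed simp
  finally have "x ^ i * (peval k (\<phi> i) y + x * r) = 0" by (simp add: algebra_simps)
  then have rel: "peval k (\<phi> i) y = - (x * r)" using x(2) by (simp add: eq_neg_iff_add_eq_0)
  have "\<exists>j e. peval k p y = y ^ j * e \<and> e \<in> U" if "p ~= 0" for p :: "'a poly"
   using that
  proof (induction p)
   case (pCons a p)
   show ?case
   proof (cases "a = 0")
    case True
    then have "p ~= 0" using pCons by auto
    then obtain j e where "peval k p y = y ^ j * e" "e \<in> U" using pCons by blast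
    then show ?thesis using True by (intro exI[of _ "Suc j"] exI[of _ e]) simp
   next
    case False
    have "peval k (pCons a p) y \<notin> maxid"
    proof
     assume "peval k (pCons a p) y \<in> maxid"
     then have "peval k (pCons a p) y + - (peval k (pCons a p) y - k (coeff (pCons a p) 0)) \<in> maxid"
      by (intro maxid_add maxid_uminus peval_y_const)
     then show False using const_maxid False by simp
    qed
    then have "peval k (pCons a p) y \<in> U" using VU peval_y_V by blast
    then show ?thesis by (intro exI[of _ 0] exI[of _ "peval k (pCons a p) y"]) simp
   qed
  qed simp
  then obtain j e where je: "peval k (\<phi> i) y = y ^ j * e" "e \<in> U" using i(2) by blast
  have "y ^ j = x * - (r * inverse e)" using je rel unfolding U_def by (simp add: field_simps)
  then have "y ^ j / x = - (r * inverse e)" using x(2) by simp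
  moreover have "- (r * inverse e) \<in> V" using rV je(2) unfolding U_def by (intro V.D_uminus V.D_mult) auto
  ultimately show ?thesis by (intro exI[of _ j]) simp
 qed
 have unit_V: "\<exists>n::nat. x / t ^ n \<in> U" if x: "x \<in> V" "x ~= 0" for x
 proof (rule ccontr)
  assume neg: "\<not> (\<exists>n. x / t ^ n \<in> U)"
  have inm: "x / t ^ n \<in> maxid" for n
  proof (induction n)
   case 0
   show ?case using VU[OF x(1)] neg by (metis div_by_1 power_0)
  next
   case (Suc n)
   have "x / t ^ n / t \<in> V" by (rule t(3)[OF Suc])
   then have "x / t ^ Suc n \<in> V" by (simp add: mult.commute)
   then show ?case using VU neg by blast
  qed
  obtain j where j: "y ^ j / x \<in> V" using divides[OF x] by blast
  have "(y ^ j / x) * (x / t ^ (l * j)) \<in> maxid" by (rule maxid_mult[OF j inm])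
  then have "y ^ j / t ^ (l * j) \<in> maxid" using x(2) by simp
  then show False using yjl U_not by blast
 qed
 have ex: "\<exists>n::int. \<exists>e\<in>U. x = t powi n * e" if x: "x \<in> K" "x ~= 0" for x
 proof (cases "x \<in> V")
  case True
  then obtain n where "x / t ^ n \<in> U" using unit_V x(2) by blast
  then show ?thesis using t(2) by (intro exI[of _ "int n"] bexI[of _ "x / t ^ n"]) auto
 next
  case False
  then have "inverse x \<in> V" using valuation_ring[OF x] by blast
  then obtain n where n: "inverse x / t ^ n \<in> U" using unit_V[of "inverse x"] x(2) by auto
  have "x = t powi (- int n) * inverse (inverse x / t ^ n)"
   using t(2) x(2) by (simp add: power_int_minus divide_simps)
  then show ?thesis using U_inv[OF n] by blast
 qed
 have uniq: "n = m" if "t powi n * e = t powi m * e'" "e \<in> U" "e' \<in> U" for n m e e'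
 proof (rule ccontr)
  assume "n ~= m"
  have e0: "e ~= 0" using that(2) unfolding U_def by simp
  have "t powi (n - m) * e = e'"
   using that(1) t(2) by (simp add: power_int_diff field_simps)
  then have "t powi (n - m) = e' * inverse e" using e0 by (simp add: field_simps)
  then have "t powi (n - m) \<in> U" using U_mult U_inv that by simp
  then show False using tpowU[of "n - m"] \<open>n ~= m\<close> by simp
 qed
 define u where "u = (\<lambda>x. THE n::int. \<exists>e\<in>U. x = t powi n * e)"
 have u_eq: "u (t powi n * e) = n" if "e \<in> U" for n e
  unfolding u_def using that uniq by (intro the_equality) blast+
 have V_nonneg: "n \<ge> 0" if "t powi n * e \<in> V" "e \<in> U" for n e
 proof (rule ccontr)
  assume "\<not> n \<ge> 0"
  then obtain m where m: "- n = int (Suc m)" by (metis gr0_implies_Suc neg_0_less_iff_less not_le zero_less_imp_eq_int)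
  have "t powi n * e * inverse e \<in> V"
   by (rule V.D_mult[OF that(1)]) (use that(2) in \<open>simp add: U_def\<close>)
  moreover have "t powi n * e * inverse e = t powi n" using that(2) unfolding U_def by simp
  ultimately have "t powi n \<in> V" by simp
  then have "t powi n * t ^ Suc m \<in> maxid" by (rule maxid_mult[OF _ tpow])
  moreover have "t powi n * t ^ Suc m = 1"
  proof -
   have "t ^ Suc m = t powi (- n)" unfolding m by (simp only: power_int_of_nat)
   then show ?thesis using t(2) by (simp add: power_int_minus)
  qed
  ultimately show False using one_notin_maxid by simp
 qed
 have tV': "t powi n \<in> V" if n0: "n \<ge> 0" for n
 proof -
  obtain m where "n = int m" using n0 nonneg_int_cases by blast
  then show ?thesis using V.D_power[OF tV, of m] by simp
 qed
 have UK: "e \<in> K" "e ~= 0" if "e \<in> U" for e using that V_K unfolding U_def by auto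
 have tpK: "t powi n \<in> K" for n
  using tK by (cases "n \<ge> 0") (auto simp: power_int_def intro!: K.D_power K_inverse)
 have min_le: "u (x + z) \<ge> u x"
  if xz: "x \<in> K" "x ~= 0" "z \<in> K" "z ~= 0" "x + z ~= 0" "u x \<le> u z" for x z
 proof -
  obtain n e where x: "x = t powi n * e" "e \<in> U" using ex xz by blast
  obtain m e' where z: "z = t powi m * e'" "e' \<in> U" using ex xz by blast
  have nm: "n \<le> m" using xz(6) unfolding x z by (simp add: u_eq x(2) z(2))
  have zz: "z = t powi n * (t powi (m - n) * e')" unfolding z using t(2) by (simp add: power_int_diff)
  define s where "s = e + t powi (m - n) * e'"
  have xz': "x + z = t powi n * s" unfolding s_def distrib_left zz[symmetric] x(1) ..
  have sV: "s \<in> V" unfolding s_def using x z nm tV'[of "m - n"] unfolding U_def by (intro V.D_add V.D_mult) auto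
  have s0: "s ~= 0" using xz(5) xz' by auto
  obtain j e'' where s: "s = t powi j * e''" "e'' \<in> U" using ex[of s] sV V_K s0 by blast
  have "j \<ge> 0" using V_nonneg[of j e''] sV s by simp
  have "x + z = t powi (n + j) * e''" unfolding xz' s(1) using t(2) by (simp add: power_int_add mult.assoc)
  then have "u (x + z) = n + j" using u_eq[OF s(2)] by simp
  moreover have "u x = n" unfolding x(1) by (rule u_eq[OF x(2)])
  ultimately show ?thesis using \<open>j \<ge> 0\<close> by simp
 qed
 have "is_place u"
  unfolding is_place_def
 proof (intro conjI ballI allI impI)
  fix x z assume xz: "x \<in> K - {0}" "z \<in> K - {0}"
  obtain n e where x: "x = t powi n * e" "e \<in> U" using ex xz by blast
  obtain m e' where z: "z = t powi m * e'" "e' \<in> U" using ex xz by blast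
  have "x * z = t powi (n + m) * (e * e')" unfolding x z using t(2) by (simp add: power_int_add ac_simps)
  then have "u (x * z) = n + m" using u_eq[OF U_mult[OF x(2) z(2)]] by simp
  then show "u (x * z) = u x + u z" unfolding x(1) z(1) u_eq[OF x(2)] u_eq[OF z(2)] .
  assume "x + z ~= 0"
  then show "u (x + z) \<ge> min (u x) (u z)"
   using min_le[of x z] min_le[of z x] xz by (auto simp: min_def add.commute)
 next
  have "n \<in> u ` (K - {0})" for n
  proof -
   have "u (t powi n * 1) = n" by (rule u_eq[OF U_1])
   moreover have "t powi n * 1 \<in> K - {0}" using tpK t(2) by simp
   ultimately show ?thesis by (metis image_eqI)
  qed
  then show "u ` (K - {0}) = UNIV" by auto
 next
  fix c :: 'a assume c: "c ~= 0"
  have "k c \<in> U" unfolding U_def using V.D_const[of c] V.D_const[of "inverse c"] c by simp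
  then show "u (k c) = 0" using u_eq[of "k c" 0] by simp
 qed
 moreover have "u y > 0"
 proof -
  have y: "y = t powi int l * (y / t ^ l)" using t(2) by simp
  then have "u y = int l" using u_eq[OF l, of "int l"] by simp
  moreover have "l ~= 0" using l U_not y_maxid by (metis div_by_1 power_0)
  ultimately show ?thesis by simp
 qed
 ultimately show ?thesis by blast
qed

end

text \<open>Every transcendental element has a pole.\<close>

lemma (in subfield_over) place_exists:
 fixes N :: nat
 assumes z: "z \<in> K" and transc: "\<And>p. peval k p z = 0 ==> p = 0"
  and fin: "finite_over (inverse z) N"
 shows "\<exists>u. is_place u \<and> u (inverse z) > 0"
proof -
 define y where "y = inverse z"
 have z0: "z ~= 0" using transc[of "[:0, 1:]"] by auto
 have y: "y \<in> K" "y ~= 0" "inverse y = z" using z z0 K_inverse by (auto simp: y_def)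
 have rev: "z ^ n * peval k p y = peval k (\<Sum>i\<le>n. Polynomial.monom (coeff p i) (n - i)) z"
  if "degree p \<le> n" for p n
 proof -
  have "z ^ n * peval k p y = (\<Sum>i\<le>n. k (coeff p i) * (z ^ n * y ^ i))"
   unfolding peval_sum_le[OF that] by (simp add: sum_distrib_left ac_simps)
  also have "\<dots> = (\<Sum>i\<le>n. k (coeff p i) * z ^ (n - i))"
  proof (rule sum.cong)
   fix i assume "i \<in> {..n}"
   then have "z ^ n = z ^ (n - i) * z ^ i" by (simp flip: power_add)
   then show "k (coeff p i) * (z ^ n * y ^ i) = k (coeff p i) * z ^ (n - i)"
    using z0 by (simp add: y_def power_inverse)
  qed simp
  finally show ?thesis by (simp add: peval_sum)
 qed
 have y_transc: "p = 0" if "peval k p y = 0" for p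
 proof -
  let ?n = "degree p"
  have "(\<Sum>i\<le>?n. Polynomial.monom (coeff p i) (?n - i)) = 0"
   using rev[of p ?n] that transc by simp
  then have "coeff (\<Sum>i\<le>?n. Polynomial.monom (coeff p i) (?n - i)) 0 = 0" by simp
  then have "(\<Sum>i\<le>?n. if ?n - i = 0 then coeff p i else 0) = 0" by (simp add: coeff_sum coeff_monom)
  moreover have "(\<Sum>i\<le>?n. if ?n - i = 0 then coeff p i else 0) = (\<Sum>i\<le>?n. if i = ?n then coeff p i else 0)"
   by (rule sum.cong) auto
  ultimately show ?thesis by simp
 qed
 define F where "F = {S. subring_of k S \<and> S \<subseteq> K \<and> y \<in> S \<and> z \<notin> S}"
 have start: "range (\<lambda>p. peval k p y) \<in> F"
  unfolding F_def
 proof (intro CollectI conjI)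
  show "subring_of k (range (\<lambda>p. peval k p y))"
  proof
   show "k c \<in> range (\<lambda>p. peval k p y)" for c using rangeI[of "\<lambda>p. peval k p y" "[:c:]"] by simp
  qed (auto simp flip: peval_add peval_mult peval_minus)
  show "range (\<lambda>p. peval k p y) \<subseteq> K" using K_peval[OF y(1)] by auto
  show "y \<in> range (\<lambda>p. peval k p y)" using rangeI[of "\<lambda>p. peval k p y" "[:0, 1:]"] by simp
  show "z \<notin> range (\<lambda>p. peval k p y)"
  proof
   assume "z \<in> range (\<lambda>p. peval k p y)"
   then obtain p where p: "z = peval k p y" by blast
   let ?n = "degree p"
   let ?q = "Polynomial.monom 1 (Suc ?n) - (\<Sum>i\<le>?n. Polynomial.monom (coeff p i) (?n - i))"
   have "peval k ?q z = z ^ Suc ?n - z ^ ?n * z" using rev[of p ?n] p by simp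
   then have "peval k ?q z = 0" by simp
   then have "?q = 0" by (rule transc)
   moreover have "coeff ?q (Suc ?n) = 1"
   proof -
    have "(\<Sum>i\<le>?n. coeff (Polynomial.monom (coeff p i) (?n - i)) (Suc ?n)) = 0"
     by (rule sum.neutral) auto
    then show ?thesis by (simp add: coeff_sum)
   qed
   ultimately show False by simp
  qed
 qed
 have chain: "\<Union>C \<in> F" if C: "C ~= {}" "subset.chain F C" for C
 proof -
  have CF: "S \<in> F" if "S \<in> C" for S using C(2) that unfolding subset.chain_def by blast
  have lin: "S \<subseteq> T \<or> T \<subseteq> S" if "S \<in> C" "T \<in> C" for S T
   using C(2) that unfolding subset.chain_def by (auto simp: subset_iff)
  obtain S0 where S0: "S0 \<in> C" using C(1) by blast
  have "subring_of k (\<Union>C)"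
  proof
   show "k c \<in> \<Union>C" for c using CF[OF S0] S0 unfolding F_def by (auto intro: subring_of.D_const)
   fix a b assume "a \<in> \<Union>C" "b \<in> \<Union>C"
   then obtain S T where "a \<in> S" "S \<in> C" "b \<in> T" "T \<in> C" by blast
   then obtain W where W: "a \<in> W" "b \<in> W" "W \<in> C" using lin by blast
   then have "subring_of k W" using CF unfolding F_def by blast
   then show "a + b \<in> \<Union>C" "a * b \<in> \<Union>C" using W subring_of.D_add subring_of.D_mult by blast+
  next
   fix a assume "a \<in> \<Union>C"
   then obtain W where W: "a \<in> W" "W \<in> C" by blast
   then have "subring_of k W" using CF unfolding F_def by blast
   then show "- a \<in> \<Union>C" using W subring_of.D_uminus by blast
  qed
  then show ?thesis using CF S0 unfolding F_def by blast
 qed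
 obtain V where V: "V \<in> F" "\<And>S. S \<in> F ==> V \<subseteq> S ==> S = V"
  using subset_Zorn_nonempty[of F] start chain by blast
 have VF: "subring_of k V" "V \<subseteq> K" "y \<in> V" "z \<notin> V" using V(1) unfolding F_def by auto
 have max: "S = V" if S: "subring_of k S" "V \<subseteq> S" "S \<subseteq> K" "inverse y \<notin> S" for S
 proof -
  have "S \<in> F" using S VF unfolding F_def y(3) by blast
  then show ?thesis using V(2) S by blast
 qed
 interpret maximal_subring k K y V
  by (intro maximal_subring.intro maximal_subring_axioms.intro subfield_over_axioms y(1,2) VF(1-3))
   (use VF(4) y(3) max in auto)
 interpret discrete_maximal_subring k K y V N
  by unfold_locales (use y_transc fin in \<open>auto simp: y_def\<close>)
 show ?thesis using ex_place unfolding y_def .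
qed

section \<open>Valuations and residues\<close>

lemma complete_square:
 fixes c :: "'a::comm_ring_1"
 shows "c * (a ^ 2 + b ^ 2) + x * (- (2 * c * a) + x * c) = c * ((x - a) ^ 2 + b ^ 2)"
 by (simp add: power2_eq_square algebra_simps)

lemma square_difference:
 fixes x :: "'a::comm_ring_1"
 shows "(x - a) ^ 2 + b ^ 2 - (x + c - 2 * a) * (x - c) = (c - a) ^ 2 + b ^ 2"
 by (simp add: power2_eq_square algebra_simps)

context subfield_over
begin

definition Places :: "('b => int) set" where
 "Places = {u \<in> extensional (K - {0}). is_place u}"

definition ge :: "('b => int) => int => 'b => bool" where
 "ge u n x \<longleftrightarrow> x \<in> K \<and> (x ~= 0 \<longrightarrow> n \<le> u x)"

lemma Places_restrict: "is_place u ==> restrict u (K - {0}) \<in> Places"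
 unfolding Places_def is_place_def by (simp add: K_mult K_add K_const)

lemma
 assumes "u \<in> Places"
 shows place_mult: "x \<in> K ==> y \<in> K ==> x ~= 0 ==> y ~= 0 ==> u (x * y) = u x + u y"
  and place_add: "x \<in> K ==> y \<in> K ==> x ~= 0 ==> y ~= 0 ==> x + y ~= 0 ==> min (u x) (u y) \<le> u (x + y)"
  and place_const: "c ~= 0 ==> u (k c) = 0"
  and place_surj: "\<exists>x\<in>K - {0}. u x = n"
proof -
 have p: "is_place u" using assms by (simp add: Places_def)
 show "x \<in> K ==> y \<in> K ==> x ~= 0 ==> y ~= 0 ==> u (x * y) = u x + u y"
  "x \<in> K ==> y \<in> K ==> x ~= 0 ==> y ~= 0 ==> x + y ~= 0 ==> min (u x) (u y) \<le> u (x + y)"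
  "c ~= 0 ==> u (k c) = 0"
  using p unfolding is_place_def by simp_all
 have "n \<in> u ` (K - {0})" using p unfolding is_place_def by simp
 then show "\<exists>x\<in>K - {0}. u x = n" by auto
qed

lemma place_one: "u \<in> Places ==> u 1 = 0"
 using place_const[of u 1] by simp

lemma place_inverse: "u \<in> Places ==> x \<in> K ==> x ~= 0 ==> u (inverse x) = - u x"
 using place_mult[of u x "inverse x"] place_one[of u] K_inverse[of x] by simp

lemma place_divide: "u \<in> Places ==> x \<in> K ==> y \<in> K ==> x ~= 0 ==> y ~= 0 ==> u (x / y) = u x - u y"
 unfolding field_class.field_divide_inverse
 using place_mult[of u x "inverse y"] place_inverse[of u y] K_inverse[of y] by simp

lemma place_power: "u \<in> Places ==> x \<in> K ==> x ~= 0 ==> u (x ^ n) = int n * u x"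
proof (induction n)
 case (Suc n)
 have "u (x * x ^ n) = u x + u (x ^ n)" by (rule place_mult) (use Suc.prems K.D_power in auto)
 then show ?case using Suc by (simp add: distrib_right)
qed (simp add: place_one)

lemma ge_K: "ge u n x ==> x \<in> K" by (simp add: ge_def)

lemma ge_0 [simp]: "ge u n 0" using K.D_0 by (simp add: ge_def)

lemma ge_mono: "ge u n x ==> m \<le> n ==> ge u m x" by (auto simp: ge_def)

lemma ge_const: "u \<in> Places ==> ge u 0 (k c)"
 by (cases "c = 0") (auto simp: ge_def K_const K.D_0 place_const)

lemma ge_1: "u \<in> Places ==> ge u 0 1" using ge_const[of u 1] by simp

lemma ge_add: "u \<in> Places ==> ge u n x ==> ge u n y ==> ge u n (x + y)"
 using place_add[of u x y] K_add[of x y] unfolding ge_def by (cases "x = 0"; cases "y = 0") auto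

lemma ge_mult: "u \<in> Places ==> ge u n x ==> ge u m y ==> ge u (n + m) (x * y)"
 using place_mult[of u x y] K_mult[of x y] unfolding ge_def by (cases "x = 0"; cases "y = 0") auto

lemma ge_mult0: "u \<in> Places ==> ge u 0 x ==> ge u m y ==> ge u m (x * y)"
 using ge_mult[of u 0 x m y] by simp

lemma ge_scale: "u \<in> Places ==> ge u m y ==> ge u m (k c * y)"
 by (rule ge_mult0[OF _ ge_const])

lemma ge_uminus: "u \<in> Places ==> ge u n x ==> ge u n (- x)"
 using ge_scale[of u n x "- 1"] by simp

lemma ge_diff: "u \<in> Places ==> ge u n x ==> ge u n y ==> ge u n (x - y)"
 using ge_add[of u n x "- y"] ge_uminus[of u n y] by simp

lemma ge_sum: "u \<in> Places ==> (\<And>i. i \<in> I ==> ge u n (g i)) ==> ge u n (sum g I)"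
 by (induction I rule: infinite_finite_induct) (auto intro: ge_add)

lemma ge_power: "u \<in> Places ==> ge u n x ==> ge u (int j * n) (x ^ j)"
 using place_power[of u x j] K.D_power[of x j] unfolding ge_def by (cases "x = 0") (auto simp: K.D_0 K.D_1 place_one intro: mult_left_mono split: nat.splits)

lemma ge_peval: "u \<in> Places ==> ge u 0 x ==> ge u 0 (peval k p x)"
 by (induction p) (auto intro!: ge_add ge_const ge_mult0)

lemma ge_prime: "u \<in> Places ==> ge u 0 x ==> ge u 0 y ==> ge u 1 (x * y) ==> ge u 1 x \<or> ge u 1 y"
 using place_mult[of u x y] unfolding ge_def by (cases "x = 0"; cases "y = 0") auto

lemma ge1_const: "u \<in> Places ==> ge u 1 (k c) ==> c = 0"
 using place_const[of u c] by (cases "c = 0") (auto simp: ge_def)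

lemma ge_divide: "u \<in> Places ==> ge u n x ==> y \<in> K ==> y ~= 0 ==> ge u (n - u y) (x / y)"
 using place_divide[of u x y] K_divide[of x y] unfolding ge_def by (cases "x = 0") auto

text \<open>An algebraic element has no poles: its powers have different orders at a pole.\<close>

lemma algebraic_no_pole:
 assumes u: "u \<in> Places" and x: "x \<in> K" and p: "p ~= 0" "peval k p x = 0"
 shows "ge u 0 x"
proof (rule ccontr)
 assume "\<not> ge u 0 x"
 then have x0: "x ~= 0" "u x < 0" using x unfolding ge_def by auto
 let ?n = "degree p"
 have n: "?n ~= 0"
 proof
  assume "?n = 0"
  then obtain c where "p = [:c:]" using degree_eq_zeroE by blast
  then show False using p by simp
 qed
 have lc: "k (lead_coeff p) ~= 0" using p by simp
 have "0 = (\<Sum>i\<le>?n. k (coeff p i) * x ^ i)" unfolding peval_sum_le[OF order.refl, symmetric] p(2) ..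
 also have "\<dots> = k (lead_coeff p) * x ^ ?n + (\<Sum>i<?n. k (coeff p i) * x ^ i)"
  by (simp flip: lessThan_Suc_atMost)
 finally have "k (lead_coeff p) * x ^ ?n = - (\<Sum>i<?n. k (coeff p i) * x ^ i)"
  by (simp add: eq_neg_iff_add_eq_0)
 moreover have "ge u (int (?n - 1) * u x) (- (\<Sum>i<?n. k (coeff p i) * x ^ i))"
 proof (intro ge_uminus ge_sum ge_scale u)
  fix i assume "i \<in> {..<?n}"
  then have "int (?n - 1) * u x \<le> int i * u x" using x0(2) by (intro mult_right_mono_neg) auto
  then show "ge u (int (?n - 1) * u x) (x ^ i)"
   using place_power[OF u x x0(1)] K.D_power[OF x] by (simp add: ge_def)
 qed
 ultimately have "ge u (int (?n - 1) * u x) (k (lead_coeff p) * x ^ ?n)" by simp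
 then have "int (?n - 1) * u x \<le> int ?n * u x"
  using lc x0 by (simp add: ge_def place_mult[OF u] place_power[OF u] place_const[OF u] K_const K.D_power x p(1))
 then show False using n x0(2) by (simp add: of_nat_diff algebra_simps)
qed

text \<open>A relation over \<open>k[y]\<close> with \<open>y\<close> in the maximal ideal of \<open>u\<close> reduces to a relation over \<open>k\<close>
 between residues. So the degree of a place is at most the degree of \<open>K\<close> over \<open>k(y)\<close>.\<close>

lemma residue_dependence:
 fixes N :: nat
 assumes u: "u \<in> Places" and y: "y ~= 0" "ge u 1 y" "finite_over y N"
  and z: "\<And>j. j \<le> N ==> ge u 0 (z j)"
 shows "\<exists>c. (\<exists>j\<le>N. c j ~= 0) \<and> ge u 1 (\<Sum>j\<le>N. k (c j) * z j)"
proof -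
 obtain \<phi> where \<phi>: "\<exists>j\<le>N. coeff (\<phi> j) 0 ~= 0" "(\<Sum>j\<le>N. peval k (\<phi> j) y * z j) = 0"
  using primitive_relation[OF y(1,3), of z] z ge_K by blast
 have y0: "ge u 0 y" using ge_mono[OF y(2)] by simp
 have r: "ge u 1 ((peval k p y - k (coeff p 0)) * t)" if "ge u 0 t" for p t
 proof (cases p)
  case (pCons a q)
  have "ge u 1 ((peval k q y * t) * y)" by (intro ge_mult0 ge_peval u y0 y that)
  then show ?thesis using pCons by (simp add: ac_simps)
 qed
 have "(\<Sum>j\<le>N. k (coeff (\<phi> j) 0) * z j)
   = (\<Sum>j\<le>N. peval k (\<phi> j) y * z j) - (\<Sum>j\<le>N. (peval k (\<phi> j) y - k (coeff (\<phi> j) 0)) * z j)"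
  unfolding sum_subtractf[symmetric] by (rule sum.cong) (simp_all add: left_diff_distrib)
 moreover have "ge u 1 \<dots>" unfolding \<phi>(2) by (intro ge_diff ge_sum u ge_0 r z) simp
 ultimately show ?thesis using \<phi>(1) by (intro exI[of _ "\<lambda>j. coeff (\<phi> j) 0"]) simp
qed

lemma residue_polynomial:
 assumes u: "u \<in> Places" and y: "y ~= 0" "ge u 1 y" "finite_over y N" and x: "ge u 0 x"
 shows "\<exists>p. p ~= 0 \<and> degree p \<le> N \<and> ge u 1 (peval k p x)"
proof -
 have "ge u 0 (x ^ j)" for j using ge_power[OF u x, of j] by simp
 then obtain c where c: "\<exists>j\<le>N. c j ~= 0" "ge u 1 (\<Sum>j\<le>N. k (c j) * x ^ j)"
  using residue_dependence[OF u y, of "\<lambda>j. x ^ j"] by blast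
 let ?p = "\<Sum>j\<le>N. Polynomial.monom (c j) j"
 have co: "coeff ?p i = (if i \<le> N then c i else 0)" for i
  by (simp add: coeff_sum)
 have "?p ~= 0" using c(1) co by (metis coeff_0)
 moreover have "degree ?p \<le> N" by (rule degree_le) (simp add: co)
 moreover have "peval k ?p x = (\<Sum>j\<le>N. k (c j) * x ^ j)" by (simp add: peval_sum)
 ultimately show ?thesis using c(2) by auto
qed

end

subsection \<open>Factorization of quartics over a real closed field\<close>

lemma ex_root_odd_degree:
 fixes p :: "'a::real_closed_field poly"
 assumes "odd (degree p)"
 shows "\<exists>x. poly p x = 0"
proof -
 have "coeff p (degree p) ~= 0" using assms by (cases "p = 0") auto
 then show ?thesis using odd_degree_imp_root[OF assms, of "coeff p"] by (simp add: poly_altdef)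
qed

text \<open>A monic cubic with negative constant term has a positive root: if some root is negative, the
 product of the other two is negative, and so these are real of opposite signs.\<close>

lemma ex_pos_root_cubic:
 fixes e :: "'a::real_closed_field"
 assumes "e > 0"
 shows "\<exists>z>0. z ^ 3 + b * z ^ 2 + c * z - e = 0"
proof -
 obtain z where z: "poly [:- e, c, b, 1:] z = 0" using ex_root_odd_degree[of "[:- e, c, b, 1:]"] by auto
 have root: "z ^ 3 + b * z ^ 2 + c * z - e = 0"
  using z by (simp add: power2_eq_square power3_eq_cube algebra_simps)
 have z0: "z ~= 0" using root assms by auto
 show ?thesis
 proof (cases "z > 0")
  case False
  then have zn: "z < 0" using z0 by simp
  define q where "q = z ^ 2 + b * z + c"
  have qz: "q * z = e" using root by (simp add: q_def power2_eq_square power3_eq_cube algebra_simps)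
  then have "q < 0" using zn assms by (metis less_asym' zero_less_mult_iff)
  have "0 \<le> (z + b) ^ 2" by simp
  then have "0 \<le> (z + b) ^ 2 - 4 * q" using \<open>q < 0\<close> by linarith
  then obtain s where s: "s \<ge> 0" "s ^ 2 = (z + b) ^ 2 - 4 * q" using nonneg_sqrt by blast
  have "s ^ 2 > (z + b) ^ 2" using s(2) \<open>q < 0\<close> by simp
  then have "\<bar>z + b\<bar> < s" using s(1) power2_less_imp_less[of "\<bar>z + b\<bar>" s] by (simp add: power2_less_imp_less)
  then have "(s - (z + b)) / 2 > 0" by auto
  moreover define y where "y = (s - (z + b)) / 2"
  moreover have "y ^ 2 + (z + b) * y + q = 0"
  proof -
   have "4 * (y ^ 2 + (z + b) * y + q) = s ^ 2 - ((z + b) ^ 2 - 4 * q)"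
    unfolding y_def by (simp add: power2_eq_square field_simps)
   then show ?thesis using s(2) by simp
  qed
  moreover have "y ^ 3 + b * y ^ 2 + c * y - e = (y - z) * (y ^ 2 + (z + b) * y + q)"
   using qz unfolding q_def by (simp add: power2_eq_square power3_eq_cube algebra_simps)
  ultimately show ?thesis by (metis mult_zero_right)
 qed (use root in auto)
qed

text \<open>Ferrari's method: \<open>u\<^sup>2\<close> is a positive root of the resolvent cubic.\<close>

lemma depressed_quartic_factors:
 fixes p q r :: "'a::real_closed_field"
 shows "\<exists>u s t. s + t - u ^ 2 = p \<and> u * (t - s) = q \<and> s * t = r"
proof (cases "q = 0")
 case True
 show ?thesis
 proof (cases "p ^ 2 - 4 * r \<ge> 0")
  case True
  then obtain d where d: "d ^ 2 = p ^ 2 - 4 * r" using nonneg_sqrt by blast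
  have "((p + d) / 2) * ((p - d) / 2) = r"
   using d by (simp add: power2_eq_square field_simps)
  then show ?thesis using \<open>q = 0\<close>
   by (intro exI[of _ 0] exI[of _ "(p + d) / 2"] exI[of _ "(p - d) / 2"]) (simp add: field_simps)
 next
  case False
  then have "4 * r > p ^ 2" by simp
  moreover have "p ^ 2 \<ge> 0" by simp
  ultimately have "r \<ge> 0" by linarith
  then obtain s where s: "s \<ge> 0" "s ^ 2 = r" using nonneg_sqrt by blast
  have "(2 * s) ^ 2 > p ^ 2" using \<open>4 * r > p ^ 2\<close> s by (simp add: power_mult_distrib)
  then have "2 * s > \<bar>p\<bar>" using s(1) power2_less_imp_less[of "\<bar>p\<bar>" "2 * s"] by simp
  then have "2 * s - p \<ge> 0" by auto
  then obtain u where "u ^ 2 = 2 * s - p" using nonneg_sqrt by blast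
  then show ?thesis using s \<open>q = 0\<close> by (intro exI[of _ u] exI[of _ s]) (simp add: power2_eq_square)
 qed
next
 case False
 then have "q ^ 2 > 0" by simp
 then obtain z where z: "z > 0" "z ^ 3 + (2 * p) * z ^ 2 + (p ^ 2 - 4 * r) * z - q ^ 2 = 0"
  using ex_pos_root_cubic by blast
 obtain u where u: "u > 0" "u ^ 2 = z" using pos_sqrt[OF z(1)] by blast
 define s where "s = (p + u ^ 2 - q / u) / 2"
 define t where "t = (p + u ^ 2 + q / u) / 2"
 have "s + t - u ^ 2 = p" "u * (t - s) = q" using u(1) by (simp_all add: s_def t_def field_simps)
 moreover have "s * t = r"
 proof -
  have "4 * u ^ 2 * (s * t) = u ^ 2 * (p + u ^ 2) ^ 2 - q ^ 2"
   using u(1) unfolding s_def t_def by (simp add: power2_eq_square field_simps)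
  also have "\<dots> = 4 * u ^ 2 * r"
   using z(2) unfolding u(2) by (simp add: power2_eq_square power3_eq_cube algebra_simps)
  finally show ?thesis using u(1) by simp
 qed
 ultimately show ?thesis by blast
qed

text \<open>A translation removes the cubic term.\<close>

lemma degree_le_4_factors:
 fixes p :: "'a::real_closed_field poly"
 assumes "degree p \<le> 4"
 shows "\<exists>q r. p = q * r \<and> degree q \<le> 2 \<and> degree r \<le> 2"
proof -
 consider "degree p \<le> 2" | "degree p = 3" | "degree p = 4" using assms by linarith
 then show ?thesis
 proof cases
  case 1
  then show ?thesis by (intro exI[of _ p] exI[of _ 1]) simp
 next
  case 2
  then obtain x where "poly p x = 0" using ex_root_odd_degree[of p] by auto
  then obtain q where q: "p = [:- x, 1:] * q" unfolding poly_eq_0_iff_dvd by blast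
  then have "degree p = 1 + degree q"
   using 2 by (subst q, subst degree_mult_eq) auto
  then show ?thesis using q 2 by (intro exI[of _ "[:- x, 1:]"] exI[of _ q]) simp
 next
  case 3
  define a where "a = coeff p 4"
  have "p ~= 0" using 3 by auto
  then have a0: "a ~= 0" using 3 unfolding a_def by (metis leading_coeff_0_iff)
  define h where "h = coeff p 3 / (4 * a)"
  define g where "g = pcompose p [:- h, 1:]"
  have pg: "p = pcompose g [:h, 1:]"
   unfolding g_def by (simp add: pcompose_pCons flip: pcompose_assoc)
  have h: "coeff p 3 = 4 * a * h" using a0 by (simp add: h_def)
  have pe: "p = [:coeff p 0, coeff p 1, coeff p 2, 4 * a * h, a:]"
   using 3 unfolding a_def h[unfolded a_def, symmetric]
   by (intro poly_eqI) (auto simp: coeff_pCons numeral_eq_Suc coeff_eq_0 split: nat.splits)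
  have "\<exists>c0 c1 c2. g = [:c0, c1, c2, 0, a:]"
   unfolding g_def
   by (subst pe, simp add: pcompose_pCons algebra_simps)
    (rule conjI | rule exI | rule diff_add_cancel[symmetric])+
  then obtain c0 c1 c2 where g: "g = [:c0, c1, c2, 0, a:]" by blast
  obtain u s t where ust: "s + t - u ^ 2 = c2 / a" "u * (t - s) = c1 / a" "s * t = c0 / a"
   using depressed_quartic_factors by blast
  have c: "c2 = a * (s + t - u ^ 2)" "c1 = a * (u * (t - s))" "c0 = a * (s * t)"
   unfolding ust using a0 by simp_all
  have "g = smult a [:s, u, 1:] * [:t, - u, 1:]"
   unfolding g c by (simp add: power2_eq_square algebra_simps)
  then have "p = pcompose (smult a [:s, u, 1:]) [:h, 1:] * pcompose [:t, - u, 1:] [:h, 1:]"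
   using pg by (simp only: pcompose_mult)
  moreover have "degree (pcompose (smult a [:s, u, 1:]) [:h, 1:]) \<le> 2"
   "degree (pcompose [:t, - u, 1:] [:h, 1:]) \<le> 2"
   using a0 by (simp_all only: degree_pcompose) auto
  ultimately show ?thesis by blast
 qed
qed

lemma quadratic_root_or_definite:
 fixes c0 :: "'a::real_closed_field"
 assumes "c2 ~= 0"
 shows "(\<exists>x. c0 + c1 * x + c2 * x ^ 2 = 0) \<or>
  (\<exists>a b. b ~= 0 \<and> c0 = c2 * (a ^ 2 + b ^ 2) \<and> c1 = - 2 * c2 * a)"
proof -
 define a where "a = - c1 / (2 * c2)"
 define d where "d = c0 / c2 - a ^ 2"
 have c1: "c1 = - 2 * c2 * a" unfolding a_def using assms by simp
 have c0: "c0 = c2 * (a ^ 2 + d)" unfolding d_def using assms by simp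
 show ?thesis
 proof (cases "d > 0")
  case True
  then obtain b where "b > 0" "b ^ 2 = d" using pos_sqrt by blast
  then show ?thesis using c0 c1 by (intro disjI2 exI[of _ a] exI[of _ b]) auto
 next
  case False
  then obtain s where s: "s ^ 2 = - d" using nonneg_sqrt[of "- d"] by auto
  have "c0 + c1 * (a + s) + c2 * (a + s) ^ 2 = c2 * (d + s ^ 2)"
   unfolding c0 c1 by (simp add: power2_eq_square algebra_simps)
  then show ?thesis unfolding s by (metis add.right_inverse mult_zero_right)
 qed
qed

section \<open>Function fields over a real closed field in which -1 is not a square\<close>

locale real_function_field = rcf_hom k + subfield_over k K
 for k :: "'a::real_closed_field => 'b::field" and K +
 assumes no_i: "x \<in> K ==> x ^ 2 ~= - 1"
  and ex_finite_over: "x \<in> K ==> \<exists>N. finite_over x N"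
  and ex_degree_le_4: "\<exists>z\<in>K. (\<forall>p. peval k p z = 0 \<longrightarrow> p = 0) \<and> finite_over (inverse z) 4"
begin

text \<open>A place at which some element of degree at most four vanishes has residue field \<open>R\<close> or
 \<open>R(\<surd>-1)\<close>, because quartics over \<open>R\<close> are products of quadratic polynomials.\<close>

lemma residue_cases:
 assumes u: "u \<in> Places" and y: "y ~= 0" "ge u 1 y" "finite_over y 4" and x: "ge u 0 x"
 shows "(\<exists>c. ge u 1 (x - k c)) \<or> (\<exists>a b. b ~= 0 \<and> ge u 1 ((x - k a) ^ 2 + k (b ^ 2)))"
proof -
 obtain p where p: "p ~= 0" "degree p \<le> 4" "ge u 1 (peval k p x)"
  using residue_polynomial[OF u y x] by blast
 obtain q r where qr: "p = q * r" "degree q \<le> 2" "degree r \<le> 2"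
  using degree_le_4_factors[OF p(2)] by blast
 have "ge u 1 (peval k q x) \<or> ge u 1 (peval k r x)"
  using ge_prime[OF u ge_peval[OF u x] ge_peval[OF u x], of q r] p(3) by (simp add: qr(1))
 then obtain g where g: "g ~= 0" "degree g \<le> 2" "ge u 1 (peval k g x)"
  using p(1) qr by auto
 have linear: "\<exists>c. ge u 1 (x - k c)" if h: "[:c0, c1:] ~= 0" "ge u 1 (peval k [:c0, c1:] x)" for c0 c1
 proof -
  have c1: "c1 ~= 0"
   using h ge1_const[OF u, of c0] by auto
  have "ge u 1 (k (inverse c1) * peval k [:c0, c1:] x)" by (rule ge_scale[OF u h(2)])
  moreover have "k (inverse c1) * peval k [:c0, c1:] x = x - k (- c0 / c1)"
   using c1 by (simp add: field_simps)
  ultimately show ?thesis by metis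
 qed
 obtain c0 c1 c2 where ge: "g = [:c0, c1, c2:]" using degree_le_2E[OF g(2)] by blast
 show ?thesis
 proof (cases "c2 = 0")
  case True
  then show ?thesis using linear[of c0 c1] g ge by simp
 next
  case c2: False
  then consider z where "c0 + c1 * z + c2 * z ^ 2 = 0"
   | a b where "b ~= 0" "c0 = c2 * (a ^ 2 + b ^ 2)" "c1 = - 2 * c2 * a"
   using quadratic_root_or_definite[OF c2, of c0 c1] by blast
  then show ?thesis
  proof cases
   case 1
   have gx: "g = [:- z, 1:] * [:c1 + c2 * z, c2:]"
    unfolding ge using 1 by (simp add: power2_eq_square algebra_simps eq_neg_iff_add_eq_0)
   have "ge u 1 (peval k [:- z, 1:] x) \<or> ge u 1 (peval k [:c1 + c2 * z, c2:] x)"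
    using ge_prime[OF u ge_peval[OF u x] ge_peval[OF u x], of "[:- z, 1:]" "[:c1 + c2 * z, c2:]"] g(3)
    by (simp only: gx peval_mult)
   then show ?thesis using linear[of "- z" 1] linear[of "c1 + c2 * z" c2] c2 by auto
  next
   case 2
   have "peval k g x = k c2 * ((x - k a) ^ 2 + k (b ^ 2))"
   proof -
    have "peval k g x = k c0 + x * (k c1 + x * k c2)" by (simp add: ge)
    moreover have "k c0 = k c2 * (k a ^ 2 + k b ^ 2)" "k c1 = - (2 * k c2 * k a)" by (simp_all add: 2)
    ultimately have "peval k g x = k c2 * (k a ^ 2 + k b ^ 2) + x * (- (2 * k c2 * k a) + x * k c2)"
     by simp
    also have "\<dots> = k c2 * ((x - k a) ^ 2 + k b ^ 2)" by (rule complete_square)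
    finally show ?thesis by simp
   qed
   then have "ge u 1 (k (inverse c2) * (k c2 * ((x - k a) ^ 2 + k (b ^ 2))))"
    using ge_scale[OF u g(3), of "inverse c2"] by (simp only:)
   moreover have "k (inverse c2) * (k c2 * ((x - k a) ^ 2 + k (b ^ 2))) = (x - k a) ^ 2 + k (b ^ 2)"
    using c2 by simp
   ultimately have "ge u 1 ((x - k a) ^ 2 + k (b ^ 2))" by (simp only:)
   then show ?thesis using 2(1) by blast
  qed
 qed
qed

lemma ex_low_degree_place: "\<exists>u y. u \<in> Places \<and> y ~= 0 \<and> ge u 1 y \<and> finite_over y 4"
proof -
 obtain z where z: "z \<in> K" "\<And>p. peval k p z = 0 ==> p = 0" "finite_over (inverse z) 4"
  using ex_degree_le_4 by blast
 have z0: "z ~= 0" using z(2)[of "[:0, 1:]"] by auto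
 obtain u where u: "is_place u" "u (inverse z) > 0" using place_exists[OF z] by blast
 have "ge (restrict u (K - {0})) 1 (inverse z)" using u(2) z(1) z0 by (simp add: ge_def K_inverse)
 then show ?thesis using Places_restrict[OF u(1)] z z0 by (intro exI[of _ "restrict u (K - {0})"] exI[of _ "inverse z"]) simp
qed

text \<open>The minimal polynomial of an algebraic element is its minimal polynomial modulo a place, so it
 has degree at most two; it has no quadratic factor because \<open>K\<close> does not contain \<open>\<surd>-1\<close>.\<close>

lemma algebraic_imp_const:
 assumes x: "x \<in> K" and p: "p ~= 0" "peval k p x = 0"
 shows "x \<in> range k"
proof -
 obtain u y where u: "u \<in> Places" and y: "y ~= 0" "ge u 1 y" "finite_over y 4"
  using ex_low_degree_place by blast
 have xu: "ge u 0 x" by (rule algebraic_no_pole[OF u x p])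
 obtain p where p: "p ~= 0" "peval k p x = 0"
  and min: "\<And>q. degree q < degree p ==> q ~= 0 ==> peval k q x ~= 0"
 proof -
  let ?P = "\<lambda>p. p ~= 0 \<and> peval k p x = 0"
  have "\<exists>q. ?P q \<and> (\<forall>r. ?P r \<longrightarrow> degree q \<le> degree r)"
   using p by (intro ex_has_least_nat[of ?P p degree]) blast
  then show thesis using that by (metis not_le)
 qed
 from residue_cases[OF u y xu] show ?thesis
 proof (elim disjE exE conjE)
  fix c assume c: "ge u 1 (x - k c)"
  obtain q where q: "p = [:- c, 1:] * q + [:poly p c:]"
   using synthetic_div_correct'[of c p] by metis
  have "peval k p x = (x - k c) * peval k q x + k (poly p c)"
   by (subst q) (simp del: mult_pCons_left)
  then have e: "k (poly p c) = - ((x - k c) * peval k q x)" using p(2) by (simp add: eq_neg_iff_add_eq_0 add.commute)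
  have "ge u 1 (peval k q x * (x - k c))" by (intro ge_mult0 ge_peval u xu c)
  then have "ge u 1 (k (poly p c))" unfolding e by (intro ge_uminus u) (simp add: mult.commute)
  then have pc: "poly p c = 0" by (rule ge1_const[OF u])
  have q0: "q ~= 0" using p(1) q pc by auto
  have "degree p = Suc (degree q)"
   using q q0 pc by (metis degree_pCons_eq_if degree_mult_eq add.right_neutral pCons_0_0 one_neq_zero plus_1_eq_Suc mult_zero_left pCons_eq_0_iff)
  then have "peval k q x ~= 0" using min[of q] q0 by simp
  then show ?thesis using e pc by auto
 next
  fix a b :: 'a assume ab: "b ~= 0" "ge u 1 ((x - k a) ^ 2 + k (b ^ 2))"
  let ?D = "[:a ^ 2 + b ^ 2, - 2 * a, 1:]"
  have Dx: "peval k ?D x = (x - k a) ^ 2 + k (b ^ 2)" by (simp add: power2_eq_square algebra_simps)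
  define q where "q = p div ?D"
  define r where "r = p mod ?D"
  have qr: "p = q * ?D + r" by (simp only: q_def r_def div_mult_mod_eq)
  have dr: "degree r < 2"
   using degree_mod_less[of ?D p] by (auto simp: r_def)
  obtain r0 r1 where r: "r = [:r0, r1:]"
  proof
   show "r = [:coeff r 0, coeff r 1:]"
    using dr by (intro poly_eqI) (auto simp: coeff_pCons coeff_eq_0 split: nat.splits)
  qed
  have px: "peval k p x = peval k q x * ((x - k a) ^ 2 + k (b ^ 2)) + peval k r x"
   by (subst qr) (simp only: peval_add peval_mult Dx)
  have rx: "ge u 1 (peval k r x)"
  proof -
   have "peval k r x = - (peval k q x * ((x - k a) ^ 2 + k (b ^ 2)))"
    using px p(2) by (simp add: eq_neg_iff_add_eq_0 add.commute)
   moreover have "ge u 1 \<dots>" by (intro ge_uminus ge_mult0 ge_peval u xu ab)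
   ultimately show ?thesis by simp
  qed
  have "r1 = 0"
  proof (rule ccontr)
   assume r1: "r1 ~= 0"
   define c where "c = - r0 / r1"
   have "ge u 1 (k (inverse r1) * peval k r x)" by (rule ge_scale[OF u rx])
   moreover have "k (inverse r1) * peval k r x = x - k c" unfolding r c_def using r1 by (simp add: field_simps)
   ultimately have "ge u 1 (x - k c)" by simp
   then have "ge u 1 ((x + k c - k (2 * a)) * (x - k c))"
    by (rule ge_mult0[OF u, rotated]) (intro ge_diff ge_add ge_const u xu)
   then have "ge u 1 ((x - k a) ^ 2 + k (b ^ 2) - (x + k c - k (2 * a)) * (x - k c))"
    by (rule ge_diff[OF u ab(2)])
   moreover have "(x - k a) ^ 2 + k (b ^ 2) - (x + k c - k (2 * a)) * (x - k c) = k ((c - a) ^ 2 + b ^ 2)"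
    using square_difference[of x "k a" "k b" "k c"] by simp
   ultimately have "(c - a) ^ 2 + b ^ 2 = 0" using ge1_const[OF u] by metis
   then show False using ab(1) by (simp add: sum_power2_eq_zero_iff)
  qed
  then have "r = 0" using r rx ge1_const[OF u, of r0] by simp
  then have e: "peval k q x * ((x - k a) ^ 2 + k (b ^ 2)) = 0" using px p(2) by simp
  have q0: "q ~= 0" using qr \<open>r = 0\<close> p(1) by auto
  have "degree p = 2 + degree q"
   using qr \<open>r = 0\<close> q0 degree_mult_eq[of ?D q] by simp
  then have "peval k q x ~= 0" using min[of q] q0 by simp
  then have s: "(x - k a) ^ 2 = - ((k b) ^ 2)" using e by (simp add: eq_neg_iff_add_eq_0)
  have "((x - k a) / k b) ^ 2 = - 1" using ab(1) s by (simp add: power_divide)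
  moreover have "(x - k a) / k b \<in> K" by (intro K_divide K_diff K_const x)
  ultimately show ?thesis using no_i by blast
 qed
qed

lemma nonconst_imp_transcendental: "x \<in> K ==> x \<notin> range k ==> peval k p x = 0 ==> p = 0"
 using algebraic_imp_const by blast

lemma regular_imp_const:
 assumes x: "x \<in> K" and reg: "\<And>u. u \<in> Places ==> ge u 0 x"
 shows "x \<in> range k"
proof (rule ccontr)
 assume "x \<notin> range k"
 then have tr: "\<And>p. peval k p x = 0 ==> p = 0" using nonconst_imp_transcendental[OF x] by blast
 have x0: "x ~= 0" using tr[of "[:0, 1:]"] by auto
 obtain N where "finite_over (inverse x) N" using ex_finite_over[OF K_inverse[OF x]] by blast
 then obtain u where u: "is_place u" "u (inverse x) > 0" using place_exists[OF x tr] by blast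
 let ?u = "restrict u (K - {0})"
 have "?u (inverse x) = - ?u x" by (rule place_inverse[OF Places_restrict[OF u(1)] x x0])
 then show False using reg[OF Places_restrict[OF u(1)]] u(2) x x0 by (simp add: ge_def K_inverse)
qed

lemma regular_vanishing_imp_0:
 assumes x: "x \<in> K" and reg: "\<And>u. u \<in> Places ==> ge u 0 x" and van: "u \<in> Places" "ge u 1 x"
 shows "x = 0"
 using regular_imp_const[OF x reg] ge1_const[OF van(1)] van(2) by auto

end

section \<open>Dimensions in the function field and its residue fields\<close>

text \<open>A bound on the size of independent lists makes a vector space finite dimensional.\<close>

lemma (in ring) dimension_bounded:
 fixes m :: nat
 assumes K: "subfield K R" and E: "\<And>Us. set Us \<subseteq> E ==> Span K Us \<subseteq> E" "E \<subseteq> carrier R"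
  and bound: "\<And>Us. independent K Us ==> set Us \<subseteq> E ==> length Us \<le> m"
 shows "\<exists>n\<le>m. dimension n K E"
proof -
 let ?P = "\<lambda>n. \<exists>Us. independent K Us \<and> set Us \<subseteq> E \<and> length Us = n"
 have "?P 0" by auto
 moreover have "\<And>n. ?P n ==> n \<le> m" using bound by blast
 ultimately obtain n where n: "?P n" "\<And>n'. ?P n' ==> n' \<le> n"
  using Nat.ex_has_greatest_nat[of ?P 0 m] by blast
 then obtain Us where Us: "independent K Us" "set Us \<subseteq> E" "length Us = n" by blast
 have "x \<in> Span K Us" if x: "x \<in> E" for x
 proof (rule ccontr)
  assume "x \<notin> Span K Us"
  then have "independent K (x # Us)" using E(2) x by (intro li_Cons Us) auto
  then have "?P (Suc n)" using Us x by (intro exI[of _ "x # Us"]) auto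
  then show False using n(2) by fastforce
 qed
 then have "Span K Us = E" using E(1)[OF Us(2)] by blast
 then have "dimension n K E" using dimensionI[OF K Us(1)] Us(3) by blast
 moreover have "n \<le> m" using bound[OF Us(1,2)] Us(3) by simp
 ultimately show ?thesis by blast
qed

lemma (in ring) dimension_carrier_one:
 assumes K: "subfield K R" and d: "dimension 1 K (carrier R)" and nz: "\<one> ~= \<zero>"
 shows "carrier R = K"
proof -
 have ind: "independent K [\<one>]" using nz by (intro li_Cons) auto
 have "Span K [\<one>] = carrier R"
  using independent_length_eq_dimension[OF K d ind] by simp
 moreover have "Span K [\<one>] = K"
  using line_extension_mem_iff[of _ K \<one> "{\<zero>}"] subfieldE(3)[OF K] by (auto simp add: rev_subsetD)
 ultimately show ?thesis by simp
qed

text \<open>A ring whose operations are the images, under \<open>\<rho>\<close>, of those of a subring of a field. This covers both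
 the abstract function field and its residue fields.\<close>

locale image_ring = subring_of k D for k :: "'a::field => 'b::field" and D +
 fixes \<rho> :: "'b => 'r" and A :: "('r, 'm) ring_scheme" (structure)
 assumes carrier_image: "carrier A = \<rho> ` D"
  and image_add: "x \<in> D ==> y \<in> D ==> \<rho> x \<oplus> \<rho> y = \<rho> (x + y)"
  and image_mult: "x \<in> D ==> y \<in> D ==> \<rho> x \<otimes> \<rho> y = \<rho> (x * y)"
  and image_0: "\<zero> = \<rho> 0" and image_1: "\<one> = \<rho> 1"
begin

lemma image_cring: "cring A"
proof (rule cringI)
 show "abelian_group A"
 proof (rule abelian_groupI)
  fix x assume "x \<in> carrier A"
  then obtain a where "x = \<rho> a" "a \<in> D" by (auto simp: carrier_image)
  then show "\<exists>y\<in>carrier A. y \<oplus> x = \<zero>"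
   using D_uminus[of a] by (intro bexI[of _ "\<rho> (- a)"]) (simp_all add: carrier_image image_add image_0)
 qed (auto simp: carrier_image image_0 image_add D_0 D_add add_ac)
 show "comm_monoid A"
  by (rule comm_monoidI) (auto simp: carrier_image image_1 image_mult D_1 D_mult mult_ac)
 show "(x \<oplus> y) \<otimes> z = x \<otimes> z \<oplus> y \<otimes> z" if "x \<in> carrier A" "y \<in> carrier A" "z \<in> carrier A" for x y z
  using that by (auto simp: carrier_image image_add image_mult D_add D_mult distrib_right)
qed

lemma image_uminus: "x \<in> D ==> \<ominus> \<rho> x = \<rho> (- x)"
proof -
 interpret cring A by (rule image_cring)
 assume x: "x \<in> D"
 show ?thesis
  by (rule minus_equality) (use x D_uminus[of x] in \<open>auto simp: carrier_image image_add image_0\<close>)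
qed

lemma image_combine: "length cs = length xs ==> set cs \<subseteq> D ==> set xs \<subseteq> D ==>
  ring.combine A (map \<rho> cs) (map \<rho> xs) = \<rho> (\<Sum>j<length xs. cs ! j * xs ! j)
  \<and> (\<Sum>j<length xs. cs ! j * xs ! j) \<in> D"
proof (induction cs xs rule: list_induct2)
 case Nil
 interpret cring A by (rule image_cring)
 show ?case by (simp add: image_0 D_0)
next
 case (Cons c cs x xs)
 interpret cring A by (rule image_cring)
 have "(\<Sum>j<length (x # xs). (c # cs) ! j * (x # xs) ! j) = c * x + (\<Sum>j<length xs. cs ! j * xs ! j)"
  by (simp add: sum.lessThan_Suc_shift del: sum.lessThan_Suc)
 then show ?case using Cons by (auto simp: image_mult image_add D_mult D_add)
qed

end

locale image_field = image_ring +
 assumes image_inverse: "x \<in> D ==> \<rho> x ~= \<rho> 0 ==> \<exists>y\<in>D. \<rho> (x * y) = \<rho> 1"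
  and image_nontrivial: "\<rho> 1 ~= \<rho> 0"
begin

lemma image_is_field: "field A"
proof -
 interpret cring A by (rule image_cring)
 show ?thesis
 proof (rule cring_fieldI, intro equalityI subsetI)
  fix x assume x: "x \<in> Units A"
  have "x ~= \<zero>"
  proof
   assume "x = \<zero>"
   then have "\<one> = \<zero>" using x by (auto simp: Units_def)
   then show False using image_nontrivial by (simp add: image_0 image_1)
  qed
  then show "x \<in> carrier A - {\<zero>}" using x by auto
 next
  fix x assume "x \<in> carrier A - {\<zero>}"
  then obtain a where a: "x = \<rho> a" "a \<in> D" "\<rho> a ~= \<rho> 0" by (auto simp: carrier_image image_0)
  then obtain b where b: "b \<in> D" "\<rho> (a * b) = \<rho> 1" using image_inverse by blast
  have "x \<otimes> \<rho> b = \<one>" using a b by (simp add: image_mult image_1)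
  moreover have "\<rho> b \<in> carrier A" "x \<in> carrier A" using a b by (simp_all add: carrier_image)
  ultimately show "x \<in> Units A" using m_comm[of x "\<rho> b"] unfolding Units_def by auto
 qed
qed

definition const_field where "const_field = \<rho> ` range k"

lemma const_subfield: "subfield const_field A"
proof -
 interpret F: field A by (rule image_is_field)
 have rk: "subring_of k (range k)"
  by unfold_locales (auto simp flip: hom_add hom_mult hom_minus)
 have "image_field k (range k) \<rho> (A\<lparr>carrier := const_field\<rparr>)"
 proof (intro image_field.intro image_ring.intro rk image_ring_axioms.intro image_field_axioms.intro)
  fix x assume x: "x \<in> range k" "\<rho> x ~= \<rho> 0"
  then obtain c where c: "x = k c" "c ~= 0" by (metis hom_0 rangeE)
  have "x * k (inverse c) = 1" using c by simp
  then show "\<exists>y\<in>range k. \<rho> (x * y) = \<rho> 1" by (metis rangeI)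
 qed (auto simp: const_field_def image_add image_mult D_const image_0 image_1 image_nontrivial)
 then have "field (A\<lparr>carrier := const_field\<rparr>)" by (rule image_field.image_is_field)
 moreover have "const_field \<subseteq> carrier A" unfolding const_field_def carrier_image using D_const by auto
 ultimately show ?thesis by (rule F.subfield_iff(1))
qed

text \<open>Lists of elements and of scalars are lifted along \<open>\<rho>\<close>.\<close>

lemma image_dimension_bounded:
 fixes m :: nat
 assumes E: "E \<subseteq> D" "0 \<in> E" "\<And>x y. x \<in> E ==> y \<in> E ==> x + y \<in> E" "\<And>c x. x \<in> E ==> k c * x \<in> E"
  and dep: "\<And>z. (\<And>j. j \<le> m ==> z j \<in> E) ==> \<exists>c. (\<exists>j\<le>m. c j ~= 0) \<and> \<rho> (\<Sum>j\<le>m. k (c j) * z j) = \<rho> 0"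
 shows "\<exists>n\<le>m. ring.dimension A n const_field (\<rho> ` E)"
proof -
 interpret F: field A by (rule image_is_field)
 have Esum: "sum g I \<in> E" if "\<And>i. i \<in> I ==> g i \<in> E" for g and I :: "nat set"
  using that by (induction I rule: infinite_finite_induct) (auto intro: E)
 have lift: "\<exists>xs. Us = map \<rho> xs \<and> set xs \<subseteq> T" if "set Us \<subseteq> \<rho> ` T" for Us T
  using that
 proof (induction Us)
  case (Cons u Us)
  then obtain xs x where "Us = map \<rho> xs" "set xs \<subseteq> T" "x \<in> T" "u = \<rho> x" by auto
  then show ?case by (intro exI[of _ "x # xs"]) auto
 qed auto
 show ?thesis
 proof (rule F.dimension_bounded[OF const_subfield])
  show EA: "\<rho> ` E \<subseteq> carrier A" using E(1) by (auto simp: carrier_image)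
  fix Us assume Us: "set Us \<subseteq> \<rho> ` E"
  then obtain xs where xs: "Us = map \<rho> xs" "set xs \<subseteq> E" using lift by blast
  show "F.Span const_field Us \<subseteq> \<rho> ` E"
  proof
   fix a assume "a \<in> F.Span const_field Us"
   moreover have "set Us \<subseteq> carrier A" using Us EA by blast
   ultimately obtain Cs where Cs: "set Cs \<subseteq> const_field" "length Cs = length Us" "a = F.combine Cs Us"
    using F.Span_mem_iff_length_version[OF const_subfield] by blast
   obtain cs where cs: "Cs = map \<rho> cs" "set cs \<subseteq> range k" using lift Cs(1) unfolding const_field_def by blast
   have l: "length cs = length xs" using Cs(2) cs xs by simp
   have "a = \<rho> (\<Sum>j<length xs. cs ! j * xs ! j)"
    unfolding Cs(3) cs xs using image_combine[OF l] cs(2) xs(2) E(1) D_const by blast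
   moreover have "(\<Sum>j<length xs. cs ! j * xs ! j) \<in> E"
   proof (rule Esum)
    fix j assume "j \<in> {..<length xs}"
    then have "cs ! j \<in> range k" "xs ! j \<in> E" using cs(2) xs(2) l by (auto simp: subset_iff)
    then show "cs ! j * xs ! j \<in> E" using E(4) by auto
   qed
   ultimately show "a \<in> \<rho> ` E" by blast
  qed
  show "length Us \<le> m" if ind: "F.independent const_field Us"
  proof (rule ccontr)
   assume "\<not> length Us \<le> m"
   then have l: "m < length xs" using xs by simp
   have "\<exists>c. (\<exists>j\<le>m. c j ~= 0) \<and> \<rho> (\<Sum>j\<le>m. k (c j) * xs ! j) = \<rho> 0"
    by (rule dep) (use l xs(2) in \<open>auto simp: subset_iff\<close>)
   then obtain c where c: "\<exists>j\<le>m. c j ~= 0" "\<rho> (\<Sum>j\<le>m. k (c j) * xs ! j) = \<rho> 0" by blast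
   define cs where "cs = map (\<lambda>j. if j \<le> m then k (c j) else 0) [0..<length xs]"
   have lcs: "length cs = length xs" by (simp add: cs_def)
   have csk: "set cs \<subseteq> range k" unfolding cs_def using rangeI[of k 0] by (auto simp del: rangeI)
   have "(\<Sum>j<length xs. cs ! j * xs ! j) = (\<Sum>j\<le>m. k (c j) * xs ! j)"
   proof -
    have "(\<Sum>j<length xs. cs ! j * xs ! j) = (\<Sum>j<length xs. if j \<le> m then k (c j) * xs ! j else 0)"
     by (rule sum.cong) (simp_all add: cs_def)
    also have "\<dots> = (\<Sum>j\<le>m. k (c j) * xs ! j)"
     using l by (intro sum.mono_neutral_cong_right) auto
    finally show ?thesis .
   qed
   then have "F.combine (map \<rho> cs) Us = \<zero>"
    unfolding xs(1) using image_combine[OF lcs] csk xs(2) E(1) D_const c(2) image_0 by auto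
   moreover have "set (map \<rho> cs) \<subseteq> const_field" unfolding const_field_def using csk by auto
   ultimately have z: "set (take (length Us) (map \<rho> cs)) \<subseteq> {\<zero>}"
    using F.independent_imp_trivial_combine[OF const_subfield ind] by blast
   obtain j where j: "j \<le> m" "c j ~= 0" using c(1) by blast
   have "\<rho> (k (c j)) \<in> set (map \<rho> cs)" using j l by (force simp: cs_def)
   then have "\<rho> (k (c j)) = \<rho> 0" using z lcs xs by (auto simp: image_0)
   moreover have "\<rho> (k (c j)) ~= \<rho> 0"
   proof
    assume e: "\<rho> (k (c j)) = \<rho> 0"
    have "\<rho> (k (inverse (c j))) \<otimes> \<rho> (k (c j)) = \<rho> 1"
     using j(2) by (subst image_mult) (auto simp: D_const simp flip: hom_mult simp del: hom_inverse)
    moreover have "\<rho> (k (inverse (c j))) \<otimes> \<rho> 0 = \<rho> 0"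
     by (subst image_mult) (auto simp: D_const D_0 simp del: hom_inverse)
    ultimately show False using e image_nontrivial by simp
   qed
   ultimately show False by simp
  qed
 qed
qed

end

section \<open>Places and divisors of an abstract copy of the function field\<close>

text \<open>An isomorphism \<open>\<eta>\<close> from the concrete field \<open>K\<close> to an abstract field with constants \<open>C\<close>.\<close>

locale function_field_model = subfield_over k K for k :: "'a::field => 'b::field" and K +
 fixes F :: "'r ring" and \<eta> :: "'b => 'r" and C :: "'r set"
 assumes carrier_F: "carrier F = \<eta> ` K" and inj_\<eta>: "inj_on \<eta> K" and C_eq: "C = \<eta> ` range k"
  and \<eta>_add: "x \<in> K ==> y \<in> K ==> \<eta> x \<oplus>\<^bsub>F\<^esub> \<eta> y = \<eta> (x + y)"
  and \<eta>_mult: "x \<in> K ==> y \<in> K ==> \<eta> x \<otimes>\<^bsub>F\<^esub> \<eta> y = \<eta> (x * y)"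
  and \<eta>_0: "\<zero>\<^bsub>F\<^esub> = \<eta> 0" and \<eta>_1: "\<one>\<^bsub>F\<^esub> = \<eta> 1"
begin

lemma \<eta>_eq_iff: "x \<in> K ==> y \<in> K ==> \<eta> x = \<eta> y \<longleftrightarrow> x = y"
 using inj_\<eta> by (auto dest: inj_onD)

sublocale FK: image_field k K \<eta> F
proof unfold_locales
 fix x assume x: "x \<in> K" "\<eta> x ~= \<eta> 0"
 then have "x ~= 0" by auto
 then show "\<exists>y\<in>K. \<eta> (x * y) = \<eta> 1" using K_inverse[OF x(1)] by (intro bexI[of _ "inverse x"]) auto
qed (auto simp: carrier_F \<eta>_add \<eta>_mult \<eta>_0 \<eta>_1 \<eta>_eq_iff K.D_0 K.D_1)

lemma C_const_field: "C = FK.const_field" unfolding C_eq FK.const_field_def ..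

lemma carrier_F_nonzero: "carrier F - {\<zero>\<^bsub>F\<^esub>} = \<eta> ` (K - {0})"
 unfolding carrier_F \<eta>_0 using \<eta>_eq_iff K.D_0 by auto

definition pull :: "('r => int) => 'b => int" where
 "pull v = restrict (\<lambda>x. v (\<eta> x)) (K - {0})"

definition push :: "('b => int) => 'r => int" where
 "push u = restrict (\<lambda>a. u (inv_into K \<eta> a)) (carrier F - {\<zero>\<^bsub>F\<^esub>})"

lemma push_eq: "x \<in> K ==> x ~= 0 ==> push u (\<eta> x) = u x"
 unfolding push_def using inv_into_f_f[OF inj_\<eta>] carrier_F_nonzero by auto

lemma pull_eq: "x \<in> K ==> x ~= 0 ==> pull v x = v (\<eta> x)"
 unfolding pull_def by simp

lemma pull_push: "u \<in> Places ==> pull (push u) = u"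
 unfolding pull_def Places_def by (intro extensionalityI[of _ "K - {0}"]) (auto simp: push_eq)

lemma push_pull: "v \<in> places F C ==> push (pull v) = v"
proof (rule extensionalityI[of _ "carrier F - {\<zero>\<^bsub>F\<^esub>}"])
 fix a assume "a \<in> carrier F - {\<zero>\<^bsub>F\<^esub>}"
 then obtain x where "x \<in> K" "x ~= 0" "a = \<eta> x" unfolding carrier_F_nonzero by auto
 then show "push (pull v) a = v a" by (simp add: push_eq pull_eq)
qed (auto simp: places_def push_def)

lemma push_places: assumes u: "u \<in> Places" shows "push u \<in> places F C"
 unfolding places_def
proof (intro CollectI conjI ballI impI)
 show "push u \<in> extensional (carrier F - {\<zero>\<^bsub>F\<^esub>})" by (simp add: push_def)
 fix a b assume "a \<in> carrier F - {\<zero>\<^bsub>F\<^esub>}" "b \<in> carrier F - {\<zero>\<^bsub>F\<^esub>}"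
 then obtain x y where xy: "x \<in> K" "x ~= 0" "a = \<eta> x" "y \<in> K" "y ~= 0" "b = \<eta> y"
  unfolding carrier_F_nonzero by auto
 show "push u (a \<otimes>\<^bsub>F\<^esub> b) = push u a + push u b"
  using xy by (simp add: \<eta>_mult push_eq K_mult place_mult[OF u])
 assume "a \<oplus>\<^bsub>F\<^esub> b ~= \<zero>\<^bsub>F\<^esub>"
 then have "x + y ~= 0" using xy by (auto simp: \<eta>_add \<eta>_0)
 then show "min (push u a) (push u b) \<le> push u (a \<oplus>\<^bsub>F\<^esub> b)"
  using xy place_add[OF u, of x y] by (simp add: \<eta>_add push_eq K_add)
next
 show "push u ` (carrier F - {\<zero>\<^bsub>F\<^esub>}) = UNIV"
 proof (intro equalityI subsetI UNIV_I)
  fix n :: int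
  obtain x where x: "x \<in> K - {0}" "u x = n" using place_surj[OF u] by blast
  then have "push u (\<eta> x) = n" "\<eta> x \<in> carrier F - {\<zero>\<^bsub>F\<^esub>}" unfolding carrier_F_nonzero by (simp_all add: push_eq)
  then show "n \<in> push u ` (carrier F - {\<zero>\<^bsub>F\<^esub>})" by blast
 qed
 fix a assume "a \<in> C - {\<zero>\<^bsub>F\<^esub>}"
 then have "a \<in> \<eta> ` range k" "a ~= \<eta> 0" unfolding C_eq \<eta>_0 by simp_all
 then obtain c where c: "a = \<eta> (k c)" "k c ~= 0" by fastforce
 then show "push u a = 0" using push_eq[OF K_const c(2)] place_const[OF u, of c] by auto
qed

lemma pull_places: assumes v: "v \<in> places F C" shows "pull v \<in> Places"
proof -
 have nz: "\<eta> x \<in> carrier F - {\<zero>\<^bsub>F\<^esub>}" if "x \<in> K" "x ~= 0" for x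
  using that unfolding carrier_F_nonzero by auto
 have "is_place (\<lambda>x. v (\<eta> x))"
  unfolding is_place_def
 proof (intro conjI ballI impI allI)
  fix x y assume xy: "x \<in> K - {0}" "y \<in> K - {0}"
  then have n: "\<eta> x \<in> carrier F - {\<zero>\<^bsub>F\<^esub>}" "\<eta> y \<in> carrier F - {\<zero>\<^bsub>F\<^esub>}" using nz by auto
  show "v (\<eta> (x * y)) = v (\<eta> x) + v (\<eta> y)"
  proof -
   have "v (\<eta> x \<otimes>\<^bsub>F\<^esub> \<eta> y) = v (\<eta> x) + v (\<eta> y)" using v n unfolding places_def by blast
   then show ?thesis using \<eta>_mult[of x y] xy by simp
  qed
  assume "x + y ~= 0"
  then have "\<eta> x \<oplus>\<^bsub>F\<^esub> \<eta> y ~= \<zero>\<^bsub>F\<^esub>" using nz[of "x + y"] xy K_add[of x y] \<eta>_add[of x y] by auto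
  then show "min (v (\<eta> x)) (v (\<eta> y)) \<le> v (\<eta> (x + y))"
  proof -
   have "min (v (\<eta> x)) (v (\<eta> y)) \<le> v (\<eta> x \<oplus>\<^bsub>F\<^esub> \<eta> y)"
    using v n \<open>\<eta> x \<oplus>\<^bsub>F\<^esub> \<eta> y ~= \<zero>\<^bsub>F\<^esub>\<close> unfolding places_def by blast
   then show ?thesis using \<eta>_add[of x y] xy by simp
  qed
 next
  have "v ` \<eta> ` (K - {0}) = UNIV" using v unfolding places_def carrier_F_nonzero by simp
  then show "(\<lambda>x. v (\<eta> x)) ` (K - {0}) = UNIV" by (simp add: image_image)
 next
  fix c :: 'a assume "c ~= 0"
  then have "\<eta> (k c) \<in> C - {\<zero>\<^bsub>F\<^esub>}" using nz[OF K_const, of c] unfolding C_eq by auto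
  then show "v (\<eta> (k c)) = 0" using v unfolding places_def by auto
 qed
 then show ?thesis unfolding pull_def by (rule Places_restrict)
qed

lemma places_cases:
 assumes "v \<in> places F C" obtains u where "u \<in> Places" "v = push u"
 using push_pull[OF assms] pull_places[OF assms] by metis

subsection \<open>Residue fields\<close>

context
 fixes u assumes u: "u \<in> Places"
begin

definition \<rho> :: "'b => 'r set" where
 "\<rho> x = place_ideal F (push u) +>\<^bsub>place_ring F (push u)\<^esub> \<eta> x"

lemma subring_ge: "subring_of k {x. ge u 0 x}"
 by unfold_locales (auto intro: ge_const ge_add ge_mult0 ge_uminus u)

lemma place_ring_carrier: "carrier (place_ring F (push u)) = \<eta> ` {x. ge u 0 x}"
proof -
 have "a \<in> carrier (place_ring F (push u)) \<longleftrightarrow> a \<in> \<eta> ` {x. ge u 0 x}" for a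
  unfolding place_ring_def carrier_F \<eta>_0 ge_def
  by (simp add: image_iff) (metis push_eq K.D_0)
 then show ?thesis by blast
qed

lemma place_ideal_eq: "place_ideal F (push u) = \<eta> ` {x. ge u 1 x}"
proof -
 have pos: "(1 \<le> n) = (0 < n)" for n :: int by auto
 have "a \<in> place_ideal F (push u) \<longleftrightarrow> a \<in> \<eta> ` {x. ge u 1 x}" for a
  unfolding place_ideal_def carrier_F \<eta>_0 ge_def pos
  by (simp add: image_iff) (metis push_eq K.D_0)
 then show ?thesis by blast
qed

lemma place_ring_image: "image_ring k {x. ge u 0 x} \<eta> (place_ring F (push u))"
 by (intro image_ring.intro subring_ge image_ring_axioms.intro place_ring_carrier)
  (auto simp: place_ring_def \<eta>_0 \<eta>_1 dest!: ge_K intro: \<eta>_add \<eta>_mult)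

interpretation PR: image_ring k "{x. ge u 0 x}" \<eta> "place_ring F (push u)" by (rule place_ring_image)
interpretation cring "place_ring F (push u)" by (rule PR.image_cring)

lemma place_ideal: "ideal (place_ideal F (push u)) (place_ring F (push u))"
proof (rule idealI)
 show "ring (place_ring F (push u))" by (rule ring_axioms)
 show "subgroup (place_ideal F (push u)) (add_monoid (place_ring F (push u)))"
 proof
  show "place_ideal F (push u) \<subseteq> carrier (add_monoid (place_ring F (push u)))"
   unfolding place_ideal_eq place_ring_carrier partial_object.simps monoid.simps
   by (auto simp: place_ring_carrier intro!: imageI dest: ge_mono[of u 1 _ 0])
  show "\<one>\<^bsub>add_monoid (place_ring F (push u))\<^esub> \<in> place_ideal F (push u)"
   unfolding place_ideal_eq using PR.image_0 by auto
 next
  fix a b assume "a \<in> place_ideal F (push u)" "b \<in> place_ideal F (push u)"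
  then obtain x y where xy: "a = \<eta> x" "ge u 1 x" "b = \<eta> y" "ge u 1 y" unfolding place_ideal_eq by auto
  then show "a \<otimes>\<^bsub>add_monoid (place_ring F (push u))\<^esub> b \<in> place_ideal F (push u)"
   unfolding place_ideal_eq using ge_add[OF u xy(2,4)] PR.image_add[of x y] ge_mono[OF xy(2), of 0] ge_mono[OF xy(4), of 0] by auto
 next
  fix a assume "a \<in> place_ideal F (push u)"
  then obtain x where x: "a = \<eta> x" "ge u 1 x" unfolding place_ideal_eq by auto
  have "inv\<^bsub>add_monoid (place_ring F (push u))\<^esub> a = \<eta> (- x)"
   using PR.image_uminus[of x] ge_mono[OF x(2), of 0] x(1) by (simp add: a_inv_def)
  then show "inv\<^bsub>add_monoid (place_ring F (push u))\<^esub> a \<in> place_ideal F (push u)"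
   unfolding place_ideal_eq using ge_uminus[OF u x(2)] by auto
 qed
 fix a b assume "a \<in> place_ideal F (push u)" and b: "b \<in> carrier (place_ring F (push u))"
 then obtain x y where xy: "a = \<eta> x" "ge u 1 x" "b = \<eta> y" "ge u 0 y" unfolding place_ideal_eq place_ring_carrier by auto
 have "b \<otimes>\<^bsub>place_ring F (push u)\<^esub> a = \<eta> (y * x)"
  using xy PR.image_mult[of y x] ge_mono[OF xy(2), of 0] by simp
 then show "b \<otimes>\<^bsub>place_ring F (push u)\<^esub> a \<in> place_ideal F (push u)"
  unfolding place_ideal_eq using ge_mult0[OF u xy(4,2)] by auto
 have "a \<in> carrier (place_ring F (push u))" using xy ge_mono[OF xy(2), of 0] unfolding place_ring_carrier by auto
 then show "a \<otimes>\<^bsub>place_ring F (push u)\<^esub> b \<in> place_ideal F (push u)"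
  using m_comm[OF _ b] \<open>b \<otimes>\<^bsub>place_ring F (push u)\<^esub> a \<in> place_ideal F (push u)\<close> by simp
qed

interpretation I: ideal "place_ideal F (push u)" "place_ring F (push u)" by (rule place_ideal)

lemma \<rho>_eq_iff: "ge u 0 x ==> ge u 0 y ==> \<rho> x = \<rho> y \<longleftrightarrow> ge u 1 (x - y)"
proof -
 assume xy: "ge u 0 x" "ge u 0 y"
 have c: "\<eta> x \<in> carrier (place_ring F (push u))" "\<eta> y \<in> carrier (place_ring F (push u))"
  using xy by (auto simp: place_ring_carrier)
 have "\<eta> x \<ominus>\<^bsub>place_ring F (push u)\<^esub> \<eta> y = \<eta> (x - y)"
  unfolding a_minus_def using PR.image_uminus[of y] PR.image_add[of x "- y"] xy ge_uminus[OF u xy(2)] by simp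
 moreover have "\<eta> (x - y) \<in> \<eta> ` {x. ge u 1 x} \<longleftrightarrow> ge u 1 (x - y)"
  using \<eta>_eq_iff K_diff[OF ge_K[OF xy(1)] ge_K[OF xy(2)]] by (auto dest: ge_K)
 ultimately have "\<eta> x \<ominus>\<^bsub>place_ring F (push u)\<^esub> \<eta> y \<in> place_ideal F (push u) \<longleftrightarrow> ge u 1 (x - y)"
  unfolding place_ideal_eq by simp
 then show ?thesis unfolding \<rho>_def quotient_eq_iff_same_a_r_cos[OF place_ideal c, symmetric] .
qed

lemma residue_image: "image_field k {x. ge u 0 x} \<rho> (residue_field F (push u))"
proof (intro image_field.intro image_ring.intro subring_ge image_ring_axioms.intro image_field_axioms.intro)
 show "carrier (residue_field F (push u)) = \<rho> ` {x. ge u 0 x}"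
  unfolding residue_field_def FactRing_def A_RCOSETS_def' place_ring_carrier \<rho>_def by auto
 show "\<rho> x \<oplus>\<^bsub>residue_field F (push u)\<^esub> \<rho> y = \<rho> (x + y)" if "x \<in> {x. ge u 0 x}" "y \<in> {x. ge u 0 x}" for x y
  using that unfolding residue_field_def FactRing_def \<rho>_def
  by (simp add: I.a_rcos_sum place_ring_carrier PR.image_add)
 show "\<rho> x \<otimes>\<^bsub>residue_field F (push u)\<^esub> \<rho> y = \<rho> (x * y)" if "x \<in> {x. ge u 0 x}" "y \<in> {x. ge u 0 x}" for x y
  using that unfolding residue_field_def FactRing_def \<rho>_def
  by (simp add: I.rcoset_mult_add place_ring_carrier PR.image_mult)
 show "\<zero>\<^bsub>residue_field F (push u)\<^esub> = \<rho> 0"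
  unfolding residue_field_def FactRing_def \<rho>_def PR.image_0[symmetric]
  by (simp add: I.a_rcos_const)
 show "\<one>\<^bsub>residue_field F (push u)\<^esub> = \<rho> 1"
  unfolding residue_field_def FactRing_def \<rho>_def by (simp add: PR.image_1)
 show "\<rho> 1 ~= \<rho> 0"
  using \<rho>_eq_iff[of 1 0] ge1_const[OF u, of 1] ge_1[OF u] by auto
 fix x assume "x \<in> {x. ge u 0 x}" "\<rho> x ~= \<rho> 0"
 then have x: "ge u 0 x" "\<not> ge u 1 x" using \<rho>_eq_iff[of x 0] by auto
 then have "x ~= 0" "u x = 0" unfolding ge_def by auto
 then have "ge u 0 (inverse x)" using x place_inverse[OF u] K_inverse unfolding ge_def by simp
 then show "\<exists>y\<in>{x. ge u 0 x}. \<rho> (x * y) = \<rho> 1" using \<open>x ~= 0\<close> by (intro bexI[of _ "inverse x"]) auto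
qed

interpretation RF: image_field k "{x. ge u 0 x}" \<rho> "residue_field F (push u)" by (rule residue_image)

lemma residue_consts_eq: "residue_consts F C (push u) = \<rho> ` range k"
 unfolding residue_consts_def C_eq \<rho>_def by (simp add: image_image)

definition rational_place :: bool where
 "rational_place \<longleftrightarrow> (\<forall>x. ge u 0 x \<longrightarrow> (\<exists>c. ge u 1 (x - k c)))"

lemma rational_places_iff: "push u \<in> rational_places F C \<longleftrightarrow> rational_place"
proof -
 have c: "\<rho> ` range k \<subseteq> \<rho> ` {x. ge u 0 x}" using ge_const[OF u] by blast
 have "push u \<in> rational_places F C \<longleftrightarrow> \<rho> ` {x. ge u 0 x} = \<rho> ` range k"
  unfolding rational_places_def residue_consts_eq[symmetric] RF.carrier_image[symmetric]
  using push_places[OF u] by simp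
 also have "\<dots> \<longleftrightarrow> \<rho> ` {x. ge u 0 x} \<subseteq> \<rho> ` range k" using c by blast
 also have "\<dots> \<longleftrightarrow> (\<forall>x. ge u 0 x \<longrightarrow> (\<exists>c. \<rho> x = \<rho> (k c)))" by auto
 also have "\<dots> \<longleftrightarrow> rational_place"
  unfolding rational_place_def using \<rho>_eq_iff[OF _ ge_const[OF u]] by blast
 finally show ?thesis .
qed

text \<open>The bound makes the residue field finite dimensional, so that its dimension is meaningful. Dimension
 one means that there are no residues besides the constants.\<close>

lemma place_degree_cases:
 fixes N :: nat
 assumes dep: "\<And>z. (\<And>j. j \<le> N ==> ge u 0 (z j)) ==>
   \<exists>c. (\<exists>j\<le>N. c j ~= 0) \<and> ge u 1 (\<Sum>j\<le>N. k (c j) * z j)"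
 shows "place_degree F C (push u) \<le> N" and "1 \<le> place_degree F C (push u)"
  and "rational_place ==> place_degree F C (push u) = 1"
  and "\<not> rational_place ==> 2 \<le> place_degree F C (push u)"
proof -
 interpret A: field "residue_field F (push u)" by (rule RF.image_is_field)
 have "\<exists>n\<le>N. A.dimension n RF.const_field (\<rho> ` {x. ge u 0 x})"
 proof (rule RF.image_dimension_bounded)
  fix z :: "nat => 'b" assume z: "\<And>j. j \<le> N ==> z j \<in> {x. ge u 0 x}"
  then obtain c where c: "\<exists>j\<le>N. c j ~= 0" "ge u 1 (\<Sum>j\<le>N. k (c j) * z j)" using dep[of z] unfolding mem_Collect_eq by blast
  moreover have "ge u 0 (\<Sum>j\<le>N. k (c j) * z j)" using ge_mono[OF c(2)] by simp
  ultimately show "\<exists>c. (\<exists>j\<le>N. c j ~= 0) \<and> \<rho> (\<Sum>j\<le>N. k (c j) * z j) = \<rho> 0"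
   using \<rho>_eq_iff[of "\<Sum>j\<le>N. k (c j) * z j" 0, OF _ ge_0] by (intro exI[of _ c]) simp
 qed (simp_all add: ge_add ge_scale u)
 then obtain n where n: "n \<le> N" "A.dimension n RF.const_field (carrier (residue_field F (push u)))"
  unfolding RF.carrier_image by blast
 have deg: "place_degree F C (push u) = n"
  unfolding place_degree_def residue_consts_eq RF.const_field_def[symmetric] using A.dimI[OF RF.const_subfield n(2)] by (simp add: over_def)
 show "place_degree F C (push u) \<le> N" using deg n(1) by simp
 have "n ~= 0"
 proof
  assume "n = 0"
  then have "carrier (residue_field F (push u)) = {\<zero>\<^bsub>residue_field F (push u)\<^esub>}"
   using n(2) A.dimension_zero[OF RF.const_subfield] by simp
  then show False using A.one_closed A.one_not_zero by blast
 qed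
 then show d1: "1 \<le> place_degree F C (push u)" using deg by simp
 show "place_degree F C (push u) = 1" if r: rational_place
 proof -
  have "carrier (residue_field F (push u)) = RF.const_field"
   using rational_places_iff r unfolding rational_places_def RF.const_field_def by (simp add: residue_consts_eq)
  then have "A.dimension 1 RF.const_field (carrier (residue_field F (push u)))"
   using A.dimension_one[OF RF.const_subfield] by simp
  then show ?thesis using A.dimension_is_inj[OF RF.const_subfield n(2)] deg by simp
 qed
 show "2 \<le> place_degree F C (push u)" if r: "\<not> rational_place"
 proof (rule ccontr)
  assume "\<not> ?thesis"
  then have "n = 1" using deg d1 by simp
  then have "carrier (residue_field F (push u)) = RF.const_field"
   using A.dimension_carrier_one[OF RF.const_subfield] n(2) A.one_not_zero by simp
  then show False using r rational_places_iff push_places[OF u] unfolding rational_places_def RF.const_field_def by (simp add: residue_consts_eq)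
 qed
qed

end

subsection \<open>Riemann's inequality\<close>

text \<open>If the Riemann-Roch space had a smaller dimension, the divisor would contradict genus zero. An
 infinite dimensional space also contains independent families of every size.\<close>

lemma genus_0_sections:
 assumes g: "has_genus F C 0" and D: "D \<in> divisors F C" "divisor_degree F C D = int d"
 shows "\<exists>z. (\<forall>j\<le>d. z j \<in> K \<and> (\<forall>u\<in>Places. ge u (- D (push u)) (z j))) \<and> indep_fam {..d} z"
proof (rule ccontr)
 assume no: "\<not> ?thesis"
 define E where "E = {x \<in> K. \<forall>u\<in>Places. ge u (- D (push u)) x}"
 interpret A: field F by (rule FK.image_is_field)
 have "\<exists>n\<le>d. A.dimension n FK.const_field (\<eta> ` E)"
 proof (rule FK.image_dimension_bounded)
  fix z assume z: "\<And>j. j \<le> d ==> z j \<in> E"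
  then have "\<not> indep_fam {..d} z" using no unfolding E_def by blast
  then obtain c where "(\<Sum>j\<le>d. k (c j) * z j) = 0" "\<exists>j\<le>d. c j ~= 0" unfolding indep_fam_def by auto
  then show "\<exists>c. (\<exists>j\<le>d. c j ~= 0) \<and> \<eta> (\<Sum>j\<le>d. k (c j) * z j) = \<eta> 0" by auto
 qed (auto simp: E_def K.D_0 intro: K_add K_mult K_const ge_add ge_scale)
 moreover have "riemann_roch_space F C D = \<eta> ` E"
 proof -
  have "a \<in> riemann_roch_space F C D \<longleftrightarrow> a \<in> \<eta> ` E" for a
  proof
   assume a: "a \<in> riemann_roch_space F C D"
   then obtain x where x: "x \<in> K" "a = \<eta> x" unfolding riemann_roch_space_def carrier_F by auto
   have "ge u (- D (push u)) x" if "u \<in> Places" for u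
    using a x push_places[OF that] push_eq[OF x(1), of u] \<eta>_eq_iff[OF x(1) K.D_0]
    unfolding riemann_roch_space_def ge_def \<eta>_0 by auto
   then show "a \<in> \<eta> ` E" using x unfolding E_def by auto
  next
   assume "a \<in> \<eta> ` E"
   then obtain x where x: "a = \<eta> x" "x \<in> K" "\<And>u. u \<in> Places ==> ge u (- D (push u)) x" unfolding E_def by auto
   have "a = \<zero>\<^bsub>F\<^esub> \<or> - D v \<le> v a" if v: "v \<in> places F C" for v
   proof -
    obtain u where "u \<in> Places" "v = push u" using places_cases[OF v] .
    then show ?thesis using x(3)[of u] push_eq[OF x(2), of u] unfolding x(1) ge_def \<eta>_0 by (cases "x = 0") auto
   qed
   then show "a \<in> riemann_roch_space F C D" using x unfolding riemann_roch_space_def carrier_F by auto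
  qed
  then show ?thesis by blast
 qed
 ultimately obtain n where n: "n \<le> d" "A.dimension n C (riemann_roch_space F C D)"
  unfolding C_const_field by auto
 then have "A.dim C (riemann_roch_space F C D) = n"
  using A.dimI[OF FK.const_subfield] unfolding C_const_field over_def by blast
 moreover have "divisor_degree F C D - int (A.dim C (riemann_roch_space F C D)) + 1 \<le> 0"
  using g D(1) unfolding has_genus_def Let_def by blast
 ultimately show False using n(1) D(2) by simp
qed

end

section \<open>Conics with a pencil of lines\<close>

lemma shift_circle:
 fixes s :: "'a::comm_ring_1"
 shows "s ^ 2 + t ^ 2 = (s + p) ^ 2 + (t + q) ^ 2 - ((p + p) * (s + p) + (q + q) * (t + q)) + p ^ 2 + q ^ 2"
 by (simp add: power2_eq_square algebra_simps)

lemma substitute_linear: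
 fixes s :: "'a::comm_ring_1"
 shows "b * (- (e + f * (s - c)) + d) + a * s = b * (d - e + f * c) + (a - b * f) * s"
 by (simp add: algebra_simps)

lemma square_factors:
 fixes x :: "'a::comm_ring_1"
 shows "(x - c) ^ 2 + d ^ 2 - d ^ 2 * (r ^ 2 + 1) = (x - (c + d * r)) * (x - (c + - d * r))"
 by (simp add: power2_eq_square algebra_simps)

context real_function_field
begin

definition linear_independent3 :: "'b => 'b => 'b => bool" where
 "linear_independent3 x y z \<longleftrightarrow> (\<forall>a b c. k a * x + k b * y + k c * z = 0 \<longrightarrow> a = 0 \<and> b = 0 \<and> c = 0)"

definition lin :: "'b => 'b => (nat => 'a) => 'b" where
 "lin x y a = k (a 0) + k (a 1) * x + k (a 2) * y"

definition quadratic_over :: "'b => bool" where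
 "quadratic_over u \<longleftrightarrow> (\<exists>\<omega> e. \<omega> \<in> K \<and> degree e \<le> 2 \<and> \<omega> ^ 2 = peval k e u \<and> K \<subseteq> fieldgen k {u, \<omega>})"

definition pencils_quadratic :: "'b => 'b => bool" where
 "pencils_quadratic x y \<longleftrightarrow> (\<forall>a b. lin x y b ~= 0 \<longrightarrow> lin x y a / lin x y b \<notin> range k \<longrightarrow>
   quadratic_over (lin x y a / lin x y b))"

lemma lin_K: "x \<in> K ==> y \<in> K ==> lin x y a \<in> K"
 unfolding lin_def by (intro K_add K_mult K_const)

lemma lin_pencil:
 assumes x: "x \<in> K" "y \<in> K" and b: "lin x y b ~= 0" and u: "u = lin x y a / lin x y b" "u \<notin> range k"
 defines "p \<equiv> \<lambda>i. [:a i, - b i:]"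
 shows "peval k (p 0) u + peval k (p 1) u * x + peval k (p 2) u * y = 0"
  and "peval k (p 1) u ~= 0 \<or> peval k (p 2) u ~= 0"
proof -
 have "u * lin x y b = lin x y a" using b u(1) by simp
 then show rel: "peval k (p 0) u + peval k (p 1) u * x + peval k (p 2) u * y = 0"
  unfolding p_def lin_def by (simp add: algebra_simps)
 have uK: "u \<in> K" unfolding u(1) by (intro K_divide lin_K x)
 have p0: "p i = 0 ==> b i = 0" for i unfolding p_def by simp
 show "peval k (p 1) u ~= 0 \<or> peval k (p 2) u ~= 0"
 proof (rule ccontr)
  assume "\<not> ?thesis"
  then have "peval k (p 0) u = 0" "peval k (p 1) u = 0" "peval k (p 2) u = 0" using rel by auto
  then have "b 0 = 0" "b 1 = 0" "b 2 = 0" using nonconst_imp_transcendental[OF uK u(2)] p0 by blast+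
  then show False using b unfolding lin_def by simp
 qed
qed

text \<open>In a residue field in which every element is real or of the form \<open>c + d\<surd>-1\<close>, there is only one square
 root of \<open>-1\<close> up to sign.\<close>

lemma residue_generated:
 assumes u: "u \<in> Places"
  and cases: "(\<exists>c. ge u 1 (x - k c)) \<or> (\<exists>a b. b ~= 0 \<and> ge u 1 ((x - k a) ^ 2 + k (b ^ 2)))"
  and r: "ge u 0 r" "ge u 1 (r ^ 2 + 1)" and x: "ge u 0 x"
 shows "\<exists>c d. ge u 1 (x - (k c + k d * r))"
 using cases
proof (elim disjE exE conjE)
 fix c assume "ge u 1 (x - k c)"
 then show ?thesis by (intro exI[of _ c] exI[of _ 0]) simp
next
 fix c d assume "ge u 1 ((x - k c) ^ 2 + k (d ^ 2))"
 then have "ge u 1 ((x - k c) ^ 2 + k (d ^ 2) - k (d ^ 2) * (r ^ 2 + 1))"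
  by (intro ge_diff ge_scale u r)
 moreover have "(x - k c) ^ 2 + k (d ^ 2) - k (d ^ 2) * (r ^ 2 + 1) = (x - (k c + k d * r)) * (x - (k c + k (- d) * r))"
  using square_factors[of x "k c" "k d" r] by simp
 ultimately have "ge u 1 ((x - (k c + k d * r)) * (x - (k c + k (- d) * r)))" by simp
 moreover have "ge u 0 (x - (k c + k d' * r))" for d' by (intro ge_diff ge_add ge_const ge_scale u x r)
 ultimately show ?thesis using ge_prime[OF u] by blast
qed

text \<open>On the parabola \<open>(t, t\<^sup>2)\<close>, the parameter of a pencil of lines satisfies a quadratic equation whose
 coefficients are linear in the parameter.\<close>

lemma pencils_quadratic_parabola:
 assumes t: "t \<in> K" "K \<subseteq> fieldgen k {t}"
 shows "pencils_quadratic t (t ^ 2)"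
 unfolding pencils_quadratic_def
proof (intro allI impI)
 fix a b assume b: "lin t (t ^ 2) b ~= 0" and u: "lin t (t ^ 2) a / lin t (t ^ 2) b \<notin> range k"
 define u where "u = lin t (t ^ 2) a / lin t (t ^ 2) b"
 have t2: "t ^ 2 \<in> K" by (rule K.D_power[OF t(1)])
 define p where "p = (\<lambda>i. [:a i, - b i:])"
 define \<alpha> \<beta> \<gamma> where "\<alpha> = peval k (p 2) u" and "\<beta> = peval k (p 1) u" and "\<gamma> = peval k (p 0) u"
 have rel: "\<gamma> + \<beta> * t + \<alpha> * t ^ 2 = 0" and nz: "\<beta> ~= 0 \<or> \<alpha> ~= 0"
  using lin_pencil[OF t(1) t2 b u_def] u unfolding \<alpha>_def \<beta>_def \<gamma>_def p_def u_def by auto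
 define \<omega> where "\<omega> = 2 * \<alpha> * t + \<beta>"
 have uK: "u \<in> K" unfolding u_def by (intro K_divide lin_K t t2)
 have "\<omega> ^ 2 = \<beta> ^ 2 - 4 * \<alpha> * \<gamma> + 4 * \<alpha> * (\<gamma> + \<beta> * t + \<alpha> * t ^ 2)"
  unfolding \<omega>_def by (simp add: power2_eq_square algebra_simps)
 then have w2: "\<omega> ^ 2 = peval k (p 1 ^ 2 - smult 4 (p 2 * p 0)) u"
  unfolding rel by (simp add: \<alpha>_def \<beta>_def \<gamma>_def power2_eq_square)
 have "degree (p 1 ^ 2 - smult 4 (p 2 * p 0)) \<le> 2"
  by (intro degree_diff_le degree_smult_le[THEN order_trans])
   (simp_all add: p_def power2_eq_square del: mult_pCons_left mult_pCons_right, (rule degree_mult_le[THEN order_trans], simp)+)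
 moreover have fgu: "u \<in> fieldgen k {u, \<omega>}" "\<omega> \<in> fieldgen k {u, \<omega>}" by (auto intro: fg)
 have c: "\<alpha> \<in> fieldgen k {u, \<omega>}" "\<beta> \<in> fieldgen k {u, \<omega>}" "\<gamma> \<in> fieldgen k {u, \<omega>}"
  unfolding \<alpha>_def \<beta>_def \<gamma>_def by (rule fg_peval[OF fgu(1)])+
 have "t \<in> fieldgen k {u, \<omega>}"
 proof (cases "\<alpha> = 0")
  case True
  then have "t = - \<gamma> / \<beta>" using rel nz by (simp add: field_simps eq_neg_iff_add_eq_0)
  then show ?thesis using fg_divide[OF fg(5)[OF c(3)] c(2)] by simp
 next
  case False
  then have "t = (\<omega> - \<beta>) / (\<alpha> + \<alpha>)" unfolding \<omega>_def by (simp add: field_simps)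
  then show ?thesis using fg_divide[OF fg_diff[OF fgu(2) c(2)] fg(3)[OF c(1) c(1)]] by simp
 qed
 then have "K \<subseteq> fieldgen k {u, \<omega>}" using t(2) fieldgen_least[of "{t}"] by blast
 moreover have "\<omega> \<in> K" unfolding \<omega>_def \<alpha>_def \<beta>_def
  using K.D_const[of 2] by (intro K_add K_mult K_peval uK t) simp_all
 ultimately show "quadratic_over (lin t (t ^ 2) a / lin t (t ^ 2) b)"
  unfolding quadratic_over_def u_def[symmetric] using w2 by blast
qed

text \<open>On a circle the same holds for the tangential coordinate of the intersection point.\<close>

lemma pencils_quadratic_circle:
 assumes st: "s \<in> K" "t \<in> K" "K \<subseteq> fieldgen k {s, t}" and circle: "s ^ 2 + t ^ 2 = k r"
 shows "pencils_quadratic s t"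
 unfolding pencils_quadratic_def
proof (intro allI impI)
 fix a b assume b: "lin s t b ~= 0" and u: "lin s t a / lin s t b \<notin> range k"
 define u where "u = lin s t a / lin s t b"
 define p where "p = (\<lambda>i. [:a i, - b i:])"
 define \<alpha> \<beta> \<gamma> where "\<alpha> = peval k (p 1) u" and "\<beta> = peval k (p 2) u" and "\<gamma> = peval k (p 0) u"
 have rel: "\<gamma> + \<alpha> * s + \<beta> * t = 0" and nz: "\<alpha> ~= 0 \<or> \<beta> ~= 0"
  using lin_pencil[OF st(1,2) b u_def] u unfolding \<alpha>_def \<beta>_def \<gamma>_def p_def u_def by auto
 have uK: "u \<in> K" unfolding u_def by (intro K_divide lin_K st)
 have abK: "\<alpha> \<in> K" "\<beta> \<in> K" unfolding \<alpha>_def \<beta>_def by (intro K_peval uK)+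
 define N where "N = \<alpha> ^ 2 + \<beta> ^ 2"
 have N0: "N ~= 0"
 proof
  assume N: "N = 0"
  have "\<beta> ~= 0" using N nz unfolding N_def by auto
  then have "(\<alpha> / \<beta>) ^ 2 = - 1" using N unfolding N_def by (simp add: power_divide field_simps eq_neg_iff_add_eq_0)
  then show False using no_i K_divide[OF abK] by blast
 qed
 define \<omega> where "\<omega> = \<alpha> * t - \<beta> * s"
 have g: "\<gamma> = - (\<alpha> * s + \<beta> * t)" using rel by (simp only: eq_neg_iff_add_eq_0 add.assoc)
 have "\<omega> ^ 2 + \<gamma> ^ 2 = N * (s ^ 2 + t ^ 2)"
  unfolding \<omega>_def g N_def by (simp add: power2_eq_square algebra_simps)
 then have "\<omega> ^ 2 = k r * N - \<gamma> ^ 2" unfolding circle by (simp add: eq_diff_eq mult.commute)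
 then have w2: "\<omega> ^ 2 = peval k (smult r (p 1 ^ 2 + p 2 ^ 2) - p 0 ^ 2) u"
  by (simp add: \<alpha>_def \<beta>_def \<gamma>_def N_def power2_eq_square)
 have d2: "degree (p i ^ 2) \<le> 2" for i
  unfolding power2_eq_square by (rule degree_mult_le[THEN order_trans]) (simp add: p_def)
 have deg: "degree (smult r (p 1 ^ 2 + p 2 ^ 2) - p 0 ^ 2) \<le> 2"
  by (intro degree_diff_le degree_smult_le[THEN order_trans] degree_add_le d2)
 have fgu: "u \<in> fieldgen k {u, \<omega>}" "\<omega> \<in> fieldgen k {u, \<omega>}" by (auto intro: fg)
 have c: "\<alpha> \<in> fieldgen k {u, \<omega>}" "\<beta> \<in> fieldgen k {u, \<omega>}" "\<gamma> \<in> fieldgen k {u, \<omega>}"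
  unfolding \<alpha>_def \<beta>_def \<gamma>_def by (rule fg_peval[OF fgu(1)])+
 have N: "N \<in> fieldgen k {u, \<omega>}" unfolding N_def by (intro fg(3) fg_power c)
 have "s * N = - (\<gamma> * \<alpha>) - \<beta> * \<omega>" "t * N = \<alpha> * \<omega> - \<beta> * \<gamma>"
  unfolding \<omega>_def g N_def by (simp_all add: power2_eq_square algebra_simps)
 then have e: "s = (- (\<gamma> * \<alpha>) - \<beta> * \<omega>) / N" "t = (\<alpha> * \<omega> - \<beta> * \<gamma>) / N" using N0 by (simp_all add: field_simps)
 have s: "s \<in> fieldgen k {u, \<omega>}" by (subst e(1)) (intro fg_divide fg_diff fg(4,5) c fgu N)
 have t: "t \<in> fieldgen k {u, \<omega>}" by (subst e(2)) (intro fg_divide fg_diff fg(4,5) c fgu N)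
 have "K \<subseteq> fieldgen k {u, \<omega>}" using st(3) s t fieldgen_least[of "{s, t}" "{u, \<omega>}"] by blast
 moreover have "\<omega> \<in> K" unfolding \<omega>_def by (intro K_diff K_mult abK st)
 ultimately show "quadratic_over (lin s t a / lin s t b)"
  unfolding quadratic_over_def u_def[symmetric] using w2 deg by blast
qed

end

section \<open>Riemann-Roch spaces of multiples of a place on a curve of genus zero\<close>

text \<open>The sections and the functions \<open>g\<close> come from Riemann's inequality for the divisors \<open>nP\<close> and
 \<open>Q - P\<close>.\<close>

locale genus_zero_function_field = real_function_field k K
 for k :: "'a::real_closed_field => 'b::field" and K +
 fixes P :: "'b => int" and \<delta> :: nat
 assumes P: "P \<in> Places" and \<delta>_pos: "0 < \<delta>"
  and ex_sections: "\<exists>z. (\<forall>j\<le>n * \<delta>. z j \<in> K \<and> ge P (- int n) (z j) \<and>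
    (\<forall>u\<in>Places - {P}. ge u 0 (z j))) \<and> indep_fam {..n * \<delta>} z"
  and ex_move_to_P: "Q \<in> Places ==> Q ~= P ==> \<exists>g. g ~= 0 \<and> ge P 1 g \<and> ge Q (- 1) g \<and>
    (\<forall>u\<in>Places - {P, Q}. ge u 0 g)"
begin

definition L :: "nat => 'b set" where
 "L n = {x. ge P (- int n) x \<and> (\<forall>u\<in>Places - {P}. ge u 0 x)}"

lemma L_K: "x \<in> L n ==> x \<in> K" unfolding L_def using ge_K by blast

lemma L_add: "x \<in> L n ==> y \<in> L n ==> x + y \<in> L n"
 unfolding L_def using P by (simp add: ge_add)

lemma L_diff: "x \<in> L n ==> y \<in> L n ==> x - y \<in> L n"
 unfolding L_def using P by (simp add: ge_diff)

lemma L_scale: "x \<in> L n ==> k c * x \<in> L n"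
 unfolding L_def using P by (simp add: ge_scale)

lemma L_sum: "(\<And>i. i \<in> I ==> g i \<in> L n) ==> sum g I \<in> L n"
 unfolding L_def using P by (simp add: ge_sum)

lemma L_mult: "x \<in> L n ==> y \<in> L m ==> x * y \<in> L (n + m)"
 unfolding L_def using P ge_mult[OF P, of "- int n" x "- int m" y] by (simp add: ge_mult0)

lemma L_mono: "n \<le> m ==> x \<in> L n ==> x \<in> L m"
 unfolding L_def using ge_mono[of P "- int n" x "- int m"] by simp

lemma L_const: "k c \<in> L n"
 unfolding L_def using P ge_mono[OF ge_const[OF P], of "- int n"] by (simp add: ge_const)

lemma L_1: "1 \<in> L n" using L_const[of 1] by simp

lemma L_power: "x \<in> L n ==> x ^ i \<in> L (i * n)"
 by (induction i) (auto intro: L_1 L_mult simp del: One_nat_def)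

lemma L_0_const: "x \<in> L 0 ==> x \<in> range k"
proof (rule regular_imp_const)
 fix u assume "x \<in> L 0" "u \<in> Places"
 then show "ge u 0 x" unfolding L_def by (cases "u = P") auto
qed (rule L_K)

lemma L_drop: "x \<in> L (Suc n) ==> ge P (- int n) x ==> x \<in> L n"
 unfolding L_def by simp

lemma sections: "\<exists>z. (\<forall>j\<le>n * \<delta>. z j \<in> L n) \<and> indep_fam {..n * \<delta>} z"
 using ex_sections[of n] unfolding L_def by blast

lemma L_not_spanned: "finite B ==> card B \<le> n * \<delta> ==> \<exists>x\<in>L n. x \<notin> vs.span B"
proof (rule ccontr)
 assume B: "finite B" "card B \<le> n * \<delta>" "\<not> (\<exists>x\<in>L n. x \<notin> vs.span B)"
 obtain z where "\<forall>j\<le>n * \<delta>. z j \<in> L n" "indep_fam {..n * \<delta>} z" using sections by blast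
 then have "card {..n * \<delta>} \<le> card B" using B by (intro indep_fam_card_le) auto
 then show False using B(2) by simp
qed

lemma ex_simple_pole: "\<exists>t\<in>L 1. t \<notin> range k"
proof -
 obtain t where t: "t \<in> L 1" "t \<notin> vs.span {1}" using L_not_spanned[of "{1}" 1] \<delta>_pos by auto
 have "k c \<in> vs.span {1}" for c using vs.span_scale[OF vs.span_base, of 1 "{1}" c] by simp
 then have "t \<notin> range k" using t(2) by (metis rangeE)
 then show ?thesis using t(1) by blast
qed

lemma simple_pole: "t \<in> L 1 ==> t \<notin> range k ==> t ~= 0 \<and> P t = - 1"
proof -
 assume t: "t \<in> L 1" "t \<notin> range k"
 then have "t \<notin> L 0" using L_0_const by blast
 then have "\<not> ge P (- int 0) t" using L_drop[of t 0] t by auto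
 then show ?thesis using t L_K[OF t(1)] unfolding L_def ge_def by auto
qed

text \<open>Outside the poles of its coefficients, the solution of an integral equation has no poles.\<close>

lemma integral_no_pole:
 assumes u: "u \<in> Places" and x: "x \<in> K" and a: "\<And>i. i < n ==> ge u 0 (a i)"
  and rel: "x ^ n = (\<Sum>i<n. a i * x ^ i)" and n: "0 < n"
 shows "ge u 0 x"
proof (rule ccontr)
 assume "\<not> ge u 0 x"
 then have x0: "x ~= 0" "u x < 0" using x unfolding ge_def by auto
 have "ge u (int (n - 1) * u x) (\<Sum>i<n. a i * x ^ i)"
 proof (intro ge_sum u)
  fix i assume i: "i \<in> {..<n}"
  then have "int (n - 1) * u x \<le> int i * u x" using x0(2) by (intro mult_right_mono_neg) auto
  then have "ge u (int (n - 1) * u x) (x ^ i)"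
   using place_power[OF u x x0(1)] K.D_power[OF x] by (simp add: ge_def)
  then show "ge u (int (n - 1) * u x) (a i * x ^ i)" using a i by (intro ge_mult0 u) auto
 qed
 then have "int (n - 1) * u x \<le> int n * u x"
  unfolding rel[symmetric] using x0 place_power[OF u x x0(1), of n] by (simp add: ge_def)
 then show False using n x0(2) by (simp add: of_nat_diff algebra_simps)
qed

text \<open>The elements without poles outside \<open>P\<close> form a ring with quotient field \<open>K\<close>: clearing the leading
 coefficient of an equation over \<open>R[t]\<close> makes an element integral.\<close>

lemma ex_denominator:
 assumes y: "y \<in> K"
 shows "\<exists>c n. c ~= 0 \<and> c \<in> L n \<and> c * y \<in> L n"
proof -
 obtain t where t: "t \<in> L 1" "t \<notin> range k" using ex_simple_pole by blast
 have tK: "t \<in> K" using L_K[OF t(1)] .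
 obtain N where "finite_over t N" using ex_finite_over[OF tK] by blast
 then obtain \<phi> where \<phi>: "\<exists>j\<le>N. \<phi> j ~= 0" "(\<Sum>j\<le>N. peval k (\<phi> j) t * y ^ j) = 0"
  unfolding finite_over_def using K.D_power[OF y] by meson
 define J where "J = {j. j \<le> N \<and> \<phi> j ~= 0}"
 define M where "M = Max J"
 have J: "finite J" "J ~= {}" using \<phi>(1) unfolding J_def by auto
 have M: "M \<le> N" "\<phi> M ~= 0" using Max_in[OF J] unfolding M_def J_def by auto
 have above: "\<phi> j = 0" if "j \<le> N" "M < j" for j
 proof (rule ccontr)
  assume "\<phi> j ~= 0"
  then have "j \<le> M" unfolding M_def using J(1) that(1) by (intro Max_ge) (auto simp: J_def)
  then show False using that(2) by simp
 qed
 define c where "c = peval k (\<phi> M) t"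
 have c0: "c ~= 0" unfolding c_def using nonconst_imp_transcendental[OF tK t(2)] M(2) by blast
 have "(\<Sum>j\<le>N. peval k (\<phi> j) t * y ^ j) = (\<Sum>j\<le>M. peval k (\<phi> j) t * y ^ j)"
  using M(1) above by (intro sum.mono_neutral_right) auto
 also have "\<dots> = c * y ^ M + (\<Sum>j<M. peval k (\<phi> j) t * y ^ j)"
  unfolding c_def by (simp flip: lessThan_Suc_atMost)
 finally have lead: "c * y ^ M = - (\<Sum>j<M. peval k (\<phi> j) t * y ^ j)"
  using \<phi>(2) by (simp add: eq_neg_iff_add_eq_0)
 have M0: "0 < M" using lead c0 by (cases M) auto
 have "(c * y) ^ M = c ^ (M - 1) * (c * y ^ M)"
  using M0 by (cases M) (simp_all add: power_mult_distrib)
 also have "\<dots> = (\<Sum>j<M. (- (peval k (\<phi> j) t * c ^ (M - 1 - j))) * (c * y) ^ j)"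
  unfolding lead mult_minus_right sum_distrib_left sum_negf[symmetric]
 proof (rule sum.cong)
  fix j assume "j \<in> {..<M}"
  then have "c ^ (M - 1) = c ^ (M - 1 - j) * c ^ j" by (simp flip: power_add)
  then show "- (c ^ (M - 1) * (peval k (\<phi> j) t * y ^ j)) = - (peval k (\<phi> j) t * c ^ (M - 1 - j)) * (c * y) ^ j"
   by (simp add: power_mult_distrib)
 qed simp
 finally have rel: "(c * y) ^ M = (\<Sum>j<M. (- (peval k (\<phi> j) t * c ^ (M - 1 - j))) * (c * y) ^ j)" .
 have cK: "c \<in> K" unfolding c_def by (rule K_peval[OF tK])
 have cyK: "c * y \<in> K" by (rule K_mult[OF cK y])
 have reg: "ge u 0 c" "ge u 0 (c * y)" if u: "u \<in> Places - {P}" for u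
 proof -
  have tu: "ge u 0 t" using t(1) u unfolding L_def by blast
  have uP: "u \<in> Places" using u by blast
  show cu: "ge u 0 c" unfolding c_def by (rule ge_peval[OF uP tu])
  have cp: "ge u 0 (c ^ i)" for i using ge_power[OF uP cu, of i] by simp
  show "ge u 0 (c * y)"
   by (rule integral_no_pole[OF uP cyK _ rel M0]) (intro ge_uminus ge_mult0 ge_peval uP tu cp)
 qed
 have big: "\<exists>n. \<forall>m\<ge>n. ge P (- int m) x" if "x \<in> K" for x
  using that unfolding ge_def by (intro exI[of _ "nat (- P x)"]) auto
 obtain n1 where n1: "\<And>m. m \<ge> n1 ==> ge P (- int m) c" using big[OF cK] by blast
 obtain n2 where n2: "\<And>m. m \<ge> n2 ==> ge P (- int m) (c * y)" using big[OF cyK] by blast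
 have "c \<in> L (max n1 n2)" "c * y \<in> L (max n1 n2)"
  unfolding L_def using reg n1[of "max n1 n2"] n2[of "max n1 n2"] by auto
 then show ?thesis using c0 by blast
qed

text \<open>Leading terms at \<open>P\<close>: \<open>s\<close> has a simple pole and \<open>t/s\<close> generates the residue field.\<close>

lemma L_step:
 assumes s: "s \<in> L 1" "s \<notin> range k" and t: "t \<in> L 1"
  and res: "\<And>x. ge P 0 x ==> \<exists>c d. ge P 1 (x - (k c + k d * (t / s)))" and x: "x \<in> L (Suc n)"
 shows "\<exists>c d. x - (k c * s ^ Suc n + k d * (s ^ n * t)) \<in> L n"
proof -
 have s0: "s ~= 0" "P s = - 1" using simple_pole[OF s] by auto
 have sK: "s \<in> K" "s ^ Suc n \<in> K" using L_K[OF s(1)] K.D_power by blast+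
 have Ps: "P (s ^ Suc n) = - int (Suc n)" using place_power[OF P sK(1) s0(1), of "Suc n"] s0(2) by simp
 have "ge P (- int (Suc n) - P (s ^ Suc n)) (x / s ^ Suc n)"
  by (rule ge_divide[OF P _ sK(2)]) (use x s0 in \<open>auto simp: L_def\<close>)
 then have "ge P 0 (x / s ^ Suc n)" unfolding Ps by simp
 then obtain c d where cd: "ge P 1 (x / s ^ Suc n - (k c + k d * (t / s)))" using res by blast
 have "ge P (- int (Suc n)) (s ^ Suc n)" using Ps sK by (simp add: ge_def)
 then have "ge P (- int (Suc n) + 1) (s ^ Suc n * (x / s ^ Suc n - (k c + k d * (t / s))))"
  by (rule ge_mult[OF P _ cd])
 moreover have "s ^ Suc n * (x / s ^ Suc n - (k c + k d * (t / s))) = x - (k c * s ^ Suc n + k d * (s ^ n * t))"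
  using s0(1) by (simp add: field_simps)
 ultimately have "ge P (- int n) (x - (k c * s ^ Suc n + k d * (s ^ n * t)))" by simp
 moreover have "s ^ Suc n \<in> L (Suc n)" "s ^ n * t \<in> L (Suc n)"
  using L_power[OF s(1), of "Suc n"] L_mult[OF L_power[OF s(1), of n] t] by simp_all
 then have "x - (k c * s ^ Suc n + k d * (s ^ n * t)) \<in> L (Suc n)"
  by (intro L_diff L_add L_scale x)
 ultimately show ?thesis using L_drop by blast
qed

text \<open>Induction on the order of the pole.\<close>

lemma L_generated:
 assumes "s \<in> L 1" "s \<notin> range k" "t \<in> L 1"
  and "\<And>x. ge P 0 x ==> \<exists>c d. ge P 1 (x - (k c + k d * (t / s)))"
 shows "x \<in> L n ==> x \<in> fieldgen k {s, t}"
proof (induction n arbitrary: x)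
 case 0
 then show ?case using L_0_const by (auto intro: fg)
next
 case (Suc n)
 have g: "s \<in> fieldgen k {s, t}" "t \<in> fieldgen k {s, t}" by (auto intro: fg)
 obtain c d where "x - (k c * s ^ Suc n + k d * (s ^ n * t)) \<in> L n" using L_step[OF assms Suc.prems] by blast
 then have "x - (k c * s ^ Suc n + k d * (s ^ n * t)) \<in> fieldgen k {s, t}" by (rule Suc.IH)
 moreover have "k c * s ^ Suc n + k d * (s ^ n * t) \<in> fieldgen k {s, t}"
  by (intro fg(1,3,4) fg_power g)
 ultimately have "x - (k c * s ^ Suc n + k d * (s ^ n * t)) + (k c * s ^ Suc n + k d * (s ^ n * t)) \<in> fieldgen k {s, t}"
  by (rule fg(3))
 then show ?case by simp
qed

lemma K_generated:
 assumes "s \<in> L 1" "s \<notin> range k" "t \<in> L 1"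
  and "\<And>x. ge P 0 x ==> \<exists>c d. ge P 1 (x - (k c + k d * (t / s)))"
 shows "K \<subseteq> fieldgen k {s, t}"
proof
 fix y assume "y \<in> K"
 then obtain c n where c: "c ~= 0" "c \<in> L n" "c * y \<in> L n" using ex_denominator by blast
 then have "c * y / c \<in> fieldgen k {s, t}" using L_generated[OF assms] by (intro fg_divide)
 then show "y \<in> fieldgen k {s, t}" using c(1) by simp
qed

text \<open>The divisor \<open>N P\<close> has degree two, so \<open>1, x, y\<close> map the curve to a conic.\<close>

definition anticanonical_model :: "nat => 'b => 'b => bool" where
 "anticanonical_model N x y \<longleftrightarrow> x \<in> L N \<and> y \<in> L N \<and> linear_independent3 1 x y \<and> pencils_quadratic x y \<and>
   (\<exists>B. finite B \<and> card B \<le> 5 \<and> L (2 * N) \<subseteq> vs.span B)"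

text \<open>With a simple pole \<open>t\<close> at a rational place, \<open>L(nP)\<close> consists of the polynomials of degree \<open>n\<close> in \<open>t\<close>.\<close>

lemma model_rational_place:
 assumes res: "\<And>x. ge P 0 x ==> \<exists>c. ge P 1 (x - k c)"
 shows "\<exists>x y. anticanonical_model 2 x y"
proof -
 obtain t where t: "t \<in> L 1" "t \<notin> range k" using ex_simple_pole by blast
 have tK: "t \<in> K" using L_K[OF t(1)] .
 have z: "0 \<in> L 1" using L_const[of 0] by simp
 have res': "\<exists>c d. ge P 1 (x - (k c + k d * (0 / t)))" if "ge P 0 x" for x using res[OF that] by simp
 have "K \<subseteq> fieldgen k {t, 0}" by (rule K_generated[OF t z res'])
 then have gen: "K \<subseteq> fieldgen k {t}" using fieldgen_least[of "{t, 0}" "{t}"] by (auto intro: fg)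
 have tr: "p = 0" if "peval k p t = 0" for p using nonconst_imp_transcendental[OF tK t(2) that] .
 have "linear_independent3 1 t (t ^ 2)"
  unfolding linear_independent3_def
 proof (intro allI impI)
  fix a b c assume "k a * 1 + k b * t + k c * t ^ 2 = 0"
  then have "peval k [:a, b, c:] t = 0" by (simp add: power2_eq_square algebra_simps)
  then show "a = 0 \<and> b = 0 \<and> c = 0" using tr[of "[:a, b, c:]"] by simp
 qed
 moreover have span: "x \<in> vs.span ((\<lambda>i. t ^ i) ` {..n})" if "x \<in> L n" for x n
  using that
 proof (induction n arbitrary: x)
  case 0
  then obtain c where x: "x = k c * t ^ 0" using L_0_const by auto
  show ?case unfolding x by (rule vs.span_scale[OF vs.span_base]) simp
 next
  case (Suc n)
  obtain c where "x - (k c * t ^ Suc n + k 0 * (t ^ n * 0)) \<in> L n"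
   using L_step[OF t z res' Suc.prems] by auto
  then have "x - k c * t ^ Suc n \<in> vs.span ((\<lambda>i. t ^ i) ` {..n})" using Suc.IH by simp
  then have 1: "x - k c * t ^ Suc n \<in> vs.span ((\<lambda>i. t ^ i) ` {..Suc n})"
   by (rule subsetD[OF vs.span_mono, rotated]) auto
  have 2: "k c * t ^ Suc n \<in> vs.span ((\<lambda>i. t ^ i) ` {..Suc n})"
   by (rule vs.span_scale[OF vs.span_base]) (rule imageI, simp)
  show ?case using vs.span_add[OF 1 2] by simp
 qed
 have "\<exists>B. finite B \<and> card B \<le> 5 \<and> L (2 * 2) \<subseteq> vs.span B"
  using span[of _ 4] card_image_le[of "{..4}" "\<lambda>i. t ^ i"]
  by (intro exI[of _ "(\<lambda>i. t ^ i) ` {..4}"]) auto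
 moreover have "t \<in> L 2" "t ^ 2 \<in> L 2" using L_mono[OF _ t(1), of 2] L_power[OF t(1), of 2] by simp_all
 ultimately show ?thesis
  unfolding anticanonical_model_def using pencils_quadratic_parabola[OF tK gen] by blast
qed

text \<open>At a place with residue field \<open>R(\<surd>-1)\<close>, two functions \<open>s, t\<close> with \<open>t/s\<close> reducing to \<open>\<surd>-1\<close>
 satisfy \<open>s\<^sup>2 + t\<^sup>2 \<in> L(P)\<close>, which is the equation of a circle.\<close>

lemma model_complex_place:
 assumes res: "\<And>x. ge P 0 x ==>
   (\<exists>c. ge P 1 (x - k c)) \<or> (\<exists>a b. b ~= 0 \<and> ge P 1 ((x - k a) ^ 2 + k (b ^ 2)))"
  and \<delta>: "2 \<le> \<delta>"
 shows "\<exists>x y. anticanonical_model 1 x y"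
proof -
 obtain s where s: "s \<in> L 1" "s \<notin> range k" using ex_simple_pole by blast
 have s0: "s ~= 0" "P s = - 1" "s \<in> K" using simple_pole[OF s] L_K[OF s(1)] by auto
 have "card {1, s} \<le> 2" by (simp add: card_insert_if)
 then obtain t0 where t0: "t0 \<in> L 1" "t0 \<notin> vs.span {1, s}" using L_not_spanned[of "{1, s}" 1] \<delta> by auto
 have t0K: "t0 \<in> K" using L_K[OF t0(1)] .
 have sp: "k a + k b * s \<in> vs.span {1, s}" for a b
  using vs.span_add[OF vs.span_scale[OF vs.span_base, of 1 "{1, s}" a] vs.span_scale[OF vs.span_base, of s "{1, s}" b]] by simp
 have "ge P (- 1 - P s) (t0 / s)" by (rule ge_divide[OF P _ s0(3,1)]) (use t0 in \<open>simp add: L_def\<close>)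
 then have r0: "ge P 0 (t0 / s)" unfolding s0(2) by simp
 have "\<not> ge P 1 (t0 / s - k c)" for c
 proof
  assume c: "ge P 1 (t0 / s - k c)"
  have "ge P (- 1 + 1) (s * (t0 / s - k c))" by (rule ge_mult[OF P _ c]) (use s0 in \<open>simp add: ge_def\<close>)
  moreover have "s * (t0 / s - k c) = t0 - k c * s" using s0 by (simp add: field_simps)
  ultimately have "t0 - k c * s \<in> L 0"
   using L_drop[of "t0 - k c * s" 0] L_diff[OF t0(1) L_scale[OF s(1)]] by simp
  then obtain a where "t0 - k c * s = k a" using L_0_const by blast
  then have "t0 = k a + k c * s" by (simp add: algebra_simps)
  then show False using t0(2) sp by simp
 qed
 then obtain a b where ab: "b ~= 0" "ge P 1 ((t0 / s - k a) ^ 2 + k (b ^ 2))" using res[OF r0] by blast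
 define t where "t = k (inverse b) * (t0 - k a * s)"
 have t: "t \<in> L 1" unfolding t_def by (intro L_scale L_diff t0 s)
 have tK: "t \<in> K" using L_K[OF t] .
 have t0_eq: "t0 = k b * t + k a * s" unfolding t_def using ab(1) by (simp add: field_simps)
 have "k (inverse b ^ 2) * ((t0 / s - k a) ^ 2 + k (b ^ 2)) = (t / s) ^ 2 + 1"
  unfolding t0_eq using ab(1) s0(1) by (simp add: field_simps power2_eq_square)
 then have i: "ge P 1 ((t / s) ^ 2 + 1)" using ge_scale[OF P ab(2), of "inverse b ^ 2"] by simp
 have ts: "ge P 0 (t / s)"
 proof -
  have "ge P (- 1 - P s) (t / s)" by (rule ge_divide[OF P _ s0(3,1)]) (use t in \<open>simp add: L_def\<close>)
  then show ?thesis unfolding s0(2) by simp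
 qed
 have res': "\<exists>c d. ge P 1 (x - (k c + k d * (t / s)))" if x: "ge P 0 x" for x
  by (rule residue_generated[OF P res[OF x] ts i x])
 note step = L_step[OF s t res']
 have gen: "K \<subseteq> fieldgen k {s, t}" by (rule K_generated[OF s t res'])
 have "ge P (- 2) (s ^ 2)" using place_power[OF P s0(3,1), of 2] K.D_power[OF s0(3), of 2] s0(2) by (simp add: ge_def)
 then have "ge P (- 2 + 1) (s ^ 2 * ((t / s) ^ 2 + 1))" by (rule ge_mult[OF P _ i])
 moreover have "s ^ 2 * ((t / s) ^ 2 + 1) = s ^ 2 + t ^ 2" using s0(1) by (simp add: field_simps)
 ultimately have "ge P (- 1) (s ^ 2 + t ^ 2)" by simp
 moreover have "s ^ 2 + t ^ 2 \<in> L (Suc 1)" using L_add[OF L_power[OF s(1), of 2] L_power[OF t, of 2]] by (simp add: numeral_2_eq_2)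
 ultimately have "s ^ 2 + t ^ 2 \<in> L (Suc 0)" using L_drop[of "s ^ 2 + t ^ 2" 1] by simp
 then obtain c1 d1 where "s ^ 2 + t ^ 2 - (k c1 * s ^ Suc 0 + k d1 * (s ^ 0 * t)) \<in> L 0" using step by blast
 then obtain c0 where c0: "s ^ 2 + t ^ 2 - (k c1 * s + k d1 * t) = k c0" using L_0_const by fastforce
 define s' t' where "s' = s - k (c1 / 2)" and "t' = t - k (d1 / 2)"
 have st: "s = s' + k (c1 / 2)" "t = t' + k (d1 / 2)" unfolding s'_def t'_def by simp_all
 have h: "k c1 = k (c1 / 2) + k (c1 / 2)" "k d1 = k (d1 / 2) + k (d1 / 2)"
  by (simp_all flip: hom_add del: hom_divide)
 have circle: "s' ^ 2 + t' ^ 2 = k (c0 + (c1 / 2) ^ 2 + (d1 / 2) ^ 2)"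
  unfolding hom_add c0[symmetric] h hom_power st by (rule shift_circle)
 have s'L: "s' \<in> L 1" "t' \<in> L 1" unfolding s'_def t'_def by (intro L_diff s t L_const)+
 have s'K: "s' \<in> K" "t' \<in> K" using s'L L_K by blast+
 have g': "s' \<in> fieldgen k {s', t'}" "t' \<in> fieldgen k {s', t'}" by (auto intro: fg)
 have "s \<in> fieldgen k {s', t'}" "t \<in> fieldgen k {s', t'}" unfolding st by (intro fg(1,3) g')+
 then have gen': "K \<subseteq> fieldgen k {s', t'}" using gen fieldgen_least[of "{s, t}" "{s', t'}"] by blast
 have "linear_independent3 1 s' t'"
  unfolding linear_independent3_def
 proof (intro allI impI)
  fix e0 e1 e2 assume "k e0 * 1 + k e1 * s' + k e2 * t' = 0"
  then have e: "k e0 + k e1 * s' + k e2 * t' = 0" by simp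
  have e2: "e2 = 0"
  proof (rule ccontr)
   assume e2: "e2 ~= 0"
   then have "t' = - (k (e0 / e2) + k (e1 / e2) * s')"
    using e by (simp add: field_simps eq_neg_iff_add_eq_0)
   then have "t0 = k (b * (d1 / 2 - e0 / e2 + e1 / e2 * (c1 / 2))) + k (a - b * (e1 / e2)) * s"
   proof -
    assume t': "t' = - (k (e0 / e2) + k (e1 / e2) * s')"
    have "t0 = k b * (- (k (e0 / e2) + k (e1 / e2) * (s - k (c1 / 2))) + k (d1 / 2)) + k a * s"
     unfolding t0_eq st(2) t' s'_def ..
    then show ?thesis unfolding hom_mult hom_add hom_diff substitute_linear .
   qed
   then show False using t0(2) sp by metis
  qed
  have e1: "e1 = 0"
  proof (rule ccontr)
   assume e1: "e1 ~= 0"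
   then have "s' = k (- e0 / e1)" using e e2 by (simp add: field_simps eq_neg_iff_add_eq_0)
   then have "s = k (- e0 / e1 + c1 / 2)" unfolding st(1) by simp
   then show False using s(2) by blast
  qed
  show "e0 = 0 \<and> e1 = 0 \<and> e2 = 0" using e e1 e2 by simp
 qed
 moreover have "\<exists>B. finite B \<and> card B \<le> 5 \<and> L (2 * 1) \<subseteq> vs.span B"
 proof (intro exI conjI subsetI)
  let ?B = "set [1, s, t, s ^ 2, s * t]"
  show "finite ?B" by simp
  show "card ?B \<le> 5" by (rule card_length[THEN order_trans]) simp
  fix x assume "x \<in> L (2 * 1)"
  then have "x \<in> L (Suc 1)" by (simp add: numeral_2_eq_2)
  then obtain c2 d2 where "x - (k c2 * s ^ Suc 1 + k d2 * (s ^ 1 * t)) \<in> L 1" using step by blast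
  then have "x - (k c2 * s ^ 2 + k d2 * (s * t)) \<in> L (Suc 0)" by (simp add: numeral_2_eq_2)
  then obtain c1 d1 where "x - (k c2 * s ^ 2 + k d2 * (s * t)) - (k c1 * s ^ Suc 0 + k d1 * (s ^ 0 * t)) \<in> L 0" using step by blast
  then obtain c0 where "x - (k c2 * s ^ 2 + k d2 * (s * t)) - (k c1 * s + k d1 * t) = k c0" using L_0_const by fastforce
  then have "x = k c0 * 1 + k c1 * s + k d1 * t + k c2 * s ^ 2 + k d2 * (s * t)" by (simp add: algebra_simps)
  then show "x \<in> vs.span ?B" by (simp only:) (intro vs.span_add vs.span_scale vs.span_base; simp)
 qed
 ultimately show ?thesis
  unfolding anticanonical_model_def using s'L pencils_quadratic_circle[OF s'K gen' circle] by blast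
qed

end

section \<open>Singular pencils of symmetric matrices\<close>

lemma ex_orthogonal_pair:
 fixes c :: "nat => 'a::field"
 obtains x y where "x 0 * c 0 + x 1 * c 1 + x 2 * c 2 = 0" "y 0 * c 0 + y 1 * c 1 + y 2 * c 2 = 0"
  "\<And>r::'a. \<exists>i<3. x i ~= r * y i" "\<exists>i<3::nat. y i ~= 0"
proof -
 let ?v = "\<lambda>(a::'a) b c (i::nat). if i = 0 then a else if i = 1 then b else c"
 consider "c 0 ~= 0" | "c 0 = 0" "c 1 ~= 0" | "c 0 = 0" "c 1 = 0" by blast
 then show thesis
 proof cases
  case 1
  have "\<exists>i<3. ?v (c 1) (- c 0) 0 i ~= r * ?v (c 2) 0 (- c 0) i" for r using 1 by (intro exI[of _ 1]) simp
  moreover have "\<exists>i<3. ?v (c 2) 0 (- c 0) i ~= 0" using 1 by (intro exI[of _ 2]) simp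
  ultimately show thesis using that[of "?v (c 1) (- c 0) 0" "?v (c 2) 0 (- c 0)"] by simp
 next
  case 2
  have "\<exists>i<3. ?v 1 0 0 i ~= r * ?v 0 (c 2) (- c 1) i" for r by (intro exI[of _ 0]) simp
  moreover have "\<exists>i<3. ?v 0 (c 2) (- c 1) i ~= 0" using 2 by (intro exI[of _ 2]) simp
  ultimately show thesis using that[of "?v 1 0 0" "?v 0 (c 2) (- c 1)"] 2 by simp
 next
  case 3
  have "\<exists>i<3. ?v 1 0 0 i ~= r * ?v 0 1 0 i" for r by (intro exI[of _ 0]) simp
  moreover have "\<exists>i<3. ?v 0 1 0 i ~= 0" by (intro exI[of _ 1]) simp
  ultimately show thesis using that[of "?v 1 0 0" "?v 0 1 0"] 3 by simp
 qed
qed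

lemma cross_product:
 fixes a :: "'a::comm_ring_1"
 shows "a * (b * c' - c * b') + b * (c * a' - a * c') + c * (a * b' - b * a') = 0 \<and>
  a' * (b * c' - c * b') + b' * (c * a' - a * c') + c' * (a * b' - b * a') = 0"
 by (simp add: algebra_simps)

lemma product_of_three_linear:
 fixes a1 :: "'a::comm_ring_1"
 shows "degree ([:b1, a1:] * ([:b2, a2:] * [:b3, a3:])) \<le> 3 \<and>
  coeff ([:b1, a1:] * ([:b2, a2:] * [:b3, a3:])) 3 = a1 * (a2 * a3)"
proof -
 have "[:b1, a1:] * ([:b2, a2:] * [:b3, a3:]) =
   [:b1 * (b2 * b3), a1 * (b2 * b3) + b1 * (a2 * b3 + b2 * a3), b1 * (a2 * a3) + a1 * (a2 * b3 + b2 * a3), a1 * (a2 * a3):]"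
  by (simp add: algebra_simps)
 then show ?thesis by (simp add: numeral_3_eq_3)
qed

text \<open>The kernel is spanned by a cross product of two rows, or, in rank one, consists of everything
 orthogonal to a single row.\<close>

lemma singular_matrix_kernel:
 fixes a :: "'a::field"
 assumes "a * (e * i - f * h) - b * (d * i - f * g) + c * (d * h - e * g) = 0"
 shows "\<exists>x y z. (x ~= 0 \<or> y ~= 0 \<or> z ~= 0) \<and>
  a * x + b * y + c * z = 0 \<and> d * x + e * y + f * z = 0 \<and> g * x + h * y + i * z = 0"
proof (cases "e * i - f * h ~= 0 \<or> f * g - d * i ~= 0 \<or> d * h - e * g ~= 0")
 case True
 have "a * (e * i - f * h) + b * (f * g - d * i) + c * (d * h - e * g) = 0" using assms by (simp add: algebra_simps)
 then show ?thesis using True cross_product[of d e i f h g]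
  by (intro exI[of _ "e * i - f * h"] exI[of _ "f * g - d * i"] exI[of _ "d * h - e * g"]) blast
next
 case r23: False
 show ?thesis
 proof (cases "b * i - c * h ~= 0 \<or> c * g - a * i ~= 0 \<or> a * h - b * g ~= 0")
  case True
  have "d * (b * i - c * h) + e * (c * g - a * i) + f * (a * h - b * g)
    = - (a * (e * i - f * h) - b * (d * i - f * g) + c * (d * h - e * g))" by (simp add: algebra_simps)
  then show ?thesis using True cross_product[of a b i c h g] assms
   by (intro exI[of _ "b * i - c * h"] exI[of _ "c * g - a * i"] exI[of _ "a * h - b * g"]) simp
 next
  case r13: False
  show ?thesis
  proof (cases "b * f - c * e ~= 0 \<or> c * d - a * f ~= 0 \<or> a * e - b * d ~= 0")
   case True
   have "g * (b * f - c * e) + h * (c * d - a * f) + i * (a * e - b * d)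
     = a * (e * i - f * h) - b * (d * i - f * g) + c * (d * h - e * g)" by (simp add: algebra_simps)
   then show ?thesis using True cross_product[of a b f c e d] assms
    by (intro exI[of _ "b * f - c * e"] exI[of _ "c * d - a * f"] exI[of _ "a * e - b * d"]) simp
  next
   case r12: False
   have rank1: "\<exists>x y z. (x ~= 0 \<or> y ~= 0 \<or> z ~= 0) \<and> p * x + q * y + r * z = 0 \<and>
     p' * x + q' * y + r' * z = 0 \<and> p'' * x + q'' * y + r'' * z = 0"
    if nz: "p ~= 0 \<or> q ~= 0 \<or> r ~= 0"
     and m: "q * r' = r * q'" "r * p' = p * r'" "p * q' = q * p'"
      "q * r'' = r * q''" "r * p'' = p * r''" "p * q'' = q * p''"
    for p q r p' q' r' p'' q'' r'' :: 'a
   proof (cases "p = 0 \<and> q = 0")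
    case True
    then show ?thesis using nz m by (intro exI[of _ 1] exI[of _ 0]) auto
   next
    case False
    then show ?thesis using m
     by (intro exI[of _ q] exI[of _ "- p"] exI[of _ 0]) (auto simp: mult.commute)
   qed
   have rel: "b * f = c * e" "c * d = a * f" "a * e = b * d" "b * i = c * h" "c * g = a * i" "a * h = b * g"
    "e * i = f * h" "f * g = d * i" "d * h = e * g" using r12 r13 r23 by auto
   consider "a ~= 0 \<or> b ~= 0 \<or> c ~= 0" | "d ~= 0 \<or> e ~= 0 \<or> f ~= 0"
    | "a = 0" "b = 0" "c = 0" "d = 0" "e = 0" "f = 0" by blast
   then show ?thesis
   proof cases
    case 1
    show ?thesis by (rule rank1[OF 1]) (use rel in auto)
   next
    case 2
    have "\<exists>x y z. (x ~= 0 \<or> y ~= 0 \<or> z ~= 0) \<and> d * x + e * y + f * z = 0 \<and>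
      a * x + b * y + c * z = 0 \<and> g * x + h * y + i * z = 0"
     by (rule rank1[OF 2]) (use rel in \<open>auto simp: mult.commute\<close>)
    then show ?thesis by blast
   next
    case 3
    show ?thesis
    proof (cases "g = 0 \<and> h = 0")
     case True
     then show ?thesis using 3 by (intro exI[of _ 1] exI[of _ 0]) simp
    next
     case False
     then show ?thesis using 3
      by (intro exI[of _ h] exI[of _ "- g"] exI[of _ 0]) (auto simp: mult.commute)
    qed
   qed
  qed
 qed
qed

text \<open>The determinant is a cubic form in the parameters of the pencil, so it has a nontrivial zero.\<close>

lemma singular_pencil:
 fixes A B :: "nat => nat => 'a::real_closed_field"
 obtains l m x where "l ~= 0 \<or> m ~= 0" "\<exists>j<3::nat. x j ~= 0"
  "\<And>i. i < 3 ==> l * (\<Sum>j<3. A i j * x j) + m * (\<Sum>j<3. B i j * x j) = 0"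
proof -
 define D where "D = (\<lambda>a b c d e f g h i. a * (e * i - f * h) - b * (d * i - f * g) + c * (d * h - e * g) :: 'a)"
 define M where "M = (\<lambda>l m i j. l * A i j + m * B i j)"
 have "\<exists>l m. (l ~= 0 \<or> m ~= 0) \<and> D (M l m 0 0) (M l m 0 1) (M l m 0 2) (M l m 1 0) (M l m 1 1) (M l m 1 2)
   (M l m 2 0) (M l m 2 1) (M l m 2 2) = 0"
 proof (cases "D (A 0 0) (A 0 1) (A 0 2) (A 1 0) (A 1 1) (A 1 2) (A 2 0) (A 2 1) (A 2 2) = 0")
  case True
  then show ?thesis by (intro exI[of _ 1] exI[of _ 0]) (simp add: M_def)
 next
  case False
  define q where "q = (\<lambda>i j. [:B i j, A i j:])"
  define p where "p = q 0 0 * (q 1 1 * q 2 2) - q 0 0 * (q 1 2 * q 2 1) - q 0 1 * (q 1 0 * q 2 2)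
    + q 0 1 * (q 1 2 * q 2 0) + q 0 2 * (q 1 0 * q 2 1) - q 0 2 * (q 1 1 * q 2 0)"
  have t: "degree (q i j * (q i' j' * q i'' j'')) \<le> 3"
   "coeff (q i j * (q i' j' * q i'' j'')) 3 = A i j * (A i' j' * A i'' j'')" for i j i' j' i'' j''
   unfolding q_def using product_of_three_linear by blast+
  have "degree p \<le> 3" unfolding p_def by (intro degree_add_le degree_diff_le t)
  moreover have "coeff p 3 = D (A 0 0) (A 0 1) (A 0 2) (A 1 0) (A 1 1) (A 1 2) (A 2 0) (A 2 1) (A 2 2)"
   unfolding p_def coeff_add coeff_diff t D_def by (simp add: right_diff_distrib)
  ultimately have co: "degree p \<le> 3 \<and>
    coeff p 3 = D (A 0 0) (A 0 1) (A 0 2) (A 1 0) (A 1 1) (A 1 2) (A 2 0) (A 2 1) (A 2 2)" by blast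
  then have "degree p = 3" using False le_degree[of p 3] by simp
  then obtain t where "poly p t = 0" using ex_root_odd_degree[of p] by auto
  then have "D (M t 1 0 0) (M t 1 0 1) (M t 1 0 2) (M t 1 1 0) (M t 1 1 1) (M t 1 1 2)
   (M t 1 2 0) (M t 1 2 1) (M t 1 2 2) = 0"
  proof -
   have "poly (q i j) t = M t 1 i j" for i j unfolding q_def M_def by simp
   then show ?thesis using \<open>poly p t = 0\<close> unfolding p_def D_def by (simp add: right_diff_distrib)
  qed
  then show ?thesis by (intro exI[of _ t] exI[of _ 1]) simp
 qed
 then obtain l m where lm: "l ~= 0 \<or> m ~= 0" "D (M l m 0 0) (M l m 0 1) (M l m 0 2) (M l m 1 0) (M l m 1 1) (M l m 1 2)
   (M l m 2 0) (M l m 2 1) (M l m 2 2) = 0" by blast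
 from singular_matrix_kernel[OF lm(2)[unfolded D_def]] obtain x y z where xyz: "x ~= 0 \<or> y ~= 0 \<or> z ~= 0"
  "M l m 0 0 * x + M l m 0 1 * y + M l m 0 2 * z = 0" "M l m 1 0 * x + M l m 1 1 * y + M l m 1 2 * z = 0"
  "M l m 2 0 * x + M l m 2 1 * y + M l m 2 2 * z = 0" by blast
 let ?x = "\<lambda>j::nat. if j = 0 then x else if j = 1 then y else z"
 have s3: "(\<Sum>j<3. g j) = g 0 + g 1 + g 2" for g :: "nat => 'a"
  by (simp add: numeral_3_eq_3 numeral_2_eq_2)
 show thesis
 proof (rule that[OF lm(1), of ?x])
  have "?x 0 ~= 0 \<or> ?x 1 ~= 0 \<or> ?x 2 ~= 0" using xyz(1) by simp
  then show "\<exists>j<3. ?x j ~= 0" 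
  proof (elim disjE)
   assume "?x 0 ~= 0" then show ?thesis by (intro exI[of _ 0]) simp
  next
   assume "?x 1 ~= 0" then show ?thesis by (intro exI[of _ 1]) simp
  next
   assume "?x 2 ~= 0" then show ?thesis by (intro exI[of _ 2]) simp
  qed
  fix i :: nat assume "i < 3"
  then consider "i = 0" | "i = 1" | "i = 2" by linarith
  then show "l * (\<Sum>j<3. A i j * ?x j) + m * (\<Sum>j<3. B i j * ?x j) = 0"
   by cases (use xyz in \<open>simp_all add: s3 M_def algebra_simps\<close>)
 qed
qed

section \<open>Plane quartics of genus zero\<close>

text \<open>The field is generated by a plane curve of degree at most four, so that projections from points
 have degree at most four.\<close>

locale plane_genus_zero = genus_zero_function_field k K P \<delta>
 for k :: "'a::real_closed_field => 'b::field" and K P \<delta> +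
 fixes v w :: 'b
 assumes v_K: "v \<in> K" and w_K: "w \<in> K" and vw_independent: "linear_independent3 1 v w"
  and pencil_degree: "lin v w b ~= 0 ==> lin v w a / lin v w b \<notin> range k ==>
   finite_over (lin v w a / lin v w b) 4"
begin

definition coord :: "nat => 'b" where "coord i = (if i = 0 then 1 else if i = 1 then v else w)"

lemma lin_coord: "lin v w a = (\<Sum>i<3. k (a i) * coord i)"
 by (simp add: lin_def coord_def numeral_3_eq_3 numeral_2_eq_2)

lemma lin_eq_0: "lin v w a = 0 ==> i < 3 ==> a i = 0"
proof -
 assume "lin v w a = 0" "i < 3"
 then have "a 0 = 0 \<and> a 1 = 0 \<and> a 2 = 0" using vw_independent unfolding linear_independent3_def lin_def by simp
 moreover have "i = 0 \<or> i = 1 \<or> i = 2" using \<open>i < 3\<close> by linarith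
 ultimately show "a i = 0" by auto
qed

lemma lin_combine: "k c * lin v w a + k d * lin v w b = lin v w (\<lambda>i. c * a i + d * b i)"
 by (simp add: lin_def algebra_simps)

lemma ge_prod: "u \<in> Places ==> (\<And>i. i \<in> I ==> ge u (e i) (g i)) ==> ge u (sum e I) (prod g I)"
 by (induction I rule: infinite_finite_induct) (auto intro: ge_1 ge_mult)

definition scaled :: "nat => 'b => bool" where
 "scaled n h \<longleftrightarrow> h ~= 0 \<and> (\<forall>i<3. h * coord i \<in> L n)"

lemma ex_scaled: "\<exists>n h. scaled n h"
proof -
 obtain c n where c: "c ~= 0" "c \<in> L n" "c * v \<in> L n" using ex_denominator[OF v_K] by blast
 obtain d m where d: "d ~= 0" "d \<in> L m" "d * w \<in> L m" using ex_denominator[OF w_K] by blast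
 have "c * d \<in> L (n + m)" "c * d * v \<in> L (n + m)" "c * d * w \<in> L (n + m)"
  using L_mult[OF c(2) d(2)] L_mult[OF c(3) d(2)] L_mult[OF c(2) d(3)] by (simp_all add: ac_simps)
 then have "scaled (n + m) (c * d)" using c(1) d(1) unfolding scaled_def coord_def by auto
 then show ?thesis by blast
qed

definition level :: nat where "level = (LEAST n. \<exists>h. scaled n h)"

lemma level_scaled: "\<exists>h. scaled level h"
 unfolding level_def using LeastI_ex[OF ex_scaled] .

lemma level_minimal: "scaled n h ==> level \<le> n"
 unfolding level_def by (rule Least_le) blast

lemma level_pos: "0 < level"
proof (rule ccontr)
 assume "\<not> 0 < level"
 then obtain h where h: "scaled 0 h" using level_scaled by auto
 have "h * coord 0 \<in> range k" "h * coord 1 \<in> range k" using h L_0_const unfolding scaled_def by auto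
 then obtain a b where ab: "h = k a" "h * v = k b" unfolding coord_def by auto
 have "lin v w (\<lambda>i. if i = 0 then b else if i = 1 then - a else 0) = 0"
  unfolding lin_def using ab by simp
 then have "a = 0" using lin_eq_0[of _ 1] by fastforce
 then show False using ab(1) h unfolding scaled_def by simp
qed

context
 fixes h assumes h: "scaled level h"
begin

lemma h_nz: "h ~= 0" and h_L: "i < 3 ==> h * coord i \<in> L level"
 using h unfolding scaled_def by auto

lemma h_lin_L: "h * lin v w a \<in> L level"
proof -
 have "h * lin v w a = (\<Sum>i<3. k (a i) * (h * coord i))"
  unfolding lin_coord by (simp add: sum_distrib_left ac_simps)
 moreover have "\<dots> \<in> L level" by (intro L_sum L_scale h_L) simp
 ultimately show ?thesis by simp
qed

text \<open>A common zero could be moved to \<open>P\<close> and so lower the level.\<close>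

lemma no_common_zero:
 assumes Q: "Q \<in> Places" "Q ~= P"
 shows "\<exists>i<3. \<not> ge Q 1 (h * coord i)"
proof (rule ccontr)
 assume "\<not> ?thesis"
 then have z: "\<And>i. i < 3 ==> ge Q 1 (h * coord i)" by blast
 obtain g where g: "g ~= 0" "ge P 1 g" "ge Q (- 1) g" "\<And>u. u \<in> Places - {P, Q} ==> ge u 0 g"
  using ex_move_to_P[OF Q] by blast
 have "g * h * coord i \<in> L (level - 1)" if i: "i < 3" for i
  unfolding L_def
 proof (intro CollectI conjI ballI)
  have "ge P (1 + - int level) (g * (h * coord i))"
   by (rule ge_mult[OF P g(2)]) (use h_L[OF i] in \<open>simp add: L_def\<close>)
  then show "ge P (- int (level - 1)) (g * h * coord i)" using level_pos by (simp add: of_nat_diff mult.assoc)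
  fix u assume u: "u \<in> Places - {P}"
  then have uP: "u \<in> Places" by blast
  show "ge u 0 (g * h * coord i)"
  proof (cases "u = Q")
   case True
   then show ?thesis using ge_mult[OF Q(1) g(3) z[OF i]] by (simp add: mult.assoc)
  next
   case False
   have "ge u 0 (h * coord i)" using h_L[OF i] u unfolding L_def by blast
   then show ?thesis using ge_mult0[OF uP g(4)] u False by (simp add: mult.assoc)
  qed
 qed
 then have "scaled (level - 1) (g * h)" using g(1) h_nz unfolding scaled_def by simp
 then show False using level_minimal level_pos by fastforce
qed

text \<open>Otherwise the level could be lowered.\<close>

lemma ex_full_pole: "\<exists>i<3. P (h * coord i) = - int level \<and> h * coord i ~= 0"
proof (rule ccontr)
 assume no: "\<not> ?thesis"
 have "h * coord i \<in> L (level - 1)" if i: "i < 3" for i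
 proof -
  have "h * coord i \<in> L (Suc (level - 1))" using h_L[OF i] level_pos by simp
  moreover have "ge P (- int (level - 1)) (h * coord i)"
  proof (cases "h * coord i = 0")
   case False
   then have "P (h * coord i) ~= - int level" using no i by blast
   moreover have "ge P (- int level) (h * coord i)" using h_L[OF i] unfolding L_def by blast
   ultimately show ?thesis using False level_pos unfolding ge_def by (simp add: of_nat_diff)
  next
   case True
   show ?thesis unfolding True by (rule ge_0)
  qed
  ultimately show ?thesis by (rule L_drop)
 qed
 then have "scaled (level - 1) h" using h_nz unfolding scaled_def by blast
 then show False using level_minimal level_pos by fastforce
qed

text \<open>A function in \<open>L level\<close> has at most \<open>level\<close> zeros, so in a pencil of linear forms some member has
 no common zero with it.\<close>

lemma ex_coprime_pencil:
 "\<exists>a b. P (h * lin v w b) = - int level \<and> lin v w b ~= 0 \<and> lin v w a / lin v w b \<notin> range k \<and>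
   (\<forall>Q\<in>Places - {P}. \<not> (ge Q 1 (h * lin v w a) \<and> ge Q 1 (h * lin v w b)))"
proof -
 obtain i0 where i0: "i0 < 3" "P (h * coord i0) = - int level" "h * coord i0 ~= 0" using ex_full_pole by blast
 obtain i1 i2 where i: "i1 < 3" "i2 < 3" "{..<3} = {i0, i1, i2}" "i0 ~= i1" "i0 ~= i2" "i1 ~= i2"
 proof -
  consider "i0 = 0" | "i0 = 1" | "i0 = 2" using i0(1) by linarith
  then show thesis by cases (rule that[of 1 2] that[of 0 2] that[of 0 1]; auto)+
 qed
 define b where "b = (\<lambda>i. if i = i0 then 1 else 0 :: 'a)"
 define a where "a = (\<lambda>(l::'a) i. if i = i1 then 1 else if i = i2 then l else 0)"
 have s3: "(\<Sum>i<3. g i) = g i0 + g i1 + g i2" for g :: "nat => 'b" unfolding i(3) using i(4-6) by simp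
 have linb: "lin v w b = coord i0" unfolding lin_coord s3 b_def using i(4-6) by simp
 have lina: "lin v w (a l) = coord i1 + k l * coord i2" for l unfolding lin_coord s3 a_def using i(4-6) by auto
 have bL: "h * lin v w b \<in> L level" by (rule h_lin_L)
 have b0: "lin v w b ~= 0" using i0(3) unfolding linb by auto
 have nonconst: "lin v w (a l) / lin v w b \<notin> range k" for l
 proof
  assume "lin v w (a l) / lin v w b \<in> range k"
  then obtain c where "lin v w (a l) = k c * lin v w b" using b0 by (auto simp: field_simps)
  then have "k 1 * lin v w (a l) + k (- c) * lin v w b = 0" by simp
  then have "lin v w (\<lambda>i. 1 * a l i + (- c) * b i) = 0" unfolding lin_combine .
  then have "1 * a l i1 + (- c) * b i1 = 0" by (rule lin_eq_0[OF _ i(1)])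
  then show False using i(4-6) unfolding a_def b_def by simp
 qed
 have "\<exists>l. \<forall>Q\<in>Places - {P}. \<not> (ge Q 1 (h * lin v w (a l)) \<and> ge Q 1 (h * lin v w b))"
 proof (rule ccontr)
  assume "\<not> ?thesis"
  then have "\<forall>l. \<exists>Q. Q \<in> Places \<and> Q ~= P \<and> ge Q 1 (h * lin v w (a l)) \<and> ge Q 1 (h * lin v w b)" by blast
  then obtain Q where Q: "\<And>l. Q l \<in> Places" "\<And>l. Q l ~= P" "\<And>l. ge (Q l) 1 (h * lin v w (a l))"
   "\<And>l. ge (Q l) 1 (h * lin v w b)" by metis
  have Q_inj: "l = m" if "Q l = Q m" for l m
  proof (rule ccontr)
   assume lm: "l ~= m"
   have "ge (Q l) 1 (h * lin v w (a l) - h * lin v w (a m))"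
    by (rule ge_diff[OF Q(1) Q(3)]) (unfold that, rule Q(3))
   moreover have "k (inverse (l - m)) * (h * lin v w (a l) - h * lin v w (a m)) = h * coord i2"
   proof -
    have "h * lin v w (a l) - h * lin v w (a m) = k (l - m) * (h * coord i2)"
     unfolding lina by (simp add: algebra_simps)
    then show ?thesis using lm by (simp add: field_simps)
   qed
   ultimately have z2: "ge (Q l) 1 (h * coord i2)" using ge_scale[OF Q(1)] by metis
   have "ge (Q l) 1 (h * lin v w (a l) - k l * (h * coord i2))" by (intro ge_diff ge_scale Q z2)
   moreover have "h * lin v w (a l) - k l * (h * coord i2) = h * coord i1" unfolding lina by (simp add: algebra_simps)
   ultimately have z1: "ge (Q l) 1 (h * coord i1)" by simp
   have z0: "ge (Q l) 1 (h * coord i0)" using Q(4)[of l] unfolding linb .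
   obtain i' where "i' < 3" "\<not> ge (Q l) 1 (h * coord i')" using no_common_zero[OF Q(1,2)] by blast
   moreover from this have "i' \<in> {i0, i1, i2}" using i(3) by blast
   ultimately show False using z0 z1 z2 by auto
  qed
  have "\<forall>l. \<exists>g. g ~= 0 \<and> ge P 1 g \<and> ge (Q l) (- 1) g \<and> (\<forall>u\<in>Places - {P, Q l}. ge u 0 g)"
   using ex_move_to_P[OF Q(1,2)] by blast
  then obtain g where g: "\<And>l. g l ~= 0" "\<And>l. ge P 1 (g l)" "\<And>l. ge (Q l) (- 1) (g l)"
   "\<And>l u. u \<in> Places - {P, Q l} ==> ge u 0 (g l)" by metis
  define I where "I = (of_nat :: nat => 'a) ` {..level}"
  have cI: "card I = Suc level" "finite I" unfolding I_def by (simp_all add: card_image inj_on_def)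
  define y where "y = h * lin v w b * prod g I"
  have "ge P (- int level + (\<Sum>l\<in>I. 1)) y"
   unfolding y_def by (intro ge_mult ge_prod P g) (use bL in \<open>simp add: L_def\<close>)
  then have yP: "ge P 1 y" using cI by simp
  have yu: "ge u 0 y" if u: "u \<in> Places" for u
  proof (cases "u = P")
   case True
   then show ?thesis using ge_mono[OF yP] by simp
  next
   case uP: False
   show ?thesis
   proof (cases "\<exists>l\<in>I. Q l = u")
    case True
    then obtain l where l: "l \<in> I" "Q l = u" by blast
    have "ge u (if m = l then - 1 else 0) (g m)" for m
    proof (cases "m = l")
     case True
     then show ?thesis using g(3)[of l] unfolding l(2) by simp
    next
     case False
     have "Q m ~= u"
     proof
      assume "Q m = u"
      then have "Q m = Q l" unfolding l(2) .
      then show False using Q_inj False by blast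
     qed
     then show ?thesis using False g(4)[of u m] u uP by simp
    qed
    then have "ge u (1 + (\<Sum>m\<in>I. if m = l then - 1 else 0)) y"
     unfolding y_def using Q(4)[of l] by (intro ge_mult ge_prod u) (auto simp: l(2))
    then show ?thesis using cI(2) l(1) by simp
   next
    case False
    have "ge u (0 + (\<Sum>l\<in>I. 0)) y" unfolding y_def
    proof (intro ge_mult ge_prod u)
     show "ge u 0 (h * lin v w b)" using bL u uP unfolding L_def by blast
     fix l assume "l \<in> I"
     then show "ge u 0 (g l)" using False u uP by (intro g(4)) auto
    qed
    then show ?thesis by simp
   qed
  qed
  have "y = 0" using regular_vanishing_imp_0[OF ge_K[OF yP] yu P yP] .
  then show False unfolding y_def using h_nz b0 g(1) cI(2) by simp
 qed
 then show ?thesis using i0(2) b0 nonconst unfolding linb[symmetric] by blast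
qed

text \<open>Elements of \<open>L (level - 1)\<close> that are independent over \<open>R\<close> stay independent over the field of the
 parameter of a pencil without base points; this field has index at most four.\<close>

lemma level_bound: "(level - 1) * \<delta> < 4"
proof (rule ccontr)
 assume "\<not> (level - 1) * \<delta> < 4"
 then have big: "4 \<le> (level - 1) * \<delta>" by simp
 obtain a b where ab: "P (h * lin v w b) = - int level" "lin v w b ~= 0" "lin v w a / lin v w b \<notin> range k"
  and cop: "\<And>Q. Q \<in> Places - {P} ==> \<not> (ge Q 1 (h * lin v w a) \<and> ge Q 1 (h * lin v w b))"
  using ex_coprime_pencil by blast
 define A where "A = h * lin v w a"
 define B where "B = h * lin v w b"
 have L: "A \<in> L level" "B \<in> L level" unfolding A_def B_def by (rule h_lin_L)+
 have AK: "A \<in> K" "B \<in> K" using L L_K by blast+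
 have B0: "B ~= 0" unfolding B_def using h_nz ab(2) by simp
 have A0: "A ~= 0"
 proof
  assume "A = 0"
  then have "lin v w a / lin v w b = k 0" unfolding A_def using h_nz by simp
  then show False using ab(3) by blast
 qed
 define r where "r = A / B"
 have r: "r = lin v w a / lin v w b" unfolding r_def A_def B_def using h_nz by simp
 have r0: "r ~= 0" unfolding r_def using A0 B0 by simp
 obtain z where z: "\<And>j. j \<le> (level - 1) * \<delta> ==> z j \<in> L (level - 1)" "indep_fam {..(level - 1) * \<delta>} z"
  using sections by blast
 have zK: "\<forall>j\<le>4. z j \<in> K" using z(1) L_K big by (meson order_trans)
 obtain \<phi> where \<phi>: "\<exists>j\<le>4::nat. \<phi> j ~= 0" "(\<Sum>j\<le>4. peval k (\<phi> j) r * z j) = 0"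
  using pencil_degree[OF ab(2,3)] zK unfolding r finite_over_def by meson
 define E where "E = Max ((\<lambda>j. degree (\<phi> j)) ` {j. j \<le> 4 \<and> \<phi> j ~= 0})"
 have fin: "finite ((\<lambda>j. degree (\<phi> j)) ` {j. j \<le> 4 \<and> \<phi> j ~= 0})"
  "(\<lambda>j. degree (\<phi> j)) ` {j. j \<le> 4 \<and> \<phi> j ~= 0} ~= {}" using \<phi>(1) by auto
 have dE: "degree (\<phi> j) \<le> E" if "j \<le> 4" for j
  using that fin(1) unfolding E_def by (cases "\<phi> j = 0") (auto intro: Max_ge)
 obtain j0 where j0: "j0 \<le> 4" "coeff (\<phi> j0) E ~= 0"
  using Max_in[OF fin] unfolding E_def[symmetric] by auto
 define y where "y = (\<lambda>i. \<Sum>j\<le>4. k (coeff (\<phi> j) i) * z j)"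
 have yL: "y i \<in> L (level - 1)" for i
  unfolding y_def using z(1) big by (intro L_sum L_scale) auto
 have yE: "y E ~= 0"
 proof
  assume "y E = 0"
  then have "(\<Sum>j\<le>(level - 1) * \<delta>. k (if j \<le> 4 then coeff (\<phi> j) E else 0) * z j) = 0"
   using big unfolding y_def by (subst sum.mono_neutral_cong_right[where S = "{..4}"]) auto
  then have "\<forall>j\<in>{..(level - 1) * \<delta>}. (if j \<le> 4 then coeff (\<phi> j) E else 0) = 0"
   using z(2) unfolding indep_fam_def by (elim allE[of _ "\<lambda>j. if j \<le> 4 then coeff (\<phi> j) E else 0"]) blast
  moreover have "j0 \<in> {..(level - 1) * \<delta>}" using j0(1) big unfolding atMost_iff by (rule order_trans)
  ultimately have "(if j0 \<le> 4 then coeff (\<phi> j0) E else 0) = 0" by (rule bspec)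
  then show False using j0 by simp
 qed
 have "(\<Sum>i\<le>E. r ^ i * y i) = (\<Sum>j\<le>4. peval k (\<phi> j) r * z j)"
 proof -
  have "(\<Sum>j\<le>4. peval k (\<phi> j) r * z j) = (\<Sum>j\<le>4. \<Sum>i\<le>E. k (coeff (\<phi> j) i) * r ^ i * z j)"
   by (rule sum.cong) (simp_all add: peval_sum_le[OF dE] sum_distrib_right)
  also have "\<dots> = (\<Sum>i\<le>E. r ^ i * y i)"
   unfolding y_def sum_distrib_left by (subst sum.swap) (simp add: ac_simps)
  finally show ?thesis by simp
 qed
 then have "(\<Sum>i\<le>E. r ^ i * y i) = 0" unfolding \<phi>(2) .
 moreover have "(\<Sum>i\<le>E. r ^ i * y i) = r ^ E * y E + (\<Sum>i<E. r ^ i * y i)"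
  by (simp flip: lessThan_Suc_atMost)
 ultimately have rel: "r ^ E * y E = - (\<Sum>i<E. r ^ i * y i)" by (simp add: eq_neg_iff_add_eq_0)
 have yE_eq: "y E = - (\<Sum>i<E. inverse r ^ (E - i) * y i)"
 proof -
  have "y E = inverse r ^ E * (r ^ E * y E)" using r0 by (simp add: power_inverse)
  also have "\<dots> = - (\<Sum>i<E. inverse r ^ E * (r ^ i * y i))" unfolding rel by (simp add: sum_distrib_left)
  also have "(\<Sum>i<E. inverse r ^ E * (r ^ i * y i)) = (\<Sum>i<E. inverse r ^ (E - i) * y i)"
  proof (rule sum.cong)
   fix i assume "i \<in> {..<E}"
   then have "inverse r ^ E = inverse r ^ (E - i) * inverse r ^ i" by (simp flip: power_add)
   then show "inverse r ^ E * (r ^ i * y i) = inverse r ^ (E - i) * y i" using r0 by (simp add: power_inverse)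
  qed simp
  finally show ?thesis .
 qed
 have yK: "y E \<in> K" using yL L_K by blast
 have yBP: "ge P 1 (y E / B)"
 proof -
  have "ge P (- int (level - 1) - P B) (y E / B)"
   by (rule ge_divide[OF P _ AK(2) B0]) (use yL in \<open>simp add: L_def\<close>)
  then show ?thesis using ab(1) level_pos unfolding B_def by (simp add: of_nat_diff)
 qed
 have yB: "ge u 0 (y E / B)" if u: "u \<in> Places" for u
 proof (cases "u = P")
  case True
  then show ?thesis using ge_mono[OF yBP] by simp
 next
  case uP: False
  then have u': "u \<in> Places - {P}" using u by blast
  have reg: "ge u 0 (y i)" "ge u 0 A" "ge u 0 B" for i using yL[of i] L u' unfolding L_def by blast+
  have "ge u (u B) (y E)"
  proof (cases "u B = 0")
   case True
   then show ?thesis using reg by simp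
  next
   case False
   then have uB: "u B > 0" using reg(3) B0 unfolding ge_def by auto
   then have "ge u 1 B" using AK by (simp add: ge_def)
   then have "\<not> ge u 1 A" using cop[OF u'] unfolding A_def B_def by blast
   then have uA: "u A = 0" using reg(2) AK unfolding ge_def by auto
   have ir: "inverse r = B / A" unfolding r_def by simp
   have irK: "inverse r \<in> K" unfolding ir by (intro K_divide AK)
   have "u (inverse r) = u B" unfolding ir using place_divide[OF u AK(2,1) B0 A0] uA by simp
   then have irg: "ge u (u B) (inverse r)" using irK by (simp add: ge_def)
   have "ge u (u B) (inverse r ^ (E - i) * y i)" if "i < E" for i
   proof -
    have "ge u (int (E - i) * u B + 0) (inverse r ^ (E - i) * y i)"
     by (rule ge_mult[OF u ge_power[OF u irg] reg(1)])
    moreover have "u B \<le> int (E - i) * u B" using that uB by simp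
    ultimately show ?thesis using ge_mono by simp
   qed
   then show ?thesis unfolding yE_eq by (intro ge_uminus ge_sum u) simp
  qed
  then show ?thesis using ge_divide[OF u _ AK(2) B0, of "u B"] by simp
 qed
 have "y E / B = 0" using regular_vanishing_imp_0[OF ge_K[OF yBP] yB P yBP] .
 then show False using yE B0 by simp
qed

end

text \<open>The elements of \<open>h \<langle>1, v, w\<rangle>\<close> form a three-dimensional subspace of a five-dimensional space
 containing all products of two elements of \<open>V = \<langle>1, x, y\<rangle>\<close>. If \<open>\<phi>\<^sub>1, \<phi>\<^sub>2\<close> cut out this subspace,
 some member of the pencil of bilinear forms \<open>\<phi>\<^sub>i(pq)\<close> on \<open>V\<close> has a nonzero element \<open>m\<close> in its radical,
 and then \<open>m p\<close> lies in the subspace for two independent \<open>p\<close>.\<close>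

lemma ex_quadratic_pencil:
 assumes model: "anticanonical_model N x y" and N: "N * \<delta> = 2"
 shows "\<exists>a b. lin v w b ~= 0 \<and> lin v w a / lin v w b \<notin> range k \<and> quadratic_over (lin v w a / lin v w b)"
proof -
 obtain h where h: "scaled level h" using level_scaled by blast
 have "(level - 1) * \<delta> < (2 * N) * \<delta>" using level_bound[OF h] N by (simp add: mult.assoc)
 then have "level \<le> 2 * N" using \<delta>_pos by simp
 then have hL: "h * lin v w a \<in> L (2 * N)" for a using L_mono h_lin_L[OF h] by blast
 have h0: "h ~= 0" using h_nz[OF h] .
 obtain B where B: "finite B" "card B \<le> 5" "L (2 * N) \<subseteq> vs.span B"
  and xy: "x \<in> L N" "y \<in> L N" "linear_independent3 1 x y" "pencils_quadratic x y"
  using model unfolding anticanonical_model_def by blast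
 define \<Lambda> where "\<Lambda> = (\<lambda>i. h * coord i) ` {..<3}"
 have hlin: "h * lin v w a = (\<Sum>i<3. k (a i) * (h * coord i))" for a
  unfolding lin_coord by (simp add: sum_distrib_left ac_simps)
 have inj: "inj_on (\<lambda>i. h * coord i) {..<3}"
 proof (rule inj_onI, rule ccontr)
  fix i j assume ij: "i \<in> {..<3}" "j \<in> {..<3}" "h * coord i = h * coord j" "i ~= j"
  define a where "a = (\<lambda>l. if l = i then 1 else if l = j then - 1 else 0 :: 'a)"
  have "lin v w a = (\<Sum>l\<in>{i, j}. k (a l) * coord l)"
   unfolding lin_coord using ij by (intro sum.mono_neutral_right) (auto simp: a_def)
  also have "\<dots> = 0" using ij h0 by (simp add: a_def)
  finally have "a i = 0" using lin_eq_0 ij(1) by blast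
  then show False by (simp add: a_def)
 qed
 have ind: "vs.independent \<Lambda>"
  unfolding vs.independent_explicit_finite_subsets
 proof (intro allI impI ballI)
  fix A g s assume A: "A \<subseteq> \<Lambda>" "finite A" and g: "(\<Sum>s\<in>A. k (g s) * s) = 0" and s: "s \<in> A"
  define a where "a = (\<lambda>i. if h * coord i \<in> A then g (h * coord i) else 0)"
  have "h * lin v w a = (\<Sum>s\<in>\<Lambda>. if s \<in> A then k (g s) * s else 0)"
   unfolding hlin \<Lambda>_def sum.reindex[OF inj] by (rule sum.cong) (auto simp: a_def)
  also have "\<dots> = (\<Sum>s\<in>A. k (g s) * s)"
   using A by (intro sum.mono_neutral_cong_right) (auto simp: \<Lambda>_def)
  finally have "lin v w a = 0" using g h0 by simp
  then have "\<And>i. i < 3 ==> a i = 0" using lin_eq_0 by blast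
  moreover obtain i where "i < 3" "s = h * coord i" using s A(1) unfolding \<Lambda>_def by auto
  ultimately show "g s = 0" using s unfolding a_def by fastforce
 qed
 have \<Lambda>L: "\<Lambda> \<subseteq> vs.span B"
 proof -
  have "h * coord i \<in> L (2 * N)" if "i < 3" for i
   using that h_L[OF h that] L_mono[OF \<open>level \<le> 2 * N\<close>] by blast
  then show ?thesis unfolding \<Lambda>_def using B(3) by auto
 qed
 obtain D where D: "\<Lambda> \<subseteq> D" "D \<subseteq> vs.span B" "vs.independent D" "vs.span B \<subseteq> vs.span D"
  using vs.maximal_independent_subset_extend[OF \<Lambda>L ind] by blast
 have cD: "finite D" "card D \<le> 5" using vs.independent_span_bound[OF B(1) D(3,2)] B(2) by auto
 have "card \<Lambda> = 3" unfolding \<Lambda>_def using card_image[OF inj] by simp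
 then have "card (D - \<Lambda>) \<le> 2" using cD D(1) card_Diff_subset[of \<Lambda> D] finite_subset[OF D(1)] by simp
 then consider "card (D - \<Lambda>) = 0" | "card (D - \<Lambda>) = 1" | "card (D - \<Lambda>) = 2" by linarith
 then have "\<exists>\<kappa>1 \<kappa>2. D - \<Lambda> \<subseteq> {\<kappa>1, \<kappa>2}"
 proof cases
  case 1
  then have "D - \<Lambda> = {}" using cD(1) by simp
  then show ?thesis by (metis empty_subsetI)
 next
  case 2
  then obtain z where "D - \<Lambda> = {z}" by (rule card_1_singletonE)
  then show ?thesis by (intro exI[of _ z]) simp
 next
  case 3
  then obtain z z' where "D - \<Lambda> = {z, z'}" unfolding card_2_iff by blast
  then show ?thesis by (intro exI[of _ z] exI[of _ z']) simp
 qed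
 then obtain \<kappa>1 \<kappa>2 where \<kappa>: "D - \<Lambda> \<subseteq> {\<kappa>1, \<kappa>2}" by blast
 define \<phi> where "\<phi> = (\<lambda>\<kappa> z. vs.representation D z \<kappa>)"
 have span: "z \<in> vs.span D" if "z \<in> L (2 * N)" for z using that B(3) D(4) by blast
 have \<phi>_add: "\<phi> \<kappa> (z + z') = \<phi> \<kappa> z + \<phi> \<kappa> z'" if "z \<in> L (2 * N)" "z' \<in> L (2 * N)" for \<kappa> z z'
  unfolding \<phi>_def using vs.representation_add[OF D(3) span[OF that(2)] span[OF that(1)]] by simp
 have \<phi>_scale: "\<phi> \<kappa> (k c * z) = c * \<phi> \<kappa> z" if "z \<in> L (2 * N)" for \<kappa> z c
  unfolding \<phi>_def using vs.representation_scale[OF D(3) span[OF that]] by simp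
 have kernel: "\<exists>a. z = h * lin v w a" if z: "z \<in> L (2 * N)" "\<phi> \<kappa>1 z = 0" "\<phi> \<kappa>2 z = 0" for z
 proof -
  have "z = (\<Sum>d\<in>D. k (vs.representation D z d) * d)"
   using vs.sum_representation_eq[OF D(3) span[OF z(1)] cD(1) order.refl] by simp
  also have "\<dots> = (\<Sum>d\<in>\<Lambda>. k (vs.representation D z d) * d)"
   using z(2,3) \<kappa> D(1) cD(1) unfolding \<phi>_def by (intro sum.mono_neutral_right) auto
  also have "\<dots> = h * lin v w (\<lambda>i. vs.representation D z (h * coord i))"
   unfolding hlin \<Lambda>_def sum.reindex[OF inj] by simp
  finally show ?thesis by blast
 qed
 define V where "V = (\<lambda>i::nat. if i = 0 then 1 else if i = 1 then x else y)"
 have V: "V i \<in> L N" for i unfolding V_def using xy L_1 by simp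
 have VV: "V i * V j \<in> L (2 * N)" for i j using L_mult[OF V V] by (simp add: mult_2)
 have linV: "lin x y a = (\<Sum>i<3. k (a i) * V i)" for a
  by (simp add: lin_def V_def numeral_3_eq_3 numeral_2_eq_2)
 have lin0: "a i = 0" if "lin x y a = 0" "i < 3" for a i
 proof -
  have "a 0 = 0 \<and> a 1 = 0 \<and> a 2 = 0" using xy(3) that(1) unfolding linear_independent3_def lin_def by simp
  moreover have "i = 0 \<or> i = 1 \<or> i = 2" using that(2) by linarith
  ultimately show ?thesis by auto
 qed
 have \<phi>_sum: "\<phi> \<kappa> (\<Sum>i<n. k (c i) * g i) = (\<Sum>i<n. c i * \<phi> \<kappa> (g i))" if "\<And>i. g i \<in> L (2 * N)" for \<kappa> c g and n :: nat
 proof (induction n)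
  case 0
  show ?case using \<phi>_scale[OF L_1, of \<kappa> 0] by simp
 next
  case (Suc n)
  have "(\<Sum>i<n. k (c i) * g i) \<in> L (2 * N)" by (intro L_sum L_scale that)
  then show ?case using Suc by (simp add: \<phi>_add L_scale \<phi>_scale that)
 qed
 obtain l m \<mu> where sing: "l ~= 0 \<or> m ~= 0" "\<exists>j<3. \<mu> j ~= 0"
  "\<And>i. i < 3 ==> l * (\<Sum>j<3. \<phi> \<kappa>1 (V i * V j) * \<mu> j) + m * (\<Sum>j<3. \<phi> \<kappa>2 (V i * V j) * \<mu> j) = 0"
  using singular_pencil[of "\<lambda>i j. \<phi> \<kappa>1 (V i * V j)" "\<lambda>i j. \<phi> \<kappa>2 (V i * V j)"] by blast
 define M where "M = lin x y \<mu>"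
 have M0: "M ~= 0" unfolding M_def using lin0 sing(2) by blast
 have MV_L: "M * V i \<in> L (2 * N)" for i
 proof -
  have "M \<in> L N" unfolding M_def linV by (intro L_sum L_scale V)
  then show ?thesis using L_mult[OF _ V, of M N i] by (simp add: mult_2)
 qed
 have \<phi>M: "\<phi> \<kappa> (M * V i) = (\<Sum>j<3. \<phi> \<kappa> (V i * V j) * \<mu> j)" for \<kappa> i
 proof -
  have "M * V i = (\<Sum>j<3. k (\<mu> j) * (V i * V j))"
   unfolding M_def linV by (simp add: sum_distrib_right sum_distrib_left ac_simps)
  then show ?thesis using \<phi>_sum[of "\<lambda>j. V i * V j", OF VV] by (simp add: mult.commute)
 qed
 define c1 c2 where "c1 = (\<lambda>i. \<phi> \<kappa>1 (M * V i))" and "c2 = (\<lambda>i. \<phi> \<kappa>2 (M * V i))"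
 have c: "l * c1 i + m * c2 i = 0" if "i < 3" for i unfolding c1_def c2_def \<phi>M using sing(3)[OF that] .
 have \<phi>Mp: "\<phi> \<kappa>1 (M * lin x y p) = p 0 * c1 0 + p 1 * c1 1 + p 2 * c1 2"
  "\<phi> \<kappa>2 (M * lin x y p) = p 0 * c2 0 + p 1 * c2 1 + p 2 * c2 2" "M * lin x y p \<in> L (2 * N)" for p
 proof -
  have e: "M * lin x y p = (\<Sum>i<3. k (p i) * (M * V i))" unfolding linV by (simp add: sum_distrib_left ac_simps)
  show "M * lin x y p \<in> L (2 * N)" unfolding e by (intro L_sum L_scale MV_L)
  show "\<phi> \<kappa>1 (M * lin x y p) = p 0 * c1 0 + p 1 * c1 1 + p 2 * c1 2"
   "\<phi> \<kappa>2 (M * lin x y p) = p 0 * c2 0 + p 1 * c2 1 + p 2 * c2 2"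
   unfolding e \<phi>_sum[OF MV_L] c1_def c2_def by (simp_all add: numeral_3_eq_3 numeral_2_eq_2)
 qed
 have both: "p 0 * c1 0 + p 1 * c1 1 + p 2 * c1 2 = 0 \<and> p 0 * c2 0 + p 1 * c2 1 + p 2 * c2 2 = 0"
  if "p 0 * d 0 + p 1 * d 1 + p 2 * d 2 = 0" "d = (if m ~= 0 then c1 else c2)" for p d
 proof -
  have cc: "l * c1 0 + m * c2 0 = 0" "l * c1 1 + m * c2 1 = 0" "l * c1 2 + m * c2 2 = 0" using c by simp_all
  have "l * (p 0 * c1 0 + p 1 * c1 1 + p 2 * c1 2) + m * (p 0 * c2 0 + p 1 * c2 1 + p 2 * c2 2)
    = p 0 * (l * c1 0 + m * c2 0) + p 1 * (l * c1 1 + m * c2 1) + p 2 * (l * c1 2 + m * c2 2)"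
   by (simp add: algebra_simps)
  also have "\<dots> = 0" unfolding cc by simp
  finally show ?thesis using that sing(1) by (cases "m = 0") auto
 qed
 obtain p q where pq: "p 0 * (if m ~= 0 then c1 else c2) 0 + p 1 * (if m ~= 0 then c1 else c2) 1 + p 2 * (if m ~= 0 then c1 else c2) 2 = 0"
  "q 0 * (if m ~= 0 then c1 else c2) 0 + q 1 * (if m ~= 0 then c1 else c2) 1 + q 2 * (if m ~= 0 then c1 else c2) 2 = 0"
  "\<And>r::'a. \<exists>i<3. p i ~= r * q i" "\<exists>i<3::nat. q i ~= 0"
  using ex_orthogonal_pair by blast
 obtain a where a: "M * lin x y p = h * lin v w a"
  using kernel[of "M * lin x y p"] \<phi>Mp[of p] both[OF pq(1) refl] by auto
 obtain b where b: "M * lin x y q = h * lin v w b"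
  using kernel[of "M * lin x y q"] \<phi>Mp[of q] both[OF pq(2) refl] by auto
 have q0: "lin x y q ~= 0" using lin0 pq(4) by blast
 have b0: "lin v w b ~= 0" using b M0 q0 by auto
 have eq: "lin v w a / lin v w b = lin x y p / lin x y q"
 proof -
  have "lin v w a = M * lin x y p / h" "lin v w b = M * lin x y q / h" using a b h0 by (simp_all add: field_simps)
  then show ?thesis using h0 M0 by simp
 qed
 have nc: "lin x y p / lin x y q \<notin> range k"
 proof
  assume "lin x y p / lin x y q \<in> range k"
  then obtain r where "lin x y p = k r * lin x y q" using q0 by (auto simp: field_simps)
  then have "lin x y (\<lambda>i. p i - r * q i) = 0" unfolding lin_def by (simp add: algebra_simps)
  then show False using lin0 pq(3)[of r] by fastforce
 qed
 show ?thesis using b0 nc eq xy(4) q0 unfolding pencils_quadratic_def by metis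
qed

end

section \<open>Polynomials in two variables and changes of coordinates\<close>

text \<open>Roots are counted first in one variable and then in the other.\<close>

lemma vanishing_imp_0:
 fixes F :: "'a::linordered_field poly poly"
 assumes "\<And>s t. poly (poly F [:s:]) t = 0"
 shows "F = 0"
proof (rule ccontr)
 assume F: "F ~= 0"
 have inf: "infinite (UNIV :: 'a set)" by (rule infinite_UNIV_char_0)
 have z: "poly F [:s:] = 0" for s
 proof (rule ccontr)
  assume n: "poly F [:s:] ~= 0"
  have "{t. poly (poly F [:s:]) t = 0} = UNIV" using assms by blast
  then show False using poly_roots_finite[OF n] inf by simp
 qed
 have "(\<lambda>s. [:s:]) ` UNIV \<subseteq> {p. poly F p = 0}" using z by auto
 then have "finite ((\<lambda>s::'a. [:s:]) ` UNIV)" using poly_roots_finite[OF F] finite_subset by blast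
 then show False using inf by (auto dest!: finite_imageD simp: inj_on_def)
qed

text \<open>Two independent rows are completed to an invertible matrix by a unit vector; the inverse is
 expressed by cross products of the rows.\<close>

lemma ex_invertible_matrix:
 fixes a b :: "nat => 'a::field"
 assumes ind: "\<And>c d. \<forall>i<3. c * b i + d * a i = 0 ==> d = 0" and b: "\<exists>i<3. b i ~= 0"
 shows "\<exists>M N. inverse3 M N \<and> inverse3 N M \<and> (\<forall>i<3. M 0 i = b i) \<and> (\<forall>i<3. M 1 i = a i)"
proof -
 define cross where "cross = (\<lambda>(p::nat => 'a) (q::nat => 'a) j. if j = (0::nat) then p 1 * q 2 - p 2 * q 1
  else if j = 1 then p 2 * q 0 - p 0 * q 2 else p 0 * q 1 - p 1 * q 0)"
 define dot where "dot = (\<lambda>(p::nat => 'a) (q::nat => 'a). p 0 * q 0 + p 1 * q 1 + p 2 * q 2)"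
 have sq: "i = 0 \<or> i = 1 \<or> i = 2" if "i < 3" for i :: nat using that by linarith
 have "\<exists>c. dot b (cross a c) ~= 0"
 proof (rule ccontr)
  assume no: "\<not> ?thesis"
  have d0: "dot b (cross a c) = 0" for c using no by blast
  have e0: "b 2 * a 1 = b 1 * a 2"
   using d0[of "\<lambda>i. if i = 0 then 1 else 0"] by (simp add: dot_def cross_def)
  have e1: "b 0 * a 2 = b 2 * a 0"
   using d0[of "\<lambda>i. if i = 1 then 1 else 0"] by (simp add: dot_def cross_def)
  have e2: "b 1 * a 0 = b 0 * a 1"
   using d0[of "\<lambda>i. if i = 2 then 1 else 0"] by (simp add: dot_def cross_def)
  obtain i where i: "i < 3" "b i ~= 0" using b by blast
  have "\<forall>j<3. (- a i) * b j + b i * a j = 0"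
   using sq[OF i(1)] e0 e1 e2 by (auto dest!: sq simp: mult.commute)
  then show False using ind i(2) by blast
 qed
 then obtain c where c: "dot b (cross a c) ~= 0" by blast
 define D where "D = dot b (cross a c)"
 define M where "M = (\<lambda>i j. if i = (0::nat) then b j else if i = 1 then a j else c (j::nat))"
 define N where "N = (\<lambda>j i. (if i = (0::nat) then cross a c j else if i = 1 then cross c b j else cross b a j) / D)"
 have D: "D ~= 0" using c unfolding D_def .
 have De: "D = b 0 * (a 1 * c 2 - a 2 * c 1) + b 1 * (a 2 * c 0 - a 0 * c 2) + b 2 * (a 0 * c 1 - a 1 * c 0)"
  unfolding D_def dot_def cross_def by simp
 have q: "x / D + y / D + z / D = (if P then 1 else 0)" if "x + y + z = (if P then D else 0)" for x y z P
  using that D by (simp add: add_divide_distrib[symmetric])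
 have 1: "inverse3 M N"
  unfolding inverse3_def
 proof (intro allI impI)
  fix i j :: nat assume "i < 3" "j < 3"
  then show "M i 0 * N 0 j + M i 1 * N 1 j + M i 2 * N 2 j = (if i = j then 1 else 0)"
   unfolding N_def times_divide_eq_right
   by (intro q) (auto dest!: sq simp: M_def cross_def De algebra_simps)
 qed
 have 2: "inverse3 N M"
  unfolding inverse3_def
 proof (intro allI impI)
  fix i j :: nat assume ij: "i < 3" "j < 3"
  show "N i 0 * M 0 j + N i 1 * M 1 j + N i 2 * M 2 j = (if i = j then 1 else 0)"
   unfolding N_def times_divide_eq_left
   using sq[OF ij(1)] sq[OF ij(2)]
   by (intro q) (elim disjE; simp add: M_def cross_def De; simp add: algebra_simps)
 qed
 show ?thesis using 1 2 by (intro exI[of _ M] exI[of _ N]) (simp add: M_def)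
qed

lemma row_nonzero: "inverse3 N M ==> linear_poly N 0 ~= 0"
proof
 assume inv: "inverse3 N M" and "linear_poly N 0 = 0"
 then have "N 0 0 = 0" "N 0 1 = 0" "N 0 2 = 0" by (auto simp: linear_poly_def)
 moreover have "N 0 0 * M 0 0 + N 0 1 * M 1 0 + N 0 2 * M 2 0 = 1"
  using inv unfolding inverse3_def by (metis zero_less_numeral)
 ultimately show False by simp
qed

text \<open>Both facts are checked at a generic point, where a change of coordinates can be undone.\<close>

lemma
 fixes q :: "'a::field poly poly"
 assumes q: "tdeg_le q n" and MN: "inverse3 M N" "inverse3 N M"
 shows change_coords_0_imp: "change_coords n M q = 0 ==> q = 0"
  and change_coords_dvd: "f ~= 0 ==> f dvd change_coords n M q ==> change_coords (total_degree f) N f dvd q"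
proof -
 obtain k :: "'a => 'a poly poly poly fract alg_closure" and v w x
  where k: "field_hom k" and ind: "field_hom.alg_indep3 k v w x"
  using ex_generic_point by blast
 interpret field_hom k by (rule k)
 have inj: "p = 0" if "ev2 k p v w = 0" for p
 proof -
  have "ev3 k [:p:] v w x = 0" using that by simp
  then have "[:p:] = 0" using ind unfolding alg_indep3_iff by blast
  then show ?thesis by simp
 qed
 define z where "z = mat_vec k N (affine_point v w)"
 have z0: "z 0 ~= 0"
 proof
  assume "z 0 = 0"
  then have "ev2 k (linear_poly N 0) v w = 0" by (simp add: ev2_linear_poly z_def)
  then show False using inj row_nonzero[OF MN(2)] by blast
 qed
 have rel: "ev2 k q v w = z 0 ^ n * ev2 k (change_coords n M q) (z 1 / z 0) (z 2 / z 0)"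
  using change_coords_relation(1)[OF q MN(1), of v w] z0 unfolding z_def by blast
 show 0: "q = 0" if "change_coords n M q = 0" using inj rel that by simp
 assume f: "f ~= 0" and dvd: "f dvd change_coords n M q"
 show "change_coords (total_degree f) N f dvd q"
 proof (cases "q = 0")
  case False
  define d where "d = total_degree f"
  obtain g where g: "change_coords n M q = f * g" using dvd by blast
  have g0: "g ~= 0" using g 0 False by auto
  have "total_degree (f * g) \<le> n" unfolding g[symmetric] total_degree_le_iff by (rule tdeg_le_change_coords)
  then have dn: "d + total_degree g \<le> n" unfolding total_degree_mult[OF f g0] d_def .
  have tf: "tdeg_le f d" and tg: "tdeg_le g (n - d)"
   using dn by (simp_all flip: total_degree_le_iff add: d_def)
  have e: "ev2 k (change_coords m N p) v w = z 0 ^ m * ev2 k p (z 1 / z 0) (z 2 / z 0)" if "tdeg_le p m" for p m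
   unfolding ev2_change_coords z_def[symmetric] by (rule heval_field[where Z = z, OF comm_hom_axioms that z0])
  interpret E: comm_hom "\<lambda>p. ev2 k p v w" by (rule comm_hom_ev2)
  interpret E': comm_hom "\<lambda>p. ev2 k p (z 1 / z 0) (z 2 / z 0)" by (rule comm_hom_ev2)
  have "z 0 ^ n = z 0 ^ d * z 0 ^ (n - d)" using dn by (simp flip: power_add)
  then have "ev2 k q v w = ev2 k (change_coords d N f * change_coords (n - d) N g) v w"
   unfolding rel g E'.hom_mult E.hom_mult e[OF tf] e[OF tg] by simp
  then have "q - change_coords d N f * change_coords (n - d) N g = 0" by (intro inj) simp
  then show ?thesis unfolding d_def by simp
 qed simp
qed

section \<open>The function field as a subfield of an algebraically closed field\<close>

lemma peval_map_poly: "h 0 = 0 ==> k 0 = 0 ==> peval k (map_poly h p) x = peval (\<lambda>c. k (h c)) p x"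
 unfolding peval_def by (simp add: map_poly_map_poly o_def)

text \<open>Gauss's lemma, in the form that a prime equation generates the ideal of all equations of its
 root.\<close>

lemma root_kernel:
 fixes h :: "'c::idom => 'd::field" and F :: "'c poly"
 assumes h: "comm_hom h" and inj: "\<And>c. h c = 0 ==> c = 0" and F: "prime_elem F" "degree F > 0"
  and w: "peval h F w = 0"
 shows "peval h p w = 0 \<longleftrightarrow> F dvd p"
proof -
 interpret comm_hom h by (rule h)
 have F0: "F ~= 0" using F(2) by auto
 let ?P = "\<lambda>r. r ~= 0 \<and> peval h r w = 0"
 obtain r where r: "?P r" "\<And>s. ?P s ==> degree r \<le> degree s"
  using ex_has_least_nat[of ?P F degree] F0 w by blast
 have small: "s = 0" if "peval h s w = 0" "degree s < degree r" for s
  using r(2)[of s] that by auto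
 have dr: "degree r ~= 0"
 proof
  assume "degree r = 0"
  then obtain c where "r = [:c:]" using degree_eq_zeroE by blast
  then show False using r(1) inj by auto
 qed
 have pseudo: "\<exists>a q. a ~= 0 \<and> smult a g = s * q" if gs: "peval h g w = 0" "peval h s w = 0" and s0: "s ~= 0" and ds: "degree s \<le> degree r" for g s
 proof -
  obtain a q where aq: "a ~= 0" "smult a g = s * q + pseudo_mod g s"
   using pseudo_mod(1)[of s g] s0 by blast
  have "peval h (smult a g) w = peval h (s * q + pseudo_mod g s) w" unfolding aq(2) ..
  then have "peval h (pseudo_mod g s) w = 0" using gs by simp
  moreover have "pseudo_mod g s = 0 \<or> degree (pseudo_mod g s) < degree s"
   using pseudo_mod(2)[of s g] s0 by blast
  ultimately have "pseudo_mod g s = 0" using small ds by fastforce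
  then show ?thesis using aq by auto
 qed
 obtain a q where aq: "a ~= 0" "smult a F = r * q" using pseudo[OF w _ _ order.refl] r(1) by blast
 have "F dvd r * q" unfolding aq(2)[symmetric] by (simp add: dvd_smult)
 then have "F dvd r \<or> F dvd q" using F(1) by (simp add: prime_elem_dvd_mult_iff)
 then have Fr: "F dvd r"
 proof
  assume "F dvd q"
  then obtain q' where "q = F * q'" by blast
  then have "F * [:a:] = F * (r * q')" using aq(2) by (simp add: ac_simps)
  then have e: "[:a:] = r * q'" using F0 by (metis mult_cancel_left)
  then have "q' ~= 0" using aq(1) by auto
  then have "degree [:a:] = degree r + degree q'"
   unfolding e using r(1) by (simp add: degree_mult_eq)
  then show ?thesis using dr by simp
 qed
 have dF: "degree F \<le> degree r" using Fr r(1) by (simp add: dvd_imp_degree_le)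
 show ?thesis
 proof
  assume "peval h p w = 0"
  then obtain b g where bg: "b ~= 0" "smult b p = F * g" using pseudo[OF _ w F0 dF] by blast
  then have "F dvd [:b:] * p" by simp
  then have "F dvd [:b:] \<or> F dvd p" using F(1) by (simp only: prime_elem_dvd_mult_iff)
  moreover have "\<not> F dvd [:b:]"
   using dvd_imp_degree_le[of F "[:b:]"] bg(1) F(2) by auto
  ultimately show "F dvd p" by blast
 next
  assume "F dvd p"
  then show "peval h p w = 0" using w by auto
 qed
qed

text \<open>A linear functional over the ground ring, applied to the coefficients of a polynomial.\<close>

lemma map_poly_functional:
 fixes e :: "'a::comm_ring_1 => 'b::comm_ring_1" and l :: "'b => 'a"
 assumes add: "\<And>x y. l (x + y) = l x + l y" and scale: "\<And>c x. l (e c * x) = c * l x" and e0: "e 0 = 0"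
 shows "map_poly l (p + q) = map_poly l p + map_poly l q"
  and "map_poly l (map_poly e r * q) = r * map_poly l q"
proof -
 have l0: "l 0 = 0" using scale[of 0 0] by simp
 show "map_poly l (p + q) = map_poly l p + map_poly l q"
  by (rule poly_eqI) (simp add: coeff_map_poly l0 add)
 have ls: "l (sum g A) = (\<Sum>i\<in>A. l (g i))" for g :: "nat => 'b" and A
  by (induction A rule: infinite_finite_induct) (simp_all add: l0 add)
 show "map_poly l (map_poly e r * q) = r * map_poly l q"
  by (rule poly_eqI) (simp add: coeff_map_poly l0 coeff_mult ls e0 scale)
qed

lemma functional_divides:
 fixes l :: "'a::field alg_closure => 'a"
 assumes add: "\<And>x y. l (x + y) = l x + l y" and scale: "\<And>c x. l (to_ac c * x) = c * l x"
  and dvd: "map_poly (map_poly to_ac) f dvd g"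
 shows "f dvd map_poly (map_poly l) g"
proof -
 obtain h where h: "g = map_poly (map_poly to_ac) f * h" using dvd by blast
 have "map_poly (map_poly l) g = f * map_poly (map_poly l) h"
  unfolding h by (rule map_poly_functional(2)) (use map_poly_functional[OF add scale] in auto)
 then show ?thesis by simp
qed

text \<open>This is a dual vector of a basis extending \<open>B\<close>.\<close>

lemma (in field_hom) ex_functional:
 assumes B: "vs.independent B" "b \<in> B"
 shows "\<exists>l :: 'b => 'a. (\<forall>x y. l (x + y) = l x + l y) \<and> (\<forall>c x. l (k c * x) = c * l x) \<and>
  l b = 1 \<and> (\<forall>b'\<in>B - {b}. l b' = 0)"
proof -
 define E where "E = vs.extend_basis B"
 have E: "vs.independent E" "B \<subseteq> E" "vs.span E = UNIV"
  unfolding E_def using vs.independent_extend_basis[OF B(1)] vs.extend_basis_superset[OF B(1)] vs.span_extend_basis[OF B(1)] by auto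
 define l where "l = (\<lambda>x. vs.representation E x b)"
 have "l (x + y) = l x + l y" for x y
  unfolding l_def using vs.representation_add[OF E(1), of y x] E(3) by simp
 moreover have "l (k c * x) = c * l x" for c x
  unfolding l_def using vs.representation_scale[OF E(1), of x c] E(3) by simp
 moreover have "l b' = (if b = b' then 1 else 0)" if "b' \<in> B" for b'
  unfolding l_def using vs.representation_basis[OF E(1), of b'] that E(2) by auto
 ultimately show ?thesis using B(2) by (intro exI[of _ l]) auto
qed

lemma (in field_hom) fieldgen_fraction:
 assumes "x \<in> fieldgen k {v, w}"
 shows "\<exists>p q. ev2 k q v w ~= 0 \<and> x = ev2 k p v w / ev2 k q v w"
proof -
 interpret E: comm_hom "\<lambda>p. ev2 k p v w" by (rule comm_hom_ev2)
 show ?thesis using assms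
 proof (induction x rule: fieldgen.induct)
  case (const c)
  show ?case by (intro exI[of _ "[:[:c:]:]"] exI[of _ 1]) simp
 next
  case (gen x)
  then show ?case
   by (elim insertE emptyE; intro exI[of _ "if x = v then [:[:0, 1:]:] else [:0, 1:]"] exI[of _ 1]) auto
 next
  case (add x y)
  then obtain p q p' q' where "ev2 k q v w ~= 0" "x = ev2 k p v w / ev2 k q v w"
   "ev2 k q' v w ~= 0" "y = ev2 k p' v w / ev2 k q' v w" by blast
  then show ?case by (intro exI[of _ "p * q' + p' * q"] exI[of _ "q * q'"]) (simp add: add_frac_eq)
 next
  case (mult x y)
  then obtain p q p' q' where "ev2 k q v w ~= 0" "x = ev2 k p v w / ev2 k q v w"
   "ev2 k q' v w ~= 0" "y = ev2 k p' v w / ev2 k q' v w" by blast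
  then show ?case by (intro exI[of _ "p * p'"] exI[of _ "q * q'"]) simp
 next
  case (uminus x)
  then obtain p q where "ev2 k q v w ~= 0" "x = ev2 k p v w / ev2 k q v w" by blast
  then show ?case by (intro exI[of _ "- p"] exI[of _ q]) simp
 next
  case (inverse x)
  then obtain p q where pq: "ev2 k q v w ~= 0" "x = ev2 k p v w / ev2 k q v w" by blast
  show ?case
  proof (cases "ev2 k p v w = 0")
   case True
   then show ?thesis using pq by (intro exI[of _ 0] exI[of _ 1]) simp
  next
   case False
   then show ?thesis using pq by (intro exI[of _ q] exI[of _ p]) simp
  qed
 qed
qed

text \<open>The curve is geometrically integral, so its generic point can be taken over the algebraic closure.
 Functionals over the real closed field transfer divisibility by the equation back to the ground field,
 and show that \<open>\<surd>-1\<close> does not lie in the function field over the ground field.\<close>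

lemma ex_generic_point_of_curve:
 fixes f :: "'a::real_closed_field poly poly"
 assumes pr: "prime_elem (map_poly (map_poly to_ac) f :: 'a alg_closure poly poly)" and td: "2 \<le> total_degree f"
 shows "\<exists>(k :: 'a => 'a alg_closure poly fract alg_closure) v w. field_hom k \<and>
  (\<forall>p. ev2 k p v w = 0 \<longleftrightarrow> f dvd p) \<and> (\<forall>p. peval k p v = 0 \<longrightarrow> p = 0) \<and>
  (\<forall>x\<in>fieldgen k {v, w}. x ^ 2 ~= - 1)"
proof -
 let ?F = "map_poly (map_poly to_ac) f :: 'a alg_closure poly poly"
 interpret t: field_hom "to_ac :: 'a => 'a alg_closure" by unfold_locales auto
 define h where "h = (\<lambda>g :: 'a alg_closure poly. to_ac (to_fract g))"
 have h: "comm_hom h" by unfold_locales (auto simp: h_def)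
 interpret h: comm_hom h by (rule h)
 have h0: "h c = 0 ==> c = 0" for c by (simp add: h_def)
 define kC where "kC = (\<lambda>c. h [:c:])"
 define v where "v = h [:0, 1:]"
 have kC: "field_hom kC"
 proof
  show "kC 0 = 0" "kC 1 = 1" by (simp_all add: kC_def flip: one_pCons)
  show "kC (x + y) = kC x + kC y" "kC (x * y) = kC x * kC y" for x y
   unfolding kC_def h.hom_add[symmetric] h.hom_mult[symmetric] by (simp_all add: mult.commute)
 qed
 interpret C: field_hom kC by (rule kC)
 have pv: "peval kC g v = h g" for g
 proof (induction g)
  case (pCons a g)
  have "pCons a g = [:a:] + [:0, 1:] * g" by simp
  then have "h (pCons a g) = kC a + v * h g" unfolding kC_def v_def by (metis h.hom_add h.hom_mult)
  then show ?case using pCons.IH by simp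
 qed (simp add: h.hom_0)
 have coeffs: "map_poly to_ac p = 0 \<longleftrightarrow> p = 0" for p :: "'a poly"
  by (simp add: poly_eq_iff coeff_map_poly)
 have cF: "coeff (coeff ?F j) i = to_ac (coeff (coeff f j) i)" for i j
  by (simp add: coeff_map_poly)
 have tdF: "total_degree ?F = total_degree f" unfolding total_degree_def cF by simp
 have dF: "degree ?F > 0"
 proof (rule ccontr)
  assume "\<not> degree ?F > 0"
  then obtain c where c: "?F = [:c:]" using degree_eq_zeroE by blast
  have dc: "2 \<le> degree c"
  proof (rule ccontr)
   assume "\<not> 2 \<le> degree c"
   then have "tdeg_le ?F 1" unfolding c tdeg_le_def
    by (auto simp: coeff_pCons split: nat.splits dest: le_degree)
   then show False using td tdF total_degree_le_iff[of ?F 1] by simp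
  qed
  then obtain z where "poly c z = 0" using alg_closed_imp_poly_has_root[of c] by auto
  then obtain c' where c': "c = [:- z, 1:] * c'" unfolding poly_eq_0_iff_dvd by blast
  have nz: "c' ~= 0" using c' dc by auto
  have dc': "degree c = 1 + degree c'" unfolding c' using nz by (subst degree_mult_eq) auto
  have "?F = [:[:- z, 1:]:] * [:c':]" unfolding c c' by simp
  then have "?F dvd [:[:- z, 1:]:] \<or> ?F dvd [:c':]" using pr by (metis dvd_refl prime_elem_dvd_mult_iff)
  then have "c dvd [:- z, 1:] \<or> c dvd c'" unfolding c by simp
  then show False using dvd_imp_degree_le[of c "[:- z, 1:]"] dvd_imp_degree_le[of c c'] nz dc dc' by auto
 qed
 have "degree (map_poly h ?F) > 0" using dF by (subst degree_map_poly) (auto dest: h0)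
 then obtain w where w: "poly (map_poly h ?F) w = 0" using alg_closed_imp_poly_has_root by blast
 have evC: "ev2 kC p v w = peval h p w" for p unfolding ev2_def pv ..
 have kerC: "ev2 kC p v w = 0 \<longleftrightarrow> ?F dvd p" for p
  unfolding evC by (rule root_kernel[OF h h0 pr dF]) (use w in \<open>simp_all add: peval_def\<close>)
 define k where "k = (\<lambda>c. kC (to_ac c))"
 have k: "field_hom k" unfolding k_def by unfold_locales auto
 interpret k: field_hom k by (rule k)
 have ev: "ev2 k p v w = ev2 kC (map_poly (map_poly to_ac) p) v w" for p
  unfolding ev2_def k_def by (subst peval_map_poly) (simp_all add: peval_map_poly)
 have ind1: "t.vs.independent {1}" by simp
 obtain l :: "'a alg_closure => 'a" where l: "\<And>x y. l (x + y) = l x + l y" "\<And>c x. l (to_ac c * x) = c * l x" "l 1 = 1"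
  using t.ex_functional[OF ind1, of 1] by blast
 have l_ac: "l (to_ac c) = c" for c using l(2)[of c 1] l(3) by simp
 have ker: "ev2 k p v w = 0 \<longleftrightarrow> f dvd p" for p
 proof
  assume "ev2 k p v w = 0"
  then have "f dvd map_poly (map_poly l) (map_poly (map_poly to_ac) p)"
   unfolding ev kerC by (rule functional_divides[OF l(1,2)])
  moreover have "map_poly (map_poly l) (map_poly (map_poly to_ac) p) = p"
   using l_ac[of 0] by (intro poly_eqI) (simp add: coeff_map_poly l_ac)
  ultimately show "f dvd p" by simp
 next
  interpret E: comm_hom "\<lambda>p. ev2 k p v w" by (rule k.comm_hom_ev2)
  assume "f dvd p"
  moreover have "ev2 k f v w = 0" unfolding ev kerC by simp
  ultimately show "ev2 k p v w = 0" by (auto simp: E.hom_mult)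
 qed
 have v_tr: "p = 0" if "peval k p v = 0" for p
 proof -
  have "peval k p v = h (map_poly to_ac p)" unfolding pv[symmetric] k_def by (simp add: peval_map_poly)
  then have "h (map_poly to_ac p) = 0" using that by simp
  then have "map_poly to_ac p = (0 :: 'a alg_closure poly)" by (rule h0)
  then show ?thesis unfolding coeffs .
 qed
 have "x ^ 2 ~= - 1" if x: "x \<in> fieldgen k {v, w}" for x
 proof
  assume x2: "x ^ 2 = - 1"
  obtain p q where pq: "ev2 k q v w ~= 0" "x = ev2 k p v w / ev2 k q v w" using k.fieldgen_fraction[OF x] by blast
  obtain i0 :: "'a alg_closure" where i0: "i0 ^ 2 = - 1" using nth_root_exists[of 2 "- 1"] by auto
  have "(kC i0) ^ 2 = x ^ 2" unfolding x2 using i0 by (metis C.hom_power C.hom_minus C.hom_1)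
  then have "x = kC i0 \<or> x = - kC i0" by (auto simp: power2_eq_iff)
  then obtain i where i: "i ^ 2 = - 1" "x = kC i" using i0 by (metis C.hom_minus power2_minus)
  interpret EC: comm_hom "\<lambda>p. ev2 kC p v w" by (rule C.comm_hom_ev2)
  let ?p = "map_poly (map_poly to_ac) p" and ?q = "map_poly (map_poly to_ac) q"
  have "ev2 kC (?p - [:[:i:]:] * ?q) v w = ev2 k p v w - x * ev2 k q v w"
   unfolding EC.hom_diff EC.hom_mult ev i(2) by simp
  also have "\<dots> = 0" using pq by simp
  finally have d: "?F dvd ?p - [:[:i:]:] * ?q" unfolding kerC .
  have i_notin: "i \<notin> t.vs.span {1}"
  proof
   assume "i \<in> t.vs.span {1}"
   then obtain c where "i = to_ac c" unfolding t.vs.span_singleton by auto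
   then have "to_ac (c ^ 2) = (to_ac (- 1) :: 'a alg_closure)" using i(1) by simp
   then have "c ^ 2 = - 1" by (simp only: t.hom_eq_iff)
   moreover have "0 \<le> c ^ 2" by simp
   ultimately show False by simp
  qed
  then have "t.vs.independent {i, 1}" using ind1 by (simp add: t.vs.independent_insert)
  moreover have "1 ~= i" using i_notin t.vs.span_base[of 1 "{1}"] by auto
  ultimately obtain m :: "'a alg_closure => 'a" where m: "\<And>x y. m (x + y) = m x + m y"
   "\<And>c x. m (to_ac c * x) = c * m x" "m i = 1" "m 1 = 0"
   using t.ex_functional[of "{i, 1}" i] by blast
  have "f dvd map_poly (map_poly m) (?p - [:[:i:]:] * ?q)" by (rule functional_divides[OF m(1,2) d])
  moreover have "map_poly (map_poly m) (?p - [:[:i:]:] * ?q) = - q"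
  proof -
   have m0: "m 0 = 0" using m(2)[of 0 0] by simp
   have ms: "m (x - y) = m x - m y" for x y using m(1)[of x "- y"] m(2)[of "- 1" y] by simp
   have "m (to_ac c - i * to_ac d) = - d" for c d
    using m(2)[of c 1] m(2)[of d i] m(3,4) by (simp add: ms mult.commute)
   then show ?thesis using m0 by (intro poly_eqI) (simp add: coeff_map_poly)
  qed
  ultimately have "f dvd q" by simp
  then show False using ker pq(1) by blast
 qed
 then show ?thesis using k ker v_tr by blast
qed

section \<open>Signs of discriminants\<close>

text \<open>If \<open>e\<close> is negative at a root \<open>\<rho>\<close> of \<open>a\<close>, the discriminant, which is there a square, has to vanish,
 to even order.\<close>

lemma simple_root_common_zero:
 fixes a b c e :: "'a::linordered_field poly"
 assumes rel: "r2 ^ 2 * (b ^ 2 - smult 4 (a * c)) = r1 ^ 2 * e" and r: "r1 ~= 0" "r2 ~= 0"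
  and a: "poly a \<rho> = 0" "poly (pderiv a) \<rho> ~= 0" and e: "poly e \<rho> < 0"
 shows "poly b \<rho> = 0 \<and> poly c \<rho> = 0"
proof -
 define D where "D = b ^ 2 - smult 4 (a * c)"
 have e0: "e ~= 0" using e by auto
 have D0: "D ~= 0" using rel r e0 unfolding D_def[symmetric] by auto
 have Dr: "poly D \<rho> = poly b \<rho> ^ 2" unfolding D_def using a(1) by simp
 have oe: "order \<rho> e = 0" using e by (simp add: order_0I)
 have eq: "r2 * r2 * D = r1 * r1 * e" using rel unfolding D_def power2_eq_square .
 have n: "r2 * r2 * D ~= 0" "r1 * r1 * e ~= 0" "r2 * r2 ~= 0" "r1 * r1 ~= 0" using r e0 D0 by auto
 have o: "2 * order \<rho> r2 + order \<rho> D = 2 * order \<rho> r1"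
  using order_mult[OF n(1), of \<rho>] order_mult[OF n(2), of \<rho>] order_mult[OF n(3), of \<rho>] order_mult[OF n(4), of \<rho>] oe
  unfolding eq by linarith
 have "poly D \<rho> = 0"
 proof (rule ccontr)
  assume "poly D \<rho> ~= 0"
  then have "order \<rho> D = 0" by (simp add: order_0I)
  then have o': "order \<rho> r2 = order \<rho> r1" using o by simp
  obtain s1 where s1: "r1 = [:- \<rho>, 1:] ^ order \<rho> r1 * s1" "\<not> [:- \<rho>, 1:] dvd s1"
   using order_decomp[OF r(1)] by blast
  obtain s2 where s2: "r2 = [:- \<rho>, 1:] ^ order \<rho> r1 * s2" "\<not> [:- \<rho>, 1:] dvd s2"
   using order_decomp[OF r(2), of \<rho>] unfolding o' by blast
  define L where "L = [:- \<rho>, 1:] ^ order \<rho> r1"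
  have L0: "L ~= 0" unfolding L_def by simp
  have "L ^ 2 * (s2 ^ 2 * D) = L ^ 2 * (s1 ^ 2 * e)"
   using rel unfolding D_def[symmetric] by (subst (asm) s1(1), subst (asm) s2(1)) (simp add: L_def power_mult_distrib mult.assoc)
  then have "s2 ^ 2 * D = s1 ^ 2 * e" using L0 by simp
  then have "poly (s2 ^ 2 * D) \<rho> = poly (s1 ^ 2 * e) \<rho>" by simp
  then have eq: "(poly s2 \<rho> * poly b \<rho>) ^ 2 = poly s1 \<rho> ^ 2 * poly e \<rho>"
   by (simp add: Dr power_mult_distrib)
  have "poly s1 \<rho> ~= 0" using s1(2) by (simp add: poly_eq_0_iff_dvd)
  then have "poly s1 \<rho> ^ 2 * poly e \<rho> < 0" using e by (simp add: mult_pos_neg)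
  then show False unfolding eq[symmetric] by (simp add: not_less[symmetric])
 qed
 then have b: "poly b \<rho> = 0" using Dr by simp
 have "order \<rho> D ~= 0" using \<open>poly D \<rho> = 0\<close> D0 by (simp add: order_root)
 then have "2 \<le> order \<rho> D" using o by presburger
 then have "[:- \<rho>, 1:] ^ 2 dvd D" using order_divides D0 by blast
 moreover obtain b' where b': "b = [:- \<rho>, 1:] * b'" using b unfolding poly_eq_0_iff_dvd by blast
 then have "[:- \<rho>, 1:] ^ 2 dvd b ^ 2" by (simp only: power_mult_distrib dvd_triv_left)
 ultimately have "[:- \<rho>, 1:] ^ 2 dvd b ^ 2 - D" by (rule dvd_diff[rotated])
 then have "[:- \<rho>, 1:] ^ 2 dvd smult 4 (a * c)" unfolding D_def by simp
 then have d: "[:- \<rho>, 1:] ^ 2 dvd a * c" by (simp add: dvd_smult_iff)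
 obtain a' where a': "a = [:- \<rho>, 1:] * a'" using a(1) unfolding poly_eq_0_iff_dvd by blast
 have "pderiv a = [:- \<rho>, 1:] * pderiv a' + a' * pderiv [:- \<rho>, 1:]" unfolding a' by (rule pderiv_mult)
 then have "poly (pderiv a) \<rho> = poly a' \<rho>" by (simp add: pderiv_pCons)
 then have "poly a' \<rho> ~= 0" using a(2) by simp
 moreover have "[:- \<rho>, 1:] dvd a' * c"
 proof -
  obtain g where "[:- \<rho>, 1:] * a' * c = [:- \<rho>, 1:] ^ 2 * g" using d unfolding a' by blast
  then have "[:- \<rho>, 1:] * (a' * c) = [:- \<rho>, 1:] * ([:- \<rho>, 1:] * g)" by (simp only: power2_eq_square mult.assoc)
  then have "a' * c = [:- \<rho>, 1:] * g" by (subst (asm) mult_cancel_left) auto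
  then show ?thesis by (rule dvdI)
 qed
 then have "poly a' \<rho> * poly c \<rho> = 0" by (simp flip: poly_eq_0_iff_dvd)
 ultimately show ?thesis using b by simp
qed

text \<open>The same argument at infinity.\<close>

lemma negative_leading_coeff:
 fixes a b c e :: "'a::linordered_field poly"
 assumes rel: "r2 ^ 2 * (b ^ 2 - smult 4 (a * c)) = r1 ^ 2 * e" and r: "r1 ~= 0" "r2 ~= 0"
  and deg: "degree a = 1" "degree b \<le> 3" "degree c \<le> 4"
  and e: "degree e \<le> 2" "coeff e 2 < 0"
 shows "coeff b 3 = 0 \<and> coeff c 4 = 0"
proof -
 define D where "D = b ^ 2 - smult 4 (a * c)"
 have de: "degree e = 2" using e le_degree[of e 2] by simp
 have e0: "e ~= 0" using e(2) by auto
 have D0: "D ~= 0" using rel r e0 unfolding D_def[symmetric] by auto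
 have "degree (r2 ^ 2 * D) = degree (r1 ^ 2 * e)" using rel unfolding D_def by simp
 then have dD: "2 * degree r2 + degree D = 2 * degree r1 + 2"
  using r e0 D0 de by (simp add: degree_mult_eq degree_power_eq)
 have "lead_coeff (r2 ^ 2 * D) = lead_coeff (r1 ^ 2 * e)" using rel unfolding D_def by simp
 then have "lead_coeff r2 ^ 2 * lead_coeff D = lead_coeff r1 ^ 2 * coeff e 2"
  by (simp add: lead_coeff_mult lead_coeff_power de)
 moreover have "lead_coeff r1 ^ 2 * coeff e 2 < 0" using r e(2) by (intro mult_pos_neg) simp_all
 ultimately have lD: "lead_coeff D < 0"
  using zero_le_power2[of "lead_coeff r2"] by (metis mult_nonneg_nonneg not_le)
 have ex: "p = (\<Sum>i\<le>n. Polynomial.monom (coeff p i) i)" if "degree p \<le> n" for p :: "'a poly" and n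
  using poly_as_sum_of_monoms'[OF that] by simp
 have dac: "degree (a * c) \<le> 5" using degree_mult_le[of a c] deg by simp
 have dbb: "degree (b ^ 2) \<le> 6" unfolding power2_eq_square using degree_mult_le[of b b] deg by simp
 have dD6: "degree D \<le> 6" unfolding D_def
  by (intro degree_diff_le dbb order_trans[OF degree_smult_le] order_trans[OF dac]) simp
 have c6: "coeff D 6 = coeff b 3 ^ 2"
 proof -
  have "coeff (b * b) (3 + 3) = (\<Sum>i\<le>6. coeff b i * coeff b (6 - i))" by (simp add: coeff_mult)
  also have "\<dots> = (\<Sum>i\<in>{3}. coeff b i * coeff b (6 - i))"
  proof (rule sum.mono_neutral_right)
   show "\<forall>i\<in>{..6} - {3}. coeff b i * coeff b (6 - i) = 0"
   proof
    fix i :: nat assume "i \<in> {..6} - {3}"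
    then have "3 < i \<or> 3 < 6 - i" by auto
    then show "coeff b i * coeff b (6 - i) = 0" using deg(2) by (auto simp: coeff_eq_0)
   qed
  qed auto
  finally have "coeff (b * b) 6 = coeff b 3 ^ 2" by (simp add: power2_eq_square)
  moreover have "coeff (a * c) 6 = 0" using dac by (simp add: coeff_eq_0)
  ultimately show ?thesis unfolding D_def by (simp add: power2_eq_square)
 qed
 have b3: "coeff b 3 = 0"
 proof (rule ccontr)
  assume n: "coeff b 3 ~= 0"
  then have "degree D = 6" using c6 dD6 le_degree[of D 6] by simp
  then have "0 \<le> lead_coeff D" using c6 by simp
  then show False using lD by simp
 qed
 have db: "degree b \<le> 2"
 proof (rule degree_le, intro allI impI)
  fix i :: nat assume "2 < i"
  then have "i = 3 \<or> 3 < i" by linarith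
  then show "coeff b i = 0" using b3 deg(2) by (auto simp: coeff_eq_0)
 qed
 have "degree (b ^ 2) \<le> 4" unfolding power2_eq_square using degree_mult_le[of b b] db by simp
 then have bb5: "coeff (b ^ 2) 5 = 0" by (simp add: coeff_eq_0)
 have "coeff (a * c) (1 + 4) = coeff a 1 * coeff c 4"
 proof (cases "coeff c 4 = 0")
  case True
  have "degree c \<le> 3"
  proof (rule degree_le, intro allI impI)
   fix i :: nat assume "3 < i"
   then have "i = 4 \<or> 4 < i" by linarith
   then show "coeff c i = 0" using True deg(3) by (auto simp: coeff_eq_0)
  qed
  then have "degree (a * c) \<le> 4" using degree_mult_le[of a c] deg(1) by simp
  then show ?thesis using True by (simp add: coeff_eq_0)
 next
  case False
  then have "degree c = 4" using deg(3) le_degree[of c 4] by simp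
  then show ?thesis using coeff_mult_degree_sum[of a c] deg(1) by simp
 qed
 then have c5: "coeff D 5 = - 4 * (coeff a 1 * coeff c 4)" unfolding D_def using bb5 by simp
 have "coeff c 4 = 0"
 proof (rule ccontr)
  assume c4: "coeff c 4 ~= 0"
  have "coeff a 1 ~= 0" using deg(1) by (metis leading_coeff_0_iff degree_0 zero_neq_one)
  then have "coeff D 5 ~= 0" using c5 c4 by simp
  moreover have "coeff D 6 = 0" using c6 b3 by simp
  ultimately have "degree D = 5"
   using le_degree[of D 5] dD6 by (metis le_antisym le_neq_implies_less leading_coeff_0_iff coeff_0 less_Suc_eq_le eval_nat_numeral(3) eval_nat_numeral(2) semiring_norm(26,27,28))
  then show False using dD by presburger
 qed
 then show ?thesis using b3 by simp
qed

lemma nonpositive_quadratic: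
 fixes e :: "'a::real_closed_field poly"
 assumes deg: "degree e \<le> 2" and le: "\<And>t. poly e t \<le> 0"
 shows "\<exists>q h s. e = - ([:h, q:] ^ 2 + [:s ^ 2:])"
proof -
 obtain e0 e1 e2 where e: "e = [:e0, e1, e2:]" using degree_le_2E[OF deg] by blast
 have ev: "e0 + e1 * t + e2 * t ^ 2 \<le> 0" for t using le[of t] unfolding e by (simp add: power2_eq_square algebra_simps)
 show ?thesis
 proof (cases "e2 = 0")
  case True
  have "e1 = 0"
  proof (rule ccontr)
   assume e1: "e1 ~= 0"
   have "e0 + e1 * ((1 - e0) / e1) + e2 * ((1 - e0) / e1) ^ 2 = 1" using True e1 by simp
   then show False using ev[of "(1 - e0) / e1"] by simp
  qed
  moreover obtain s where "s ^ 2 = - e0" using nonneg_sqrt[of "- e0"] ev[of 0] by auto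
  ultimately show ?thesis using True unfolding e by (intro exI[of _ 0] exI[of _ s]) simp
 next
  case e2: False
  define h where "h = e1 / (2 * e2)"
  define r where "r = e0 - e2 * h ^ 2"
  have e1: "e1 = 2 * e2 * h" unfolding h_def using e2 by simp
  have e0: "e0 = r + e2 * h ^ 2" unfolding r_def by simp
  have sq: "e0 + e1 * t + e2 * t ^ 2 = e2 * (t + h) ^ 2 + r" for t
   unfolding e0 e1 by (simp add: power2_eq_square algebra_simps)
  have r: "r \<le> 0" using ev[of "- h"] unfolding sq by simp
  have "e2 < 0"
  proof (rule ccontr)
   assume "\<not> e2 < 0"
   then have p: "e2 > 0" using e2 by simp
   then obtain x where x: "x ^ 2 = (1 - r) / e2" using nonneg_sqrt[of "(1 - r) / e2"] r by auto
   then have "e2 * x ^ 2 = 1 - r" using p by simp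
   then show False using ev[of "x - h"] unfolding sq by simp
  qed
  then obtain q where q: "q ^ 2 = - e2" using nonneg_sqrt[of "- e2"] by auto
  obtain s where s: "s ^ 2 = - r" using nonneg_sqrt[of "- r"] r by auto
  have "e = - ([:q * h, q:] ^ 2 + [:s ^ 2:])"
  proof -
   have A: "(q * h) ^ 2 + s ^ 2 = - e0" unfolding power_mult_distrib q s e0 by simp
   have "2 * (q * h * q) = 2 * h * q ^ 2" by (simp add: power2_eq_square)
   then have B: "2 * (q * h * q) = - e1" unfolding q e1 by simp
   have "[:q * h, q:] ^ 2 + [:s ^ 2:] = [:(q * h) ^ 2 + s ^ 2, 2 * (q * h * q), q ^ 2:]"
    by (simp add: power2_eq_square algebra_simps)
   then show ?thesis unfolding e A B q by simp
  qed
  then show ?thesis by blast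
 qed
qed

lemma ev2_real: "ev2 (\<lambda>x. x) p t s = poly (poly p [:s:]) (t :: 'a::comm_ring_1)"
proof -
 have p1: "peval (\<lambda>x. x) g t = poly g t" for g unfolding peval_def by (simp add: map_poly_idI)
 interpret E: comm_hom "\<lambda>g. poly g t" by unfold_locales auto
 show ?thesis unfolding ev2_def p1 by (induction p) simp_all
qed

context subfield_over
begin

lemma finite_over_mono: "finite_over y N ==> N \<le> N' ==> finite_over y N'"
 unfolding finite_over_def
proof (intro allI impI)
 fix g assume f: "\<forall>g. (\<forall>j\<le>N. g j \<in> K) \<longrightarrow> (\<exists>\<phi>. (\<exists>j\<le>N. \<phi> j ~= 0) \<and> (\<Sum>j\<le>N. peval k (\<phi> j) y * g j) = 0)"
  and NN: "N \<le> N'" and g: "\<forall>j\<le>N'. g j \<in> K"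
 then obtain \<phi> where \<phi>: "\<exists>j\<le>N. \<phi> j ~= 0" "(\<Sum>j\<le>N. peval k (\<phi> j) y * g j) = 0" by (meson order_trans)
 have "(\<Sum>j\<le>N'. peval k (if j \<le> N then \<phi> j else 0) y * g j) = (\<Sum>j\<le>N. peval k (\<phi> j) y * g j)"
  using NN by (intro sum.mono_neutral_cong_right) auto
 then show "\<exists>\<phi>. (\<exists>j\<le>N'. \<phi> j ~= 0) \<and> (\<Sum>j\<le>N'. peval k (\<phi> j) y * g j) = 0"
  using \<phi> NN by (intro exI[of _ "\<lambda>j. if j \<le> N then \<phi> j else 0"]) auto
qed

lemma finite_over_generator:
 assumes K: "K = fieldgen k {u, \<zeta>}" and tr: "\<And>p. peval k p u = 0 ==> p = 0" and G: "G ~= 0" "ev2 k G u \<zeta> = 0"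
 shows "finite_over u (degree G)" "finite_over (inverse u) (degree G)"
  and "x \<in> K ==> \<exists>N. finite_over x N"
proof -
 have lc: "peval k (lead_coeff G) u ~= 0" using tr[of "lead_coeff G"] G(1) by auto
 note roc = relation_over_controlled[OF G(2) lc]
 have u0: "u ~= 0" using tr[of "[:0, 1:]"] by auto
 show "finite_over u (degree G)"
  unfolding finite_over_def unfolding K using roc(3)[OF roc(2)] by simp
 have "controlled (\<lambda>M. vs.span ((\<lambda>(a, b). u ^ a * \<zeta> ^ b) ` ({..M} \<times> {..<degree G}))) u (inverse u) 1"
  using roc(2) u0 unfolding controlled_def by simp
 from roc(3)[OF this] show "finite_over (inverse u) (degree G)"
  unfolding finite_over_def unfolding K by simp
 assume "x \<in> K"
 then obtain b r where "controlled (\<lambda>M. vs.span ((\<lambda>(a, b). u ^ a * \<zeta> ^ b) ` ({..M} \<times> {..<degree G}))) b x r"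
  using roc(1) unfolding K by blast
 from roc(3)[OF this] show "\<exists>N. finite_over x N" unfolding finite_over_def unfolding K by blast
qed

text \<open>Dividing by the element with the smallest valuation and reducing modulo the place gives \<open>1 + a\<^sup>2 + b\<^sup>2 = 0\<close>
 in the ground field.\<close>

lemma sum_three_squares:
 assumes u: "u \<in> Places" and rat: "\<And>x. ge u 0 x ==> \<exists>c. ge u 1 (x - k c)"
  and k: "\<And>a b :: 'a. a ^ 2 + b ^ 2 ~= - 1"
  and K: "x \<in> K" "y \<in> K" "z \<in> K" and sum: "x ^ 2 + y ^ 2 + z ^ 2 = 0"
 shows "x = 0 \<and> y = 0 \<and> z = 0"
proof -
 have main: False if xyz: "x \<in> K" "ge u (u x) y" "ge u (u x) z" "x ^ 2 + y ^ 2 + z ^ 2 = 0" "x ~= 0" for x y z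
 proof -
  have g: "ge u 0 (y / x)" "ge u 0 (z / x)" using ge_divide[OF u xyz(2) xyz(1,5)] ge_divide[OF u xyz(3) xyz(1,5)] by simp_all
  obtain c d where cd: "ge u 1 (y / x - k c)" "ge u 1 (z / x - k d)" using rat g by blast
  have "ge u 1 ((y / x + k c) * (y / x - k c) + (z / x + k d) * (z / x - k d))"
   by (intro ge_add ge_mult0 ge_const u cd g)
  moreover have "(y / x + k c) * (y / x - k c) + (z / x + k d) * (z / x - k d) = k (- 1 - (c ^ 2 + d ^ 2))"
  proof -
   have "1 + (y / x) ^ 2 + (z / x) ^ 2 = (x ^ 2 + y ^ 2 + z ^ 2) / x ^ 2"
    using xyz(5) by (simp add: power_divide add_divide_distrib)
   then have "(y / x) ^ 2 + (z / x) ^ 2 = - 1" unfolding xyz(4) by (simp add: eq_neg_iff_add_eq_0 add_ac)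
   then show ?thesis by (simp add: power2_eq_square algebra_simps)
  qed
  ultimately have "- 1 - (c ^ 2 + d ^ 2) = 0" using ge1_const[OF u] by metis
  then show False using k[of c d] by (simp add: eq_neg_iff_add_eq_0 add_ac)
 qed
 have ord: "ge u (u p) q" if "p \<in> K" "q \<in> K" "q = 0 \<or> u p \<le> u q" for p q
  using that unfolding ge_def by auto
 show ?thesis
 proof (rule ccontr)
  assume nz: "\<not> ?thesis"
  define S where "S = {p \<in> {x, y, z}. p ~= 0}"
  have S: "finite S" "S ~= {}" using nz unfolding S_def by auto
  obtain p where p: "p \<in> S" "\<And>q. q \<in> S ==> u p \<le> u q"
   using arg_min_if_finite[OF S, of u] by (metis not_le)
  have o: "ge u (u p) q" if "q \<in> {x, y, z}" for q
   using p that K by (intro ord) (auto simp: S_def)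
  have "p \<in> {x, y, z}" "p ~= 0" "p \<in> K" using p(1) K unfolding S_def by auto
  then consider "p = x" | "p = y" | "p = z" by blast
  then show False
  proof cases
   case 1
   then show False using main[of x y z] o \<open>p ~= 0\<close> K sum by simp
  next
   case 2
   then show False using main[of y x z] o \<open>p ~= 0\<close> K sum by (simp add: add_ac)
  next
   case 3
   then show False using main[of z x y] o \<open>p ~= 0\<close> K sum by (simp add: add_ac)
  qed
 qed
qed

end

section \<open>Plane curves of degree two and four\<close>

text \<open>The point \<open>(v, w)\<close> is a generic point of the curve \<open>f = 0\<close> of degree \<open>2m\<close>.\<close>

locale plane_curve_function_field = rcf_hom k for k :: "'a::real_closed_field => 'b::field" +
 fixes v w :: 'b and f :: "'a poly poly" and m :: nat
 assumes kernel: "ev2 k p v w = 0 \<longleftrightarrow> f dvd p" and v_transcendental: "peval k q v = 0 ==> q = 0"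
  and no_sqrt: "x \<in> fieldgen k {v, w} ==> x ^ 2 ~= - 1"
  and degree_f: "total_degree f = 2 * m" "m = 1 \<or> m = 2"
begin

abbreviation K where "K \<equiv> fieldgen k {v, w}"

sublocale SF: subfield_over k K
 by unfold_locales (auto intro: fg)

lemma f_nz: "f ~= 0" using degree_f total_degree_le_iff[of "0 :: 'a poly poly" 0] by auto

lemma tdeg_f: "tdeg_le f (2 * m)" using degree_f(1) total_degree_le_iff[of f "2 * m"] by simp

lemma f_root: "ev2 k f v w = 0" by (simp add: kernel)

lemma small_degree_imp_0:
 assumes "tdeg_le p n" "n < 2 * m" "ev2 k p v w = 0"
 shows "p = 0"
proof (rule ccontr)
 assume p: "p ~= 0"
 obtain g where g: "p = f * g" using assms(3) unfolding kernel by blast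
 then have "g ~= 0" using p by auto
 then have "total_degree p = 2 * m + total_degree g" unfolding g using total_degree_mult[OF f_nz] degree_f(1) by simp
 moreover have "total_degree p \<le> n" using assms(1) total_degree_le_iff by blast
 ultimately show False using assms(2) by simp
qed

lemma degree_f_le_4: "degree f \<le> 4"
 using tdeg_le_degree(1)[OF tdeg_f] degree_f(2) by auto

sublocale RF: real_function_field k K
proof
 show "x ^ 2 ~= - 1" if "x \<in> K" for x using no_sqrt that .
 show "\<exists>N. SF.finite_over x N" if "x \<in> K" for x
  using SF.finite_over_generator(3)[OF refl v_transcendental f_nz f_root that] .
 show "\<exists>z\<in>K. (\<forall>p. peval k p z = 0 \<longrightarrow> p = 0) \<and> SF.finite_over (inverse z) 4"
  using SF.finite_over_mono[OF SF.finite_over_generator(2)[OF refl v_transcendental f_nz f_root] degree_f_le_4] v_transcendental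
  by (intro bexI[of _ v]) (auto intro: fg)
qed

lemma v_in: "v \<in> K" and w_in: "w \<in> K" by (auto intro: fg)

lemma affine_in: "affine_point v w i \<in> K" unfolding affine_point_def using v_in w_in by simp

lemma independent: "RF.linear_independent3 1 v w"
 unfolding RF.linear_independent3_def
proof (intro allI impI)
 fix a b c assume "k a * 1 + k b * v + k c * w = 0"
 then have "ev2 k [:[:a, b:], [:c:]:] v w = 0" by (simp add: algebra_simps)
 then have "[:[:a, b:], [:c:]:] = 0" using small_degree_imp_0[OF tdeg_le_linear] degree_f(2) by auto
 then show "a = 0 \<and> b = 0 \<and> c = 0" by simp
qed

lemma ex_coordinates:
 assumes b: "RF.lin v w b ~= 0" and u: "RF.lin v w a / RF.lin v w b \<notin> range k"
 shows "\<exists>M N. inverse3 M N \<and> inverse3 N M \<and> mat_vec k M (affine_point v w) 0 = RF.lin v w b \<and>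
  mat_vec k M (affine_point v w) 1 = RF.lin v w a"
proof -
 have s: "i = 0 \<or> i = 1 \<or> i = 2" if "i < 3" for i :: nat using that by linarith
 have ind: "d = 0" if cd: "\<forall>i<3. c * b i + d * a i = 0" for c d
 proof (rule ccontr)
  assume d: "d ~= 0"
  have "k c * RF.lin v w b + k d * RF.lin v w a = k (c * b 0 + d * a 0) + k (c * b 1 + d * a 1) * v + k (c * b 2 + d * a 2) * w"
   unfolding RF.lin_def by (simp add: algebra_simps)
  also have "\<dots> = 0" using cd by simp
  finally have "k d * RF.lin v w a = - (k c * RF.lin v w b)" by (simp add: eq_neg_iff_add_eq_0 add.commute)
  then have "RF.lin v w a / RF.lin v w b = k (- c / d)" using b d by (simp add: field_simps)
  then show False using u by blast
 qed
 have exb: "\<exists>i<3. b i ~= 0"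
 proof (rule ccontr)
  assume "\<not> ?thesis"
  then have "b 0 = 0" "b 1 = 0" "b 2 = 0" by auto
  then show False using b unfolding RF.lin_def by simp
 qed
 have "\<exists>M N. inverse3 M N \<and> inverse3 N M \<and> (\<forall>i<3. M 0 i = b i) \<and> (\<forall>i<3. M 1 i = a i)"
  by (rule ex_invertible_matrix[OF _ exb]) (erule ind)
 then obtain M N where
  MN: "inverse3 M N" "inverse3 N M" "\<forall>i<3. M 0 i = b i" "\<forall>i<3. M 1 i = a i" by blast
 then show ?thesis unfolding mat_vec_def RF.lin_def affine_point_def by (intro exI[of _ M] exI[of _ N]) simp
qed

context
 fixes M N :: "nat => nat => 'a"
 assumes MN: "inverse3 M N" "inverse3 N M" and l0: "mat_vec k M (affine_point v w) 0 ~= 0"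
begin

definition l where "l = mat_vec k M (affine_point v w)"
definition u where "u = l 1 / l 0"
definition z where "z = l 2 / l 0"
definition f' where "f' = change_coords (2 * m) N f"

lemma l0': "l 0 ~= 0" using l0 by (simp add: l_def)

lemma f'_root: "ev2 k f' u z = 0"
 using change_coords_relation(1)[OF tdeg_f MN(2) l0] f_root l0' unfolding f'_def u_def z_def l_def by simp

lemma f'_nz: "f' ~= 0"
 unfolding f'_def using change_coords_0_imp[OF tdeg_f MN(2,1)] f_nz by blast

lemma ev2_back: "tdeg_le q n ==> ev2 k (change_coords n M q) v w = l 0 ^ n * ev2 k q u z"
 unfolding ev2_change_coords l_def[symmetric] u_def z_def by (rule heval_field[where Z = l, OF comm_hom_axioms _ l0'])

lemma f'_kernel: "ev2 k q u z = 0 ==> f' dvd q"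
proof -
 assume q: "ev2 k q u z = 0"
 obtain n where n: "tdeg_le q n" using ex_tdeg_le by blast
 have "f dvd change_coords n M q" using ev2_back[OF n] q kernel by simp
 then show ?thesis using change_coords_dvd[OF n MN f_nz] unfolding f'_def degree_f(1) by blast
qed

text \<open>The inverse matrix expresses \<open>v, w\<close> by \<open>u, z\<close>.\<close>

lemma K_eq: "K = fieldgen k {u, z}"
proof (rule fieldgen_eqI)
 define n where "n = mat_vec k N (affine_point u z)"
 have l_in: "l i \<in> K" for i unfolding l_def mat_vec_def by (intro fg(1,3,4) affine_in)
 show "{u, z} \<subseteq> K" unfolding u_def z_def using l_in by (auto intro: fg_divide)
 have n: "l 0 * n i = affine_point v w i" if "i < 3" for i
  using change_coords_relation(2,3)[OF tdeg_f MN(2) l0, of i] that unfolding n_def u_def z_def l_def by simp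
 have n_in: "n i \<in> fieldgen k {u, z}" for i
 proof -
  have "affine_point u z j \<in> fieldgen k {u, z}" for j unfolding affine_point_def by (auto intro: fg)
  then show ?thesis unfolding n_def mat_vec_def by (intro fg(1,3,4))
 qed
 have ln: "l 0 * n 0 = 1" using n[of 0] by (simp add: affine_point_def)
 then have n0: "n 0 ~= 0" by auto
 then have l0_eq: "l 0 = 1 / n 0" using ln by (simp add: eq_divide_eq)
 have l0_in: "l 0 \<in> fieldgen k {u, z}" unfolding l0_eq by (intro fg_divide fg_1 n_in)
 have vw: "l 0 * n 1 = v" "l 0 * n 2 = w" using n[of 1] n[of 2] by (simp_all add: affine_point_def)
 have "l 0 * n 1 \<in> fieldgen k {u, z}" "l 0 * n 2 \<in> fieldgen k {u, z}" by (rule fg(4)[OF l0_in n_in])+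
 then have "v \<in> fieldgen k {u, z}" "w \<in> fieldgen k {u, z}" unfolding vw .
 then show "{v, w} \<subseteq> fieldgen k {u, z}" by blast
qed

lemma u_in: "u \<in> K" and z_in: "z \<in> K" unfolding K_eq by (auto intro: fg)

lemma tdeg_f': "tdeg_le f' (2 * m)" unfolding f'_def by (rule tdeg_le_change_coords)

lemma pencil_finite:
 assumes "u \<notin> range k" shows "SF.finite_over u 4"
proof -
 have "SF.finite_over u (degree f')"
  using SF.finite_over_generator(1)[OF K_eq RF.nonconst_imp_transcendental[OF u_in assms] f'_nz f'_root] .
 then show ?thesis by (rule SF.finite_over_mono) (use tdeg_le_degree(1)[OF tdeg_f'] degree_f(2) in auto)
qed

text \<open>A relation between the powers of \<open>z\<close> over \<open>R[u]\<close> is a multiple of the equation in the new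
 coordinates.\<close>

lemma degree_f'_le:
 assumes fin: "SF.finite_over u n"
 shows "degree f' \<le> n"
proof -
 have "\<forall>j\<le>n. z ^ j \<in> K" using SF.K.D_power[OF z_in] by blast
 then obtain \<phi> where \<phi>: "\<exists>j\<le>n. \<phi> j ~= 0" "(\<Sum>j\<le>n. peval k (\<phi> j) u * z ^ j) = 0"
  using fin unfolding SF.finite_over_def by blast
 let ?q = "\<Sum>j\<le>n. Polynomial.monom (\<phi> j) j"
 have co: "coeff ?q i = (if i \<le> n then \<phi> i else 0)" for i by (simp add: coeff_sum)
 interpret E: comm_hom "\<lambda>g. peval k g u" by (rule comm_hom_peval)
 have "ev2 k ?q u z = 0" unfolding ev2_def using \<phi>(2) by (simp add: E.peval_sum)
 then have "f' dvd ?q" by (rule f'_kernel)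
 moreover have "?q ~= 0" using \<phi>(1) co by (metis coeff_0)
 ultimately have "degree f' \<le> degree ?q" by (rule dvd_imp_degree_le)
 also have "\<dots> \<le> n" by (rule degree_le) (simp add: co)
 finally show ?thesis .
qed

text \<open>An irreducible equation has no factor depending on the base coordinate only.\<close>

lemma no_vertical_factor:
 assumes u: "u \<notin> range k" and g: "f' = [:q:] * g"
 shows "degree q = 0"
proof -
 interpret E: comm_hom "\<lambda>p. ev2 k p u z" by (rule comm_hom_ev2)
 have q0: "q ~= 0" using g f'_nz by auto
 have "peval k q u ~= 0" using RF.nonconst_imp_transcendental[OF u_in u] q0 by blast
 moreover have "peval k q u * ev2 k g u z = 0" using f'_root unfolding g E.hom_mult by simp
 ultimately have "ev2 k g u z = 0" by simp
 then obtain g' where g': "g = f' * g'" using f'_kernel by blast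
 then have "f' * 1 = f' * ([:q:] * g')" using g by (simp add: ac_simps)
 then have "[:q:] * g' = 1" using f'_nz by (metis mult_cancel_left)
 then have "coeff ([:q:] * g') 0 = 1" by simp
 then have "q * coeff g' 0 = 1" by simp
 then have "q dvd 1" by (metis dvd_triv_left)
 then show ?thesis by (auto simp: is_unit_poly_iff)
qed

lemma not_small_tdeg:
 assumes "tdeg_le f' n" shows "2 * m \<le> n"
proof (rule ccontr)
 assume "\<not> ?thesis"
 then have "change_coords n M f' = 0"
  using small_degree_imp_0[OF tdeg_le_change_coords] ev2_back[OF assms] f'_root by simp
 then show False using change_coords_0_imp[OF assms MN] f'_nz by blast
qed

text \<open>Here the conditions for the rationality of the conic bundle are verified.\<close>

lemma rational_if_quadratic:
 assumes u: "u \<notin> range k" and quad: "RF.quadratic_over u"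
  and pos: "(\<exists>P\<in>SF.Places. \<forall>x. SF.ge P 0 x \<longrightarrow> (\<exists>c. SF.ge P 1 (x - k c))) \<or> nonnegative_poly f"
 shows "rational_sum_two_squares f"
proof -
 obtain \<omega> e where \<omega>: "\<omega> \<in> K" "degree e \<le> 2" "\<omega> ^ 2 = peval k e u" "K \<subseteq> fieldgen k {u, \<omega>}"
  using quad unfolding RF.quadratic_over_def by blast
 have tr: "p = 0" if "peval k p u = 0" for p using RF.nonconst_imp_transcendental[OF u_in u that] .
 have "fieldgen k {u, \<omega>} \<subseteq> K" using fieldgen_least[of "{u, \<omega>}" "{v, w}"] u_in \<omega>(1) by blast
 then have K\<omega>: "K = fieldgen k {u, \<omega>}" using \<omega>(4) by blast
 have "ev2 k [:- e, 0, 1:] u \<omega> = 0" using \<omega>(3) by (simp add: power2_eq_square)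
 from SF.finite_over_generator(1)[OF K\<omega> tr _ this]
 have fin2: "SF.finite_over u 2" by (simp add: numeral_2_eq_2)
 obtain c b a where f': "f' = [:c, b, a:]" using degree_le_2E[OF degree_f'_le[OF fin2]] by blast
 have m2: "m \<le> 2" using degree_f(2) by auto
 have degs: "degree a \<le> 2 * m - 2" "degree b \<le> 2 * m - 1" "degree c \<le> 2 * m"
  using tdeg_le_degree(2)[OF tdeg_f', of 2] tdeg_le_degree(2)[OF tdeg_f', of 1] tdeg_le_degree(2)[OF tdeg_f', of 0]
  unfolding f' by (simp_all add: numeral_2_eq_2)
 define \<alpha> \<beta> \<gamma> where "\<alpha> = peval k a u" and "\<beta> = peval k b u" and "\<gamma> = peval k c u"
 have root: "\<gamma> + z * (\<beta> + z * \<alpha>) = 0" using f'_root unfolding f' by (simp add: \<alpha>_def \<beta>_def \<gamma>_def)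
 let ?U = "fieldgen k {u}"
 have uU: "peval k p u \<in> ?U" for p by (intro fg_peval) (auto intro: fg)
 have not_U: "\<not> K \<subseteq> ?U" if "a ~= 0"
 proof
  assume "K \<subseteq> ?U"
  moreover have "?U \<subseteq> K" using fieldgen_least[of "{u}" "{v, w}"] u_in by blast
  moreover have "?U = fieldgen k {u, 0}" by (rule fieldgen_eqI) (auto intro: fg)
  ultimately have "K = fieldgen k {u, 0}" by simp
  moreover have "ev2 k [:0, 1:] u 0 = 0" by simp
  ultimately have "SF.finite_over u 1" using SF.finite_over_generator(1)[of u 0 "[:0, 1:]"] tr by simp
  then have "degree f' \<le> 1" by (rule degree_f'_le)
  then show False using that unfolding f' by simp
 qed
 have \<omega>_U: "\<omega> \<notin> ?U" if "a ~= 0"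
 proof
  assume "\<omega> \<in> ?U"
  then have "{u, \<omega>} \<subseteq> ?U" by (auto intro: fg)
  then show False using not_U[OF that] \<omega>(4) fieldgen_least[of "{u, \<omega>}" "{u}"] by blast
 qed
 have z_U: "z \<notin> ?U" if "a ~= 0"
 proof
  assume "z \<in> ?U"
  then have "{u, z} \<subseteq> ?U" by (auto intro: fg)
  then show False using not_U[OF that] K_eq fieldgen_least[of "{u, z}" "{u}"] by blast
 qed
 have disc: "\<exists>r1 r2. r1 ~= 0 \<and> r2 ~= 0 \<and> r2 ^ 2 * (b ^ 2 - smult 4 (a * c)) = r1 ^ 2 * e" if a: "a ~= 0"
 proof -
  have \<alpha>0: "\<alpha> ~= 0" unfolding \<alpha>_def using tr a by blast
  define y where "y = (\<alpha> + \<alpha>) * z + \<beta>"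
  have z_y: "z = (y - \<beta>) / (\<alpha> + \<alpha>)"
  proof -
   have "\<alpha> + \<alpha> = 2 * \<alpha>" by simp
   then have "\<alpha> + \<alpha> ~= 0" using \<alpha>0 by simp
   then show ?thesis unfolding y_def by simp
  qed
  have "y ^ 2 = \<beta> ^ 2 - 4 * (\<alpha> * \<gamma>) + 4 * \<alpha> * (\<gamma> + z * (\<beta> + z * \<alpha>))"
   unfolding y_def by (simp add: power2_eq_square algebra_simps)
  then have y2: "y ^ 2 = peval k (b ^ 2 - smult 4 (a * c)) u"
   unfolding root by (simp add: \<alpha>_def \<beta>_def \<gamma>_def power2_eq_square)
  have aU: "\<alpha> \<in> ?U" "\<beta> \<in> ?U" unfolding \<alpha>_def \<beta>_def by (rule uU)+
  have y_U: "y \<notin> ?U"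
  proof
   assume "y \<in> ?U"
   then have "(y - \<beta>) / (\<alpha> + \<alpha>) \<in> ?U" by (intro fg_divide fg_diff fg(3) aU)
   then show False using z_U[OF a] z_y by simp
  qed
  have "y \<in> K" unfolding y_def \<alpha>_def \<beta>_def by (intro fg(3,4) fg_peval u_in z_in)
  then have "\<forall>j\<le>2. (if j = 0 then 1 else if j = 1 then \<omega> else y) \<in> K" using \<omega>(1) by simp
  then obtain \<phi> where \<phi>: "\<exists>j\<le>2::nat. \<phi> j ~= 0"
   "(\<Sum>j\<le>2. peval k (\<phi> j) u * (if j = 0 then 1 else if j = 1 then \<omega> else y)) = 0"
   using fin2[unfolded SF.finite_over_def, rule_format, of "\<lambda>j. if j = 0 then 1 else if j = 1 then \<omega> else y"] by blast
  define A B C where "A = peval k (\<phi> 0) u" and "B = peval k (\<phi> 1) u" and "C = peval k (\<phi> 2) u"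
  have rel: "A + B * \<omega> + C * y = 0" using \<phi>(2) by (simp add: numeral_2_eq_2 A_def B_def C_def)
  have ABC: "A \<in> ?U" "B \<in> ?U" "C \<in> ?U" unfolding A_def B_def C_def by (rule uU)+
  have C0: "C ~= 0"
  proof
   assume C: "C = 0"
   have "B = 0"
   proof (rule ccontr)
    assume B: "B ~= 0"
    then have "\<omega> = - A / B" using rel C by (simp add: field_simps eq_neg_iff_add_eq_0)
    moreover have "- A / B \<in> ?U" by (intro fg_divide fg(5) ABC)
    ultimately show False using \<omega>_U[OF a] by simp
   qed
   then have "A = 0" using rel C by simp
   then have "\<phi> 0 = 0" "\<phi> 1 = 0" "\<phi> 2 = 0" using \<open>B = 0\<close> C tr unfolding A_def B_def C_def by blast+
   then have "\<phi> j = 0" if "j \<le> 2" for j using that by (auto simp: le_Suc_eq numeral_2_eq_2)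
   then show False using \<phi>(1) by blast
  qed
  have "C * y + (A + B * \<omega>) = 0" using rel by (simp only: add_ac)
  then have Cy: "C * y = - (A + B * \<omega>)" by (simp only: eq_neg_iff_add_eq_0)
  have B0: "B ~= 0"
  proof
   assume "B = 0"
   then have "y = - A / C" using Cy C0 by (simp add: field_simps)
   moreover have "- A / C \<in> ?U" by (intro fg_divide fg(5) ABC)
   ultimately show False using y_U by simp
  qed
  have sq: "C ^ 2 * y ^ 2 = A ^ 2 + (A * B + A * B) * \<omega> + B ^ 2 * \<omega> ^ 2"
  proof -
   have "C ^ 2 * y ^ 2 = (C * y) ^ 2" by (simp add: power_mult_distrib)
   then show ?thesis unfolding Cy by (simp add: power2_eq_square algebra_simps)
  qed
  have "A = 0"
  proof (rule ccontr)
   assume A: "A ~= 0"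
   have "A * B + A * B = 2 * (A * B)" by simp
   then have n: "A * B + A * B ~= 0" using A B0 by simp
   have "(A * B + A * B) * \<omega> = C ^ 2 * y ^ 2 - A ^ 2 - B ^ 2 * \<omega> ^ 2" using sq by simp
   then have "\<omega> = (C ^ 2 * y ^ 2 - A ^ 2 - B ^ 2 * \<omega> ^ 2) / (A * B + A * B)"
    using n by (metis nonzero_mult_div_cancel_left)
   moreover have "(C ^ 2 * peval k (b ^ 2 - smult 4 (a * c)) u - A ^ 2 - B ^ 2 * peval k e u) / (A * B + A * B) \<in> ?U"
    by (intro fg_divide fg_diff fg(3,4) fg_power ABC uU)
   ultimately show False using \<omega>_U[OF a] unfolding y2 \<omega>(3) by simp
  qed
  then have "C ^ 2 * peval k (b ^ 2 - smult 4 (a * c)) u = B ^ 2 * peval k e u" using sq unfolding y2 \<omega>(3) by simp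
  then have "peval k (\<phi> 2 ^ 2 * (b ^ 2 - smult 4 (a * c)) - \<phi> 1 ^ 2 * e) u = 0"
   unfolding B_def C_def by (simp add: power2_eq_square)
  then have "\<phi> 2 ^ 2 * (b ^ 2 - smult 4 (a * c)) - \<phi> 1 ^ 2 * e = 0" by (rule tr)
  moreover have "\<phi> 1 ~= 0" "\<phi> 2 ~= 0" using B0 C0 unfolding B_def C_def by auto
  ultimately show ?thesis by (intro exI[of _ "\<phi> 1"] exI[of _ "\<phi> 2"]) simp
 qed
 then obtain r1 r2 where r: "a ~= 0 ==> r1 ~= 0 \<and> r2 ~= 0 \<and> r2 ^ 2 * (b ^ 2 - smult 4 (a * c)) = r1 ^ 2 * e"
  by (cases "a = 0") blast+
 have nsq: "e ~= g ^ 2" if "a ~= 0" for g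
 proof
  assume "e = g ^ 2"
  then have "\<omega> ^ 2 = peval k g u ^ 2" using \<omega>(3) by (simp add: power2_eq_square)
  then have "\<omega> = peval k g u \<or> \<omega> = - peval k g u" by (simp add: power2_eq_iff)
  then show False using \<omega>_U[OF that] uU[of g] fg(5)[OF uU[of g]] by auto
 qed
 show ?thesis
 proof (rule rational_sum_two_squares_conic_bundle[OF tdeg_f MN f'[unfolded f'_def]])
  show "b ~= 0" if "a = 0"
  proof
   assume "b = 0"
   then have "peval k c u = 0" using root that unfolding \<alpha>_def \<beta>_def \<gamma>_def by simp
   then show False using tr f'_nz that \<open>b = 0\<close> unfolding f' by auto
  qed
  show "degree a \<le> 2" using degs(1) m2 by simp
  show "r1 ~= 0 \<and> r2 ~= 0 \<and> r2 ^ 2 * (b ^ 2 - smult 4 (a * c)) = r1 ^ 2 * e" if "a ~= 0" using r[OF that] .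
  show "degree e \<le> 2" by (rule \<omega>(2))
  show "e ~= h ^ 2" if "a ~= 0" for h using nsq[OF that] .
  show "0 \<le> poly e \<rho>" if a: "a ~= 0" "poly a \<rho> = 0" "poly (pderiv a) \<rho> ~= 0" for \<rho>
  proof (rule ccontr)
   assume "\<not> 0 \<le> poly e \<rho>"
   then have "poly b \<rho> = 0 \<and> poly c \<rho> = 0"
    using simple_root_common_zero[of r2 b a c r1 e \<rho>] r[OF a(1)] a by auto
   then obtain a' b' c' where "a = [:- \<rho>, 1:] * a'" "b = [:- \<rho>, 1:] * b'" "c = [:- \<rho>, 1:] * c'"
    using a(2) unfolding poly_eq_0_iff_dvd by (meson dvdE)
   then have "f' = [:[:- \<rho>, 1:]:] * [:c', b', a':]" unfolding f' by simp
   then show False using no_vertical_factor[OF u] by fastforce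
  qed
  show "0 \<le> coeff e 2" if a: "degree a = 1"
  proof (rule ccontr)
   assume "\<not> 0 \<le> coeff e 2"
   then have e2: "coeff e 2 < 0" by simp
   have m: "m = 2" using degree_f(2) degs(1) a by auto
   have "a ~= 0" using a by auto
   then have bc: "coeff b 3 = 0" "coeff c 4 = 0"
    using negative_leading_coeff[of r2 b a c r1 e] r a degs m \<omega>(2) e2 by auto
   have "tdeg_le f' 3"
    unfolding tdeg_le_def
   proof (intro allI impI)
    fix i j assume ij: "coeff (coeff f' j) i ~= 0"
    then have le: "i + j \<le> 4" using tdeg_f' m unfolding tdeg_le_def by fastforce
    have "i + j ~= 4"
    proof
     assume s: "i + j = 4"
     have "j \<le> 2"
     proof (rule ccontr)
      assume "\<not> j \<le> 2"
      then have "coeff f' j = 0" unfolding f' by (simp add: coeff_eq_0)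
      then show False using ij by simp
     qed
     then consider "j = 0" "i = 4" | "j = 1" "i = 3" | "j = 2" "i = 2" using s by linarith
     then show False
     proof cases
      case 1
      then show False using ij bc unfolding f' by simp
     next
      case 2
      then show False using ij bc unfolding f' by simp
     next
      case 3
      then have "coeff a 2 ~= 0" using ij unfolding f' by (simp add: numeral_2_eq_2)
      then show False using a le_degree[of a 2] by simp
     qed
    qed
    then show "i + j \<le> 3" using le by simp
   qed
   then show False using not_small_tdeg m by fastforce
  qed
  show "(\<exists>t. 0 < poly a t) \<or> (\<exists>t. 0 < poly e t)" if a: "a ~= 0"
  proof (rule ccontr)
   assume "\<not> ?thesis"
   then have al: "poly a t \<le> 0" and el: "poly e t \<le> 0" for t by (auto simp: not_less)
   from pos show False
   proof
    assume "\<exists>P\<in>SF.Places. \<forall>x. SF.ge P 0 x \<longrightarrow> (\<exists>c. SF.ge P 1 (x - k c))"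
    then obtain P where P: "P \<in> SF.Places" "\<And>x. SF.ge P 0 x ==> \<exists>c. SF.ge P 1 (x - k c)" by blast
    obtain q h s where e: "e = - ([:h, q:] ^ 2 + [:s ^ 2:])" using nonpositive_quadratic[OF \<omega>(2) el] by blast
    have n: "x ^ 2 + y ^ 2 ~= - 1" for x y :: 'a
    proof
     assume "x ^ 2 + y ^ 2 = - 1"
     moreover have "0 \<le> x ^ 2 + y ^ 2" by simp
     ultimately show False by simp
    qed
    define y where "y = peval k [:h, q:] u"
    have pe: "peval k (- (p ^ 2 + [:s ^ 2:])) u = - (peval k p u ^ 2 + (k s) ^ 2)" for p
     by (simp add: power2_eq_square)
    have "\<omega> ^ 2 = - (y ^ 2 + (k s) ^ 2)" unfolding \<omega>(3) y_def pe[symmetric] e[symmetric] ..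
    then have sum: "\<omega> ^ 2 + y ^ 2 + (k s) ^ 2 = 0" by simp
    have yK: "y \<in> K" unfolding y_def by (rule fg_peval[OF u_in])
    have z0: "\<omega> = 0 \<and> y = 0 \<and> k s = 0"
     by (rule SF.sum_three_squares[OF P n \<omega>(1) yK fg(1) sum])
    then have "[:h, q:] = 0" unfolding y_def using tr by blast
    then have "e = 0 ^ 2" using z0 unfolding e by simp
    then show False using nsq[OF a] by blast
   next
    assume nn: "nonnegative_poly f"
    have id: "comm_hom (\<lambda>x::'a. x)" by unfold_locales auto
    define F where "F = f' * ([:a * r2:] * linear_poly N 0)"
    have "poly (poly F [:s:]) t = 0" for s t
    proof (rule ccontr)
     assume nz: "poly (poly F [:s:]) t ~= 0"
     have "poly (poly F [:s:]) t = poly (poly f' [:s:]) t * ((poly a t * poly r2 t) * poly (poly (linear_poly N 0) [:s:]) t)"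
      unfolding F_def poly_mult by simp
     then have n: "poly (poly f' [:s:]) t ~= 0" "poly a t ~= 0" "poly r2 t ~= 0" "poly (poly (linear_poly N 0) [:s:]) t ~= 0"
      using nz by auto
     define y where "y = mat_vec (\<lambda>x. x) N (affine_point t s)"
     have y0: "y 0 ~= 0"
      using n(4) unfolding y_def by (simp add: linear_poly_def mat_vec_def affine_point_def algebra_simps)
     have "poly (poly f' [:s:]) t = y 0 ^ (2 * m) * poly (poly f [:y 2 / y 0:]) (y 1 / y 0)"
      unfolding ev2_real[symmetric] f'_def comm_hom.ev2_change_coords[OF id] y_def[symmetric]
      by (rule heval_field[where Z = y, OF id tdeg_f y0])
     moreover have "0 \<le> y 0 ^ (2 * m)" by (simp add: zero_le_even_power)
     ultimately have "0 \<le> poly (poly f' [:s:]) t" using nn unfolding nonnegative_poly_def by simp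
     then have fpos: "0 < poly (poly f' [:s:]) t" using n(1) by simp
     have fe: "poly (poly f' [:s:]) t = poly c t + s * (poly b t + s * poly a t)" unfolding f' by simp
     define \<Delta> where "\<Delta> = poly b t ^ 2 - 4 * (poly a t * poly c t)"
     have "poly (r2 ^ 2 * (b ^ 2 - smult 4 (a * c))) t = poly (r1 ^ 2 * e) t" using r[OF a] by simp
     then have "poly r2 t ^ 2 * \<Delta> = poly r1 t ^ 2 * poly e t" unfolding \<Delta>_def by simp
     moreover have "poly r1 t ^ 2 * poly e t \<le> 0" using el by (simp add: mult_nonneg_nonpos)
     moreover have "0 < poly r2 t ^ 2" using n(3) by simp
     ultimately have "\<Delta> \<le> 0" by (metis mult_pos_pos not_le)
     moreover have "4 * poly a t * poly (poly f' [:s:]) t = (2 * poly a t * s + poly b t) ^ 2 - \<Delta>"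
      unfolding fe \<Delta>_def by (simp add: power2_eq_square algebra_simps)
     ultimately have "0 \<le> 4 * poly a t * poly (poly f' [:s:]) t"
      using order_trans[of \<Delta> 0 "(2 * poly a t * s + poly b t) ^ 2"] by simp
     moreover have "poly a t < 0" using al[of t] n(2) by simp
     then have "4 * poly a t * poly (poly f' [:s:]) t < 0" using fpos by (simp add: mult_neg_pos)
     ultimately show False by simp
    qed
    then have "F = 0" by (rule vanishing_imp_0)
    then show False unfolding F_def using f'_nz a r[OF a] row_nonzero[OF MN(2)] by auto
   qed
  qed
 qed
qed

end

end

section \<open>Plane curves of genus zero\<close>

context plane_curve_function_field
begin

text \<open>The coordinate ring is embedded by evaluation at the generic point.\<close>

lemma ex_model: "\<exists>\<eta>. function_field_model k K (curve_function_field f) \<eta> (curve_constants f)"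
proof -
 define e where "e = (\<lambda>c. the_elem ((\<lambda>p. ev2 k p v w) ` c))"
 let ?A = "hypersurface_ring f"
 have emb: "embedded_ring ?A e" "e ` carrier ?A = range (\<lambda>p. ev2 k p v w)"
  "\<And>\<iota> c. hypersurface_const f \<iota> c \<in> carrier ?A" "\<And>\<iota> c. e (hypersurface_const f \<iota> c) = ev2 k (\<iota> c) v w"
  unfolding e_def by (rule embedded_hypersurface[OF comm_hom_ev2[of v w] kernel])+
 interpret A: embedded_ring ?A e by (rule emb(1))
 interpret dom: domain ?A by (rule A.is_domain)
 define S where "S = carrier ?A - {\<zero>\<^bsub>?A\<^esub>}"
 interpret S: embedded_localization ?A e S
  by unfold_locales (auto simp: S_def dest: dom.integral)
 have fr: "A.fractions S = K"
 proof (intro equalityI subsetI)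
  fix x assume "x \<in> A.fractions S"
  then obtain a s where as: "a \<in> carrier ?A" "s \<in> carrier ?A" "x = e a / e s" unfolding A.fractions_def S_def by blast
  have "e a \<in> range (\<lambda>p. ev2 k p v w)" "e s \<in> range (\<lambda>p. ev2 k p v w)" using as emb(2) by blast+
  then show "x \<in> K" unfolding as(3) using v_in w_in by (auto intro!: fg_divide fg_ev2)
 next
  fix x assume "x \<in> K"
  then obtain p q where pq: "ev2 k q v w ~= 0" "x = ev2 k p v w / ev2 k q v w" using fieldgen_fraction by blast
  have "ev2 k p v w \<in> e ` carrier ?A" "ev2 k q v w \<in> e ` carrier ?A" unfolding emb(2) by blast+
  then obtain a s where as: "a \<in> carrier ?A" "e a = ev2 k p v w" "s \<in> carrier ?A" "e s = ev2 k q v w" by auto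
  have "s ~= \<zero>\<^bsub>?A\<^esub>" using as(4) pq(1) A.e_zero by metis
  then show "x \<in> A.fractions S" unfolding A.fractions_def S_def using as pq(2) by (intro CollectI exI[of _ a] exI[of _ s]) auto
 qed
 have F: "curve_function_field f = localization ?A S" unfolding curve_function_field_def Let_def S_def ..
 have S1: "\<one>\<^bsub>?A\<^esub> \<in> S" by (rule S.S_one)
 have C: "curve_constants f = A.fraction_class S ` range k"
 proof -
  have "fraction ?A S (hypersurface_const f (\<lambda>c. [:[:c:]:]) c) \<one>\<^bsub>?A\<^esub> = A.fraction_class S (k c)" for c
   unfolding S.fraction_eq[OF emb(3) S1] emb(4) by simp
  then show ?thesis unfolding curve_constants_def Let_def S_def[symmetric] by (simp add: image_image)
 qed
 have "function_field_model k K (localization ?A S) (A.fraction_class S) (curve_constants f)"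
  by (intro function_field_model.intro function_field_model_axioms.intro SF.subfield_over_axioms)
   (use S.carrier_localization S.fraction_class_inj C S.localization_ops S.localization_one_zero in \<open>simp_all add: fr\<close>)
 then show ?thesis unfolding F by blast
qed

text \<open>The degrees of all places must be known to be finite, and at least that of \<open>P\<close>, for
 \<open>Q - P\<close> to have degree \<open>\<ge> 0\<close>. If there are no rational places, every degree is at least two, and the place \<open>P\<close>
 of low degree has degree exactly two.\<close>

lemma rational_if_genus_0:
 assumes genus: "has_genus (curve_function_field f) (curve_constants f) 0"
  and points: "normalization_points f ~= {} \<or> nonnegative_poly f"
 shows "rational_sum_two_squares f"
proof -
 obtain \<eta> where "function_field_model k K (curve_function_field f) \<eta> (curve_constants f)" using ex_model by blast
 then interpret FM: function_field_model k K "curve_function_field f" \<eta> "curve_constants f" .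
 let ?deg = "\<lambda>Q. place_degree (curve_function_field f) (curve_constants f) (FM.push Q)"
 have dep: "\<exists>N::nat. \<forall>z. (\<forall>j\<le>N. SF.ge Q 0 (z j)) \<longrightarrow> (\<exists>c. (\<exists>j\<le>N. c j ~= 0) \<and> SF.ge Q 1 (\<Sum>j\<le>N. k (c j) * z j))"
  if Q: "Q \<in> SF.Places" for Q
 proof -
  obtain y where y: "y \<in> K - {0}" "Q y = 1" using SF.place_surj[OF Q] by blast
  obtain N where "SF.finite_over y N" using RF.ex_finite_over y(1) by blast
  then show ?thesis using SF.residue_dependence[OF Q, of y N] y by (intro exI[of _ N]) (auto simp: SF.ge_def)
 qed
 have deg_cases: "1 \<le> ?deg Q" "FM.rational_place Q ==> ?deg Q = 1" "\<not> FM.rational_place Q ==> 2 \<le> ?deg Q"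
  if Q: "Q \<in> SF.Places" for Q
 proof -
  obtain N :: nat where N: "\<And>z. (\<And>j. j \<le> N ==> SF.ge Q 0 (z j)) ==>
    \<exists>c. (\<exists>j\<le>N. c j ~= 0) \<and> SF.ge Q 1 (\<Sum>j\<le>N. k (c j) * z j)"
   using dep[OF Q] by blast
  show "1 \<le> ?deg Q" "FM.rational_place Q ==> ?deg Q = 1" "\<not> FM.rational_place Q ==> 2 \<le> ?deg Q"
   using FM.place_degree_cases(2-4)[OF Q N] by blast+
 qed
 have rational_iff: "FM.rational_place Q \<longleftrightarrow> (\<forall>x. SF.ge Q 0 x \<longrightarrow> (\<exists>c. SF.ge Q 1 (x - k c)))"
  if "Q \<in> SF.Places" for Q
  using that by (simp add: FM.rational_place_def)
 have push_inj: "FM.push Q = FM.push Q' \<longleftrightarrow> Q = Q'" if "Q \<in> SF.Places" "Q' \<in> SF.Places" for Q Q'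
  using FM.pull_push that by metis
 have push_pl: "FM.push Q \<in> places (curve_function_field f) (curve_constants f)" if "Q \<in> SF.Places" for Q
  using FM.push_places[OF that] .
 have core: "rational_sum_two_squares f"
  if P: "P \<in> SF.Places" and \<delta>: "?deg P = \<delta>" "0 < \<delta>" "\<And>Q. Q \<in> SF.Places ==> \<delta> \<le> ?deg Q" and N: "N * \<delta> = 2"
   and model: "genus_zero_function_field k K P \<delta> ==> \<exists>x y. genus_zero_function_field.anticanonical_model k K P N x y"
   and pos: "(\<exists>P\<in>SF.Places. \<forall>x. SF.ge P 0 x \<longrightarrow> (\<exists>c. SF.ge P 1 (x - k c))) \<or> nonnegative_poly f"
  for P \<delta> N
 proof -
  have G: "genus_zero_function_field k K P \<delta>"
  proof
   show "P \<in> SF.Places" "0 < \<delta>" by fact+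
   fix n :: nat
   define D where "D = (\<lambda>x. if x = FM.push P then int n else 0)"
   have supp: "{x. D x ~= 0} = (if n = 0 then {} else {FM.push P})" unfolding D_def by auto
   have "D \<in> divisors (curve_function_field f) (curve_constants f)"
    using push_pl[OF P] by (simp add: divisors_def supp)
   moreover have "divisor_degree (curve_function_field f) (curve_constants f) D = int (n * \<delta>)"
    unfolding divisor_degree_def supp using \<delta>(1) by (simp add: D_def)
   ultimately obtain y where y: "\<And>j. j \<le> n * \<delta> ==> y j \<in> K"
    "\<And>j u. j \<le> n * \<delta> ==> u \<in> SF.Places ==> SF.ge u (- D (FM.push u)) (y j)" "indep_fam {..n * \<delta>} y"
    using FM.genus_0_sections[OF genus] by blast
   have "SF.ge P (- int n) (y j)" if "j \<le> n * \<delta>" for j using y(2)[OF that P] unfolding D_def by simp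
   moreover have "SF.ge u' 0 (y j)" if "j \<le> n * \<delta>" "u' \<in> SF.Places - {P}" for j u'
    using y(2)[OF that(1), of u'] that(2) push_inj[of u' P] P unfolding D_def by simp
   ultimately show "\<exists>z. (\<forall>j\<le>n * \<delta>. z j \<in> K \<and> SF.ge P (- int n) (z j) \<and> (\<forall>u\<in>SF.Places - {P}. SF.ge u 0 (z j))) \<and>
     indep_fam {..n * \<delta>} z"
    using y(1,3) by (intro exI[of _ y]) blast
  next
   fix Q assume Q: "Q \<in> SF.Places" "Q ~= P"
   define D where "D = (\<lambda>x. if x = FM.push Q then 1 else if x = FM.push P then - 1 else 0 :: int)"
   have QP: "FM.push Q ~= FM.push P" using push_inj[OF Q(1) P] Q(2) by simp
   have supp: "{x. D x ~= 0} = {FM.push Q, FM.push P}" unfolding D_def by auto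
   have "D \<in> divisors (curve_function_field f) (curve_constants f)"
    using push_pl[OF P] push_pl[OF Q(1)] by (simp add: divisors_def supp)
   moreover have "divisor_degree (curve_function_field f) (curve_constants f) D = int (?deg Q - \<delta>)"
    unfolding divisor_degree_def supp using QP \<delta>(1) \<delta>(3)[OF Q(1)] by (simp add: D_def of_nat_diff)
   ultimately obtain y where y: "\<And>u. u \<in> SF.Places ==> SF.ge u (- D (FM.push u)) (y 0)" "indep_fam {..?deg Q - \<delta>} y"
    using FM.genus_0_sections[OF genus] by blast
   have "y 0 ~= 0"
   proof
    assume y0: "y 0 = 0"
    have "(\<Sum>j\<le>?deg Q - \<delta>. k (if j = 0 then 1 else 0) * y j) = 0"
     by (rule sum.neutral) (simp add: y0)
    then have "\<forall>j\<in>{..?deg Q - \<delta>}. (if j = 0 then 1 else 0) = (0 :: 'a)"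
     using y(2)[unfolded indep_fam_def, rule_format, of "\<lambda>j. if j = 0 then 1 else 0"] by blast
    then have "(if (0::nat) = 0 then 1 else 0) = (0 :: 'a)" by (rule bspec) simp
    then show False by simp
   qed
   moreover have "SF.ge P 1 (y 0)" using y(1)[OF P] QP unfolding D_def by simp
   moreover have "SF.ge Q (- 1) (y 0)" using y(1)[OF Q(1)] unfolding D_def by simp
   moreover have "SF.ge u' 0 (y 0)" if "u' \<in> SF.Places - {P, Q}" for u'
    using y(1)[of u'] that push_inj[of u' P] push_inj[of u' Q] P Q(1) unfolding D_def by simp
   ultimately show "\<exists>g. g ~= 0 \<and> SF.ge P 1 g \<and> SF.ge Q (- 1) g \<and> (\<forall>u\<in>SF.Places - {P, Q}. SF.ge u 0 g)"
    by (intro exI[of _ "y 0"]) blast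
  qed
  have pencil: "SF.finite_over (RF.lin v w a / RF.lin v w b) 4"
   if ab: "RF.lin v w b ~= 0" "RF.lin v w a / RF.lin v w b \<notin> range k" for a b
  proof -
   obtain M N where MN: "inverse3 M N" "inverse3 N M" "mat_vec k M (affine_point v w) 0 = RF.lin v w b"
    "mat_vec k M (affine_point v w) 1 = RF.lin v w a" using ex_coordinates[OF ab] by blast
   have l0: "mat_vec k M (affine_point v w) 0 ~= 0" using MN(3) ab(1) by simp
   have "u M = RF.lin v w a / RF.lin v w b" using MN l0 by (simp add: u_def l_def)
   then show ?thesis using pencil_finite[OF MN(1,2) l0] ab(2) by simp
  qed
  interpret G: plane_genus_zero k K P \<delta> v w
   by (intro plane_genus_zero.intro plane_genus_zero_axioms.intro G v_in w_in independent pencil)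
  obtain x y where "G.anticanonical_model N x y" using model[OF G] by blast
  then obtain a b where ab: "RF.lin v w b ~= 0" "RF.lin v w a / RF.lin v w b \<notin> range k"
   "RF.quadratic_over (RF.lin v w a / RF.lin v w b)" using G.ex_quadratic_pencil[OF _ N] by blast
  obtain M N where MN: "inverse3 M N" "inverse3 N M" "mat_vec k M (affine_point v w) 0 = RF.lin v w b"
   "mat_vec k M (affine_point v w) 1 = RF.lin v w a" using ex_coordinates[OF ab(1,2)] by blast
  have l0: "mat_vec k M (affine_point v w) 0 ~= 0" using MN(3) ab(1) by simp
  have "u M = RF.lin v w a / RF.lin v w b" using MN l0 by (simp add: u_def l_def)
  then show ?thesis using rational_if_quadratic[OF MN(1,2) l0] ab pos by simp
 qed
 show ?thesis
 proof (cases "normalization_points f = {}")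
  case False
  then obtain x where x: "x \<in> rational_places (curve_function_field f) (curve_constants f)"
   unfolding normalization_points_def by blast
  then have "x \<in> places (curve_function_field f) (curve_constants f)" unfolding rational_places_def by simp
  then obtain P where P: "P \<in> SF.Places" "x = FM.push P" using FM.places_cases by blast
  have rat: "FM.rational_place P" using x FM.rational_places_iff[OF P(1)] unfolding P(2) by blast
  then have res: "\<exists>c. SF.ge P 1 (x - k c)" if "SF.ge P 0 x" for x using rational_iff[OF P(1)] that by blast
  show ?thesis
  proof (rule core[OF P(1), of 1 2])
   show "\<exists>x y. genus_zero_function_field.anticanonical_model k K P 2 x y" if "genus_zero_function_field k K P 1"
    using genus_zero_function_field.model_rational_place[OF that] res by blast
  qed (use deg_cases(1) deg_cases(2)[OF P(1) rat] P(1) res in auto)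
 next
  case True
  then have nonneg: "nonnegative_poly f" using points by blast
  have not_rat: "\<not> FM.rational_place Q" if "Q \<in> SF.Places" for Q
   using True FM.rational_places_iff[OF that] unfolding normalization_points_def by blast
  obtain P y where P: "P \<in> SF.Places" and y: "y ~= 0" "SF.ge P 1 y" "SF.finite_over y 4"
   using RF.ex_low_degree_place by blast
  note res = RF.residue_cases[OF P y]
  obtain x0 where x0: "SF.ge P 0 x0" "\<And>c. \<not> SF.ge P 1 (x0 - k c)" using not_rat[OF P] rational_iff[OF P] by blast
  then obtain a b where ab: "b ~= 0" "SF.ge P 1 ((x0 - k a) ^ 2 + k (b ^ 2))" using res by blast
  define r where "r = k (inverse b) * (x0 - k a)"
  have r0: "SF.ge P 0 r" unfolding r_def by (intro SF.ge_scale SF.ge_diff SF.ge_const P x0)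
  have "k (inverse b ^ 2) * ((x0 - k a) ^ 2 + k (b ^ 2)) = r ^ 2 + 1"
   unfolding r_def using ab(1) by (simp add: power_mult_distrib distrib_left power_inverse)
  then have r1: "SF.ge P 1 (r ^ 2 + 1)" using SF.ge_scale[OF P ab(2), of "inverse b ^ 2"] by simp
  have gen: "\<exists>c d. SF.ge P 1 (x - (k c + k d * r))" if "SF.ge P 0 x" for x
   by (rule RF.residue_generated[OF P res[OF that] r0 r1 that])
  \<comment> \<open>Residues are combinations of \<open>1\<close> and \<open>r\<close>, so any three of them are dependent.\<close>
  have dep3: "\<exists>c. (\<exists>j\<le>2. c j ~= 0) \<and> SF.ge P 1 (\<Sum>j\<le>2. k (c j) * y j)"
   if y: "\<And>j. j \<le> (2::nat) ==> SF.ge P 0 (y j)" for y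
  proof -
   have "\<forall>j. \<exists>c d. j \<le> 2 \<longrightarrow> SF.ge P 1 (y j - (k c + k d * r))" using gen y by blast
   then obtain c d where cd: "\<And>j. j \<le> 2 ==> SF.ge P 1 (y j - (k (c j) + k (d j) * r))" by metis
   obtain e0 e1 e2 where e: "e0 ~= 0 \<or> e1 ~= 0 \<or> e2 ~= 0" "c 0 * e0 + c 1 * e1 + c 2 * e2 = 0"
    "d 0 * e0 + d 1 * e1 + d 2 * e2 = 0"
    using singular_matrix_kernel[of "c 0" "d 1" 0 "d 2" 0 "c 1" "d 0" 0 "c 2"] by auto
   let ?e = "\<lambda>j::nat. if j = 0 then e0 else if j = 1 then e1 else e2"
   have "(\<Sum>j\<le>2. k (?e j) * y j) = (\<Sum>j\<le>2. k (?e j) * (y j - (k (c j) + k (d j) * r)))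
     + (k (c 0 * e0 + c 1 * e1 + c 2 * e2) + k (d 0 * e0 + d 1 * e1 + d 2 * e2) * r)"
    by (simp add: numeral_2_eq_2 algebra_simps)
   also have "\<dots> = (\<Sum>j\<le>2. k (?e j) * (y j - (k (c j) + k (d j) * r)))" unfolding e by simp
   finally have "SF.ge P 1 (\<Sum>j\<le>2. k (?e j) * y j)"
    using SF.ge_sum[OF P, of "{..2}" 1 "\<lambda>j. k (?e j) * (y j - (k (c j) + k (d j) * r))"] SF.ge_scale[OF P cd] by simp
   moreover have "\<exists>j\<le>2. ?e j ~= 0"
    using e(1)
   proof (elim disjE)
    assume "e0 ~= 0" then show ?thesis by (intro exI[of _ 0]) simp
   next
    assume "e1 ~= 0" then show ?thesis by (intro exI[of _ 1]) simp
   next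
    assume "e2 ~= 0" then show ?thesis by (intro exI[of _ 2]) simp
   qed
   ultimately show ?thesis by (intro exI[of _ ?e] conjI)
  qed
  have "?deg P \<le> 2" using FM.place_degree_cases(1)[OF P, of 2] dep3 by blast
  then have dP: "?deg P = 2" using deg_cases(3)[OF P not_rat[OF P]] by simp
  show ?thesis
  proof (rule core[OF P, of 2 1])
   show "\<exists>x y. genus_zero_function_field.anticanonical_model k K P 1 x y" if "genus_zero_function_field k K P 2"
    using genus_zero_function_field.model_complex_place[OF that] res by blast
   show "2 \<le> ?deg Q" if "Q \<in> SF.Places" for Q using deg_cases(3)[OF that not_rat[OF that]] .
  qed (use dP nonneg in auto)
 qed
qed

end

theorem theorem0p3:
 fixes f :: "'a::real_closed_field poly poly" and d :: nat
 assumes "total_degree f = d" and "even d" and "d \<ge> 2"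
  and "nodal_rational_closure f"
  and "normalization_points f \<noteq> {} \<or> (normalization_points f = {} \<and> nonnegative_poly f)"
  and "d \<le> 4"
 shows "rational_sum_two_squares f"
proof -
 let ?F = "map_poly (map_poly to_ac) f :: 'a alg_closure poly poly"
 have pr: "prime_elem (homogenization ?F)" and genus: "has_genus (curve_function_field f) (curve_constants f) 0"
  using assms(4) unfolding nodal_rational_closure_def Let_def by blast+
 have "coeff (coeff ?F j) i = to_ac (coeff (coeff f j) i)" for i j by (simp add: coeff_map_poly)
 then have "total_degree ?F = total_degree f" unfolding total_degree_def by simp
 then have pF: "prime_elem ?F" using prime_elem_dehomogenize[OF pr] assms(1,3) by simp
 have td: "2 \<le> total_degree f" using assms(1,3) by simp
 from ex_generic_point_of_curve[OF pF td]
 obtain k :: "'a => 'a alg_closure poly fract alg_closure" and v w where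
  K: "field_hom k \<and> (\<forall>p. ev2 k p v w = 0 \<longleftrightarrow> f dvd p) \<and> (\<forall>p. peval k p v = 0 \<longrightarrow> p = 0) \<and>
   (\<forall>x\<in>fieldgen k {v, w}. x ^ 2 ~= - 1)"
  by (elim exE) (rule that)
 have k: "field_hom k" "\<And>p. ev2 k p v w = 0 \<longleftrightarrow> f dvd p" "\<And>p. peval k p v = 0 ==> p = 0"
   "\<And>x. x \<in> fieldgen k {v, w} ==> x ^ 2 ~= - 1"
  using K by blast+
 obtain m where m: "d = 2 * m" using assms(2) by blast
 then have "m = 1 \<or> m = 2" using assms(3,6) by linarith
 then interpret plane_curve_function_field k v w f m
  by (intro plane_curve_function_field.intro rcf_hom.intro plane_curve_function_field_axioms.intro k)
   (use assms(1) m in auto)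
 show ?thesis using rational_if_genus_0[OF genus] assms(5) by blast
qed

end
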